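(* Let $d\in C^2(\overline{\Omega})$ satisfy $d>0$ in $\Omega$, $|\nabla d|>0$ on $\overline{\Omega}$, $d=0$ on $\partial\Omega\setminus\Gamma$, and let $\varphi_0:=e^{\lambda d}$. Let $A=(A_{ij})$ be a $3\times3$ matrix-valued function in $W^{1,\infty}(\Omega)$ and $b=(b_1,b_2,b_3)^T$ a vector-valued function in $W^{2,\infty}(\Omega)$. Define $$Pf:=\mathrm{div}(fA)=A\nabla f+f\,\mathrm{div}A,\qquad Qg:=\mathrm{rot}(gb)=\nabla g\times b+g\,\mathrm{rot}\,b$$ for scalar functions $f,g\in H^1(\Omega)$. Assume that $$\det A(x)\neq0\quad\text{and}\quad|\nabla d(x)\times b(x)|\neq0\qquad\text{for }x\in\overline{\Omega}.$$ Then there exist constants $\lambda_0\ge1$, $s_0\ge1$ and a generic constant $C>0$ such that $$\int_\Omega\big(|\nabla f|^2+s^2\lambda^2\varphi_0^2|f|^2\big)e^{2s\varphi_0}\,dx\le C\int_\Omega|Pf|^2e^{2s\varphi_0}\,dx+C\int_\Gamma s\lambda\varphi_0|f|^2e^{2s\varphi_0}\,d\sigma$$ and $$\begin{aligned}\int_\Omega\big(|\nabla g|^2+s^2\lambda^2\varphi_0^2|g|^2\big)e^{2s\varphi_0}\,dx\le\;&C\int_\Omega\Big(\frac1{s^2\lambda^2\varphi_0^2}|\nabla(Qg)|^2+|Qg|^2\Big)e^{2s\varphi_0}\,dx\\&+C\int_{\partial\Omega}\Big(\frac1{s\lambda\varphi_0}|\nabla g|^2+s\lambda\varphi_0|g|^2\Big)e^{2s\varphi_0}\,d\sigma\end{aligned}$$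 for all $\lambda\ge\lambda_0$, $s\ge s_0$ and $f\in H^1(\Omega)$, $g\in H^2(\Omega)$.
   Context: $\Omega\subset\mathbb{R}^3$ is a bounded domain with smooth boundary; $\Gamma\subset\partial\Omega$ is a nonempty relatively open sub-boundary. The divergence of a matrix is $[\mathrm{div}A]_k=\sum_{j=1}^3\partial_jA_{kj}$, $\mathrm{rot}$ is the curl, and $d\sigma$ is surface measure. The generic constant $C$ is independent of $s$ and $\lambda$. *)

theory Defs
  imports "HOL-Analysis.Analysis"
begin

section \<open>Classical derivatives and smoothness\<close>

definition pd :: "'n::finite \<Rightarrow> (real^'n \<Rightarrow> 'b::real_normed_vector) \<Rightarrow> real^'n \<Rightarrow> 'b" where
  "pd j u x = frechet_derivative u (at x) (axis j 1)"

text \<open>\<open>C^k\<close> on an open set \<open>U\<close>.\<close>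

primrec Ck :: "nat \<Rightarrow> (real^'n::finite) set \<Rightarrow> (real^'n \<Rightarrow> 'b::real_normed_vector) \<Rightarrow> bool" where
  "Ck 0 U u \<longleftrightarrow> continuous_on U u"
| "Ck (Suc k) U u \<longleftrightarrow> (\<forall>x\<in>U. u differentiable at x) \<and> (\<forall>j. Ck k U (pd j u))"

definition smooth :: "(real^'n::finite) set \<Rightarrow> (real^'n \<Rightarrow> 'b::real_normed_vector) \<Rightarrow> bool" where
  "smooth U u \<longleftrightarrow> (\<forall>k. Ck k U u)"

text \<open>\<open>C^k\<close> up to the boundary of an open set \<open>\<Omega>\<close>: \<open>u\<close> is continuous on the closure and all its partial
  derivatives of order at most \<open>k\<close>, taken inside \<open>\<Omega>\<close>, extend continuously to the closure.\<close>

primrec Ck_closure :: "nat \<Rightarrow> (real^'n::finite) set \<Rightarrow> (real^'n \<Rightarrow> 'b::real_normed_vector) \<Rightarrow> bool" where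
  "Ck_closure 0 \<Omega> u \<longleftrightarrow> continuous_on (closure \<Omega>) u"
| "Ck_closure (Suc k) \<Omega> u \<longleftrightarrow>
     continuous_on (closure \<Omega>) u \<and> (\<forall>x\<in>\<Omega>. u differentiable at x) \<and>
     (\<forall>j. \<exists>v. Ck_closure k \<Omega> v \<and> (\<forall>x\<in>\<Omega>. v x = pd j u x))"

text \<open>The continuous extension to the closure of the gradient of a \<open>C^1\<close> function; inside \<open>\<Omega>\<close> it is
  the gradient itself.\<close>

definition grad_closure :: "(real^'n::finite) set \<Rightarrow> (real^'n \<Rightarrow> real) \<Rightarrow> real^'n \<Rightarrow> real^'n" where
  "grad_closure \<Omega> u x = (\<chi> j. Lim (at x within \<Omega>) (pd j u))"


section \<open>Domains with smooth boundary\<close>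

text \<open>Near every boundary point, \<open>\<Omega>\<close> is one side of the graph of a smooth function over one of the
  coordinate hyperplanes. The function \<open>\<gamma>\<close> of the remaining coordinates is encoded as a function on
  the whole space that does not depend on the coordinate \<open>k\<close>.\<close>

definition smooth_boundary :: "(real^'n::finite) set \<Rightarrow> bool" where
  "smooth_boundary \<Omega> \<longleftrightarrow>
     (\<forall>p\<in>frontier \<Omega>. \<exists>r>0. \<exists>k. \<exists>\<epsilon>\<in>{-1, 1::real}. \<exists>\<gamma>::real^'n \<Rightarrow> real.
        smooth UNIV \<gamma> \<and> (\<forall>x t. \<gamma> (x + t *\<^sub>R axis k 1) = \<gamma> x) \<and>
        \<Omega> \<inter> ball p r = {x \<in> ball p r. \<epsilon> * x $ k > \<gamma> x})"

definition smooth_bounded_domain :: "(real^'n::finite) set \<Rightarrow> bool" where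
  "smooth_bounded_domain \<Omega> \<longleftrightarrow>
     open \<Omega> \<and> connected \<Omega> \<and> \<Omega> \<noteq> {} \<and> bounded \<Omega> \<and> smooth_boundary \<Omega>"


section \<open>Surface measure\<close>

text \<open>Regular smooth local parametrizations of a surface \<open>S\<close>.\<close>

definition local_param :: "(real^3) set \<Rightarrow> (real^2) set \<Rightarrow> (real^2 \<Rightarrow> real^3) \<Rightarrow> bool" where
  "local_param S V \<psi> \<longleftrightarrow>
     open V \<and> smooth V \<psi> \<and> inj_on \<psi> V \<and>
     openin (top_of_set S) (\<psi> ` V) \<and> continuous_on (\<psi> ` V) (inv_into V \<psi>) \<and>
     (\<forall>y\<in>V. cross3 (pd 1 \<psi> y) (pd 2 \<psi> y) \<noteq> 0)"

text \<open>A Borel measure on the whole space, concentrated on \<open>S\<close>, whose value on the part of \<open>S\<close> covered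
  by a local parametrization is given by the classical area formula. For the boundary of a smooth
  bounded domain these conditions determine the measure uniquely.\<close>

definition is_surface_measure :: "(real^3) set \<Rightarrow> (real^3) measure \<Rightarrow> bool" where
  "is_surface_measure S \<sigma> \<longleftrightarrow>
     sets \<sigma> = sets borel \<and> emeasure \<sigma> (- S) = 0 \<and>
     (\<forall>V \<psi> B. local_param S V \<psi> \<longrightarrow> B \<in> sets borel \<longrightarrow> B \<subseteq> \<psi> ` V \<longrightarrow>
        emeasure \<sigma> B =
          (\<integral>\<^sup>+ y. ennreal (norm (cross3 (pd 1 \<psi> y) (pd 2 \<psi> y))) * indicator (V \<inter> \<psi> -` B) y \<partial>lborel))"

definition surface_measure :: "(real^3) set \<Rightarrow> (real^3) measure" where
  "surface_measure S = (SOME \<sigma>. is_surface_measure S \<sigma>)"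


section \<open>Weak derivatives and Sobolev spaces\<close>

text \<open>Elements of the function spaces are represented by functions on the whole space of which only
  the values on \<open>\<Omega>\<close> matter.\<close>

definition L2_on :: "'a measure \<Rightarrow> 'a set \<Rightarrow> ('a \<Rightarrow> real) \<Rightarrow> bool" where
  "L2_on M S u \<longleftrightarrow> set_borel_measurable M S u \<and> set_integrable M S (\<lambda>x. (u x)\<^sup>2)"

definition Linf_on :: "'a measure \<Rightarrow> 'a set \<Rightarrow> ('a \<Rightarrow> real) \<Rightarrow> bool" where
  "Linf_on M S u \<longleftrightarrow>
     set_borel_measurable M S u \<and> (\<exists>B. AE x in M. x \<in> S \<longrightarrow> \<bar>u x\<bar> \<le> B)"

definition test_fun :: "(real^'n::finite) set \<Rightarrow> (real^'n \<Rightarrow> real) \<Rightarrow> bool" where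
  "test_fun \<Omega> \<phi> \<longleftrightarrow>
     smooth UNIV \<phi> \<and> compact (closure {x. \<phi> x \<noteq> 0}) \<and> closure {x. \<phi> x \<noteq> 0} \<subseteq> \<Omega>"

definition locally_integrable :: "(real^'n::finite) set \<Rightarrow> (real^'n \<Rightarrow> real) \<Rightarrow> bool" where
  "locally_integrable \<Omega> u \<longleftrightarrow> (\<forall>K. compact K \<longrightarrow> K \<subseteq> \<Omega> \<longrightarrow> set_integrable lebesgue K u)"

definition is_wpd ::
  "(real^'n::finite) set \<Rightarrow> 'n \<Rightarrow> (real^'n \<Rightarrow> real) \<Rightarrow> (real^'n \<Rightarrow> real) \<Rightarrow> bool" where
  "is_wpd \<Omega> j u v \<longleftrightarrow>
     locally_integrable \<Omega> u \<and> locally_integrable \<Omega> v \<and>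
     (\<forall>\<phi>. test_fun \<Omega> \<phi> \<longrightarrow>
        (LINT x:\<Omega>|lebesgue. u x * pd j \<phi> x) = - (LINT x:\<Omega>|lebesgue. v x * \<phi> x))"

text \<open>A representative of the weak partial derivative, which is unique up to null sets.\<close>

definition wpd :: "(real^'n::finite) set \<Rightarrow> 'n \<Rightarrow> (real^'n \<Rightarrow> real) \<Rightarrow> real^'n \<Rightarrow> real" where
  "wpd \<Omega> j u = (SOME v. is_wpd \<Omega> j u v)"

text \<open>\<open>W^{k,p}(\<Omega>)\<close>, where the predicate \<open>L\<close> stands for \<open>L^p(\<Omega>)\<close>.\<close>

primrec sobolev ::
  "nat \<Rightarrow> ((real^'n \<Rightarrow> real) \<Rightarrow> bool) \<Rightarrow> (real^'n::finite) set \<Rightarrow> (real^'n \<Rightarrow> real) \<Rightarrow> bool" where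
  "sobolev 0 L \<Omega> u \<longleftrightarrow> L u"
| "sobolev (Suc k) L \<Omega> u \<longleftrightarrow> L u \<and> (\<forall>j. \<exists>v. is_wpd \<Omega> j u v \<and> sobolev k L \<Omega> v)"

definition Hk :: "nat \<Rightarrow> (real^'n::finite) set \<Rightarrow> (real^'n \<Rightarrow> real) set" where
  "Hk k \<Omega> = {u. sobolev k (L2_on lebesgue \<Omega>) \<Omega> u}"

definition Wk_inf :: "nat \<Rightarrow> (real^'n::finite) set \<Rightarrow> (real^'n \<Rightarrow> real) set" where
  "Wk_inf k \<Omega> = {u. sobolev k (Linf_on lebesgue \<Omega>) \<Omega> u}"


section \<open>Boundary traces\<close>

text \<open>The trace operator is the continuous extension of the restriction map from functions that are
  \<open>C^1\<close> up to the boundary: \<open>h\<close> is a trace of \<open>f\<close> if such functions \<open>u n\<close> converge to \<open>f\<close> in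
  \<open>H^1(\<Omega>)\<close> while their boundary values converge to \<open>h\<close> in \<open>L^2\<close> of the boundary. The trace is unique
  up to null sets.\<close>

definition is_bdry_trace :: "(real^3) set \<Rightarrow> (real^3 \<Rightarrow> real) \<Rightarrow> (real^3 \<Rightarrow> real) \<Rightarrow> bool" where
  "is_bdry_trace \<Omega> f h \<longleftrightarrow>
     f \<in> Hk 1 \<Omega> \<and> L2_on (surface_measure (frontier \<Omega>)) (frontier \<Omega>) h \<and>
     (\<exists>u::nat \<Rightarrow> real^3 \<Rightarrow> real.
        (\<forall>n. Ck_closure 1 \<Omega> (u n)) \<and>
        (\<lambda>n. LINT x:\<Omega>|lebesgue. (u n x - f x)\<^sup>2) \<longlonglongrightarrow> 0 \<and>
        (\<forall>j. (\<lambda>n. LINT x:\<Omega>|lebesgue. (pd j (u n) x - wpd \<Omega> j f x)\<^sup>2) \<longlonglongrightarrow> 0) \<and>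
        (\<lambda>n. LINT x:frontier \<Omega>|surface_measure (frontier \<Omega>). (u n x - h x)\<^sup>2) \<longlonglongrightarrow> 0)"

definition bdry_trace :: "(real^3) set \<Rightarrow> (real^3 \<Rightarrow> real) \<Rightarrow> real^3 \<Rightarrow> real" where
  "bdry_trace \<Omega> f = (SOME h. is_bdry_trace \<Omega> f h)"


section \<open>Differential operators in the weak sense\<close>

definition wgrad :: "(real^3) set \<Rightarrow> (real^3 \<Rightarrow> real) \<Rightarrow> real^3 \<Rightarrow> real^3" where
  "wgrad \<Omega> u x = (\<chi> j. wpd \<Omega> j u x)"

text \<open>The Jacobian matrix; its \<open>norm\<close> is the Frobenius norm.\<close>

definition wjac :: "(real^3) set \<Rightarrow> (real^3 \<Rightarrow> real^3) \<Rightarrow> real^3 \<Rightarrow> real^3^3" where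
  "wjac \<Omega> F x = (\<chi> k. wgrad \<Omega> (\<lambda>y. F y $ k) x)"

text \<open>Row-wise divergence of a matrix field; \<open>A x $ k $ j\<close> is the entry in row \<open>k\<close> and column \<open>j\<close>.\<close>

definition wdiv :: "(real^3) set \<Rightarrow> (real^3 \<Rightarrow> real^3^3) \<Rightarrow> real^3 \<Rightarrow> real^3" where
  "wdiv \<Omega> A x = (\<chi> k. \<Sum>j\<in>UNIV. wpd \<Omega> j (\<lambda>y. A y $ k $ j) x)"

definition wrot :: "(real^3) set \<Rightarrow> (real^3 \<Rightarrow> real^3) \<Rightarrow> real^3 \<Rightarrow> real^3" where
  "wrot \<Omega> F x = vector
     [wpd \<Omega> 2 (\<lambda>y. F y $ 3) x - wpd \<Omega> 3 (\<lambda>y. F y $ 2) x,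
      wpd \<Omega> 3 (\<lambda>y. F y $ 1) x - wpd \<Omega> 1 (\<lambda>y. F y $ 3) x,
      wpd \<Omega> 1 (\<lambda>y. F y $ 2) x - wpd \<Omega> 2 (\<lambda>y. F y $ 1) x]"

definition P_op :: "(real^3) set \<Rightarrow> (real^3 \<Rightarrow> real^3^3) \<Rightarrow> (real^3 \<Rightarrow> real) \<Rightarrow> real^3 \<Rightarrow> real^3" where
  "P_op \<Omega> A f = wdiv \<Omega> (\<lambda>x. f x *\<^sub>R A x)"

definition Q_op :: "(real^3) set \<Rightarrow> (real^3 \<Rightarrow> real^3) \<Rightarrow> (real^3 \<Rightarrow> real) \<Rightarrow> real^3 \<Rightarrow> real^3" where
  "Q_op \<Omega> b g = wrot \<Omega> (\<lambda>x. g x *\<^sub>R b x)"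

definition phi0 :: "real \<Rightarrow> (real^3 \<Rightarrow> real) \<Rightarrow> real^3 \<Rightarrow> real" where
  "phi0 l d x = exp (l * d x)"

text \<open>The trace of the gradient of a function in \<open>H^2\<close>.\<close>

definition bdry_grad :: "(real^3) set \<Rightarrow> (real^3 \<Rightarrow> real) \<Rightarrow> real^3 \<Rightarrow> real^3" where
  "bdry_grad \<Omega> g x = (\<chi> j. bdry_trace \<Omega> (wpd \<Omega> j g) x)"

end

theory Submission
  imports Defs
begin

text \<open>Both estimates are instances of one weighted energy estimate for a transport operator \<open>a \<bullet> \<nabla>\<close>. Integrating
\<open>div (\<psi> u^2 a)\<close> over the domain gives
\<open>\<integral> 2 \<psi> u (\<nabla>u \<bullet> a) + u^2 (\<psi> div a + \<nabla>\<psi> \<bullet> a) = - \<integral> \<psi> u^2 (a \<bullet> \<nu>)\<close> over the boundary, where \<open>\<nu>\<close> is the inner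
unit normal. Let \<open>\<theta> = s \<lambda> \<phi>_0\<close> and take \<open>\<psi> = \<theta> e^{2 s \<phi>_0}\<close> or \<open>\<psi> = e^{2 s \<phi>_0} / \<theta>\<close>. Then
\<open>\<nabla>\<psi> = \<psi> (2 \<theta> \<plusminus> \<lambda>) \<nabla>d\<close>, and \<open>2 \<theta> \<plusminus> \<lambda> \<ge> \<theta>\<close> because \<open>d \<ge> 0\<close> forces \<open>\<theta> \<ge> \<lambda>\<close>. If \<open>a \<bullet> \<nabla>d\<close> is bounded
below by a positive constant, the term with \<open>\<nabla>\<psi>\<close> dominates the one with \<open>div a\<close> for large \<open>\<lambda>\<close>, and Young's
inequality bounds \<open>\<integral> \<psi> \<theta> u^2\<close> by \<open>\<integral> (\<psi> / \<theta>) (a \<bullet> \<nabla>u)^2\<close> plus a boundary term. This is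
\<open>transport_general\<close>; its two instances with constants independent of \<open>s\<close> and \<open>\<lambda>\<close> are \<open>transport_estimate\<close>.

For \<open>P\<close> take \<open>a = \<nabla>d\<close>. Outside \<open>\<Gamma>\<close> the function \<open>d\<close> vanishes on the boundary and is positive inside, so \<open>\<nabla>d\<close>
does not point outwards there and that part of the boundary term has the favourable sign. Since
\<open>A \<nabla>f = P f - f div A\<close> with \<open>A\<close> uniformly invertible, \<open>\<nabla>f\<close> is controlled by \<open>P f\<close> and \<open>f\<close>, and the term with
\<open>f\<close> is absorbed for large \<open>\<lambda>\<close> (\<open>carleman_div\<close>).

For \<open>Q\<close> take \<open>a = b \<times> (\<nabla>d \<times> b)\<close>. Then \<open>a \<bullet> \<nabla>d = |\<nabla>d \<times> b|^2\<close> is positive, while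
\<open>a \<bullet> \<nabla>g = (\<nabla>g \<times> b) \<bullet> (\<nabla>d \<times> b)\<close> involves only \<open>\<nabla>g \<times> b = Q g - g rot b\<close>. The estimate with weight
\<open>\<theta> e^{2 s \<phi>_0}\<close> is applied to \<open>g\<close>. The one with weight \<open>e^{2 s \<phi>_0} / \<theta>\<close> is applied to each \<open>\<partial>_k g\<close>, because
\<open>\<nabla>(\<partial>_k g) \<times> b\<close> equals \<open>\<partial>_k (Q g)\<close> up to terms in \<open>g\<close> and \<open>\<nabla>g\<close>; these are again absorbed (\<open>carleman_rot\<close>).
Here \<open>a\<close> is only weakly differentiable, so the energy inequality is obtained by approximating \<open>b\<close>.

The rest supplies the analysis behind these computations. Finitely many boundary charts and a partition of unity give
the surface measure and the divergence theorem for functions that are \<open>C^1\<close> up to the boundary; mollifying with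
kernels that are shifted into the domain gives density of such functions in \<open>H^1\<close>; the traces, the product rule and
the energy inequality for Sobolev functions follow by passing to limits.\<close>

lemmas bint_cong = Bochner_Integration.integral_cong
  and bint_add = Bochner_Integration.integral_add
  and bint_nonneg = Bochner_Integration.integral_nonneg
  and bint_sum = Bochner_Integration.integral_sum
  and bintegrable_add = Bochner_Integration.integrable_add
  and bintegrable_bound = Bochner_Integration.integrable_bound
  and bintegrable_mult = Bochner_Integration.integrable_mult_right
  and bintegrable_sum = Bochner_Integration.integrable_sum

section \<open>Smooth bump functions\<close>

text \<open>Dividing by powers of \<open>t\<close> makes the family closed under differentiation, so that smoothness of the
  standard function \<open>exp (-1/t)\<close> is a single induction.\<close>

definition theta :: "nat \<Rightarrow> real \<Rightarrow> real" where
  "theta m t = (if t \<le> 0 then 0 else exp (- 1 / t) / t ^ m)"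

lemma theta_tendsto_0: "((\<lambda>t. exp (- 1 / t) / t ^ m) \<longlongrightarrow> (0::real)) (at_right 0)"
proof -
  have "((\<lambda>u. u ^ m / exp u) \<longlongrightarrow> (0::real)) at_top"
    by (rule tendsto_power_div_exp_0)
  from filterlim_compose[OF this filterlim_inverse_at_top_right]
  have "((\<lambda>t::real. inverse t ^ m / exp (inverse t)) \<longlongrightarrow> 0) (at_right 0)" .
  then show ?thesis
    by (simp add: exp_minus field_simps)
qed

lemma theta_deriv: "(theta m has_real_derivative (theta (m + 2) t - real m * theta (m + 1) t)) (at t)"
proof -
  consider "t < 0" | "t = 0" | "t > 0" by linarith
  then show ?thesis
  proof cases
    case 1
    have "((\<lambda>t. 0) has_real_derivative 0) (at t)" by simp
    then have "(theta m has_real_derivative 0) (at t)"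
      by (rule has_field_derivative_transform_within_open[where S="{..<0}"]) (use 1 in \<open>auto simp: theta_def\<close>)
    with 1 show ?thesis by (simp add: theta_def)
  next
    case 3
    have "((\<lambda>t. exp (- 1 / t) / t ^ m) has_real_derivative (theta (m + 2) t - real m * theta (m + 1) t)) (at t)"
      using 3 by (cases m; (auto intro!: derivative_eq_intros simp: theta_def); simp add: field_simps; metis One_nat_def Suc_pred not_gr_zero power_Suc)
    then show ?thesis
      by (rule has_field_derivative_transform_within_open[where S="{0<..}"]) (use 3 in \<open>auto simp: theta_def\<close>)
  next
    case 2
    have l: "((\<lambda>h. (theta m h - theta m 0) / h) \<longlongrightarrow> 0) (at_left 0)"
      by (rule tendsto_eventually) (auto simp: eventually_at_filter theta_def)
    have "\<forall>\<^sub>F h::real in at_right 0. exp (- 1 / h) / h ^ Suc m = (theta m h - theta m 0) / h"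
      using eventually_at_right_less[of "0::real"] by eventually_elim (simp add: theta_def field_simps)
    then have r: "((\<lambda>h. (theta m h - theta m 0) / h) \<longlongrightarrow> 0) (at_right 0)"
      using theta_tendsto_0[of "Suc m"] by (rule Lim_transform_eventually[rotated])
    have "(theta m has_real_derivative 0) (at 0)"
      using filterlim_split_at[OF l r] by (simp add: DERIV_def)
    with 2 show ?thesis by (simp add: theta_def)
  qed
qed

text \<open>A class of functions closed under partial derivatives whose members are therefore smooth; it replaces a
  calculus for the predicate \<open>smooth\<close>.\<close>

inductive_set SC :: "(real^'n::finite \<Rightarrow> real) set" where
  SC_const: "(\<lambda>x. c) \<in> SC"
| SC_coord: "(\<lambda>x. x $ i) \<in> SC"
| SC_add: "u \<in> SC \<Longrightarrow> v \<in> SC \<Longrightarrow> (\<lambda>x. u x + v x) \<in> SC"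
| SC_mult: "u \<in> SC \<Longrightarrow> v \<in> SC \<Longrightarrow> (\<lambda>x. u x * v x) \<in> SC"
| SC_theta: "u \<in> SC \<Longrightarrow> (\<lambda>x. theta m (u x)) \<in> SC"

lemma SC_diff: "u \<in> SC \<Longrightarrow> v \<in> SC \<Longrightarrow> (\<lambda>x. u x - v x) \<in> SC"
  using SC_add[of u "\<lambda>x. - 1 * v x"] SC_mult[OF SC_const[of "- 1"], of v] by simp

lemma SC_sum: "finite I \<Longrightarrow> (\<And>i. i \<in> I \<Longrightarrow> u i \<in> SC) \<Longrightarrow> (\<lambda>x. \<Sum>i\<in>I. u i x) \<in> SC"
  by (induction I rule: finite_induct) (auto intro: SC_const SC_add)

lemma pd_gderiv: "GDERIV u x :> G \<Longrightarrow> pd j u x = G $ j"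
  unfolding gderiv_def pd_def by (drule frechet_derivative_at[symmetric]) (simp add: inner_axis')

lemma gderiv_pd:
  fixes u :: "real^'n::finite \<Rightarrow> real"
  assumes "u differentiable at x"
  shows "GDERIV u x :> (\<chi> j. pd j u x)"
proof -
  have D: "(u has_derivative frechet_derivative u (at x)) (at x)"
    using assms frechet_derivative_works by blast
  then have L: "linear (frechet_derivative u (at x))"
    using has_derivative_linear by blast
  have "frechet_derivative u (at x) h = h \<bullet> (\<chi> j. pd j u x)" for h
  proof -
    have "frechet_derivative u (at x) h = frechet_derivative u (at x) (\<Sum>j\<in>UNIV. h $ j *\<^sub>R axis j 1)"
      by (simp add: basis_expansion[of h, unfolded scalar_mult_eq_scaleR])
    also have "\<dots> = (\<Sum>j\<in>UNIV. h $ j * pd j u x)"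
      by (simp add: linear_sum[OF L] linear_cmul[OF L] pd_def)
    finally show ?thesis by (simp add: inner_vec_def)
  qed
  then have "frechet_derivative u (at x) = (\<lambda>h. h \<bullet> (\<chi> j. pd j u x))" by blast
  with D show ?thesis unfolding gderiv_def by simp
qed

lemma SC_gderiv:
  assumes "u \<in> SC"
  shows "\<exists>G. (\<forall>x. GDERIV u x :> G x) \<and> (\<forall>j. (\<lambda>x. G x $ j) \<in> SC)"
  using assms
proof induction
  case (SC_const c)
  then show ?case by (intro exI[of _ "\<lambda>x. 0"]) (auto simp: GDERIV_const intro: SC.SC_const)
next
  case (SC_coord i)
  have "GDERIV (\<lambda>x. x $ i) x :> axis i 1" for x
    unfolding gderiv_def by (simp add: inner_axis bounded_linear_vec_nth bounded_linear_imp_has_derivative)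
  then show ?case
    by (intro exI[of _ "\<lambda>x. axis i 1"]) (auto intro: SC.SC_const)
next
  case (SC_add u v)
  then obtain G H where "\<forall>x. GDERIV u x :> G x" "\<forall>j. (\<lambda>x. G x $ j) \<in> SC"
    "\<forall>x. GDERIV v x :> H x" "\<forall>j. (\<lambda>x. H x $ j) \<in> SC" by metis
  then show ?case
    by (intro exI[of _ "\<lambda>x. G x + H x"]) (auto intro: SC.SC_add GDERIV_add)
next
  case (SC_mult u v)
  then obtain G H where "\<forall>x. GDERIV u x :> G x" "\<forall>j. (\<lambda>x. G x $ j) \<in> SC"
    "\<forall>x. GDERIV v x :> H x" "\<forall>j. (\<lambda>x. H x $ j) \<in> SC" by metis
  then show ?case using SC_mult.hyps
    by (intro exI[of _ "\<lambda>x. u x *\<^sub>R H x + v x *\<^sub>R G x"]) (auto intro!: SC.SC_add SC.SC_mult intro: GDERIV_mult)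
next
  case (SC_theta u m)
  then obtain G where "\<forall>x. GDERIV u x :> G x" "\<forall>j. (\<lambda>x. G x $ j) \<in> SC" by metis
  moreover from this have "GDERIV (\<lambda>x. theta m (u x)) x :> (theta (m + 2) (u x) - real m * theta (m + 1) (u x)) *\<^sub>R G x" for x
    by (intro GDERIV_DERIV_compose theta_deriv) auto
  ultimately show ?case using SC_theta.hyps
    by (intro exI[of _ "\<lambda>x. (theta (m + 2) (u x) - real m * theta (m + 1) (u x)) *\<^sub>R G x"])
      (auto intro!: SC.SC_mult SC_diff SC.SC_theta intro: SC.SC_const)
qed

lemma SC_pd: assumes "u \<in> SC" shows "u differentiable at x" "pd j u \<in> SC"
proof -
  obtain G where G: "\<forall>x. GDERIV u x :> G x" "\<forall>j. (\<lambda>x. G x $ j) \<in> SC"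
    using SC_gderiv[OF assms] by metis
  then show "u differentiable at x" by (auto simp: gderiv_def differentiable_def)
  have "pd j u = (\<lambda>x. G x $ j)" using G(1) by (auto simp: fun_eq_iff intro: pd_gderiv)
  with G(2) show "pd j u \<in> SC" by simp
qed

lemma SC_cont: "u \<in> SC \<Longrightarrow> continuous_on S u"
  using SC_pd(1) differentiable_imp_continuous_within
  by (metis continuous_at_imp_continuous_on)

lemma SC_smooth: "u \<in> SC \<Longrightarrow> smooth U u"
proof -
  have "u \<in> SC \<Longrightarrow> Ck k U u" for k
    by (induction k arbitrary: u) (auto intro: SC_cont SC_pd)
  then show "u \<in> SC \<Longrightarrow> smooth U u" by (simp add: smooth_def)
qed

definition bump :: "real^'n::finite \<Rightarrow> real \<Rightarrow> real^'n \<Rightarrow> real" where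
  "bump q r w = theta 0 (r^2 - (norm (w - q))^2)"

text \<open>The gradient of the bump function, by the chain rule and \<open>theta_deriv\<close> for \<open>m = 0\<close>.\<close>

definition bump_grad :: "real^'n::finite \<Rightarrow> real \<Rightarrow> real^'n \<Rightarrow> real^'n" where
  "bump_grad q r w = (- 2 * theta 2 (r^2 - (norm (w - q))^2)) *\<^sub>R (w - q)"

lemma theta_cont [continuous_intros]: "continuous_on S u \<Longrightarrow> continuous_on S (\<lambda>x. theta m (u x))"
proof -
  have "continuous_on UNIV (theta m)"
    using theta_deriv DERIV_isCont by (metis continuous_at_imp_continuous_on)
  then show "continuous_on S u \<Longrightarrow> continuous_on S (\<lambda>x. theta m (u x))"
    using continuous_on_compose2[of UNIV "theta m"] by blast
qed

lemma bump_cont [continuous_intros]: "continuous_on S (bump q r)" "continuous_on S (bump_grad q r)"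
  unfolding bump_def[abs_def] bump_grad_def[abs_def] by (intro continuous_intros)+

lemma bump_nonneg: "bump q r w \<ge> 0"
  by (simp add: bump_def theta_def)

lemma bump_le1: "bump q r w \<le> 1"
  by (simp add: bump_def theta_def)

lemma bump_pos_iff: "r > 0 \<Longrightarrow> bump q r w \<noteq> 0 \<longleftrightarrow> w \<in> ball q r"
proof -
  assume "r > 0"
  then have "norm (w - q) < r \<longleftrightarrow> (norm (w - q))^2 < r^2"
    by (smt (verit) norm_ge_zero power2_less_imp_less power_strict_mono zero_less_numeral)
  then show ?thesis by (auto simp: bump_def theta_def dist_norm norm_minus_commute)
qed

lemma bump_0: "r > 0 \<Longrightarrow> w \<notin> ball q r \<Longrightarrow> bump q r w = 0 \<and> bump_grad q r w = 0"
  using bump_pos_iff[of r q w] by (auto simp: bump_def bump_grad_def theta_def split: if_splits)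

lemma bump_gderiv: "GDERIV (bump q r) w :> bump_grad q r w"
proof -
  have 1: "GDERIV (\<lambda>w. r^2 - (norm (w - q))^2) w :> - 2 *\<^sub>R (w - q)"
    unfolding gderiv_def power2_norm_eq_inner
    by (auto intro!: derivative_eq_intros simp: inner_commute algebra_simps)
  show ?thesis
    using GDERIV_DERIV_compose[OF 1 theta_deriv[of 0]]
    by (simp add: bump_def[abs_def] bump_grad_def mult.commute flip: numeral_2_eq_2)
qed

lemma bump_SC: "(\<lambda>y. bump q r (x - y)) \<in> SC" "bump q r \<in> SC"
proof -
  have *: "bump q r w = theta 0 (r^2 - (\<Sum>i\<in>UNIV. (w $ i - q $ i) * (w $ i - q $ i)))" for w
    by (simp add: bump_def power2_norm_eq_inner inner_vec_def)
  show "(\<lambda>y. bump q r (x - y)) \<in> SC"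
    unfolding * vector_minus_component
    by (intro SC_theta SC_diff SC_const SC_sum SC_mult SC_coord) auto
  show "bump q r \<in> SC"
    unfolding *[abs_def]
    by (intro SC_theta SC_diff SC_const SC_sum SC_mult SC_coord) auto
qed

section \<open>Continuity of translations in the mean\<close>

lemma lborel_distr_reflect: "distr lborel borel (\<lambda>y. x - y) = (lborel :: 'a::euclidean_space measure)"
  by (subst (2) lborel_affine[of "-1" x]) (auto simp: density_1)

lemma lborel_distr_shift: "distr lborel borel (\<lambda>y. y - w) = (lborel :: 'a::euclidean_space measure)"
proof -
  have "(\<lambda>y. y - w) = (+) (- w)" by auto
  then show ?thesis using lborel_distr_plus[of "- w"] by simp
qed

lemma integral_shift:
  fixes f :: "'a::euclidean_space \<Rightarrow> 'b::{banach, second_countable_topology}"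
  assumes [measurable]: "f \<in> borel_measurable borel"
  shows "(LINT x|lborel. f (x - w)) = (LINT x|lborel. f x)"
    and "integrable lborel (\<lambda>x. f (x - w)) \<longleftrightarrow> integrable lborel f"
  by (subst (2) lborel_distr_shift[of w, symmetric], simp add: integral_distr integrable_distr_eq)+

lemma integral_reflect:
  fixes f :: "'a::euclidean_space \<Rightarrow> 'b::{banach, second_countable_topology}"
  assumes [measurable]: "f \<in> borel_measurable borel"
  shows "(LINT y|lborel. f (x - y)) = (LINT y|lborel. f y)"
    and "integrable lborel (\<lambda>y. f (x - y)) \<longleftrightarrow> integrable lborel f"
  by (subst (2) lborel_distr_reflect[of x, symmetric], simp add: integral_distr integrable_distr_eq)+

text \<open>The modulus of continuity of translations in \<open>L^1\<close>.\<close>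

definition L1_shift :: "('a::euclidean_space \<Rightarrow> real) \<Rightarrow> 'a \<Rightarrow> real" where
  "L1_shift F w = (LINT x|lborel. \<bar>F (x - w) - F x\<bar>)"

lemma L1_shift_add_le:
  assumes F: "integrable lborel F" and G: "integrable lborel G"
  shows "L1_shift F w \<le> L1_shift G w + 2 * (LINT x|lborel. \<bar>F x - G x\<bar>)"
proof -
  have [measurable]: "F \<in> borel_measurable borel" "G \<in> borel_measurable borel"
    using F G by auto
  have i: "integrable lborel (\<lambda>x. F (x - w))" "integrable lborel (\<lambda>x. G (x - w))"
    using F G integral_shift(2)[of F w] integral_shift(2)[of G w] by auto
  have "L1_shift F w \<le> (LINT x|lborel. \<bar>G (x - w) - G x\<bar> + (\<bar>F (x - w) - G (x - w)\<bar> + \<bar>F x - G x\<bar>))"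
    unfolding L1_shift_def using F G i by (intro integral_mono) auto
  also have "\<dots> = L1_shift G w + ((LINT x|lborel. \<bar>F (x - w) - G (x - w)\<bar>) + (LINT x|lborel. \<bar>F x - G x\<bar>))"
    unfolding L1_shift_def using F G i by simp
  finally show ?thesis using integral_shift(1)[of "\<lambda>x. \<bar>F x - G x\<bar>" w] by simp
qed

text \<open>For an open set the shifted indicators converge pointwise on the set itself, and the rest of the
  difference is accounted for by translation invariance: \<open>|1_U(x-v) - 1_U(x)|\<close> has integral \<open>2 |U| - 2 |U \<inter> (U
  + v)|\<close>.\<close>

lemma L1_shift_indicator_open:
  assumes U: "open U" "emeasure lborel U < \<infinity>" and w: "w \<longlonglongrightarrow> (0::'a::euclidean_space)"
  shows "(\<lambda>n. L1_shift (indicator U) (w n)) \<longlonglongrightarrow> 0"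
proof -
  let ?i = "indicator U :: 'a \<Rightarrow> real"
  have [measurable]: "U \<in> sets borel" using U by auto
  have int: "integrable lborel ?i" using U by (simp add: integrable_indicator_iff)
  have 1: "L1_shift ?i v = 2 * (LINT x|lborel. ?i x) - 2 * (LINT x|lborel. ?i x * ?i (x - v))" for v
  proof -
    have i2: "integrable lborel (\<lambda>x. ?i (x - v))" using int by (subst integral_shift) auto
    have i3: "integrable lborel (\<lambda>x. ?i x * ?i (x - v))"
      by (rule bintegrable_bound[OF int]) (auto simp: indicator_def)
    have "L1_shift ?i v = (LINT x|lborel. ?i (x - v) + ?i x - 2 * (?i x * ?i (x - v)))"
      unfolding L1_shift_def by (intro bint_cong) (auto simp: indicator_def)
    also have "\<dots> = (LINT x|lborel. ?i (x - v)) + (LINT x|lborel. ?i x) - 2 * (LINT x|lborel. ?i x * ?i (x - v))"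
      using int i2 i3 by simp
    finally show ?thesis using integral_shift(1)[of ?i v] by simp
  qed
  have "(\<lambda>n. LINT x|lborel. ?i x * ?i (x - w n)) \<longlonglongrightarrow> (LINT x|lborel. ?i x)"
  proof (rule integral_dominated_convergence[where w="?i"])
    have "(\<lambda>n. ?i x * ?i (x - w n)) \<longlonglongrightarrow> ?i x" for x
    proof (cases "x \<in> U")
      case True
      have "(\<lambda>n. x - w n) \<longlonglongrightarrow> x" using tendsto_diff[OF tendsto_const w, of x] by simp
      then have "\<forall>\<^sub>F n in sequentially. x - w n \<in> U" using U(1) True topological_tendstoD by blast
      then show ?thesis using True by (intro tendsto_eventually) (auto elim: eventually_mono)
    qed simp
    then show "AE x in lborel. (\<lambda>n. ?i x * ?i (x - w n)) \<longlonglongrightarrow> ?i x" by simp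
  qed (use int in \<open>auto simp: indicator_def\<close>)
  from tendsto_diff[OF tendsto_const tendsto_mult[OF tendsto_const this, of 2], of "2 * (LINT x|lborel. ?i x)"]
  show ?thesis unfolding 1 by simp
qed

lemma L1_shift_nonneg: "L1_shift F w \<ge> 0"
  by (simp add: L1_shift_def)

lemma L1_shift_approx:
  assumes F: "integrable lborel F"
    and ap: "\<And>e. e > 0 \<Longrightarrow> \<exists>G. integrable lborel G \<and> (LINT x|lborel. \<bar>F x - G x\<bar>) \<le> e \<and> (\<lambda>n. L1_shift G (w n)) \<longlonglongrightarrow> 0"
  shows "(\<lambda>n. L1_shift F (w n)) \<longlonglongrightarrow> 0"
proof (rule tendstoI)
  fix e :: real assume "e > 0"
  then obtain G where G: "integrable lborel G" "(LINT x|lborel. \<bar>F x - G x\<bar>) \<le> e / 3" "(\<lambda>n. L1_shift G (w n)) \<longlonglongrightarrow> 0"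
    using ap[of "e / 3"] by auto
  have "\<forall>\<^sub>F n in sequentially. dist (L1_shift G (w n)) 0 < e / 3"
    using tendstoD[OF G(3), of "e / 3"] \<open>e > 0\<close> by simp
  then show "\<forall>\<^sub>F n in sequentially. dist (L1_shift F (w n)) 0 < e"
  proof eventually_elim
    case (elim n)
    then show ?case using L1_shift_add_le[OF F G(1), of "w n"] G(2) L1_shift_nonneg[of F "w n"] by (simp add: dist_real_def)
  qed
qed

text \<open>Indicators of measurable sets are approximated by those of open supersets, and the class of functions
  with the property is closed under sums and \<open>L^1\<close> limits.\<close>

lemma L1_shift_tendsto:
  assumes F: "integrable lborel F" and w: "w \<longlonglongrightarrow> (0::'a::euclidean_space)"
  shows "(\<lambda>n. L1_shift F (w n)) \<longlonglongrightarrow> 0"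
  using F
proof (induction rule: integrable_induct)
  case (base A c)
  then have [measurable]: "A \<in> sets borel" by simp
  have intA: "integrable lborel (indicator A :: 'a \<Rightarrow> real)"
    using base by (simp add: integrable_indicator_iff)
  have ind: "(\<lambda>n. L1_shift (indicator A) (w n)) \<longlonglongrightarrow> 0"
  proof (rule L1_shift_approx[OF intA])
    fix e :: real assume "e > 0"
    then obtain U where U: "open U" "A \<subseteq> U" "emeasure lborel (U - A) < e"
      using outer_regular_lborel[of A e] by auto
    have [measurable]: "U \<in> sets borel" using U by auto
    have "emeasure lborel U = emeasure lborel A + emeasure lborel (U - A)"
      using U by (subst plus_emeasure) (auto intro: arg_cong[where f="emeasure lborel"])
    also have "\<dots> < \<infinity>" using base U(3) by (auto simp: less_top ennreal_add_eq_top) (metis ennreal_less_top less_trans top.not_eq_extremum)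
    finally have Ufin: "emeasure lborel U < \<infinity>" .
    then have iU: "integrable lborel (indicator U :: 'a \<Rightarrow> real)" by (simp add: integrable_indicator_iff)
    have "(LINT x|lborel. \<bar>indicator A x - indicator U x :: real\<bar>) = (LINT x|lborel. indicator (U - A) x)"
      using U(2) by (intro bint_cong) (auto simp: indicator_def)
    also have "\<dots> = measure lborel (U - A)" by simp
    also have "\<dots> \<le> e" using U(3) \<open>e > 0\<close> by (simp add: measure_def enn2real_leI less_imp_le)
    finally show "\<exists>G. integrable lborel G \<and> (LINT x|lborel. \<bar>indicator A x - G x\<bar>) \<le> e \<and> (\<lambda>n. L1_shift G (w n)) \<longlonglongrightarrow> 0"
      using iU L1_shift_indicator_open[OF U(1) Ufin w] by blast
  qed
  have "L1_shift (\<lambda>x. indicator A x *\<^sub>R c) v = \<bar>c\<bar> * L1_shift (indicator A) v" for v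
  proof -
    have "\<bar>indicator A (x - v) *\<^sub>R c - indicator A x *\<^sub>R c\<bar> = \<bar>c\<bar> * \<bar>indicator A (x - v) - indicator A x :: real\<bar>" for x
      by (auto simp: indicator_def)
    then show ?thesis unfolding L1_shift_def by simp
  qed
  then show ?case using tendsto_mult[OF tendsto_const ind, of "\<bar>c\<bar>"] by simp
next
  case (add f g)
  have "L1_shift (\<lambda>x. f x + g x) v \<le> L1_shift f v + L1_shift g v" for v
  proof -
    have i: "integrable lborel (\<lambda>x. f (x - v))" "integrable lborel (\<lambda>x. g (x - v))"
      using add integral_shift(2)[of f v] integral_shift(2)[of g v] by auto
    have "L1_shift (\<lambda>x. f x + g x) v \<le> (LINT x|lborel. \<bar>f (x - v) - f x\<bar> + \<bar>g (x - v) - g x\<bar>)"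
      unfolding L1_shift_def using add i by (intro integral_mono) auto
    also have "\<dots> = L1_shift f v + L1_shift g v"
      unfolding L1_shift_def using add i by simp
    finally show ?thesis .
  qed
  note le = this
  have t: "(\<lambda>n. L1_shift f (w n)) \<longlonglongrightarrow> 0" "(\<lambda>n. L1_shift g (w n)) \<longlonglongrightarrow> 0" using add by blast+
  have t2: "(\<lambda>n. L1_shift f (w n) + L1_shift g (w n)) \<longlonglongrightarrow> 0" using tendsto_add[OF t] by simp
  show ?case
    by (rule tendsto_sandwich[OF always_eventually always_eventually tendsto_const t2])
      (auto intro: le L1_shift_nonneg)
next
  case (lim f s)
  show ?case
  proof (rule L1_shift_approx[OF lim(4)])
    fix e :: real assume "e > 0"
    have "(\<lambda>i. LINT x|lborel. \<bar>f x - s i x\<bar>) \<longlonglongrightarrow> (LINT x|lborel. \<bar>f x - f x\<bar>)"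
    proof (rule integral_dominated_convergence[where w="\<lambda>x. 3 * \<bar>f x\<bar>"])
      show "AE x in lborel. (\<lambda>i. \<bar>f x - s i x\<bar>) \<longlonglongrightarrow> \<bar>f x - f x\<bar>"
        using lim(2) by (intro AE_I2 tendsto_intros) auto
      show "AE x in lborel. norm \<bar>f x - s i x\<bar> \<le> 3 * \<bar>f x\<bar>" for i
      proof (rule AE_I2)
        fix x show "norm \<bar>f x - s i x\<bar> \<le> 3 * \<bar>f x\<bar>"
          using lim(3)[of x i] by (simp add: abs_if split: if_splits)
      qed
    qed (use lim in auto)
    then have "\<forall>\<^sub>F i in sequentially. (LINT x|lborel. \<bar>f x - s i x\<bar>) < e"
      using \<open>e > 0\<close> by (auto dest: order_tendstoD(2))
    then obtain i where "(LINT x|lborel. \<bar>f x - s i x\<bar>) < e"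
      using eventually_happens by fastforce
    then show "\<exists>G. integrable lborel G \<and> (LINT x|lborel. \<bar>f x - G x\<bar>) \<le> e \<and> (\<lambda>n. L1_shift G (w n)) \<longlonglongrightarrow> 0"
      using lim by (intro exI[of _ "s i"]) auto
  qed
qed

text \<open>Truncation at height \<open>M\<close> changes little in \<open>L^2\<close>, and the shift difference of the truncated function is
  at most \<open>2 M\<close>, so its square is at most \<open>2 M\<close> times the unsquared difference, which is small in \<open>L^1\<close>.\<close>

lemma L2_shift_tendsto:
  fixes F :: "'a::euclidean_space \<Rightarrow> real"
  assumes F: "integrable lborel F" "integrable lborel (\<lambda>x. (F x)^2)" and w: "w \<longlonglongrightarrow> 0"
  shows "(\<lambda>n. LINT x|lborel. (F (x - w n) - F x)^2) \<longlonglongrightarrow> 0"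
proof (rule tendstoI)
  fix e :: real assume "e > 0"
  have [measurable]: "F \<in> borel_measurable borel" using F by auto
  \<comment> \<open>truncation at height \<open>M\<close>\<close>
  define T where "T M x = max (- real M) (min (real M) (F x))" for M x
  have [measurable]: "T M \<in> borel_measurable borel" for M unfolding T_def[abs_def] by measurable
  have "(\<lambda>M. LINT x|lborel. (F x - T M x)^2) \<longlonglongrightarrow> (LINT x|(lborel::'a measure). 0)"
  proof (rule integral_dominated_convergence[where w="\<lambda>x. (F x)^2"])
    have "(\<lambda>M. (F x - T M x)^2) \<longlonglongrightarrow> 0" for x
    proof (rule tendsto_eventually)
      obtain N where "\<bar>F x\<bar> \<le> real N" using real_arch_simple by blast
      then show "\<forall>\<^sub>F M in sequentially. (F x - T M x)^2 = 0"
        unfolding eventually_sequentially T_def by (intro exI[of _ N]) auto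
    qed
    then show "AE x in lborel. (\<lambda>M. (F x - T M x)^2) \<longlonglongrightarrow> 0" by simp
    show "AE x in lborel. norm ((F x - T M x)^2) \<le> (F x)^2" for M
    proof (rule AE_I2)
      fix x have "\<bar>F x - T M x\<bar> \<le> \<bar>F x\<bar>" unfolding T_def by auto
      then show "norm ((F x - T M x)^2) \<le> (F x)^2" by (simp add: abs_le_square_iff)
    qed
  qed (use F in auto)
  then have "\<forall>\<^sub>F M in sequentially. (LINT x|lborel. (F x - T M x)^2) < e / 12"
    using \<open>e > 0\<close> by (intro order_tendstoD(2)) auto
  then obtain M where M: "(LINT x|lborel. (F x - T M x)^2) < e / 12"
    using eventually_happens by fastforce
  have iR: "integrable lborel (\<lambda>x. (F x - T M x)^2)"
  proof (rule bintegrable_bound[OF F(2)])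
    show "AE x in lborel. norm ((F x - T M x)^2) \<le> norm ((F x)^2)"
    proof (rule AE_I2)
      fix x have "\<bar>F x - T M x\<bar> \<le> \<bar>F x\<bar>" unfolding T_def by auto
      then show "norm ((F x - T M x)^2) \<le> norm ((F x)^2)" by (simp add: abs_le_square_iff)
    qed
  qed simp
  have bound: "(LINT x|lborel. (F (x - v) - F x)^2) \<le> 6 * (LINT x|lborel. (F x - T M x)^2) + 6 * real M * L1_shift F v" for v
  proof -
    have i: "integrable lborel (\<lambda>x. (F (x - v) - T M (x - v))^2)"
      using integral_shift(2)[of "\<lambda>x. (F x - T M x)^2" v] iR by simp
    have iF: "integrable lborel (\<lambda>x. F (x - v))" using integral_shift(2)[of F v] F(1) by simp
    then have iD: "integrable lborel (\<lambda>x. \<bar>F (x - v) - F x\<bar>)" using F(1) by simp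
    have "(LINT x|lborel. (F (x - v) - F x)^2) \<le>
        (LINT x|lborel. 3 * (F (x - v) - T M (x - v))^2 + (3 * (F x - T M x)^2 + 6 * real M * \<bar>F (x - v) - F x\<bar>))"
    proof (rule integral_mono')
      show "integrable lborel (\<lambda>x. 3 * (F (x - v) - T M (x - v))^2 + (3 * (F x - T M x)^2 + 6 * real M * \<bar>F (x - v) - F x\<bar>))"
        using i iR iD by simp
      fix x
      let ?a = "F (x - v) - T M (x - v)" and ?b = "F x - T M x" and ?c = "T M (x - v) - T M x"
      have c1: "\<bar>?c\<bar> \<le> \<bar>F (x - v) - F x\<bar>" unfolding T_def by auto
      have c2: "\<bar>?c\<bar> \<le> 2 * real M" unfolding T_def by auto
      have "?c^2 = \<bar>?c\<bar> * \<bar>?c\<bar>" by (simp add: power2_eq_square)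
      also have "\<dots> \<le> (2 * real M) * \<bar>F (x - v) - F x\<bar>" using c1 c2 by (intro mult_mono) auto
      finally have c3: "?c^2 \<le> (2 * real M) * \<bar>F (x - v) - F x\<bar>" .
      have "(F (x - v) - F x)^2 = (?a + ?c - ?b)^2" by simp
      also have "\<dots> \<le> 3 * ?a^2 + 3 * ?b^2 + 3 * ?c^2"
      proof -
        have "(a + c - b)^2 \<le> 3 * a^2 + 3 * b^2 + 3 * c^2" for a b c :: real
          using sum_squares_ge_zero[of "a - c" "b + c"] zero_le_power2[of "a + b"]
          by (simp add: power2_eq_square algebra_simps)
        then show ?thesis .
      qed
      finally show "(F (x - v) - F x)^2 \<le> 3 * ?a^2 + (3 * ?b^2 + 6 * real M * \<bar>F (x - v) - F x\<bar>)"
        using c3 by simp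
    qed simp
    also have "\<dots> = 3 * (LINT x|lborel. (F (x - v) - T M (x - v))^2) + (3 * (LINT x|lborel. (F x - T M x)^2) + 6 * real M * L1_shift F v)"
      unfolding L1_shift_def using i iR iD by simp
    finally show ?thesis using integral_shift(1)[of "\<lambda>x. (F x - T M x)^2" v] by simp
  qed
  have "(\<lambda>n. 6 * real M * L1_shift F (w n)) \<longlonglongrightarrow> 6 * real M * 0"
    by (intro tendsto_intros L1_shift_tendsto F w)
  then have "\<forall>\<^sub>F n in sequentially. 6 * real M * L1_shift F (w n) < e / 2"
    using \<open>e > 0\<close> by (intro order_tendstoD(2)) auto
  then show "\<forall>\<^sub>F n in sequentially. dist (LINT x|lborel. (F (x - w n) - F x)^2) 0 < e"
  proof eventually_elim
    case (elim n)
    then show ?case using bound[of "w n"] M by (simp add: dist_real_def)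
  qed
qed

lemma L1_shift_small:
  fixes F :: "'a::euclidean_space \<Rightarrow> real"
  assumes F: "integrable lborel F" and e: "e > 0"
  shows "\<exists>\<delta>>0. \<forall>w. norm w < \<delta> \<longrightarrow> (LINT x|lborel. \<bar>F (x - w) - F x\<bar>) < e"
proof -
  have "isCont (L1_shift F) 0"
    unfolding continuous_at_sequentially o_def using L1_shift_tendsto[OF F] by (simp add: L1_shift_def)
  then have "\<exists>\<delta>>0. \<forall>w. dist w 0 < \<delta> \<longrightarrow> dist (L1_shift F w) (L1_shift F 0) < e"
    using e unfolding continuous_at_eps_delta by blast
  then show ?thesis by (auto simp: L1_shift_def)
qed

lemma L2_shift_small:
  fixes F :: "'a::euclidean_space \<Rightarrow> real"
  assumes F: "integrable lborel F" "integrable lborel (\<lambda>x. (F x)^2)" and e: "e > 0"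
  shows "\<exists>\<delta>>0. \<forall>w. norm w < \<delta> \<longrightarrow> (LINT x|lborel. (F (x - w) - F x)^2) < e"
proof -
  let ?T = "\<lambda>w. LINT x|lborel. (F (x - w) - F x)^2"
  have "isCont ?T 0"
    unfolding continuous_at_sequentially o_def using L2_shift_tendsto[OF F] by simp
  then have "\<exists>\<delta>>0. \<forall>w. dist w 0 < \<delta> \<longrightarrow> dist (?T w) (?T 0) < e"
    using e unfolding continuous_at_eps_delta by blast
  then show ?thesis by auto
qed

lemma supp_bdd:
  fixes g :: "real^'n::finite \<Rightarrow> 'b::real_normed_vector"
  assumes "continuous_on UNIV g" "\<And>w. w \<notin> ball q r \<Longrightarrow> g w = 0"
  shows "\<exists>B\<ge>0. \<forall>w. norm (g w) \<le> B"
proof -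
  have "bounded (g ` cball q r)"
    by (intro compact_imp_bounded compact_continuous_image continuous_on_subset[OF assms(1)]) auto
  then obtain B where B: "B > 0" "\<And>w. w \<in> cball q r \<Longrightarrow> norm (g w) \<le> B"
    unfolding bounded_pos by auto
  have "norm (g w) \<le> B" for w
    using B assms(2)[of w] by (cases "w \<in> cball q r") auto
  with B(1) show ?thesis by (intro exI[of _ B]) auto
qed

lemma supp_uniformly_continuous:
  fixes g :: "real^'n::finite \<Rightarrow> 'b::real_normed_vector"
  assumes c: "continuous_on UNIV g" and z: "\<And>w. w \<notin> ball q r \<Longrightarrow> g w = 0" and e: "e > 0"
  shows "\<exists>\<delta>>0. \<forall>x y. norm (x - y) < \<delta> \<longrightarrow> norm (g x - g y) < e"
proof -
  have "uniformly_continuous_on (cball q (r + 1)) g"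
    by (intro compact_uniformly_continuous continuous_on_subset[OF c]) auto
  then obtain \<delta> where \<delta>: "\<delta> > 0" "\<And>x y. x \<in> cball q (r+1) \<Longrightarrow> y \<in> cball q (r+1) \<Longrightarrow> dist y x < \<delta> \<Longrightarrow> dist (g y) (g x) < e"
    using e unfolding uniformly_continuous_on_def by metis
  have "norm (g x - g y) < e" if "norm (x - y) < min \<delta> 1" for x y
  proof (cases "x \<in> cball q (r+1) \<and> y \<in> cball q (r+1)")
    case True
    then show ?thesis using \<delta>(2)[of y x] that by (simp add: dist_norm)
  next
    case False
    have "dist q x \<le> dist q y + norm (x - y)" "dist q y \<le> dist q x + norm (x - y)"
      by (metis dist_commute dist_norm dist_triangle add.commute)+
    then have "g x = 0" "g y = 0"
      using False that z[of x] z[of y] by auto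
    then show ?thesis using e by simp
  qed
  then show ?thesis using \<delta>(1) by (intro exI[of _ "min \<delta> 1"]) auto
qed

section \<open>Mollification\<close>

definition moll :: "(real^'n::finite \<Rightarrow> real) \<Rightarrow> (real^'n \<Rightarrow> real) \<Rightarrow> real^'n \<Rightarrow> real" where
  "moll k F x = (LINT y|lborel. F y * k (x - y))"

text \<open>The gradient of the mollified function, obtained by differentiating the kernel.\<close>

definition mollg :: "(real^'n::finite \<Rightarrow> real^'n) \<Rightarrow> (real^'n \<Rightarrow> real) \<Rightarrow> real^'n \<Rightarrow> real^'n" where
  "mollg kg F x = (LINT y|lborel. F y *\<^sub>R kg (x - y))"

lemma integrable_scaleR_bdd:
  fixes g :: "'a \<Rightarrow> 'b::{banach, second_countable_topology}" and F :: "'a \<Rightarrow> real"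
  assumes F: "integrable M F" and g: "g \<in> borel_measurable M" "\<And>y. norm (g y) \<le> B"
  shows "integrable M (\<lambda>y. F y *\<^sub>R g y)"
proof (rule bintegrable_bound[where f="\<lambda>y. B * F y"])
  show "AE y in M. norm (F y *\<^sub>R g y) \<le> norm (B * F y)"
  proof (rule AE_I2)
    fix y
    have "\<bar>F y\<bar> * norm (g y) \<le> \<bar>F y\<bar> * \<bar>B\<bar>"
      using g(2)[of y] by (intro mult_left_mono) auto
    then show "norm (F y *\<^sub>R g y) \<le> norm (B * F y)" by (simp add: abs_mult mult.commute)
  qed
  show "integrable M (\<lambda>y. B * F y)" using F by simp
  show "(\<lambda>y. F y *\<^sub>R g y) \<in> borel_measurable M" using borel_measurable_integrable[OF F] g(1) by measurable
qed

lemma cont_shift_meas: "continuous_on UNIV (g :: real^'n::finite \<Rightarrow> 'b::{banach, second_countable_topology}) \<Longrightarrow> (\<lambda>y. g (x - y)) \<in> borel_measurable borel"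
proof (rule borel_measurable_continuous_onI)
  assume "continuous_on UNIV g"
  then show "continuous_on UNIV (\<lambda>y. g (x - y))"
    by (rule continuous_on_compose2) (auto intro!: continuous_intros)
qed

text \<open>Uniform continuity of the gradient of the compactly supported kernel makes the first-order remainder
  uniformly small, which allows differentiation under the integral.\<close>

lemma moll_gderiv:
  fixes F :: "real^'n::finite \<Rightarrow> real"
  assumes F: "integrable lborel F"
    and k: "\<And>w. GDERIV k w :> kg w" "continuous_on UNIV kg"
      "\<And>w. w \<notin> ball q r \<Longrightarrow> k w = 0" "\<And>w. w \<notin> ball q r \<Longrightarrow> kg w = 0"
  shows "GDERIV (moll k F) x :> mollg kg F x" and "continuous_on UNIV (mollg kg F)"
proof -
  have kc: "continuous_on UNIV k"
    using k(1) unfolding gderiv_def by (meson has_derivative_continuous continuous_at_imp_continuous_on)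
  obtain B where B: "\<And>w. norm (k w) \<le> B" using supp_bdd[of k q r, OF kc k(3)] by blast
  obtain B' where B': "\<And>w. norm (kg w) \<le> B'" using supp_bdd[of kg q r, OF k(2) k(4)] by blast
  have ik: "integrable lborel (\<lambda>y. F y * k (x - y))" for x
    using integrable_scaleR_bdd[OF F _ B, of "\<lambda>y. x - y"] cont_shift_meas[OF kc] by simp
  have ikg: "integrable lborel (\<lambda>y. F y *\<^sub>R kg (x - y))" for x
    using integrable_scaleR_bdd[OF F _ B', of "\<lambda>y. x - y"] cont_shift_meas[OF k(2)] by simp
  let ?I = "LINT y|lborel. \<bar>F y\<bar>"
  have I0: "?I \<ge> 0" by simp
  have ratio: "?I / (?I + 1) \<le> 1"
  proof -
    have "?I + 1 > 0" using I0 by linarith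
    then show ?thesis by (rule pos_divide_le_eq[THEN iffD2]) simp
  qed
  have iF: "integrable lborel (\<lambda>y. \<bar>F y\<bar>)" using F by simp
  show "GDERIV (moll k F) x :> mollg kg F x"
    unfolding gderiv_def has_derivative_at_alt
  proof (intro conjI allI impI)
    show "bounded_linear (\<lambda>h. h \<bullet> mollg kg F x)" by (rule bounded_linear_inner_left)
    fix e :: real assume e: "e > 0"
    define e' where "e' = e / (?I + 1)"
    have e': "e' > 0" unfolding e'_def using e I0 by (intro divide_pos_pos add_nonneg_pos) auto
    obtain \<delta> where \<delta>: "\<delta> > 0" "\<And>x y. norm (x - y) < \<delta> \<Longrightarrow> norm (kg x - kg y) < e'"
      using supp_uniformly_continuous[OF k(2) k(4) e'] by metis
    have lin: "\<bar>k (z + h) - k z - h \<bullet> kg z\<bar> \<le> e' * norm h" if h: "norm h < \<delta>" for z h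
    proof -
      have "norm (k (z + h) - k z - ((z + h - z) \<bullet> kg z)) \<le> norm (z + h - z) * e'"
      proof (rule differentiable_bound_linearization[where S="ball z \<delta>" and f'="\<lambda>x h. h \<bullet> kg x"])
        fix t :: real assume t: "t \<in> {0..1}"
        have "norm (t *\<^sub>R h) \<le> norm h" using t by (simp add: mult_left_le_one_le)
        then show "z + t *\<^sub>R (z + h - z) \<in> ball z \<delta>" using h by (simp add: dist_norm)
      next
        fix y assume "y \<in> ball z \<delta>"
        then have n: "norm (kg y - kg z) < e'" by (intro \<delta>(2)) (simp add: dist_norm norm_minus_commute)
        show "(k has_derivative (\<lambda>h. h \<bullet> kg y)) (at y within ball z \<delta>)"
          using k(1)[of y] unfolding gderiv_def by (rule has_derivative_at_withinI)
        show "onorm ((\<lambda>h. h \<bullet> kg y) - (\<lambda>h. h \<bullet> kg z)) \<le> e'"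
        proof (rule onorm_bound)
          show "norm (((\<lambda>h. h \<bullet> kg y) - (\<lambda>h. h \<bullet> kg z)) v) \<le> e' * norm v" for v
            using Cauchy_Schwarz_ineq2[of v "kg y - kg z"] mult_left_mono[OF less_imp_le[OF n], of "norm v"]
            by (simp add: inner_diff_right mult.commute)
        qed (use e' in simp)
      qed (use \<delta> in auto)
      then show ?thesis by (simp add: mult.commute)
    qed
    show "\<exists>d>0. \<forall>y. norm (y - x) < d \<longrightarrow> norm (moll k F y - moll k F x - (y - x) \<bullet> mollg kg F x) \<le> e * norm (y - x)"
    proof (intro exI conjI allI impI)
      fix y assume y: "norm (y - x) < \<delta>"
      define h where "h = y - x"
      have r: "moll k F y - moll k F x - h \<bullet> mollg kg F x = (LINT z|lborel. F z * (k (x - z + h) - k (x - z) - h \<bullet> kg (x - z)))"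
      proof -
        have "h \<bullet> mollg kg F x = (LINT z|lborel. F z * (h \<bullet> kg (x - z)))"
          unfolding mollg_def using ikg[of x] by (subst integral_inner_right[symmetric]) auto
        moreover have "integrable lborel (\<lambda>z. F z * (h \<bullet> kg (x - z)))"
          using integrable_inner_right[OF ikg[of x], of h] by simp
        moreover have "F z * (k (x - z + h) - k (x - z) - h \<bullet> kg (x - z)) = F z * k (y - z) - F z * k (x - z) - F z * (h \<bullet> kg (x - z))" for z
          unfolding h_def by (simp add: right_diff_distrib)
        ultimately show ?thesis using ik[of x] ik[of y] by (simp add: moll_def)
      qed
      have "norm (moll k F y - moll k F x - h \<bullet> mollg kg F x) \<le> (LINT z|lborel. norm (F z * (k (x - z + h) - k (x - z) - h \<bullet> kg (x - z))))"
        unfolding r by (rule integral_norm_bound)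
      also have "\<dots> \<le> (LINT z|lborel. \<bar>F z\<bar> * (e' * norm h))"
      proof (rule integral_mono')
        show "norm (F z * (k (x - z + h) - k (x - z) - h \<bullet> kg (x - z))) \<le> \<bar>F z\<bar> * (e' * norm h)" for z
          unfolding real_norm_def abs_mult using lin[of h "x - z"] y by (intro mult_left_mono) (auto simp: h_def)
      qed (use iF e' in auto)
      also have "\<dots> = ?I * e' * norm h" by simp
      also have "\<dots> \<le> e * norm h"
      proof (rule mult_right_mono)
        have "?I * e' = (?I / (?I + 1)) * e" by (simp add: e'_def)
        also have "\<dots> \<le> 1 * e" using e by (intro mult_right_mono[OF ratio]) simp
        finally show "?I * e' \<le> e" by simp
      qed simp
      finally show "norm (moll k F y - moll k F x - (y - x) \<bullet> mollg kg F x) \<le> e * norm (y - x)"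
        by (simp add: h_def)
    qed (rule \<delta>(1))
  qed
  show "continuous_on UNIV (mollg kg F)"
    unfolding continuous_on_iff
  proof (intro ballI allI impI)
    fix x :: "real^'n" and e :: real assume e: "e > 0"
    define e' where "e' = e / (?I + 1) / 2"
    have e': "e' > 0" unfolding e'_def using e I0 by (intro divide_pos_pos add_nonneg_pos) auto
    obtain \<delta> where \<delta>: "\<delta> > 0" "\<And>x y. norm (x - y) < \<delta> \<Longrightarrow> norm (kg x - kg y) < e'"
      using supp_uniformly_continuous[OF k(2) k(4) e'] by metis
    show "\<exists>d>0. \<forall>x'\<in>UNIV. dist x' x < d \<longrightarrow> dist (mollg kg F x') (mollg kg F x) < e"
    proof (intro exI conjI ballI impI)
      fix x' assume d: "dist x' x < \<delta>"
      have "mollg kg F x' - mollg kg F x = (LINT z|lborel. F z *\<^sub>R (kg (x' - z) - kg (x - z)))"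
        unfolding mollg_def using ikg[of x] ikg[of x'] by (simp add: scaleR_diff_right)
      also have "norm \<dots> \<le> (LINT z|lborel. norm (F z *\<^sub>R (kg (x' - z) - kg (x - z))))"
        by (rule integral_norm_bound)
      also have "\<dots> \<le> (LINT z|lborel. \<bar>F z\<bar> * e')"
      proof (rule integral_mono')
        fix z
        have "norm (kg (x' - z) - kg (x - z)) \<le> e'"
          using \<delta>(2)[of "x' - z" "x - z"] d by (simp add: dist_norm)
        then show "norm (F z *\<^sub>R (kg (x' - z) - kg (x - z))) \<le> \<bar>F z\<bar> * e'"
          by (simp add: mult_left_mono)
      qed (use iF e' in auto)
      also have "\<dots> = ?I * e'" by simp
      also have "\<dots> < e"
      proof -
        have "?I * e' = (?I / (?I + 1)) * (e / 2)" by (simp add: e'_def)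
        also have "\<dots> \<le> 1 * (e / 2)" using e by (intro mult_right_mono[OF ratio]) simp
        finally show ?thesis using e by simp
      qed
      finally show "dist (mollg kg F x') (mollg kg F x) < e" by (simp add: dist_norm)
    qed (rule \<delta>(1))
  qed
qed

lemma moll_conv:
  assumes [measurable]: "F \<in> borel_measurable borel" and k: "continuous_on UNIV k"
  shows "moll k F x = (LINT w|lborel. F (x - w) * k w)"
proof -
  have [measurable]: "k \<in> borel_measurable borel" using k by (rule borel_measurable_continuous_onI)
  show ?thesis unfolding moll_def
    using integral_reflect(1)[of "\<lambda>w. F (x - w) * k w" x] by simp
qed

text \<open>A probability density supported in a ball that need not be centred at the origin: near the boundary a
  function is averaged over points lying further inside the domain.\<close>

definition kernel :: "real^'n::finite \<Rightarrow> real \<Rightarrow> (real^'n \<Rightarrow> real) \<Rightarrow> bool" where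
  "kernel q r k \<longleftrightarrow> continuous_on UNIV k \<and> (\<forall>w. k w \<ge> 0) \<and> (\<forall>w. w \<notin> ball q r \<longrightarrow> k w = 0) \<and>
     integrable lborel k \<and> (LINT w|lborel. k w) = 1"

lemma kernel_diff:
  assumes F: "integrable lborel F" and k: "kernel q r k"
  shows "moll k F x - c = (LINT w|lborel. (F (x - w) - c) * k w)" "integrable lborel (\<lambda>w. (F (x - w) - c) * k w)"
proof -
  have kc: "continuous_on UNIV k" using k by (simp add: kernel_def)
  have [measurable]: "F \<in> borel_measurable borel" "k \<in> borel_measurable borel"
    using F k by (auto simp: kernel_def)
  obtain B where B: "\<And>w. norm (k w) \<le> B" using supp_bdd[of k q r, OF kc] k unfolding kernel_def by blast
  have "integrable lborel (\<lambda>w. F (x - w))" using integral_reflect(2)[of F x] F by simp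
  from integrable_scaleR_bdd[OF this _ B] have i: "integrable lborel (\<lambda>w. F (x - w) * k w)" by simp
  show "integrable lborel (\<lambda>w. (F (x - w) - c) * k w)"
    using i k by (simp add: left_diff_distrib kernel_def)
  show "moll k F x - c = (LINT w|lborel. (F (x - w) - c) * k w)"
    unfolding moll_conv[OF \<open>F \<in> _\<close> kc] using i k by (simp add: left_diff_distrib kernel_def)
qed

lemma moll_near:
  assumes F: "integrable lborel F" and k: "kernel q r k" and "\<And>w. w \<in> ball q r \<Longrightarrow> \<bar>F (x - w) - c\<bar> \<le> e"
  shows "\<bar>moll k F x - c\<bar> \<le> e"
proof -
  have "\<bar>moll k F x - c\<bar> \<le> (LINT w|lborel. \<bar>(F (x - w) - c) * k w\<bar>)"
    unfolding kernel_diff(1)[OF F k] by (rule integral_abs_bound)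
  also have "\<dots> \<le> (LINT w|lborel. e * k w)"
  proof (rule integral_mono)
    show "integrable lborel (\<lambda>w. \<bar>(F (x - w) - c) * k w\<bar>)" using kernel_diff(2)[OF F k] by simp
    show "integrable lborel (\<lambda>w. e * k w)" using k by (simp add: kernel_def)
    show "\<bar>(F (x - w) - c) * k w\<bar> \<le> e * k w" for w
      using assms(3)[of w] k by (cases "w \<in> ball q r") (auto simp: kernel_def abs_mult intro: mult_right_mono)
  qed
  also have "\<dots> = e" using k by (simp add: kernel_def)
  finally show ?thesis .
qed

text \<open>The Minkowski inequality for mollification, for a general convex penalty \<open>N\<close>: with Jensen's inequality
  \<open>J\<close>, exchanging the integrals reduces the error to translations by vectors in the support of the kernel.
  Both \<open>L^1\<close> and \<open>L^2\<close> convergence follow from it.\<close>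

lemma moll_Lp_aux:
  fixes F :: "real^'n::finite \<Rightarrow> real"
  assumes F: "integrable lborel F" and k: "kernel q r k"
    and N [measurable]: "N \<in> borel_measurable (borel :: real measure)" and N0: "\<And>t. N t \<ge> 0"
    and J: "\<And>x. ennreal (N (moll k F x - F x)) \<le> (\<integral>\<^sup>+w. ennreal (N (F (x - w) - F x) * k w) \<partial>lborel)"
    and M: "\<And>w. w \<in> ball q r \<Longrightarrow> (\<integral>\<^sup>+x. ennreal (N (F (x - w) - F x)) \<partial>lborel) \<le> M"
  shows "(\<integral>\<^sup>+x. ennreal (N (moll k F x - F x)) \<partial>lborel) \<le> M"
proof -
  have [measurable]: "F \<in> borel_measurable borel" "k \<in> borel_measurable borel"
    using F k by (auto simp: kernel_def)
  have k0: "k w \<ge> 0" for w using k by (simp add: kernel_def)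
  have "(\<integral>\<^sup>+x. ennreal (N (moll k F x - F x)) \<partial>lborel) \<le> (\<integral>\<^sup>+x. \<integral>\<^sup>+w. ennreal (N (F (x - w) - F x) * k w) \<partial>lborel \<partial>lborel)"
    by (intro nn_integral_mono J)
  also have "\<dots> = (\<integral>\<^sup>+w. \<integral>\<^sup>+x. ennreal (N (F (x - w) - F x) * k w) \<partial>lborel \<partial>lborel)"
    by (rule lborel_pair.Fubini') measurable
  also have "\<dots> \<le> (\<integral>\<^sup>+w. M * ennreal (k w) \<partial>lborel)"
  proof (rule nn_integral_mono)
    fix w
    have "(\<integral>\<^sup>+x. ennreal (N (F (x - w) - F x) * k w) \<partial>lborel) = (\<integral>\<^sup>+x. ennreal (N (F (x - w) - F x)) \<partial>lborel) * ennreal (k w)"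
      using N0 k0 by (simp add: ennreal_mult nn_integral_multc)
    also have "\<dots> \<le> M * ennreal (k w)"
    proof (cases "w \<in> ball q r")
      case False
      then show ?thesis using k by (simp add: kernel_def)
    qed (intro mult_right_mono M, auto)
    finally show "(\<integral>\<^sup>+x. ennreal (N (F (x - w) - F x) * k w) \<partial>lborel) \<le> M * ennreal (k w)" .
  qed
  also have "\<dots> = M * ennreal (LINT w|lborel. k w)"
    using k by (subst nn_integral_cmult) (auto simp: kernel_def nn_integral_eq_integral)
  also have "\<dots> = M" using k by (simp add: kernel_def)
  finally show ?thesis .
qed

lemma moll_L1:
  fixes F :: "real^'n::finite \<Rightarrow> real"
  assumes F: "integrable lborel F" and k: "kernel q r k"
    and M: "\<And>w. w \<in> ball q r \<Longrightarrow> (LINT x|lborel. \<bar>F (x - w) - F x\<bar>) \<le> M"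
  shows "(\<integral>\<^sup>+x. ennreal \<bar>moll k F x - F x\<bar> \<partial>lborel) \<le> M"
proof (rule moll_Lp_aux[OF F k])
  have k0: "k w \<ge> 0" for w using k by (simp add: kernel_def)
  show "ennreal \<bar>moll k F x - F x\<bar> \<le> (\<integral>\<^sup>+w. ennreal (\<bar>F (x - w) - F x\<bar> * k w) \<partial>lborel)" for x
  proof -
    have "\<bar>moll k F x - F x\<bar> \<le> (LINT w|lborel. \<bar>(F (x - w) - F x) * k w\<bar>)"
      unfolding kernel_diff(1)[OF F k] by (rule integral_abs_bound)
    then have "ennreal \<bar>moll k F x - F x\<bar> \<le> ennreal (LINT w|lborel. \<bar>(F (x - w) - F x) * k w\<bar>)"
      by (rule ennreal_leI)
    also have "\<dots> = (\<integral>\<^sup>+w. ennreal \<bar>(F (x - w) - F x) * k w\<bar> \<partial>lborel)"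
      using kernel_diff(2)[OF F k] by (intro nn_integral_eq_integral[symmetric]) auto
    finally show ?thesis using k0 by (simp add: abs_mult)
  qed
  show "(\<integral>\<^sup>+x. ennreal \<bar>F (x - w) - F x\<bar> \<partial>lborel) \<le> ennreal M" if "w \<in> ball q r" for w
  proof -
    have "integrable lborel (\<lambda>x. F (x - w))" using integral_shift(2)[of F w] F by simp
    then have "(\<integral>\<^sup>+x. ennreal \<bar>F (x - w) - F x\<bar> \<partial>lborel) = ennreal (LINT x|lborel. \<bar>F (x - w) - F x\<bar>)"
      using F by (intro nn_integral_eq_integral) auto
    then show ?thesis using M[OF that] by (simp add: ennreal_leI)
  qed
qed auto

lemma moll_L2:
  fixes F :: "real^'n::finite \<Rightarrow> real"
  assumes F: "integrable lborel F" "integrable lborel (\<lambda>x. (F x)^2)" and k: "kernel q r k"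
    and M: "\<And>w. w \<in> ball q r \<Longrightarrow> (LINT x|lborel. (F (x - w) - F x)^2) \<le> M"
  shows "(\<integral>\<^sup>+x. ennreal ((moll k F x - F x)^2) \<partial>lborel) \<le> M"
proof (rule moll_Lp_aux[OF F(1) k, where N="\<lambda>t. t^2"])
  have [measurable]: "F \<in> borel_measurable borel" "k \<in> borel_measurable borel"
    using F k by (auto simp: kernel_def)
  have k0: "k w \<ge> 0" for w using k by (simp add: kernel_def)
  show "ennreal ((moll k F x - F x)^2) \<le> (\<integral>\<^sup>+w. ennreal ((F (x - w) - F x)^2 * k w) \<partial>lborel)" for x
  proof (cases "(\<integral>\<^sup>+w. ennreal ((F (x - w) - F x)^2 * k w) \<partial>lborel) = \<infinity>")
    case False
    let ?D = "\<lambda>w. F (x - w) - F x" and ?m = "moll k F x - F x"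
    have i2: "integrable lborel (\<lambda>w. (?D w)^2 * k w)"
      using False k0 by (intro integrableI_nonneg) (auto simp: less_top)
    note i1 = kernel_diff[OF F(1) k, of x "F x"]
    have "0 \<le> (LINT w|lborel. (?D w - ?m)^2 * k w)"
      using k0 by (intro integral_nonneg_AE) auto
    also have "\<dots> = (LINT w|lborel. (?D w)^2 * k w - (2 * ?m) * (?D w * k w) + ?m^2 * k w)"
      by (intro bint_cong) (auto simp: power2_eq_square algebra_simps)
    also have "\<dots> = (LINT w|lborel. (?D w)^2 * k w) - (2 * ?m) * ?m + ?m^2"
      using i2 i1 k by (simp add: kernel_def)
    finally have "0 \<le> (LINT w|lborel. (?D w)^2 * k w) - (2 * ?m) * ?m + ?m^2" .
    moreover have "(2 * ?m) * ?m = 2 * ?m^2" unfolding power2_eq_square by (rule mult.assoc)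
    ultimately have "?m^2 \<le> (LINT w|lborel. (?D w)^2 * k w)" by linarith
    then have "ennreal (?m^2) \<le> ennreal (LINT w|lborel. (?D w)^2 * k w)" by (rule ennreal_leI)
    also have "\<dots> = (\<integral>\<^sup>+w. ennreal ((?D w)^2 * k w) \<partial>lborel)"
      using i2 k0 by (intro nn_integral_eq_integral[symmetric]) auto
    finally show ?thesis .
  qed simp
  show "(\<integral>\<^sup>+x. ennreal ((F (x - w) - F x)^2) \<partial>lborel) \<le> ennreal M" if "w \<in> ball q r" for w
  proof -
    have "integrable lborel (\<lambda>x. (F (x - w))^2)" using integral_shift(2)[of "\<lambda>x. (F x)^2" w] F by simp
    then have "integrable lborel (\<lambda>x. 2 * (F (x - w))^2 + 2 * (F x)^2)" using F by simp
    then have "integrable lborel (\<lambda>x. (F (x - w) - F x)^2)"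
    proof (rule bintegrable_bound)
      have "(a - b)^2 \<le> 2 * a^2 + 2 * b^2" for a b :: real
        using zero_le_power2[of "a + b"] by (simp add: power2_eq_square algebra_simps)
      then show "AE x in lborel. norm ((F (x - w) - F x)^2) \<le> norm (2 * (F (x - w))^2 + 2 * (F x)^2)"
        by (auto intro: order_trans)
    qed simp
    then have "(\<integral>\<^sup>+x. ennreal ((F (x - w) - F x)^2) \<partial>lborel) = ennreal (LINT x|lborel. (F (x - w) - F x)^2)"
      by (intro nn_integral_eq_integral) auto
    then show ?thesis using M[OF that] by (simp add: ennreal_leI)
  qed
qed auto

text \<open>The normalised bump function.\<close>

definition bker :: "real^'n::finite \<Rightarrow> real \<Rightarrow> real^'n \<Rightarrow> real" where
  "bker q r w = bump q r w * inverse (LINT w|lborel. bump q r w)"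

definition bker_grad :: "real^'n::finite \<Rightarrow> real \<Rightarrow> real^'n \<Rightarrow> real^'n" where
  "bker_grad q r w = inverse (LINT w|lborel. bump q r w) *\<^sub>R bump_grad q r w"

lemma bump_integral:
  assumes "r > 0"
  shows "integrable lborel (bump q r)" "(LINT w|lborel. bump q r w) > 0"
proof -
  have [measurable]: "bump q r \<in> borel_measurable borel"
    by (intro borel_measurable_continuous_onI continuous_intros)
  have "integrable lborel (indicator (ball q r) :: _ \<Rightarrow> real)"
    using emeasure_lborel_ball_finite[of q r] by (simp add: integrable_indicator_iff)
  then show i: "integrable lborel (bump q r)"
  proof (rule bintegrable_bound)
    show "AE w in lborel. norm (bump q r w) \<le> norm (indicator (ball q r) w :: real)"
    proof (rule AE_I2)
      fix w show "norm (bump q r w) \<le> norm (indicator (ball q r) w :: real)"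
      proof (cases "w \<in> ball q r")
        case True
        then show ?thesis using bump_le1[of q r w] bump_nonneg[of q r w] by simp
      next
        case False
        then show ?thesis using bump_0[OF assms False] by simp
      qed
    qed
  qed simp
  show "(LINT w|lborel. bump q r w) > 0"
  proof (rule ccontr)
    assume "\<not> ?thesis"
    moreover have "(LINT w|lborel. bump q r w) \<ge> 0" using bump_nonneg by (intro integral_nonneg_AE) auto
    ultimately have "(LINT w|lborel. bump q r w) = 0" by linarith
    then have "AE w in lborel. bump q r w = 0"
      using i bump_nonneg by (subst (asm) integral_nonneg_eq_0_iff_AE) auto
    then have "AE w in lborel. w \<notin> ball q r"
      by eventually_elim (use bump_pos_iff[OF assms] in blast)
    then have "ball q r \<in> null_sets lborel" by (simp add: AE_iff_null_sets)
    then have "negligible (ball q r)" by (simp add: negligible_iff_null_sets null_sets_completion_iff)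
    then show False using open_not_negligible[of "ball q r"] assms by simp
  qed
qed

lemma bker_kernel: assumes "r > 0" shows "kernel q r (bker q r)"
proof -
  note b = bump_integral[OF assms, of q]
  have "bker q r w \<ge> 0" for w
    unfolding bker_def using bump_nonneg b(2) by (intro mult_nonneg_nonneg) auto
  moreover have "bker q r w = 0" if "w \<notin> ball q r" for w
    unfolding bker_def using bump_0[OF assms that] by simp
  moreover have "continuous_on UNIV (bker q r)" unfolding bker_def[abs_def] by (intro continuous_intros)
  ultimately show ?thesis unfolding kernel_def using b by (auto simp: bker_def[abs_def])
qed

lemma bker_gderiv: "GDERIV (bker q r) w :> bker_grad q r w"
  using GDERIV_mult[OF bump_gderiv[of q r w] GDERIV_const[of "inverse (LINT w|lborel. bump q r w)"]]
  by (simp add: bker_def[abs_def] bker_grad_def)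

lemma bker_grad_props: "continuous_on UNIV (bker_grad q r)" "r > 0 \<Longrightarrow> w \<notin> ball q r \<Longrightarrow> bker_grad q r w = 0"
  unfolding bker_grad_def[abs_def] using bump_0[of r w q] by (auto intro!: continuous_intros)

lemma bker_SC: "(\<lambda>y. bker q r (x - y)) \<in> SC"
  unfolding bker_def by (intro SC_mult SC_const bump_SC)

lemma bker_moll_gderiv:
  assumes "integrable lborel F" "r > 0"
  shows "GDERIV (moll (bker q r) F) x :> mollg (bker_grad q r) F x" "continuous_on UNIV (mollg (bker_grad q r) F)"
proof -
  have z: "w \<notin> ball q r \<Longrightarrow> bker q r w = 0" for w using bker_kernel[OF assms(2), of q] unfolding kernel_def by blast
  show "GDERIV (moll (bker q r) F) x :> mollg (bker_grad q r) F x" "continuous_on UNIV (mollg (bker_grad q r) F)"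
    using moll_gderiv[OF assms(1) bker_gderiv bker_grad_props(1) z bker_grad_props(2)[OF assms(2)]] by blast+
qed

lemma bker_L1_small:
  fixes F :: "real^'n::finite \<Rightarrow> real"
  assumes F: "integrable lborel F" and e: "e > 0"
  shows "\<exists>\<delta>>0. \<forall>q r. r > 0 \<longrightarrow> norm q + r < \<delta> \<longrightarrow> (\<integral>\<^sup>+x. ennreal \<bar>moll (bker q r) F x - F x\<bar> \<partial>lborel) \<le> ennreal e"
proof -
  obtain \<delta> where \<delta>: "\<delta> > 0" "\<And>w. norm w < \<delta> \<Longrightarrow> (LINT x|lborel. \<bar>F (x - w) - F x\<bar>) < e"
    using L1_shift_small[OF F e] by metis
  have "(\<integral>\<^sup>+x. ennreal \<bar>moll (bker q r) F x - F x\<bar> \<partial>lborel) \<le> ennreal e" if "r > 0" "norm q + r < \<delta>" for q r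
  proof (rule moll_L1[OF F bker_kernel[OF that(1)]])
    fix w assume "w \<in> ball q r"
    then have "norm w < \<delta>" using that norm_triangle_ineq2[of w q] by (simp add: dist_norm norm_minus_commute)
    then show "(LINT x|lborel. \<bar>F (x - w) - F x\<bar>) \<le> e" using \<delta>(2) by (simp add: less_imp_le)
  qed
  then show ?thesis using \<delta>(1) by auto
qed

lemma bker_L2_small:
  fixes F :: "real^'n::finite \<Rightarrow> real"
  assumes F: "integrable lborel F" "integrable lborel (\<lambda>x. (F x)^2)" and e: "e > 0"
  shows "\<exists>\<delta>>0. \<forall>q r. r > 0 \<longrightarrow> norm q + r < \<delta> \<longrightarrow> (\<integral>\<^sup>+x. ennreal ((moll (bker q r) F x - F x)^2) \<partial>lborel) \<le> ennreal e"
proof -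
  obtain \<delta> where \<delta>: "\<delta> > 0" "\<And>w. norm w < \<delta> \<Longrightarrow> (LINT x|lborel. (F (x - w) - F x)^2) < e"
    using L2_shift_small[OF F e] by metis
  have "(\<integral>\<^sup>+x. ennreal ((moll (bker q r) F x - F x)^2) \<partial>lborel) \<le> ennreal e" if "r > 0" "norm q + r < \<delta>" for q r
  proof (rule moll_L2[OF F bker_kernel[OF that(1)]])
    fix w assume "w \<in> ball q r"
    then have "norm w < \<delta>" using that norm_triangle_ineq2[of w q] by (simp add: dist_norm norm_minus_commute)
    then show "(LINT x|lborel. (F (x - w) - F x)^2) \<le> e" using \<delta>(2) by (simp add: less_imp_le)
  qed
  then show ?thesis using \<delta>(1) by auto
qed

section \<open>Uniqueness of weak derivatives\<close>

lemma bker_test_fun: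
  assumes r: "r > 0" and U: "cball (x - q) r \<subseteq> U"
  shows "test_fun U (\<lambda>y. bker q r (x - y))"
proof -
  have "{y. bker q r (x - y) \<noteq> 0} \<subseteq> cball (x - q) r"
  proof
    fix y assume "y \<in> {y. bker q r (x - y) \<noteq> 0}"
    then have "x - y \<in> ball q r" using bker_kernel[OF r, of q] unfolding kernel_def by blast
    then show "y \<in> cball (x - q) r" by (simp add: dist_norm algebra_simps norm_minus_commute)
  qed
  then have c: "closure {y. bker q r (x - y) \<noteq> 0} \<subseteq> cball (x - q) r"
    by (rule closure_minimal) simp
  show ?thesis
    unfolding test_fun_def
  proof (intro conjI)
    show "smooth UNIV (\<lambda>y. bker q r (x - y))" by (rule SC_smooth[OF bker_SC])
    show "compact (closure {y. bker q r (x - y) \<noteq> 0})"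
      using c by (meson bounded_cball bounded_subset closed_closure compact_eq_bounded_closed)
    show "closure {y. bker q r (x - y) \<noteq> 0} \<subseteq> U" using c U by blast
  qed
qed

lemma pd_mk_reflect: "pd j (\<lambda>y. bker q r (x - y)) y = - bker_grad q r (x - y) $ j"
proof -
  have "GDERIV (\<lambda>y. bker q r (x - y)) y :> - bker_grad q r (x - y)"
    unfolding gderiv_def
    by (rule has_derivative_eq_rhs[OF has_derivative_compose[of "\<lambda>y. x - y" "\<lambda>h. - h" y UNIV "bker q r" "\<lambda>h. h \<bullet> bker_grad q r (x - y)"]])
       (use bker_gderiv[of q r "x - y"] in \<open>auto simp: gderiv_def intro!: derivative_eq_intros\<close>)
  from pd_gderiv[OF this] show ?thesis by simp
qed

text \<open>A Borel function on the whole space that vanishes off the domain and agrees with \<open>f\<close> almost everywhere;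
  it turns Lebesgue integrals over the domain into integrals against \<open>lborel\<close>.\<close>

definition borel_rep :: "(real^'n::finite) set \<Rightarrow> (real^'n \<Rightarrow> real) \<Rightarrow> (real^'n \<Rightarrow> real) \<Rightarrow> bool" where
  "borel_rep \<Omega> f F \<longleftrightarrow> F \<in> borel_measurable borel \<and> (\<forall>x. x \<notin> \<Omega> \<longrightarrow> F x = 0) \<and> (AE x in lebesgue. F x = indicator \<Omega> x * f x)"

lemma borel_rep_exists:
  assumes "set_borel_measurable lebesgue \<Omega> f" "\<Omega> \<in> sets borel"
  shows "\<exists>F. borel_rep \<Omega> f F"
proof -
  obtain G where G: "G \<in> borel_measurable lborel" "AE x in lborel. indicator \<Omega> x * f x = G x"
    using completion_ex_borel_measurable_real[of "\<lambda>x. indicator \<Omega> x * f x" lborel] assms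
    unfolding set_borel_measurable_def by auto
  have "borel_rep \<Omega> f (\<lambda>x. indicator \<Omega> x * G x)"
    unfolding borel_rep_def
  proof (intro conjI)
    show "(\<lambda>x. indicator \<Omega> x * G x) \<in> borel_measurable borel" using G(1) assms(2) by simp
    show "AE x in lebesgue. indicator \<Omega> x * G x = indicator \<Omega> x * f x"
      using AE_completion[OF G(2)] by eventually_elim (auto simp: indicator_def split: if_splits)
  qed auto
  then show ?thesis by blast
qed

lemma borel_rep_integral:
  assumes F: "borel_rep \<Omega> f F" and [measurable]: "h \<in> borel_measurable borel"
  shows "integrable lborel (\<lambda>x. F x * h x) \<longleftrightarrow> set_integrable lebesgue \<Omega> (\<lambda>x. f x * h x)"
    and "(LINT x|lborel. F x * h x) = (LINT x:\<Omega>|lebesgue. f x * h x)"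
proof -
  have [measurable]: "F \<in> borel_measurable borel" using F by (simp add: borel_rep_def)
  have ae: "AE x in lebesgue. F x * h x = indicator \<Omega> x *\<^sub>R (f x * h x)"
    using F unfolding borel_rep_def by (auto elim!: eventually_mono)
  have m: "(\<lambda>x. F x * h x) \<in> borel_measurable lebesgue"
    by (rule measurable_completion) simp
  have m2: "(\<lambda>x. indicator \<Omega> x *\<^sub>R (f x * h x)) \<in> borel_measurable lebesgue"
    using m ae by (rule borel_measurable_AE)
  show "integrable lborel (\<lambda>x. F x * h x) \<longleftrightarrow> set_integrable lebesgue \<Omega> (\<lambda>x. f x * h x)"
    unfolding set_integrable_def using integrable_cong_AE[OF m m2 ae] integrable_completion[of "\<lambda>x. F x * h x" lborel] by simp
  show "(LINT x|lborel. F x * h x) = (LINT x:\<Omega>|lebesgue. f x * h x)"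
    unfolding set_lebesgue_integral_def using integral_cong_AE[OF m m2 ae] integral_completion[of "\<lambda>x. F x * h x" lborel] by simp
qed

text \<open>The kernel \<open>y \<mapsto> k (x - y)\<close> is a test function when its support lies in the domain, so the derivative
  passes to the weak derivative.\<close>

lemma wpd_moll:
  assumes w: "is_wpd \<Omega> j f v" and F: "borel_rep \<Omega> f F" and V: "borel_rep \<Omega> v V" and iF: "integrable lborel F"
    and r: "r > 0" and x: "cball (x - q) r \<subseteq> \<Omega>"
  shows "mollg (bker_grad q r) F x $ j = moll (bker q r) V x"
proof -
  let ?\<phi> = "\<lambda>y. bker q r (x - y)"
  have z: "w \<notin> ball q r \<Longrightarrow> bker_grad q r w = 0" for w by (rule bker_grad_props(2)[OF r])
  obtain B where B: "\<And>w. norm (bker_grad q r w) \<le> B" using supp_bdd[OF bker_grad_props(1) z] by blast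
  have m: "(\<lambda>y. bker_grad q r (x - y)) \<in> borel_measurable borel"
    by (rule cont_shift_meas[OF bker_grad_props(1)])
  have bker: "?\<phi> \<in> borel_measurable borel"
    using bker_kernel[OF r, of q] by (intro cont_shift_meas) (auto simp: kernel_def)
  have mj: "(\<lambda>y. - bker_grad q r (x - y) $ j) \<in> borel_measurable borel"
    using measurable_compose[OF m borel_measurable_continuous_onI[of "\<lambda>z. - z $ j"]] by (simp add: continuous_intros)
  have i: "integrable lborel (\<lambda>y. F y *\<^sub>R bker_grad q r (x - y))"
    by (rule integrable_scaleR_bdd[OF iF _ B]) (use m in simp)
  have "(LINT y:\<Omega>|lebesgue. f y * (- bker_grad q r (x - y) $ j)) = - (LINT y:\<Omega>|lebesgue. v y * ?\<phi> y)"
    using w bker_test_fun[OF r x] unfolding is_wpd_def pd_mk_reflect[symmetric] by blast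
  then have "(LINT y|lborel. F y * (- bker_grad q r (x - y) $ j)) = - (LINT y|lborel. V y * ?\<phi> y)"
    by (simp only: borel_rep_integral(2)[OF F mj] borel_rep_integral(2)[OF V bker])
  moreover have "mollg (bker_grad q r) F x $ j = (LINT y|lborel. F y * bker_grad q r (x - y) $ j)"
    unfolding mollg_def using integral_bounded_linear[OF bounded_linear_vec_nth[of j] i] by simp
  ultimately show ?thesis by (simp add: moll_def)
qed

text \<open>Locally, every mollification of \<open>w\<close> vanishes because the kernel is a test function, and the
  mollifications converge to \<open>w\<close> in \<open>L^1\<close>. A countable subcover by balls globalises the statement.\<close>

lemma fundamental_lemma:
  fixes w :: "real^'n::finite \<Rightarrow> real"
  assumes \<Omega>: "open \<Omega>" and w: "locally_integrable \<Omega> w"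
    and z: "\<And>\<phi>. test_fun \<Omega> \<phi> \<Longrightarrow> (LINT x:\<Omega>|lebesgue. w x * \<phi> x) = 0"
  shows "AE x in lebesgue. x \<in> \<Omega> \<longrightarrow> w x = 0"
proof -
  have loc: "\<exists>\<rho>>0. (AE x in lebesgue. x \<in> ball p \<rho> \<longrightarrow> w x = 0)" if p: "p \<in> \<Omega>" for p
  proof -
    obtain R where R: "R > 0" "cball p R \<subseteq> \<Omega>" using \<Omega> p open_contains_cball by blast
    let ?K = "cball p R" and ?\<rho> = "R / 2"
    have iK: "set_integrable lebesgue ?K w" using w R(2) unfolding locally_integrable_def by simp
    have "set_borel_measurable lebesgue ?K w" using iK by (simp add: set_integrable_def set_borel_measurable_def)
    then obtain F where F: "borel_rep ?K w F" using borel_rep_exists by (metis borel_closed closed_cball)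
    have iF: "integrable lborel F"
      using borel_rep_integral(1)[OF F, of "\<lambda>x. 1"] iK by simp
    have m0: "moll (bker 0 r) F x = 0" if r: "0 < r" "r \<le> ?\<rho>" and x: "x \<in> ball p ?\<rho>" for r x
    proof -
      let ?\<phi> = "\<lambda>y. bker 0 r (x - y)"
      have sub: "cball (x - 0) r \<subseteq> ?K"
      proof
        fix y assume "y \<in> cball (x - 0) r"
        then show "y \<in> ?K" using r x dist_triangle[of p y x] by (simp add: dist_commute)
      qed
      have k0: "?\<phi> y = 0" if "y \<notin> ?K" for y
      proof -
        have "x - y \<notin> ball 0 r"
        proof
          assume "x - y \<in> ball 0 r"
          then have "y \<in> cball (x - 0) r" by (simp add: dist_norm norm_minus_commute)
          then show False using that sub by blast
        qed
        then show ?thesis using bker_kernel[OF r(1), of 0] unfolding kernel_def by blast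
      qed
      have "moll (bker 0 r) F x = (LINT y:?K|lebesgue. w y * ?\<phi> y)"
        unfolding moll_def
        by (rule borel_rep_integral(2)[OF F]) (use bker_kernel[OF r(1), of 0] in \<open>auto intro!: cont_shift_meas simp: kernel_def\<close>)
      also have "\<dots> = (LINT y:\<Omega>|lebesgue. w y * ?\<phi> y)"
        unfolding set_lebesgue_integral_def
      proof (intro bint_cong refl)
        fix y show "indicator ?K y *\<^sub>R (w y * ?\<phi> y) = indicator \<Omega> y *\<^sub>R (w y * ?\<phi> y)"
          using R(2) k0[of y] by (cases "y \<in> ?K") (auto simp del: mem_cball)
      qed
      also have "\<dots> = 0"
        by (rule z[OF bker_test_fun[OF r(1)]]) (use sub R(2) in blast)
      finally show ?thesis .
    qed
    have [measurable]: "F \<in> borel_measurable borel" using F by (simp add: borel_rep_def)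
    have "(\<integral>\<^sup>+x. ennreal \<bar>F x\<bar> * indicator (ball p ?\<rho>) x \<partial>lborel) \<le> ennreal e" if "e > 0" for e
    proof -
      obtain \<delta> where \<delta>: "\<delta> > 0" "\<forall>q r. r > 0 \<longrightarrow> norm q + r < \<delta> \<longrightarrow> (\<integral>\<^sup>+x. ennreal \<bar>moll (bker q r) F x - F x\<bar> \<partial>lborel) \<le> ennreal e"
        using bker_L1_small[OF iF \<open>e > 0\<close>] by blast
      define r where "r = min ?\<rho> (\<delta> / 2)"
      have r: "0 < r" "r \<le> ?\<rho>" "norm (0::real^'n) + r < \<delta>" using \<delta>(1) R(1) by (auto simp: r_def)
      have "(\<integral>\<^sup>+x. ennreal \<bar>F x\<bar> * indicator (ball p ?\<rho>) x \<partial>lborel) \<le> (\<integral>\<^sup>+x. ennreal \<bar>moll (bker 0 r) F x - F x\<bar> \<partial>lborel)"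
      proof (intro nn_integral_mono)
        fix x show "ennreal \<bar>F x\<bar> * indicator (ball p ?\<rho>) x \<le> ennreal \<bar>moll (bker 0 r) F x - F x\<bar>"
          using m0[OF r(1,2), of x] by (cases "x \<in> ball p ?\<rho>") (simp_all del: mem_ball)
      qed
      also have "\<dots> \<le> ennreal e" using \<delta>(2) r(1,3) by blast
      finally show ?thesis .
    qed
    note bnd = this
    let ?h = "\<lambda>x. ennreal \<bar>F x\<bar> * indicator (ball p ?\<rho>) x"
    have "integral\<^sup>N lborel ?h \<le> 0"
    proof (rule ennreal_le_epsilon)
      fix e :: real assume "0 < e"
      then show "integral\<^sup>N lborel ?h \<le> 0 + ennreal e" using bnd[of e] by (simp only: add_0)
    qed
    then have "integral\<^sup>N lborel ?h = 0" by (simp only: le_zero_eq)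
    moreover have "?h \<in> borel_measurable lborel"
      using borel_open[OF open_ball[of p ?\<rho>]] by (intro borel_measurable_times_ennreal borel_measurable_indicator) simp_all
    ultimately have "AE x in lborel. ennreal \<bar>F x\<bar> * indicator (ball p ?\<rho>) x = 0"
      by (simp only: nn_integral_0_iff_AE)
    then have "AE x in lebesgue. ennreal \<bar>F x\<bar> * indicator (ball p ?\<rho>) x = 0" by (rule AE_completion)
    moreover have "AE x in lebesgue. F x = indicator ?K x * w x" using F by (simp add: borel_rep_def)
    ultimately have "AE x in lebesgue. x \<in> ball p ?\<rho> \<longrightarrow> w x = 0"
    proof eventually_elim
      case (elim x)
      have "ball p ?\<rho> \<subseteq> ?K" using R(1) by (intro subset_trans[OF ball_subset_cball subset_cball]) simp
      then show ?case using elim by (cases "x \<in> ball p ?\<rho>") (auto simp del: mem_ball mem_cball)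
    qed
    then show ?thesis using R(1) by (intro exI[of _ ?\<rho>]) auto
  qed
  then obtain \<rho> where \<rho>: "\<And>p. p \<in> \<Omega> \<Longrightarrow> \<rho> p > 0 \<and> (AE x in lebesgue. x \<in> ball p (\<rho> p) \<longrightarrow> w x = 0)" by metis
  obtain \<F> where \<F>: "\<F> \<subseteq> (\<lambda>p. ball p (\<rho> p)) ` \<Omega>" "countable \<F>" "\<Union>\<F> = \<Union>((\<lambda>p. ball p (\<rho> p)) ` \<Omega>)"
    by (rule Lindelof[of "(\<lambda>p. ball p (\<rho> p)) ` \<Omega>"]) auto
  have "AE x in lebesgue. \<forall>B\<in>\<F>. x \<in> B \<longrightarrow> w x = 0"
  proof (subst AE_ball_countable[OF \<F>(2)], intro ballI)
    fix B assume "B \<in> \<F>"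
    then obtain p where "p \<in> \<Omega>" "B = ball p (\<rho> p)" using \<F>(1) by blast
    then show "AE x in lebesgue. x \<in> B \<longrightarrow> w x = 0" using \<rho>[of p] by (simp only:)
  qed
  then show ?thesis
  proof eventually_elim
    case (elim x)
    show ?case
    proof
      assume x: "x \<in> \<Omega>"
      then have "x \<in> \<Union>\<F>" unfolding \<F>(3) using \<rho>[OF x] by (metis UN_I centre_in_ball)
      then show "w x = 0" using elim by blast
    qed
  qed
qed

lemma test_fun_bdd:
  fixes \<phi> :: "real^'n::finite \<Rightarrow> real"
  assumes "test_fun U \<phi>"
  shows "continuous_on UNIV \<phi>" "continuous_on UNIV (pd j \<phi>)" "\<phi> differentiable at x"
    "\<phi> x \<noteq> 0 \<or> pd j \<phi> x \<noteq> 0 \<Longrightarrow> x \<in> closure {x. \<phi> x \<noteq> 0}"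
proof -
  have sm: "Ck 1 UNIV \<phi>" "Ck 0 UNIV \<phi>" using assms by (auto simp: test_fun_def smooth_def simp del: Ck.simps)
  then show "continuous_on UNIV \<phi>" "continuous_on UNIV (pd j \<phi>)" "\<phi> differentiable at x" by auto
  let ?S = "closure {x. \<phi> x \<noteq> 0}"
  have "pd j \<phi> x = 0" if "x \<notin> ?S"
  proof -
    have "((\<lambda>x. 0) has_derivative (\<lambda>h. 0)) (at x)" by simp
    then have "(\<phi> has_derivative (\<lambda>h. 0)) (at x)"
      by (rule has_derivative_transform_within_open[where s="- ?S"]) (use that closure_subset[of "{x. \<phi> x \<noteq> 0}"] in auto)
    then show ?thesis by (simp add: pd_def frechet_derivative_at[symmetric])
  qed
  moreover have "\<phi> x = 0" if "x \<notin> ?S" using that closure_subset[of "{x. \<phi> x \<noteq> 0}"] by auto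
  ultimately show "\<phi> x \<noteq> 0 \<or> pd j \<phi> x \<noteq> 0 \<Longrightarrow> x \<in> ?S" by blast
qed

lemma locally_integrable_test:
  fixes u h :: "real^'n::finite \<Rightarrow> real"
  assumes u: "locally_integrable U u" and h: "continuous_on UNIV h" and K: "compact K" "K \<subseteq> U" "\<And>x. h x \<noteq> 0 \<Longrightarrow> x \<in> K"
  shows "set_integrable lebesgue U (\<lambda>x. u x * h x)"
proof -
  have i: "integrable lebesgue (\<lambda>x. indicator K x * u x)"
    using u K unfolding locally_integrable_def set_integrable_def by simp
  obtain B where B: "\<And>x. x \<in> K \<Longrightarrow> norm (h x) \<le> B"
    using compact_imp_bounded[OF compact_continuous_image[OF continuous_on_subset[OF h] K(1)]] unfolding bounded_iff by auto
  have hm: "h \<in> borel_measurable lebesgue"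
    using borel_measurable_continuous_onI[OF h] by (simp add: measurable_completion)
  have "integrable lebesgue (\<lambda>x. (indicator K x * u x) *\<^sub>R (indicator K x * h x))"
  proof (rule integrable_scaleR_bdd[OF i, where B="max B 0"])
    show "norm (indicator K y * h y) \<le> max B 0" for y using B[of y] by (auto simp: indicator_def max_def)
    have "K \<in> sets lebesgue" using K(1) by (simp add: borel_compact)
    then show "(\<lambda>x. indicator K x * h x) \<in> borel_measurable lebesgue" using hm by simp
  qed
  also have "(\<lambda>x. (indicator K x * u x) *\<^sub>R (indicator K x * h x)) = (\<lambda>x. indicator U x *\<^sub>R (u x * h x))"
    using K by (auto simp: indicator_def fun_eq_iff)
  finally show ?thesis by (simp add: set_integrable_def)
qed

lemma wpd_unique:
  fixes v v' :: "real^'n::finite \<Rightarrow> real"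
  assumes \<Omega>: "open \<Omega>" and v: "is_wpd \<Omega> j f v" and v': "is_wpd \<Omega> j f v'"
  shows "AE x in lebesgue. x \<in> \<Omega> \<longrightarrow> v x = v' x"
proof -
  have l: "locally_integrable \<Omega> v" "locally_integrable \<Omega> v'" using v v' by (auto simp: is_wpd_def)
  then have "locally_integrable \<Omega> (\<lambda>x. v x - v' x)" unfolding locally_integrable_def by auto
  moreover have "(LINT x:\<Omega>|lebesgue. (v x - v' x) * \<phi> x) = 0" if t: "test_fun \<Omega> \<phi>" for \<phi>
  proof -
    have c: "compact (closure {x. \<phi> x \<noteq> 0})" "closure {x. \<phi> x \<noteq> 0} \<subseteq> \<Omega>" using t by (auto simp: test_fun_def)
    have "set_integrable lebesgue \<Omega> (\<lambda>x. v x * \<phi> x)" "set_integrable lebesgue \<Omega> (\<lambda>x. v' x * \<phi> x)"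
      by (intro locally_integrable_test[OF _ test_fun_bdd(1)[OF t] c] l test_fun_bdd(4)[OF t]; simp)+
    then show ?thesis using v v' t unfolding is_wpd_def by (simp add: left_diff_distrib)
  qed
  ultimately have "AE x in lebesgue. x \<in> \<Omega> \<longrightarrow> v x - v' x = 0" by (rule fundamental_lemma[OF \<Omega>])
  then show ?thesis by simp
qed

lemma wpd_is_wpd: "is_wpd \<Omega> j f v \<Longrightarrow> is_wpd \<Omega> j f (wpd \<Omega> j f)"
  unfolding wpd_def by (rule someI[where P="is_wpd \<Omega> j f"])

lemma wpd_AE: "open \<Omega> \<Longrightarrow> is_wpd \<Omega> j f v \<Longrightarrow> AE x in lebesgue. x \<in> \<Omega> \<longrightarrow> wpd \<Omega> j f x = v x"
  using wpd_unique wpd_is_wpd by blast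

section \<open>Square integrable functions\<close>

definition L2 :: "'a measure \<Rightarrow> ('a \<Rightarrow> real) \<Rightarrow> bool" where
  "L2 M u \<longleftrightarrow> u \<in> borel_measurable M \<and> integrable M (\<lambda>x. (u x)^2)"

text \<open>Convergence in \<open>L^2\<close>, with all functions involved square integrable.\<close>

definition L2lim :: "'a measure \<Rightarrow> (nat \<Rightarrow> 'a \<Rightarrow> real) \<Rightarrow> ('a \<Rightarrow> real) \<Rightarrow> bool" where
  "L2lim M U u \<longleftrightarrow> (\<forall>n. L2 M (U n)) \<and> L2 M u \<and> (\<lambda>n. LINT x|M. (U n x - u x)^2) \<longlonglongrightarrow> 0"

lemma sq_le: "\<bar>a\<bar> \<le> B \<Longrightarrow> a^2 \<le> B^2" for a :: real
  using power_mono[of "\<bar>a\<bar>" B 2] by simp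

lemma L2_prod: assumes "L2 M u" "L2 M v" shows "integrable M (\<lambda>x. u x * v x)"
proof (rule bintegrable_bound)
  show "integrable M (\<lambda>x. (u x)^2 + (v x)^2)" using assms by (simp add: L2_def)
  show "(\<lambda>x. u x * v x) \<in> borel_measurable M" using assms by (auto simp: L2_def)
  have "\<bar>a * b\<bar> \<le> a^2 + b^2" for a b :: real
  proof -
    have "0 \<le> \<bar>a\<bar> * \<bar>b\<bar>" by simp
    then have "\<bar>a\<bar> * \<bar>b\<bar> \<le> 2 * \<bar>a\<bar> * \<bar>b\<bar>" by linarith
    also have "\<dots> \<le> a^2 + b^2" using sum_squares_bound[of "\<bar>a\<bar>" "\<bar>b\<bar>"] by simp
    finally show ?thesis by (simp add: abs_mult)
  qed
  then show "AE x in M. norm (u x * v x) \<le> norm ((u x)^2 + (v x)^2)" by auto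
qed

lemma L2_add: assumes "L2 M u" "L2 M v" shows "L2 M (\<lambda>x. u x + v x)"
proof -
  have "integrable M (\<lambda>x. (u x)^2 + 2 * (u x * v x) + (v x)^2)"
    using L2_prod[OF assms] assms by (simp add: L2_def)
  then show ?thesis using assms by (auto simp: L2_def power2_sum mult.assoc add.commute add.left_commute)
qed

lemma L2_bdd:
  assumes u: "L2 M u" and g: "g \<in> borel_measurable M" "AE x in M. \<bar>g x\<bar> \<le> B"
  shows "L2 M (\<lambda>x. g x * u x)"
  unfolding L2_def
proof
  show m: "(\<lambda>x. g x * u x) \<in> borel_measurable M" using u g(1) by (auto simp: L2_def)
  show "integrable M (\<lambda>x. (g x * u x)^2)"
  proof (rule bintegrable_bound[where f="\<lambda>x. B^2 * (u x)^2"])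
    show "integrable M (\<lambda>x. B^2 * (u x)^2)" using u by (simp add: L2_def)
    show "AE x in M. norm ((g x * u x)^2) \<le> norm (B^2 * (u x)^2)"
      using g(2)
    proof eventually_elim
      case (elim x)
      then have "(g x)^2 \<le> B^2" by (rule sq_le)
      then show ?case by (simp add: power_mult_distrib mult_right_mono)
    qed
  qed (use m in simp)
qed

lemma L2_cmult: "L2 M u \<Longrightarrow> L2 M (\<lambda>x. c * u x)"
  by (rule L2_bdd[where B="\<bar>c\<bar>"]) auto

lemma L2_diff: assumes "L2 M u" "L2 M v" shows "L2 M (\<lambda>x. u x - v x)"
  using L2_add[OF assms(1) L2_cmult[OF assms(2), of "-1"]] by simp

lemma L2_sum: "finite I \<Longrightarrow> (\<And>i. i \<in> I \<Longrightarrow> L2 M (u i)) \<Longrightarrow> L2 M (\<lambda>x. \<Sum>i\<in>I. u i x)"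
proof (induction I rule: finite_induct)
  case empty
  then show ?case by (simp add: L2_def)
qed (auto intro: L2_add)

lemma L2_cong_AE:
  assumes "L2 M u" "v \<in> borel_measurable M" "AE x in M. u x = v x"
  shows "L2 M v"
proof -
  have "integrable M (\<lambda>x. (v x)^2)"
    by (rule integrable_cong_AE_imp[of M "\<lambda>x. (u x)^2"]) (use assms in \<open>auto simp: L2_def elim: eventually_mono\<close>)
  then show ?thesis using assms by (simp add: L2_def)
qed

text \<open>The quadratic form \<open>(s, t) \<mapsto> \<integral> (s u + t v)^2\<close> is nonnegative.\<close>

lemma L2_CS:
  assumes u: "L2 M u" and v: "L2 M v"
  shows "(LINT x|M. u x * v x)^2 \<le> (LINT x|M. (u x)^2) * (LINT x|M. (v x)^2)"
proof -
  let ?a = "LINT x|M. (u x)^2" and ?b = "LINT x|M. u x * v x" and ?c = "LINT x|M. (v x)^2"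
  note i = L2_prod[OF u v] L2_prod[OF u u] L2_prod[OF v v]
  have q: "0 \<le> s^2 * ?a + 2 * s * t * ?b + t^2 * ?c" for s t
  proof -
    have "0 \<le> (LINT x|M. (s * u x + t * v x)^2)" by (intro integral_nonneg_AE) auto
    also have "\<dots> = (LINT x|M. s^2 * (u x)^2 + 2 * s * t * (u x * v x) + t^2 * (v x)^2)"
      by (intro bint_cong) (auto simp: power2_eq_square algebra_simps)
    also have "\<dots> = s^2 * ?a + 2 * s * t * ?b + t^2 * ?c"
      using i by (simp add: power2_eq_square)
    finally show ?thesis .
  qed
  have c0: "?c \<ge> 0" "?a \<ge> 0" by (intro integral_nonneg_AE; simp)+
  show ?thesis
  proof (cases "?c = 0")
    case True
    have "?b = 0"
    proof (rule ccontr)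
      assume b: "?b \<noteq> 0"
      have "0 \<le> ?a + 2 * t * ?b" for t using q[of 1 t] True by simp
      from this[of "- (?a + 1) / (2 * ?b)"] have "0 \<le> ?a - (?a + 1)" using b by (simp add: field_simps)
      then show False by linarith
    qed
    then show ?thesis using c0 by simp
  next
    case False
    have "0 \<le> ?c^2 * ?a + 2 * ?c * (- ?b) * ?b + (- ?b)^2 * ?c" by (rule q)
    also have "\<dots> = ?c * (?a * ?c - ?b^2)" by (simp add: power2_eq_square algebra_simps)
    finally have "0 \<le> ?a * ?c - ?b^2" using False c0 by (simp add: zero_le_mult_iff)
    then show ?thesis by simp
  qed
qed

lemma L2lim_add:
  assumes "L2lim M U u" "L2lim M V v"
  shows "L2lim M (\<lambda>n x. U n x + V n x) (\<lambda>x. u x + v x)"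
  unfolding L2lim_def
proof (intro conjI allI)
  show "L2 M (\<lambda>x. U n x + V n x)" "L2 M (\<lambda>x. u x + v x)" for n
    using assms by (auto simp: L2lim_def intro: L2_add)
  have s: "L2 M (\<lambda>x. U n x - u x)" "L2 M (\<lambda>x. V n x - v x)" for n
    using assms by (auto simp: L2lim_def intro: L2_diff)
  have t: "(\<lambda>n. 2 * (LINT x|M. (U n x - u x)^2) + 2 * (LINT x|M. (V n x - v x)^2)) \<longlonglongrightarrow> 2 * 0 + 2 * 0"
    using assms by (intro tendsto_intros) (auto simp: L2lim_def)
  have le: "(LINT x|M. (U n x + V n x - (u x + v x))^2) \<le> 2 * (LINT x|M. (U n x - u x)^2) + 2 * (LINT x|M. (V n x - v x)^2)" for n
  proof -
    have "(LINT x|M. (U n x + V n x - (u x + v x))^2) \<le> (LINT x|M. 2 * (U n x - u x)^2 + 2 * (V n x - v x)^2)"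
    proof (rule integral_mono')
      fix x
      have "(a + b)^2 \<le> 2 * a^2 + 2 * b^2" for a b :: real
        using zero_le_power2[of "a - b"] by (simp add: power2_eq_square algebra_simps)
      from this[of "U n x - u x" "V n x - v x"]
      show "(U n x + V n x - (u x + v x))^2 \<le> 2 * (U n x - u x)^2 + 2 * (V n x - v x)^2"
        by (simp add: algebra_simps)
    qed (use s in \<open>auto simp: L2_def\<close>)
    then show ?thesis using s by (simp add: L2_def)
  qed
  show "(\<lambda>n. LINT x|M. (U n x + V n x - (u x + v x))^2) \<longlonglongrightarrow> 0"
    by (rule tendsto_sandwich[OF always_eventually always_eventually tendsto_const t[simplified]])
      (use le in \<open>auto intro: integral_nonneg_AE\<close>)
qed

lemma L2lim_bdd:
  assumes U: "L2lim M U u" and g: "g \<in> borel_measurable M" "AE x in M. \<bar>g x\<bar> \<le> B"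
  shows "L2lim M (\<lambda>n x. g x * U n x) (\<lambda>x. g x * u x)"
  unfolding L2lim_def
proof (intro conjI allI)
  show "L2 M (\<lambda>x. g x * U n x)" "L2 M (\<lambda>x. g x * u x)" for n
    using U by (auto simp: L2lim_def intro: L2_bdd[OF _ g])
  have s: "L2 M (\<lambda>x. U n x - u x)" for n
    using U by (auto simp: L2lim_def intro: L2_diff)
  have le: "(LINT x|M. (g x * U n x - g x * u x)^2) \<le> B^2 * (LINT x|M. (U n x - u x)^2)" for n
  proof -
    have "(LINT x|M. (g x * U n x - g x * u x)^2) \<le> (LINT x|M. B^2 * (U n x - u x)^2)"
    proof (rule integral_mono_AE)
      show "integrable M (\<lambda>x. (g x * U n x - g x * u x)^2)"
        using L2_bdd[OF s[of n] g] by (simp add: L2_def right_diff_distrib)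
      show "AE x in M. (g x * U n x - g x * u x)^2 \<le> B^2 * (U n x - u x)^2"
        using g(2)
      proof eventually_elim
        case (elim x)
        then have "(g x)^2 \<le> B^2" by (rule sq_le)
        then show ?case by (simp add: power_mult_distrib mult_right_mono flip: right_diff_distrib)
      qed
    qed (use s[of n] in \<open>auto simp: L2_def\<close>)
    then show ?thesis by simp
  qed
  have t: "(\<lambda>n. B^2 * (LINT x|M. (U n x - u x)^2)) \<longlonglongrightarrow> B^2 * 0"
    using U by (intro tendsto_intros) (auto simp: L2lim_def)
  show "(\<lambda>n. LINT x|M. (g x * U n x - g x * u x)^2) \<longlonglongrightarrow> 0"
    by (rule tendsto_sandwich[OF always_eventually always_eventually tendsto_const t[simplified]])
      (use le in \<open>auto intro: integral_nonneg_AE\<close>)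
qed

lemma L2lim_sum:
  "finite I \<Longrightarrow> (\<And>i. i \<in> I \<Longrightarrow> L2lim M (U i) (u i)) \<Longrightarrow> L2lim M (\<lambda>n x. \<Sum>i\<in>I. U i n x) (\<lambda>x. \<Sum>i\<in>I. u i x)"
proof (induction I rule: finite_induct)
  case empty
  then show ?case by (simp add: L2lim_def L2_def)
qed (auto intro: L2lim_add)

lemma L2lim_prod:
  assumes U: "L2lim M U u" and V: "L2lim M V v"
  shows "(\<lambda>n. LINT x|M. U n x * V n x) \<longlonglongrightarrow> (LINT x|M. u x * v x)"
proof -
  have s: "L2 M (U n)" "L2 M u" "L2 M (V n)" "L2 M v" "L2 M (\<lambda>x. U n x - u x)" "L2 M (\<lambda>x. V n x - v x)" for n
    using U V by (auto simp: L2lim_def intro: L2_diff)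
  let ?a = "\<lambda>n. LINT x|M. (U n x - u x)^2" and ?b = "\<lambda>n. LINT x|M. (V n x - v x)^2"
  have sq: "(\<lambda>n. LINT x|M. f n x * g n x) \<longlonglongrightarrow> 0"
    if "\<And>n. L2 M (f n)" "\<And>n. L2 M (g n)" "(\<lambda>n. (LINT x|M. (f n x)^2) * (LINT x|M. (g n x)^2)) \<longlonglongrightarrow> 0" for f g :: "nat \<Rightarrow> 'a \<Rightarrow> real"
  proof -
    have "(\<lambda>n. (LINT x|M. f n x * g n x)^2) \<longlonglongrightarrow> 0"
      by (rule tendsto_sandwich[OF always_eventually always_eventually tendsto_const that(3)])
        (use L2_CS[OF that(1,2)] in auto)
    then show ?thesis by (simp add: tendsto_power_zero[of _ _ 2] power_tendsto_0_iff)
  qed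
  have 1: "(\<lambda>n. LINT x|M. (U n x - u x) * (V n x - v x)) \<longlonglongrightarrow> 0"
    using tendsto_mult[of ?a 0 _ ?b 0] U V by (intro sq s) (simp add: L2lim_def)
  have 2: "(\<lambda>n. LINT x|M. (U n x - u x) * v x) \<longlonglongrightarrow> 0"
    using tendsto_mult[of ?a 0 _ "\<lambda>_. LINT x|M. (v x)^2"] U by (intro sq s) (simp add: L2lim_def tendsto_mult_left_zero)
  have 3: "(\<lambda>n. LINT x|M. u x * (V n x - v x)) \<longlonglongrightarrow> 0"
    using V by (intro sq s) (simp add: L2lim_def tendsto_mult_right_zero)
  have eq: "(LINT x|M. U n x * V n x) = (LINT x|M. (U n x - u x) * (V n x - v x)) + (LINT x|M. (U n x - u x) * v x)
    + (LINT x|M. u x * (V n x - v x)) + (LINT x|M. u x * v x)" for n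
  proof -
    have "(LINT x|M. U n x * V n x) = (LINT x|M. (U n x - u x) * (V n x - v x) + (U n x - u x) * v x + u x * (V n x - v x) + u x * v x)"
      by (intro bint_cong) (auto simp: algebra_simps)
    then show ?thesis
      using L2_prod[OF s(5)[of n] s(6)[of n]] L2_prod[OF s(5)[of n] s(4)] L2_prod[OF s(2) s(6)[of n]] L2_prod[OF s(2,4)] by simp
  qed
  show ?thesis unfolding eq
    using tendsto_add[OF tendsto_add[OF tendsto_add[OF 1 2] 3] tendsto_const[of "LINT x|M. u x * v x"]] by simp
qed

lemma L2_bounded_finite:
  assumes "finite_measure M" "u \<in> borel_measurable M" "AE x in M. \<bar>u x\<bar> \<le> B"
  shows "L2 M u"
proof -
  interpret finite_measure M by fact
  have "L2 M (\<lambda>x. 1)" by (simp add: L2_def)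
  from L2_bdd[OF this assms(2,3)] show ?thesis by simp
qed

section \<open>Slicing space along a coordinate axis\<close>

text \<open>The two coordinate directions other than \<open>k\<close>, in increasing order.\<close>

definition tng :: "3 \<Rightarrow> 2 \<Rightarrow> 3" where
  "tng k i = (if i = 1 then (if k = 1 then 2 else 1) else (if k = 3 then 2 else 3))"

text \<open>The point of space with \<open>k\<close>-th coordinate \<open>t\<close> and remaining coordinates \<open>y\<close>.\<close>

definition emb :: "3 \<Rightarrow> real^2 \<Rightarrow> real \<Rightarrow> real^3" where
  "emb k y t = y $ 1 *\<^sub>R axis (tng k 1) 1 + y $ 2 *\<^sub>R axis (tng k 2) 1 + t *\<^sub>R axis k 1"

definition proj :: "3 \<Rightarrow> real^3 \<Rightarrow> real^2" where
  "proj k x = (\<chi> i. x $ tng k i)"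

lemma tng_ne: "tng k i \<noteq> k"
  using exhaust_3[of k] exhaust_2[of i] by (auto simp: tng_def)

lemma tng_cases: "j = k \<or> j = tng k 1 \<or> j = tng k 2"
  using exhaust_3[of k] exhaust_3[of j] by (auto simp: tng_def)

lemma emb_nth [simp]: "emb k y t $ k = t" "emb k y t $ tng k i = y $ i"
  using exhaust_3[of k] exhaust_2[of i] by (auto simp: emb_def tng_def axis_def)

lemma proj_nth [simp]: "proj k x $ i = x $ tng k i"
  by (simp add: proj_def)

lemma proj_emb [simp]: "proj k (emb k y t) = y"
  by (simp add: vec_eq_iff)

lemma emb_proj [simp]: "emb k (proj k x) (x $ k) = x"
  unfolding vec_eq_iff
proof
  fix j show "emb k (proj k x) (x $ k) $ j = x $ j"
    using tng_cases[of j k] by auto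
qed

lemma emb_shift: "emb k y t = emb k y 0 + t *\<^sub>R axis k 1"
  by (simp add: emb_def)

lemma proj_cont [continuous_intros]: "continuous_on S f \<Longrightarrow> continuous_on S (\<lambda>x. proj k (f x))"
  unfolding proj_def by (intro continuous_intros)

lemma emb_cont [continuous_intros]:
  "continuous_on S f \<Longrightarrow> continuous_on S g \<Longrightarrow> continuous_on S (\<lambda>x. emb k (f x) (g x))"
  unfolding emb_def by (intro continuous_intros)

lemma emeasure_box_cart:
  fixes l u :: "real^'n::finite"
  assumes "\<And>i. l $ i \<le> u $ i"
  shows "emeasure lborel (box l u) = ennreal (\<Prod>i\<in>UNIV. u $ i - l $ i)"
proof -
  have B: "(Basis :: (real^'n) set) = (\<lambda>i. axis i 1) ` UNIV"
    unfolding Basis_vec_def by auto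
  have inj: "inj (\<lambda>i::'n. axis i (1::real))" by (auto simp: inj_on_def axis_eq_axis)
  have "emeasure lborel (box l u) = (\<Prod>b\<in>Basis. (u - l) \<bullet> b)"
    by (rule emeasure_lborel_box) (use assms in \<open>auto simp: B inner_axis\<close>)
  also have "(\<Prod>b\<in>Basis. (u - l) \<bullet> b) = (\<Prod>i\<in>UNIV. u $ i - l $ i)"
    unfolding B by (subst prod.reindex[OF inj]) (simp add: inner_axis inner_diff_left)
  finally show ?thesis .
qed

text \<open>Coordinate permutations preserve volume: both measures agree on boxes, so Fubini applies with the \<open>k\<close>-th
  axis last.\<close>

lemma distr_emb: "distr (lborel \<Otimes>\<^sub>M lborel) borel (\<lambda>(y, t). emb k y t) = (lborel :: (real^3) measure)"
proof (rule lborel_eqI[symmetric])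
  have m: "(\<lambda>(y, t). emb k y t) \<in> borel_measurable (lborel \<Otimes>\<^sub>M lborel)"
  proof -
    have "(\<lambda>z. emb k (fst z) (snd z)) \<in> borel_measurable borel"
      by (intro borel_measurable_continuous_onI continuous_intros)
    then show ?thesis by (simp add: lborel_prod split_beta')
  qed
  fix l u :: "real^3" assume lu: "\<And>b. b \<in> Basis \<Longrightarrow> l \<bullet> b \<le> u \<bullet> b"
  have lu': "l $ i \<le> u $ i" for i
    using lu[of "axis i 1"] by (simp add: inner_axis axis_in_Basis_iff)
  have pre: "(\<lambda>(y, t). emb k y t) -` box l u \<inter> space (lborel \<Otimes>\<^sub>M lborel) = box (proj k l) (proj k u) \<times> box (l $ k) (u $ k)"
  proof -
    have "emb k y t \<in> box l u \<longleftrightarrow> y \<in> box (proj k l) (proj k u) \<and> t \<in> box (l $ k) (u $ k)" for y t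
    proof -
      have "emb k y t \<in> box l u \<longleftrightarrow> (\<forall>j\<in>{k, tng k 1, tng k 2}. l $ j < emb k y t $ j \<and> emb k y t $ j < u $ j)"
        unfolding mem_box_cart
      proof
        assume *: "\<forall>j\<in>{k, tng k 1, tng k 2}. l $ j < emb k y t $ j \<and> emb k y t $ j < u $ j"
        show "\<forall>j. l $ j < emb k y t $ j \<and> emb k y t $ j < u $ j"
        proof
          fix j show "l $ j < emb k y t $ j \<and> emb k y t $ j < u $ j"
            using * tng_cases[of j k] by blast
        qed
      qed blast
      also have "\<dots> \<longleftrightarrow> (\<forall>i. l $ tng k i < y $ i \<and> y $ i < u $ tng k i) \<and> l $ k < t \<and> t < u $ k"
        unfolding forall_2 by (simp add: conj_ac)
      finally show ?thesis by (simp add: mem_box_cart)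
    qed
    note iff = this
    show ?thesis
    proof (rule set_eqI)
      fix z :: "(real^2) \<times> real"
      obtain y t where z: "z = (y, t)" by (cases z)
      show "z \<in> (\<lambda>(y, t). emb k y t) -` box l u \<inter> space (lborel \<Otimes>\<^sub>M lborel) \<longleftrightarrow> z \<in> box (proj k l) (proj k u) \<times> box (l $ k) (u $ k)"
        unfolding z using iff[of y t] by (simp add: space_pair_measure del: box_real)
    qed
  qed
  have "emeasure (distr (lborel \<Otimes>\<^sub>M lborel) borel (\<lambda>(y, t). emb k y t)) (box l u)
      = emeasure (lborel :: (real^2) measure) (box (proj k l) (proj k u)) * emeasure lborel (box (l $ k) (u $ k))"
    by (subst emeasure_distr[OF m]) (simp_all add: pre lborel.emeasure_pair_measure_Times del: box_real)
  also have "\<dots> = ennreal (\<Prod>i\<in>UNIV. u $ tng k i - l $ tng k i) * ennreal (u $ k - l $ k)"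
    using lu' by (subst emeasure_box_cart) auto
  also have "\<dots> = ennreal ((\<Prod>i\<in>UNIV. u $ tng k i - l $ tng k i) * (u $ k - l $ k))"
    using lu' by (intro ennreal_mult[symmetric] prod_nonneg) simp_all
  also have "(\<Prod>i\<in>UNIV. u $ tng k i - l $ tng k i) * (u $ k - l $ k) = (\<Prod>i\<in>UNIV. u $ i - l $ i)"
  proof -
    have p2: "prod f (UNIV :: 2 set) = f 1 * f 2" for f :: "2 \<Rightarrow> real" unfolding UNIV_2 by simp
    have p3: "prod f (UNIV :: 3 set) = f 1 * f 2 * f 3" for f :: "3 \<Rightarrow> real" unfolding UNIV_3 by simp
    consider "k = 1" | "k = 2" | "k = 3" using exhaust_3[of k] by blast
    then show ?thesis
    proof cases
      case 1 show ?thesis unfolding p2 p3 1 by (simp add: tng_def)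
    next
      case 2 show ?thesis unfolding p2 p3 2 by (simp add: tng_def)
    next
      case 3 show ?thesis unfolding p2 p3 3 by (simp add: tng_def)
    qed
  qed
  also have "\<dots> = ennreal (\<Prod>b\<in>Basis. (u - l) \<bullet> b)"
    using emeasure_box_cart[of l u] emeasure_lborel_box[OF lu] lu' by simp
  finally show "emeasure (distr (lborel \<Otimes>\<^sub>M lborel) borel (\<lambda>(y, t). emb k y t)) (box l u) = ennreal (\<Prod>b\<in>Basis. (u - l) \<bullet> b)" .
qed simp

text \<open>The integral of \<open>q\<close> is translation invariant, so all difference quotients of \<open>q\<close> in direction \<open>e\<close>
  integrate to zero, and they converge dominatedly.\<close>

lemma integral_grad_0:
  fixes q :: "'a::euclidean_space \<Rightarrow> real"
  assumes q: "\<And>x. GDERIV q x :> g x" and c: "continuous_on UNIV g" and z: "\<And>x. x \<notin> cball p R \<Longrightarrow> q x = 0"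
    "\<And>x. x \<notin> cball p R \<Longrightarrow> g x = 0"
  shows "(LINT x|lborel. g x \<bullet> e) = 0"
proof -
  have qc: "continuous_on UNIV q"
    using q unfolding gderiv_def by (meson has_derivative_continuous continuous_at_imp_continuous_on)
  have [measurable]: "q \<in> borel_measurable borel" "g \<in> borel_measurable borel"
    by (rule borel_measurable_continuous_onI; fact)+
  have "bounded (g ` cball p R)"
    by (intro compact_imp_bounded compact_continuous_image continuous_on_subset[OF c]) auto
  then obtain B where "\<And>x. x \<in> cball p R \<Longrightarrow> norm (g x) \<le> B" unfolding bounded_iff by blast
  then have B: "norm (g x) \<le> max B 0" for x
    using z(2)[of x] by (cases "x \<in> cball p R") (auto intro: max.coboundedI1 simp del: mem_cball)
  have "bounded (q ` cball p R)"
    by (intro compact_imp_bounded compact_continuous_image continuous_on_subset[OF qc]) auto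
  then obtain C where "\<And>x. x \<in> cball p R \<Longrightarrow> norm (q x) \<le> C" unfolding bounded_iff by blast
  then have C: "norm (q x) \<le> C * indicator (cball p R) x" for x using z(1)[of x] by (cases "x \<in> cball p R") auto
  have iq: "integrable lborel q"
  proof (rule bintegrable_bound[where f="\<lambda>x. C * indicator (cball p R) x"])
    show "integrable lborel (\<lambda>x. C * indicator (cball p R) x)"
      using emeasure_lborel_cball_finite[of p R] by (simp add: integrable_indicator_iff)
    show "AE x in lborel. norm (q x) \<le> norm (C * indicator (cball p R) x)"
      by (intro AE_I2 order_trans[OF C]) simp
  qed simp
  define h where "h n = 1 / real (Suc n)" for n
  have h: "h n > 0" "h n \<le> 1" for n by (auto simp: h_def)
  have h0: "h \<longlonglongrightarrow> 0" unfolding h_def[abs_def] using LIMSEQ_inverse_real_of_nat by (simp add: inverse_eq_divide)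
  let ?Q = "\<lambda>n x. (q (x - (- h n *\<^sub>R e)) - q x) / h n"
  have Q0: "(LINT x|lborel. ?Q n x) = 0" for n
    using iq integral_shift[of q "- h n *\<^sub>R e"] by simp
  have lip: "\<bar>q (x + v) - q x\<bar> \<le> max B 0 * norm v" for x v
  proof -
    have "norm (q (x + v) - q x) \<le> max B 0 * norm (x + v - x)"
    proof (rule differentiable_bound[where S=UNIV and f'="\<lambda>x h. h \<bullet> g x"])
      show "(q has_derivative (\<lambda>h. h \<bullet> g x)) (at x within UNIV)" for x using q by (simp add: gderiv_def)
      show "onorm (\<lambda>h. h \<bullet> g x) \<le> max B 0" for x
      proof (rule onorm_bound)
        show "norm (h \<bullet> g x) \<le> max B 0 * norm h" for h
          using Cauchy_Schwarz_ineq2[of h "g x"] mult_left_mono[OF B[of x] norm_ge_zero[of h]] by (simp add: mult.commute)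
      qed simp
    qed auto
    then show ?thesis by simp
  qed
  have "(\<lambda>n. LINT x|lborel. ?Q n x) \<longlonglongrightarrow> (LINT x|lborel. g x \<bullet> e)"
  proof (rule integral_dominated_convergence[where w="\<lambda>x. max B 0 * norm e * indicator (cball p (R + norm e)) x"])
    show "integrable lborel (\<lambda>x. max B 0 * norm e * indicator (cball p (R + norm e)) x)"
      using emeasure_lborel_cball_finite[of p "R + norm e"] by (simp add: integrable_indicator_iff)
    show "AE x in lborel. (\<lambda>n. ?Q n x) \<longlonglongrightarrow> g x \<bullet> e"
    proof (rule AE_I2)
      fix x
      have "((\<lambda>t. q (x + t *\<^sub>R e)) has_derivative (\<lambda>t. (t *\<^sub>R e) \<bullet> g x)) (at 0)"
        using q[of x] unfolding gderiv_def
        by (intro has_derivative_compose[of "\<lambda>t. x + t *\<^sub>R e" _ 0 UNIV q, simplified]) (auto intro!: derivative_eq_intros)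
      then have "((\<lambda>t. q (x + t *\<^sub>R e)) has_real_derivative (g x \<bullet> e)) (at 0)"
        unfolding has_field_derivative_def by (rule has_derivative_eq_rhs) (auto simp: inner_commute)
      then have "((\<lambda>t. (q (x + t *\<^sub>R e) - q x) / t) \<longlongrightarrow> g x \<bullet> e) (at 0)" by (simp add: DERIV_def)
      moreover have "filterlim h (at 0) sequentially"
        using h0 h(1) by (auto simp: filterlim_at intro!: always_eventually) (metis less_irrefl)
      ultimately show "(\<lambda>n. ?Q n x) \<longlonglongrightarrow> g x \<bullet> e"
        using filterlim_compose[of "\<lambda>t. (q (x + t *\<^sub>R e) - q x) / t" _ "at 0" h] by simp
    qed
    show "AE x in lborel. norm (?Q n x) \<le> max B 0 * norm e * indicator (cball p (R + norm e)) x" for n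
    proof (rule AE_I2)
      fix x
      show "norm (?Q n x) \<le> max B 0 * norm e * indicator (cball p (R + norm e)) x"
      proof (cases "x \<in> cball p (R + norm e)")
        case True
        have "\<bar>q (x - (- h n *\<^sub>R e)) - q x\<bar> \<le> (max B 0 * norm e) * h n"
          using lip[of x "h n *\<^sub>R e"] h[of n] by (simp add: mult_ac)
        then show ?thesis using True h(1)[of n] by (simp add: pos_divide_le_eq)
      next
        case False
        have n: "norm (h n *\<^sub>R e) \<le> norm e" using h[of n] by (simp add: mult_left_le_one_le)
        have "x \<notin> cball p R" using False norm_ge_zero[of e] unfolding mem_cball by linarith
        moreover have "x - (- h n *\<^sub>R e) \<notin> cball p R"
        proof
          assume "x - (- h n *\<^sub>R e) \<in> cball p R"
          moreover have "dist p x \<le> dist p (x + h n *\<^sub>R e) + norm (h n *\<^sub>R e)"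
            by (metis add_diff_cancel_left' dist_norm dist_triangle)
          ultimately show False using False n by simp
        qed
        ultimately show ?thesis using z(1) by simp
      qed
    qed
  qed (auto intro: borel_measurable_inner)
  then show ?thesis unfolding Q0 by (simp add: LIMSEQ_const_iff)
qed

section \<open>The divergence theorem above a graph\<close>

lemma integrable_supp:
  fixes h :: "'a::euclidean_space \<Rightarrow> 'b::{banach, second_countable_topology}"
  assumes "h \<in> borel_measurable borel" "\<And>x. norm (h x) \<le> B" "\<And>x. x \<notin> cball p R \<Longrightarrow> h x = 0"
  shows "integrable lborel h"
proof (rule bintegrable_bound[where f="\<lambda>x. B * indicator (cball p R) x"])
  show "integrable lborel (\<lambda>x. B * indicator (cball p R) x)"
    using emeasure_lborel_cball_finite[of p R] by (simp add: integrable_indicator_iff)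
  show "AE x in lborel. norm (h x) \<le> norm (B * indicator (cball p R) x)"
  proof (rule AE_I2)
    fix x
    show "norm (h x) \<le> norm (B * indicator (cball p R) x)"
      using assms(2)[of x] assms(3)[of x] by (cases "x \<in> cball p R") (simp_all del: mem_cball)
  qed
qed (use assms(1) in simp)

lemma inner_vec2: "x \<bullet> y = x $ 1 * y $ 1 + x $ 2 * y $ 2" for x y :: "real^2"
  by (simp add: inner_vec_def sum_2)

text \<open>One side of the graph of a smooth function over the hyperplane orthogonal to the \<open>k\<close>-th axis; \<open>eps\<close>
  selects the side.\<close>

locale epigraph =
  fixes k :: 3 and eps :: real and gam :: "real^3 \<Rightarrow> real"
  assumes eps: "eps \<in> {-1, 1}" and sm: "smooth UNIV gam" and inv: "\<And>x t. gam (x + t *\<^sub>R axis k 1) = gam x"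
begin

definition gam_grad :: "real^3 \<Rightarrow> real^3" where "gam_grad x = (\<chi> j. pd j gam x)"

text \<open>An inward normal, not normalised; its length is the density of the surface measure with respect to the
  parameters.\<close>

definition nv :: "real^3 \<Rightarrow> real^3" where "nv x = eps *\<^sub>R axis k 1 - gam_grad x"

text \<open>Layer coordinates: \<open>s\<close> is the height above the graph, so that the epigraph becomes the half space \<open>s >
  0\<close>. The change of coordinates is a shear, up to a reflection, and preserves volume.\<close>

definition lay :: "real^2 \<Rightarrow> real \<Rightarrow> real^3" where
  "lay y s = emb k y (eps * (gam (emb k y 0) + s))"

definition W :: "(real^3) set" where "W = {x. eps * x $ k > gam x}"

lemma eps2 [simp]: "eps * eps = 1" "\<bar>eps\<bar> = 1" "eps * (eps * a) = a" "eps \<noteq> 0"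
  using eps by auto

lemma gam_gderiv: "GDERIV gam x :> gam_grad x"
proof -
  have "Ck 1 UNIV gam" using sm by (simp add: smooth_def del: Ck.simps)
  then have "gam differentiable at x" by simp
  from gderiv_pd[OF this] show ?thesis by (simp add: gam_grad_def)
qed

lemma gam_grad_cont: "continuous_on S gam_grad"
proof -
  have "Ck 1 UNIV gam" using sm by (simp add: smooth_def del: Ck.simps)
  then have "continuous_on UNIV (pd j gam)" for j by simp
  then have "continuous_on UNIV gam_grad" unfolding gam_grad_def[abs_def] by (intro continuous_intros) auto
  then show ?thesis by (rule continuous_on_subset) simp
qed

lemma gam_cont: "continuous_on S gam"
  using gam_gderiv unfolding gderiv_def by (meson has_derivative_continuous continuous_at_imp_continuous_on)

lemma gam_emb: "gam (emb k y t) = gam (emb k y 0)"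
  using inv[of "emb k y 0" t] by (simp add: emb_shift[of k y t])

lemma gam_grad_emb: "gam_grad (emb k y t) = gam_grad (emb k y 0)"
proof -
  have "GDERIV gam (emb k y 0) :> gam_grad (emb k y t)"
  proof -
    have "((\<lambda>x. gam (x + t *\<^sub>R axis k 1)) has_derivative (\<lambda>h. h \<bullet> gam_grad (emb k y 0 + t *\<^sub>R axis k 1))) (at (emb k y 0))"
      using gam_gderiv[of "emb k y 0 + t *\<^sub>R axis k 1"] unfolding gderiv_def
      by (intro has_derivative_compose[of "\<lambda>x. x + t *\<^sub>R axis k 1" "\<lambda>h. h" _ UNIV gam, simplified])
        (auto intro!: derivative_eq_intros)
    then show ?thesis unfolding gderiv_def inv emb_shift[of k y t] .
  qed
  moreover have "GDERIV gam (emb k y 0) :> gam_grad (emb k y 0)" by (rule gam_gderiv)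
  ultimately have "pd j gam (emb k y 0) = gam_grad (emb k y t) $ j" "pd j gam (emb k y 0) = gam_grad (emb k y 0) $ j" for j
    by (auto intro: pd_gderiv)
  then show ?thesis by (metis vec_eq_iff)
qed

lemma gam_grad_k [simp]: "gam_grad x $ k = 0"
proof -
  have "((\<lambda>t. gam (x + t *\<^sub>R axis k 1)) has_derivative (\<lambda>t. (t *\<^sub>R axis k 1) \<bullet> gam_grad x)) (at 0)"
    using gam_gderiv[of x] unfolding gderiv_def
    by (intro has_derivative_compose[of "\<lambda>t. x + t *\<^sub>R axis k 1" _ 0 UNIV gam, simplified]) (auto intro!: derivative_eq_intros)
  then have "((\<lambda>t. gam x) has_derivative (\<lambda>t. (t *\<^sub>R axis k 1) \<bullet> gam_grad x)) (at (0::real))" by (simp add: inv)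
  then have "(\<lambda>t. (t *\<^sub>R axis k 1) \<bullet> gam_grad x) = (\<lambda>t::real. 0)"
    using has_derivative_unique has_derivative_const by blast
  then have "(1 *\<^sub>R axis k 1) \<bullet> gam_grad x = 0" by (rule fun_cong)
  then show ?thesis by (simp add: inner_axis')
qed

lemma nv_k [simp]: "nv x $ k = eps" by (simp add: nv_def axis_def)
lemma nv_tng [simp]: "nv x $ tng k i = - gam_grad x $ tng k i" using tng_ne[of k i] by (simp add: nv_def axis_def)
lemma nv_cont: "continuous_on S nv" unfolding nv_def[abs_def] by (intro continuous_intros gam_grad_cont)

lemma norm_nv_ge1: "norm (nv x) \<ge> 1"
  using component_le_norm_cart[of "nv x" k] by simp

lemma lay_cont: "continuous_on S f \<Longrightarrow> continuous_on S g \<Longrightarrow> continuous_on S (\<lambda>x. lay (f x) (g x))"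
  unfolding lay_def by (intro continuous_intros continuous_on_compose2[OF gam_cont[of UNIV]]) auto

lemma lay_W: "lay y s \<in> W \<longleftrightarrow> s > 0"
  unfolding W_def lay_def by (subst mem_Collect_eq, subst gam_emb) simp

lemma lay_proj: "eps * x $ k = gam x + s \<Longrightarrow> lay (proj k x) s = x"
proof -
  assume a: "eps * x $ k = gam x + s"
  have "gam (emb k (proj k x) 0) = gam x" using gam_emb[of "proj k x" "x $ k"] by simp
  then have "lay (proj k x) s = emb k (proj k x) (eps * (eps * x $ k))" using a by (simp add: lay_def)
  then show ?thesis by simp
qed

lemma W_open: "open W"
  unfolding W_def by (intro open_Collect_less continuous_intros gam_cont)

lemma distr_lay: "distr (lborel \<Otimes>\<^sub>M lborel) borel (\<lambda>(y, s). lay y s) = (lborel :: (real^3) measure)"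
proof (rule measure_eqI)
  have m: "(\<lambda>(y, s). lay y s) \<in> borel_measurable (lborel \<Otimes>\<^sub>M lborel)"
  proof -
    have "(\<lambda>z. lay (fst z) (snd z)) \<in> borel_measurable borel"
      by (intro borel_measurable_continuous_onI lay_cont continuous_intros)
    then show ?thesis by (simp add: lborel_prod split_beta')
  qed
  have me: "(\<lambda>(y, s). emb k y s) \<in> borel_measurable (lborel \<Otimes>\<^sub>M lborel)"
  proof -
    have "(\<lambda>z. emb k (fst z) (snd z)) \<in> borel_measurable borel"
      by (intro borel_measurable_continuous_onI continuous_intros)
    then show ?thesis by (simp add: lborel_prod split_beta')
  qed
  fix B assume "B \<in> sets (distr (lborel \<Otimes>\<^sub>M lborel) borel (\<lambda>(y, s). lay y s))"
  then have B: "B \<in> sets borel" by simp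
  have "emeasure (distr (lborel \<Otimes>\<^sub>M lborel) borel (\<lambda>(y, s). lay y s)) B
      = (\<integral>\<^sup>+x. indicator B x \<partial>distr (lborel \<Otimes>\<^sub>M lborel) borel (\<lambda>(y, s). lay y s))"
    using B by simp
  also have "\<dots> = (\<integral>\<^sup>+z. indicator B (case z of (y, s) \<Rightarrow> lay y s) \<partial>(lborel \<Otimes>\<^sub>M lborel))"
    using B by (subst nn_integral_distr[OF m]) auto
  also have "\<dots> = (\<integral>\<^sup>+y. \<integral>\<^sup>+s. indicator B (lay y s) \<partial>lborel \<partial>lborel)"
    using measurable_compose[OF m borel_measurable_indicator[OF B]]
    by (subst lborel.nn_integral_fst[symmetric]) auto
  also have "\<dots> = (\<integral>\<^sup>+y. \<integral>\<^sup>+t. indicator B (emb k y t) \<partial>lborel \<partial>lborel)"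
  proof (rule nn_integral_cong)
    fix y :: "real^2"
    have "(\<lambda>t. emb k y t) \<in> borel_measurable borel"
      by (intro borel_measurable_continuous_onI continuous_intros)
    from measurable_compose[OF this borel_measurable_indicator[OF B]]
    have "(\<integral>\<^sup>+t. indicator B (emb k y t) \<partial>lborel) = ennreal \<bar>eps\<bar> * (\<integral>\<^sup>+s. indicator B (emb k y (eps * gam (emb k y 0) + eps * s)) \<partial>lborel)"
      by (intro nn_integral_real_affine) auto
    then show "(\<integral>\<^sup>+s. indicator B (lay y s) \<partial>lborel) = (\<integral>\<^sup>+t. indicator B (emb k y t) \<partial>lborel)"
      by (simp add: lay_def distrib_left)
  qed
  also have "\<dots> = (\<integral>\<^sup>+z. indicator B (case z of (y, s) \<Rightarrow> emb k y s) \<partial>(lborel \<Otimes>\<^sub>M lborel))"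
    using measurable_compose[OF me borel_measurable_indicator[OF B]]
    by (subst lborel.nn_integral_fst[symmetric]) auto
  also have "\<dots> = (\<integral>\<^sup>+x. indicator B x \<partial>distr (lborel \<Otimes>\<^sub>M lborel) borel (\<lambda>(y, s). emb k y s))"
    using B by (subst nn_integral_distr[OF me]) auto
  also have "\<dots> = emeasure lborel B" using B by (simp add: distr_emb)
  finally show "emeasure (distr (lborel \<Otimes>\<^sub>M lborel) borel (\<lambda>(y, s). lay y s)) B = emeasure lborel B" .
qed simp

lemma lay_meas: "(\<lambda>(y, s). lay y s) \<in> borel_measurable (lborel \<Otimes>\<^sub>M lborel)"
proof -
  have "(\<lambda>z. lay (fst z) (snd z)) \<in> borel_measurable borel"
    by (intro borel_measurable_continuous_onI lay_cont continuous_intros)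
  then show ?thesis by (simp add: lborel_prod split_beta')
qed

lemma lay_integral:
  fixes h :: "real^3 \<Rightarrow> real"
  assumes h: "integrable lborel h"
  shows "(LINT x|lborel. h x) = (LINT y|lborel. LINT s|lborel. h (lay y s))"
    "(LINT x|lborel. h x) = (LINT s|lborel. LINT y|lborel. h (lay y s))"
    "integrable lborel (\<lambda>y. LINT s|lborel. h (lay y s))"
proof -
  have [measurable]: "h \<in> borel_measurable borel" using h by auto
  have i: "integrable (lborel \<Otimes>\<^sub>M lborel) (\<lambda>(y, s). h (lay y s))"
    using h integrable_distr_eq[OF lay_meas, of h] by (simp add: distr_lay[unfolded split_beta'] split_beta')
  have e: "(LINT x|lborel. h x) = integral\<^sup>L (lborel \<Otimes>\<^sub>M lborel) (\<lambda>(y, s). h (lay y s))"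
    using integral_distr[OF lay_meas, of h] by (simp add: distr_lay[unfolded split_beta'] split_beta')
  show "(LINT x|lborel. h x) = (LINT y|lborel. LINT s|lborel. h (lay y s))"
    unfolding e using lborel_pair.integral_fst'[OF i] by simp
  show "(LINT x|lborel. h x) = (LINT s|lborel. LINT y|lborel. h (lay y s))"
    unfolding e using lborel_pair.integral_snd[OF i] by simp
  show "integrable lborel (\<lambda>y. LINT s|lborel. h (lay y s))"
    using lborel_pair.integrable_fst'[OF i] by simp
qed

lemma lay_gderiv:
  assumes "GDERIV v (lay y s) :> D"
  shows "((\<lambda>s. v (lay y s)) has_real_derivative eps * D $ k) (at s)"
    "GDERIV (\<lambda>y. v (lay y s)) y :> (\<chi> i. D $ tng k i + eps * gam_grad (emb k y 0) $ tng k i * D $ k)"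
proof -
  have v: "(v has_derivative (\<lambda>h. h \<bullet> D)) (at (lay y s))" using assms by (simp add: gderiv_def)
  have "((\<lambda>s. lay y s) has_derivative (\<lambda>h. (eps * h) *\<^sub>R axis k 1)) (at s)"
    unfolding lay_def emb_def by (auto intro!: derivative_eq_intros)
  from has_derivative_compose[OF this v]
  show "((\<lambda>s. v (lay y s)) has_real_derivative eps * D $ k) (at s)"
    unfolding has_field_derivative_def by (rule has_derivative_eq_rhs) (auto simp: inner_axis' fun_eq_iff)
  have e0: "((\<lambda>y. emb k y 0) has_derivative (\<lambda>h. emb k h 0)) (at y)"
  proof -
    have "((\<lambda>y. y $ 1 *\<^sub>R axis (tng k 1) 1 + y $ 2 *\<^sub>R axis (tng k 2) 1 :: real^3) has_derivative (\<lambda>h. h $ 1 *\<^sub>R axis (tng k 1) 1 + h $ 2 *\<^sub>R axis (tng k 2) 1)) (at y)"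
      by (intro has_derivative_add has_derivative_scaleR_left bounded_linear_imp_has_derivative bounded_linear_vec_nth)
    then show ?thesis by (simp add: emb_def)
  qed
  have g: "((\<lambda>y. gam (emb k y 0)) has_derivative (\<lambda>h. emb k h 0 \<bullet> gam_grad (emb k y 0))) (at y)"
    using has_derivative_compose[OF e0] gam_gderiv[of "emb k y 0"] unfolding gderiv_def by blast
  have "((\<lambda>y. emb k y 0 + (eps * (gam (emb k y 0) + s)) *\<^sub>R axis k 1) has_derivative
      (\<lambda>h. emb k h 0 + (eps * (emb k h 0 \<bullet> gam_grad (emb k y 0))) *\<^sub>R axis k 1)) (at y)"
    by (intro has_derivative_add has_derivative_scaleR_left has_derivative_mult_right e0) (auto intro!: derivative_eq_intros g)
  then have "((\<lambda>y. lay y s) has_derivative (\<lambda>h. emb k h 0 + (eps * (emb k h 0 \<bullet> gam_grad (emb k y 0))) *\<^sub>R axis k 1)) (at y)"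
    unfolding lay_def emb_shift[of k _ "eps * _"] .
  from has_derivative_compose[OF this v]
  show "GDERIV (\<lambda>y. v (lay y s)) y :> (\<chi> i. D $ tng k i + eps * gam_grad (emb k y 0) $ tng k i * D $ k)"
    unfolding gderiv_def
    by (rule has_derivative_eq_rhs)
      (simp add: fun_eq_iff inner_add_left emb_def inner_axis' inner_vec2 algebra_simps)
qed

end

lemma norm_proj_le: "norm (proj k x) \<le> norm x"
proof -
  have "(norm (proj k x))^2 \<le> (norm x)^2"
  proof -
    have "(norm x)^2 = x $ 1 * x $ 1 + x $ 2 * x $ 2 + x $ 3 * x $ 3"
      by (simp add: power2_norm_eq_inner inner_vec_def sum_3)
    moreover have "(norm (proj k x))^2 = x $ tng k 1 * x $ tng k 1 + x $ tng k 2 * x $ tng k 2"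
      by (simp add: power2_norm_eq_inner inner_vec2)
    ultimately show ?thesis using exhaust_3[of k] by (auto simp: tng_def)
  qed
  then show ?thesis by (rule power2_le_imp_le) simp
qed

lemma proj_diff: "proj k x - proj k y = proj k (x - y)"
  by (simp add: vec_eq_iff)

context epigraph
begin

abbreviation "cl \<equiv> {x. eps * x $ k \<ge> gam x}"

lemma cl_closed: "closed cl"
  by (intro closed_Collect_le continuous_intros gam_cont)

lemma W_cl: "W \<subseteq> cl" by (auto simp: W_def)

lemma lay_cl: "lay y s \<in> cl \<longleftrightarrow> s \<ge> 0"
  unfolding lay_def by (subst mem_Collect_eq, subst gam_emb) simp

lemma indW_integrable:
  assumes f: "continuous_on cl f" and z: "\<And>x. x \<notin> cball p R \<Longrightarrow> f x = 0"
  shows "integrable lborel (\<lambda>x. indicator W x * f x :: real)"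
proof -
  have "compact (cl \<inter> cball p R)" using cl_closed by (simp add: closed_Int_compact)
  then have "bounded (f ` (cl \<inter> cball p R))"
    by (intro compact_imp_bounded compact_continuous_image continuous_on_subset[OF f]) auto
  then obtain B where B: "\<And>x. x \<in> cl \<inter> cball p R \<Longrightarrow> norm (f x) \<le> B" unfolding bounded_iff by blast
  show ?thesis
  proof (rule integrable_supp[where B="max B 0" and p=p and R=R])
    have "(\<lambda>x. indicator W x *\<^sub>R f x) \<in> borel_measurable borel"
      by (rule borel_measurable_continuous_on_indicator) (use W_open continuous_on_subset[OF f W_cl] in auto)
    then show "(\<lambda>x. indicator W x * f x) \<in> borel_measurable borel" by simp
    show "norm (indicator W x * f x) \<le> max B 0" for x
      using B[of x] z[of x] W_cl by (cases "x \<in> W \<and> x \<in> cball p R") (auto simp: indicator_def max_def simp del: mem_cball)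
    show "indicator W x * f x = 0" if "x \<notin> cball p R" for x using z[OF that] by simp
  qed
qed

context
  fixes v :: "real^3 \<Rightarrow> real" and D :: "real^3 \<Rightarrow> real^3" and p :: "real^3" and R :: real
  assumes vc: "continuous_on cl v" and Dc: "continuous_on cl D" and der: "\<And>x. x \<in> W \<Longrightarrow> GDERIV v x :> D x"
    and vz: "\<And>x. x \<notin> cball p R \<Longrightarrow> v x = 0" and Dz: "\<And>x. x \<notin> cball p R \<Longrightarrow> D x = 0"
begin

text \<open>The fundamental theorem of calculus along the vertical line through the boundary point of parameter
  \<open>y\<close>.\<close>

lemma line_integral: "(LINT s|lborel. indicator W (lay y s) * D (lay y s) $ k) = - eps * v (lay y 0)"
proof -
  define S where "S = \<bar>gam (emb k y 0)\<bar> + norm p + \<bar>R\<bar> + 1"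
  have S0: "S > 0" unfolding S_def by (simp add: add_nonneg_pos)
  have out: "lay y s \<notin> cball p R" if "s \<ge> S" for s
  proof
    assume "lay y s \<in> cball p R"
    then have "norm (lay y s) \<le> norm p + R" using norm_triangle_ineq2[of "lay y s" p] by (simp add: dist_norm norm_minus_commute)
    moreover have "\<bar>gam (emb k y 0) + s\<bar> \<le> norm (lay y s)"
      using component_le_norm_cart[of "lay y s" k] by (simp add: lay_def abs_mult)
    ultimately show False using that unfolding S_def by linarith
  qed
  have lc: "continuous_on {0..S} (\<lambda>s. lay y s)" by (intro lay_cont continuous_intros)
  have sub: "(\<lambda>s. lay y s) ` {0..S} \<subseteq> cl" by (auto simp: image_iff) (metis lay_cl mem_Collect_eq)
  have c1: "continuous_on {0..S} (\<lambda>s. v (lay y s))" by (rule continuous_on_compose2[OF vc lc sub])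
  have "continuous_on {0..S} (\<lambda>s. D (lay y s))" by (rule continuous_on_compose2[OF Dc lc sub])
  then have c2: "continuous_on {0..S} (\<lambda>s. eps * D (lay y s) $ k)" by (intro continuous_intros)
  have hi: "((\<lambda>s. eps * D (lay y s) $ k) has_integral (v (lay y S) - v (lay y 0))) {0..S}"
  proof (rule fundamental_theorem_of_calculus_interior[OF _ c1])
    fix s assume s: "s \<in> {0<..<S}"
    then have "GDERIV v (lay y s) :> D (lay y s)" by (intro der) (simp add: lay_W)
    from lay_gderiv(1)[OF this]
    show "((\<lambda>s. v (lay y s)) has_vector_derivative eps * D (lay y s) $ k) (at s)"
      by (simp add: has_real_derivative_iff_has_vector_derivative)
  qed (use S0 in simp)
  have I: "integral {0..S} (\<lambda>s. eps * D (lay y s) $ k) = - v (lay y 0)"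
    unfolding integral_unique[OF hi] using vz[OF out[of S]] by simp
  have si: "set_integrable lborel {0..S} (\<lambda>s. eps * D (lay y s) $ k)"
    by (rule borel_integrable_atLeastAtMost'[OF c2])
  have J: "(LINT s:{0..S}|lborel. eps * D (lay y s) $ k) = - v (lay y 0)"
    using set_borel_integral_eq_integral(2)[OF si] I by simp
  let ?F = "\<lambda>s. indicator {0..S} s *\<^sub>R (eps * D (lay y s) $ k)"
  have Fm: "?F \<in> borel_measurable lborel" using si by (auto simp: set_integrable_def)
  have G: "eps * (indicator W (lay y s) * D (lay y s) $ k) = indicator {0<..} s * ?F s" for s
    using Dz[OF out[of s]] by (cases "s \<le> S") (auto simp: indicator_def lay_W)
  have "eps * (LINT s|lborel. indicator W (lay y s) * D (lay y s) $ k) = (LINT s|lborel. indicator {0<..} s * ?F s)"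
    unfolding G[symmetric] by simp
  also have "\<dots> = (LINT s|lborel. ?F s)"
  proof (rule integral_cong_AE)
    show "AE s in lborel. indicator {0<..} s * ?F s = ?F s"
      using AE_lborel_singleton[of "0::real"] by eventually_elim (auto simp: indicator_def)
  qed (use Fm in auto)
  also have "\<dots> = - v (lay y 0)" using J unfolding set_lebesgue_integral_def .
  finally have e: "eps * (LINT s|lborel. indicator W (lay y s) * D (lay y s) $ k) = - v (lay y 0)" .
  have "(LINT s|lborel. indicator W (lay y s) * D (lay y s) $ k) = eps * (eps * (LINT s|lborel. indicator W (lay y s) * D (lay y s) $ k))"
    by (simp only: eps2)
  then show ?thesis unfolding e by simp
qed

text \<open>Integration of \<open>line_integral\<close> over the parameters, with a factor \<open>m\<close> that is constant along vertical
  lines.\<close>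

lemma normal_integral:
  assumes m: "continuous_on UNIV m" and mi: "\<And>y s. m (lay y s) = m (lay y 0)"
  shows "(LINT x|lborel. indicator W x * (m x * D x $ k)) = - eps * (LINT y|lborel. m (lay y 0) * v (lay y 0))"
proof -
  have "integrable lborel (\<lambda>x. indicator W x * (m x * D x $ k))"
  proof (rule indW_integrable)
    show "continuous_on cl (\<lambda>x. m x * D x $ k)"
      by (intro continuous_intros continuous_on_subset[OF m] Dc) auto
    show "x \<notin> cball p R \<Longrightarrow> m x * D x $ k = 0" for x using Dz by simp
  qed
  from lay_integral(1)[OF this]
  have "(LINT x|lborel. indicator W x * (m x * D x $ k)) = (LINT y|lborel. LINT s|lborel. indicator W (lay y s) * (m (lay y s) * D (lay y s) $ k))" .
  also have "\<dots> = (LINT y|lborel. - eps * (m (lay y 0) * v (lay y 0)))"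
  proof (rule bint_cong[OF refl])
    fix y
    have "(LINT s|lborel. indicator W (lay y s) * (m (lay y s) * D (lay y s) $ k)) = (LINT s|lborel. m (lay y 0) * (indicator W (lay y s) * D (lay y s) $ k))"
      by (subst mi) (simp add: mult.left_commute)
    also have "\<dots> = m (lay y 0) * (- eps * v (lay y 0))" by (simp only: integral_mult_right_zero line_integral)
    finally show "(LINT s|lborel. indicator W (lay y s) * (m (lay y s) * D (lay y s) $ k)) = - eps * (m (lay y 0) * v (lay y 0))"
      by simp
  qed
  also have "\<dots> = - eps * (LINT y|lborel. m (lay y 0) * v (lay y 0))" by simp
  finally show ?thesis .
qed

lemma gam_grad_lay: "gam_grad (lay y s) = gam_grad (emb k y 0)"
  unfolding lay_def by (rule gam_grad_emb)

text \<open>On each layer the integrand is a partial derivative of a compactly supported function of the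
  parameters.\<close>

lemma tangential_slice:
  assumes s: "s > 0"
  shows "(LINT y|lborel. D (lay y s) $ tng k i + eps * gam_grad (lay y s) $ tng k i * D (lay y s) $ k) = 0"
proof -
  let ?g = "\<lambda>y. (\<chi> i. D (lay y s) $ tng k i + eps * gam_grad (lay y s) $ tng k i * D (lay y s) $ k) :: real^2"
  have "(LINT y|lborel. ?g y \<bullet> axis i 1) = 0"
  proof (rule integral_grad_0[where q="\<lambda>y. v (lay y s)" and p="proj k p" and R=R])
    show "GDERIV (\<lambda>y. v (lay y s)) y :> ?g y" for y
      using lay_gderiv(2)[OF der[of "lay y s"]] s by (simp add: lay_W gam_grad_lay)
    have lc: "continuous_on UNIV (\<lambda>y. lay y s)" by (intro lay_cont continuous_intros)
    have "continuous_on UNIV (\<lambda>y. D (lay y s))"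
      by (rule continuous_on_compose2[OF Dc lc]) (use s in \<open>auto simp: image_iff lay_cl[simplified]\<close>)
    moreover have "continuous_on UNIV (\<lambda>y. gam_grad (lay y s))"
      by (rule continuous_on_compose2[OF gam_grad_cont[of UNIV] lc]) auto
    ultimately show "continuous_on UNIV ?g" by (intro continuous_intros)
    have out: "lay y s \<notin> cball p R" if "y \<notin> cball (proj k p) R" for y
    proof
      assume "lay y s \<in> cball p R"
      then have "norm (p - lay y s) \<le> R" by (simp add: dist_norm)
      then have "norm (proj k p - proj k (lay y s)) \<le> R" unfolding proj_diff using norm_proj_le order_trans by blast
      then show False using that by (simp add: lay_def dist_norm)
    qed
    show "y \<notin> cball (proj k p) R \<Longrightarrow> v (lay y s) = 0" "y \<notin> cball (proj k p) R \<Longrightarrow> ?g y = 0" for y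
      using vz[OF out] Dz[OF out] by (simp_all add: vec_eq_iff)
  qed
  then show ?thesis by (simp add: inner_axis)
qed

text \<open>Tangential derivatives integrate to zero on every layer once the normal derivative is added with the
  slope as factor; what remains is the normal contribution from \<open>normal_integral\<close>.\<close>

lemma epigraph_divergence:
  "(LINT x|lborel. indicator W x * D x $ j) = - (LINT y|lborel. v (lay y 0) * nv (lay y 0) $ j)"
proof (cases "j = k")
  case True
  show ?thesis using normal_integral[of "\<lambda>x. 1"] by (simp add: True)
next
  case False
  then obtain i where j: "j = tng k i" using tng_cases by metis
  let ?f = "\<lambda>x. gam_grad x $ j * D x $ k"
  have ggj: "continuous_on S (\<lambda>x. gam_grad x $ j)" for S by (intro continuous_intros gam_grad_cont)
  have i1: "integrable lborel (\<lambda>x. indicator W x * D x $ j)"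
    by (rule indW_integrable[where p=p and R=R]) (use Dz in \<open>auto intro!: continuous_intros Dc\<close>)
  have i2: "integrable lborel (\<lambda>x. indicator W x * (gam_grad x $ j * D x $ k))"
    by (rule indW_integrable[where p=p and R=R]) (use Dz in \<open>auto intro!: continuous_intros Dc gam_grad_cont\<close>)
  have "(LINT x|lborel. indicator W x * D x $ j) + eps * (LINT x|lborel. indicator W x * (gam_grad x $ j * D x $ k))
     = (LINT x|lborel. indicator W x * D x $ j + eps * (indicator W x * (gam_grad x $ j * D x $ k)))"
    using i1 i2 by simp
  also have "\<dots> = (LINT s|lborel. LINT y|lborel. indicator W (lay y s) * D (lay y s) $ j + eps * (indicator W (lay y s) * (gam_grad (lay y s) $ j * D (lay y s) $ k)))"
    by (rule lay_integral(2)) (use i1 i2 in simp)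
  also have "\<dots> = (LINT s|(lborel::real measure). 0)"
  proof (rule bint_cong[OF refl])
    fix s :: real
    show "(LINT y|lborel. indicator W (lay y s) * D (lay y s) $ j + eps * (indicator W (lay y s) * (gam_grad (lay y s) $ j * D (lay y s) $ k))) = 0"
      using tangential_slice[of s i] by (cases "s > 0") (simp_all add: lay_W j indicator_def mult.assoc)
  qed
  finally have "(LINT x|lborel. indicator W x * D x $ j) = - eps * (LINT x|lborel. indicator W x * (gam_grad x $ j * D x $ k))"
    by simp
  also have "\<dots> = - eps * (- eps * (LINT y|lborel. gam_grad (lay y 0) $ j * v (lay y 0)))"
    by (subst normal_integral[OF ggj]) (auto simp: gam_grad_lay)
  also have "\<dots> = - (LINT y|lborel. v (lay y 0) * nv (lay y 0) $ j)"
    by (simp add: j mult.commute)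
  finally show ?thesis .
qed

end

end

section \<open>Surface measure\<close>

text \<open>The change of variables formula for vector-valued integrands, applied to vectors of length one.\<close>

lemma change_of_variables_real:
  fixes f :: "real^'m::{finite,wellorder} \<Rightarrow> real" and g :: "real^'m::_ \<Rightarrow> real^'m::_"
  assumes "S \<in> sets lebesgue" "\<And>x. x \<in> S \<Longrightarrow> (g has_derivative g' x) (at x within S)" "inj_on g S"
  shows "(\<lambda>x. \<bar>det (matrix (g' x))\<bar> * f (g x)) absolutely_integrable_on S \<and>
           integral S (\<lambda>x. \<bar>det (matrix (g' x))\<bar> * f (g x)) = b
     \<longleftrightarrow> f absolutely_integrable_on (g ` S) \<and> integral (g ` S) f = b"
  using has_absolute_integral_change_of_variables[OF assms, of "\<lambda>x. vec (f x) :: real^1" "vec b"]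
  unfolding absolutely_integrable_on_1_iff integral_on_1_eq by (simp add: vec_eq_iff)

lemma nn_integral_change_of_variables:
  fixes f :: "real^'m::{finite,wellorder} \<Rightarrow> real" and g :: "real^'m::_ \<Rightarrow> real^'m::_"
  assumes S: "S \<in> sets lebesgue" and d: "\<And>x. x \<in> S \<Longrightarrow> (g has_derivative g' x) (at x within S)" and i: "inj_on g S"
    and f: "f absolutely_integrable_on (g ` S)" "\<And>x. f x \<ge> 0"
  shows "(\<integral>\<^sup>+x. ennreal (f x) * indicator (g ` S) x \<partial>lborel) = (\<integral>\<^sup>+x. ennreal (\<bar>det (matrix (g' x))\<bar> * f (g x)) * indicator S x \<partial>lborel)"
proof -
  let ?h = "\<lambda>x. \<bar>det (matrix (g' x))\<bar> * f (g x)"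
  have h: "?h absolutely_integrable_on S" "integral S ?h = integral (g ` S) f"
    using change_of_variables_real[OF S d i, of f "integral (g ` S) f"] f by auto
  have *: "(\<integral>\<^sup>+x. ennreal (u x) * indicator T x \<partial>lborel) = ennreal (integral T u)"
    if u: "u absolutely_integrable_on T" "\<And>x. u x \<ge> 0" for u :: "real^'m::{finite,wellorder} \<Rightarrow> real" and T
  proof -
    have "(\<integral>\<^sup>+x. ennreal (u x) * indicator T x \<partial>lborel) = (\<integral>\<^sup>+x. ennreal (indicator T x *\<^sub>R u x) \<partial>lebesgue)"
      unfolding nn_integral_completion by (intro nn_integral_cong) (auto simp: indicator_def)
    also have "\<dots> = ennreal (LINT x|lebesgue. indicator T x *\<^sub>R u x)"
      using u by (intro nn_integral_eq_integral) (auto simp: set_integrable_def)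
    also have "\<dots> = ennreal (integral T u)"
      using set_lebesgue_integral_eq_integral(2)[OF u(1)] by (simp add: set_lebesgue_integral_def)
    finally show ?thesis .
  qed
  show ?thesis
    unfolding *[OF f] using f(2) by (subst *) (auto intro: h simp: h(2))
qed

lemma cross_nth: "\<bar>cross3 a b $ k\<bar> = \<bar>a $ tng k 1 * b $ tng k 2 - b $ tng k 1 * a $ tng k 2\<bar>"
proof -
  consider "k = 1" | "k = 2" | "k = 3" using exhaust_3[of k] by blast
  then show ?thesis
    by cases (simp_all add: tng_def cross3_def abs_minus_commute mult.commute)
qed

text \<open>The cross product of two vectors orthogonal to \<open>N\<close> is a multiple of \<open>N\<close>, and the factor is read off from
  the \<open>k\<close>-th coordinate.\<close>

lemma norm_cross_normal:
  assumes "N \<bullet> a = 0" "N \<bullet> b = 0" "\<bar>N $ k\<bar> = 1"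
  shows "norm (cross3 a b) = \<bar>cross3 a b $ k\<bar> * norm N"
proof -
  let ?n = "cross3 a b"
  have "cross3 N ?n = 0" using assms by (simp add: Lagrange)
  then have z: "N $ 2 * ?n $ 3 = N $ 3 * ?n $ 2" "N $ 3 * ?n $ 1 = N $ 1 * ?n $ 3" "N $ 1 * ?n $ 2 = N $ 2 * ?n $ 1"
    unfolding cross3_def[of N] by (simp_all add: vec_eq_iff forall_3)
  have e: "N $ k * ?n $ i = N $ i * ?n $ k" for i
    using exhaust_3[of k] exhaust_3[of i] z by auto
  have "N $ k *\<^sub>R ?n = ?n $ k *\<^sub>R N" by (simp add: vec_eq_iff e mult.commute)
  then have "norm (N $ k *\<^sub>R ?n) = norm (?n $ k *\<^sub>R N)" by simp
  then show ?thesis using assms(3) by simp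
qed

lemma smooth_C1:
  assumes "smooth V \<psi>"
  shows "y \<in> V \<Longrightarrow> (\<psi> has_derivative frechet_derivative \<psi> (at y)) (at y)" "continuous_on V \<psi>"
proof -
  have "Ck 1 V \<psi>" "Ck 0 V \<psi>" using assms by (simp_all add: smooth_def del: Ck.simps)
  then show "y \<in> V \<Longrightarrow> (\<psi> has_derivative frechet_derivative \<psi> (at y)) (at y)" "continuous_on V \<psi>"
    using frechet_derivative_works by auto
qed

lemma continuous_preimage_borel:
  fixes \<psi> :: "'a::t2_space \<Rightarrow> 'b::topological_space"
  assumes "continuous_on V \<psi>" "open V" "B \<in> sets borel"
  shows "V \<inter> \<psi> -` B \<in> sets borel"
proof -
  have "\<psi> -` B \<inter> space (restrict_space borel V) \<in> sets (restrict_space borel V)"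
    by (rule measurable_sets[OF borel_measurable_continuous_on_restrict[OF assms(1)] assms(3)])
  then show ?thesis using assms(2) by (simp add: sets_restrict_space_iff space_restrict_space Int_commute)
qed

context epigraph
begin

text \<open>The surface measure of the whole graph, parametrised over the hyperplane.\<close>

definition gmeas :: "(real^3) measure" where
  "gmeas = distr (density lborel (\<lambda>y. ennreal (norm (nv (lay y 0))))) borel (\<lambda>y. lay y 0)"

lemma lay0_meas [measurable]: "(\<lambda>y. lay y 0) \<in> borel_measurable borel"
  by (intro borel_measurable_continuous_onI lay_cont continuous_intros)

lemma nv0_meas [measurable]: "(\<lambda>y. norm (nv (lay y 0))) \<in> borel_measurable borel"
  by (intro borel_measurable_continuous_onI continuous_intros continuous_on_compose2[OF nv_cont[of UNIV] lay_cont]) auto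

lemma sets_gmeas [simp]: "sets gmeas = sets borel" "space gmeas = UNIV"
  by (simp_all add: gmeas_def)

lemma emeasure_gmeas:
  assumes [measurable]: "B \<in> sets borel"
  shows "emeasure gmeas B = (\<integral>\<^sup>+y. ennreal (norm (nv (lay y 0))) * indicator {y. lay y 0 \<in> B} y \<partial>lborel)"
proof -
  have "{y. lay y 0 \<in> B} = (\<lambda>y. lay y 0) -` B \<inter> space lborel" by auto
  moreover have "(\<lambda>y. lay y 0) -` B \<inter> space lborel \<in> sets lborel" by measurable
  ultimately show ?thesis unfolding gmeas_def by (simp add: emeasure_distr emeasure_density)
qed

lemma lay0_out: "y \<notin> cball (proj k p) R \<Longrightarrow> lay y s \<notin> cball p R"
proof
  assume y: "y \<notin> cball (proj k p) R" and "lay y s \<in> cball p R"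
  then have "norm (p - lay y s) \<le> R" by (simp add: dist_norm)
  then have "norm (proj k p - proj k (lay y s)) \<le> R" unfolding proj_diff using norm_proj_le order_trans by blast
  then show False using y by (simp add: lay_def dist_norm)
qed

lemma nv_bounded: "\<exists>M\<ge>1. \<forall>y. lay y 0 \<in> cball p R \<longrightarrow> norm (nv (lay y 0)) \<le> M"
proof -
  have "bounded (nv ` cball p R)"
    by (intro compact_imp_bounded compact_continuous_image nv_cont) auto
  then obtain M where "\<And>x. x \<in> cball p R \<Longrightarrow> norm (nv x) \<le> M" unfolding bounded_iff by blast
  then show ?thesis by (intro exI[of _ "max M 1"]) (auto simp: le_max_iff_disj simp del: mem_cball)
qed

lemma gmeas_absint:
  assumes B: "B \<in> sets borel" "B \<subseteq> cball p R"
  shows "(\<lambda>y. norm (nv (lay y 0))) absolutely_integrable_on {y. lay y 0 \<in> B}"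
proof -
  obtain M where M: "M \<ge> 1" "\<And>y. lay y 0 \<in> cball p R \<Longrightarrow> norm (nv (lay y 0)) \<le> M" using nv_bounded by blast
  have Bs: "{y. lay y 0 \<in> B} \<in> sets borel"
    using measurable_sets[OF lay0_meas B(1)] by (simp add: vimage_def)
  have m: "(\<lambda>y. indicator {y. lay y 0 \<in> B} y *\<^sub>R norm (nv (lay y 0))) \<in> borel_measurable borel"
    using Bs by measurable
  have "integrable lborel (\<lambda>y. indicator {y. lay y 0 \<in> B} y *\<^sub>R norm (nv (lay y 0)))"
  proof (rule integrable_supp[OF m, where B=M and p="proj k p" and R=R])
    show "norm (indicator {y. lay y 0 \<in> B} y *\<^sub>R norm (nv (lay y 0))) \<le> M" for y
      using M(1) M(2)[of y] B(2) by (cases "lay y 0 \<in> B") auto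
    show "indicator {y. lay y 0 \<in> B} y *\<^sub>R norm (nv (lay y 0)) = 0" if "y \<notin> cball (proj k p) R" for y
      using lay0_out[OF that] B(2) by (auto simp: indicator_def)
  qed
  then have "integrable lebesgue (\<lambda>y. indicator {y. lay y 0 \<in> B} y *\<^sub>R norm (nv (lay y 0)))"
    using m by (subst integrable_completion) auto
  then show ?thesis unfolding set_integrable_def .
qed

lemma gmeas_finite: "B \<in> sets borel \<Longrightarrow> B \<subseteq> cball p R \<Longrightarrow> emeasure gmeas B < \<infinity>"
proof -
  assume B: "B \<in> sets borel" "B \<subseteq> cball p R"
  note i = gmeas_absint[OF B, unfolded set_integrable_def]
  have "emeasure gmeas B = (\<integral>\<^sup>+y. ennreal (indicator {y. lay y 0 \<in> B} y *\<^sub>R norm (nv (lay y 0))) \<partial>lebesgue)"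
    unfolding emeasure_gmeas[OF B(1)] nn_integral_completion by (intro nn_integral_cong) (auto simp: indicator_def)
  also have "\<dots> < \<infinity>" using i by (subst nn_integral_eq_integral) auto
  finally show ?thesis .
qed

text \<open>Differentiating the equation of the graph along a curve in it.\<close>

lemma nv_orth:
  assumes d: "(\<psi> has_derivative \<psi>') (at y)" and V: "open V" "y \<in> V" "\<And>z. z \<in> V \<Longrightarrow> eps * \<psi> z $ k = gam (\<psi> z)"
  shows "nv (\<psi> y) \<bullet> \<psi>' h = 0"
proof -
  have 1: "((\<lambda>z. eps * \<psi> z $ k) has_derivative (\<lambda>h. eps * \<psi>' h $ k)) (at y)"
    by (intro has_derivative_mult_right bounded_linear.has_derivative[OF bounded_linear_vec_nth] d)
  have "((\<lambda>z. gam (\<psi> z)) has_derivative (\<lambda>h. \<psi>' h \<bullet> gam_grad (\<psi> y))) (at y)"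
    using has_derivative_compose[OF d] gam_gderiv[of "\<psi> y"] unfolding gderiv_def by blast
  then have 2: "((\<lambda>z. eps * \<psi> z $ k) has_derivative (\<lambda>h. \<psi>' h \<bullet> gam_grad (\<psi> y))) (at y)"
    by (rule has_derivative_transform_within_open[OF _ V(1,2)]) (use V(3) in simp)
  have "(\<lambda>h. eps * \<psi>' h $ k) = (\<lambda>h. \<psi>' h \<bullet> gam_grad (\<psi> y))" by (rule has_derivative_unique[OF 1 2])
  then have "eps * \<psi>' h $ k = \<psi>' h \<bullet> gam_grad (\<psi> y)" by meson
  then show ?thesis unfolding nv_def inner_diff_left by (simp add: inner_axis' inner_commute[of "gam_grad (\<psi> y)"])
qed

context
  fixes S :: "(real^3) set" and p :: "real^3" and r :: real
  assumes graph: "S \<inter> ball p r = {x \<in> ball p r. eps * x $ k = gam x}"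
begin

lemma graph_lay: "x \<in> S \<Longrightarrow> x \<in> ball p r \<Longrightarrow> lay (proj k x) 0 = x"
proof (rule lay_proj)
  assume "x \<in> S" "x \<in> ball p r"
  then have "x \<in> S \<inter> ball p r" by blast
  then show "eps * x $ k = gam x + 0" unfolding graph by simp
qed

lemma lay_graph: "lay y 0 \<in> ball p r \<Longrightarrow> lay y 0 \<in> S"
proof -
  assume a: "lay y 0 \<in> ball p r"
  have "eps * lay y 0 $ k = gam (lay y 0)" unfolding lay_def by (subst gam_emb) simp
  then show ?thesis using a graph by blast
qed

text \<open>The area formula is independent of the parametrisation: projecting along the \<open>k\<close>-th axis turns the
  parameter change into a diffeomorphism of the plane, whose Jacobian is the \<open>k\<close>-th component of the cross
  product.\<close>

lemma gmeas_param:
  assumes lp: "local_param S V \<psi>" and B: "B \<in> sets borel" "B \<subseteq> \<psi> ` V" "B \<subseteq> ball p r"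
  shows "emeasure gmeas B = (\<integral>\<^sup>+ y. ennreal (norm (cross3 (pd 1 \<psi> y) (pd 2 \<psi> y))) * indicator (V \<inter> \<psi> -` B) y \<partial>lborel)"
proof -
  have V: "open V" "smooth V \<psi>" "inj_on \<psi> V" "openin (top_of_set S) (\<psi> ` V)" using lp by (auto simp: local_param_def)
  have S: "\<psi> ` V \<subseteq> S" using openin_imp_subset[OF V(4)] .
  note d = smooth_C1(1)[OF V(2)] and c = smooth_C1(2)[OF V(2)]
  let ?Y = "V \<inter> \<psi> -` B" and ?\<tau> = "\<lambda>y. proj k (\<psi> y)"
  define V0 where "V0 = V \<inter> \<psi> -` ball p r"
  have V0: "open V0" unfolding V0_def by (rule continuous_open_preimage[OF c V(1)]) simp
  have YV: "?Y \<subseteq> V0" using B(3) by (auto simp: V0_def)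
  have lay\<tau>: "lay (?\<tau> y) 0 = \<psi> y" if "y \<in> V0" for y
    using that S by (intro graph_lay) (auto simp: V0_def)
  have on: "eps * \<psi> y $ k = gam (\<psi> y)" if "y \<in> V0" for y
  proof -
    have "\<psi> y \<in> S \<inter> ball p r" using that S by (auto simp: V0_def)
    then show ?thesis unfolding graph by simp
  qed
  have inj: "inj_on ?\<tau> ?Y"
    by (rule inj_onI) (metis Int_iff YV V(3) inj_on_def lay\<tau> subsetD)
  have im: "?\<tau> ` ?Y = {z. lay z 0 \<in> B}"
  proof (intro set_eqI iffI)
    fix z assume "z \<in> ?\<tau> ` ?Y"
    then obtain y where y: "y \<in> ?Y" "z = ?\<tau> y" by blast
    then have "lay z 0 = \<psi> y" using lay\<tau> YV by blast
    then show "z \<in> {z. lay z 0 \<in> B}" using y by simp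
  next
    fix z assume "z \<in> {z. lay z 0 \<in> B}"
    then obtain y where y: "y \<in> V" "\<psi> y = lay z 0" "lay z 0 \<in> B" using B(2) by auto
    then have "?\<tau> y = z" by (simp add: lay_def)
    then show "z \<in> ?\<tau> ` ?Y" using y by (intro image_eqI[of _ _ y]) auto
  qed
  have Y: "?Y \<in> sets lebesgue"
    using continuous_preimage_borel[OF c V(1) B(1)] by simp
  let ?\<psi>' = "\<lambda>y. frechet_derivative \<psi> (at y)"
  have bl: "bounded_linear (proj k)" unfolding proj_def
    by (rule linear_conv_bounded_linear[THEN iffD1]) (auto intro!: linearI simp: vec_eq_iff)
  have d\<tau>: "(?\<tau> has_derivative (\<lambda>h. proj k (?\<psi>' y h))) (at y within ?Y)" if "y \<in> ?Y" for y
    using bounded_linear.has_derivative[OF bl d[of y]] that by (auto intro: has_derivative_at_withinI)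
  have f: "(\<lambda>z. norm (nv (lay z 0))) absolutely_integrable_on (?\<tau> ` ?Y)"
    unfolding im by (rule gmeas_absint[OF B(1)]) (use B(3) ball_subset_cball in blast)
  have "emeasure gmeas B = (\<integral>\<^sup>+z. ennreal (norm (nv (lay z 0))) * indicator (?\<tau> ` ?Y) z \<partial>lborel)"
    unfolding im by (rule emeasure_gmeas[OF B(1)])
  also have "\<dots> = (\<integral>\<^sup>+ y. ennreal (\<bar>det (matrix (\<lambda>h. proj k (?\<psi>' y h)))\<bar> * norm (nv (lay (?\<tau> y) 0))) * indicator ?Y y \<partial>lborel)"
    by (rule nn_integral_change_of_variables[OF Y d\<tau> inj f]) auto
  also have "\<dots> = (\<integral>\<^sup>+ y. ennreal (norm (cross3 (pd 1 \<psi> y) (pd 2 \<psi> y))) * indicator ?Y y \<partial>lborel)"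
  proof (rule nn_integral_cong)
    fix y
    show "ennreal (\<bar>det (matrix (\<lambda>h. proj k (?\<psi>' y h)))\<bar> * norm (nv (lay (?\<tau> y) 0))) * indicator ?Y y
      = ennreal (norm (cross3 (pd 1 \<psi> y) (pd 2 \<psi> y))) * indicator ?Y y"
    proof (cases "y \<in> ?Y")
      case True
      then have y0: "y \<in> V0" using YV by blast
      have o: "nv (\<psi> y) \<bullet> pd i \<psi> y = 0" for i
        unfolding pd_def by (rule nv_orth[OF d V0 y0 on]) (use True in auto)
      have "\<bar>det (matrix (\<lambda>h. proj k (?\<psi>' y h)))\<bar> = \<bar>cross3 (pd 1 \<psi> y) (pd 2 \<psi> y) $ k\<bar>"
        unfolding cross_nth by (simp add: det_2 matrix_def pd_def mult.commute)
      then show ?thesis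
        using norm_cross_normal[OF o o, of k 1 2] lay\<tau>[OF y0] by simp
    qed simp
  qed
  finally show ?thesis .
qed

end

end

lemma Ck_emb:
  fixes h :: "real^3 \<Rightarrow> real" and a c :: "real^3"
  assumes "\<And>m. Ck m UNIV h"
  shows "Ck n V (\<lambda>y. a + h (emb k y 0) *\<^sub>R c)"
  using assms
proof (induction n arbitrary: a h)
  case 0
  have "continuous_on UNIV h" using 0[of 0] by simp
  then show ?case by (auto intro!: continuous_intros continuous_on_compose2[of UNIV h])
next
  case (Suc n)
  have hd: "h differentiable at x" for x using Suc.prems[of 1] by simp
  have e0: "((\<lambda>y. emb k y 0) has_derivative (\<lambda>v. emb k v 0)) (at y)" for y
  proof -
    have "((\<lambda>y. y $ 1 *\<^sub>R axis (tng k 1) 1 + y $ 2 *\<^sub>R axis (tng k 2) 1 :: real^3) has_derivative (\<lambda>h. h $ 1 *\<^sub>R axis (tng k 1) 1 + h $ 2 *\<^sub>R axis (tng k 2) 1)) (at y)"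
      by (intro has_derivative_add has_derivative_scaleR_left bounded_linear_imp_has_derivative bounded_linear_vec_nth)
    then show ?thesis by (simp add: emb_def)
  qed
  have der: "((\<lambda>y. a + h (emb k y 0) *\<^sub>R c) has_derivative (\<lambda>v. 0 + (emb k v 0 \<bullet> (\<chi> j. pd j h (emb k y 0))) *\<^sub>R c)) (at y)" for y
  proof -
    have "((\<lambda>y. h (emb k y 0)) has_derivative (\<lambda>v. emb k v 0 \<bullet> (\<chi> j. pd j h (emb k y 0)))) (at y)"
      using has_derivative_compose[OF e0] gderiv_pd[OF hd[of "emb k y 0"]] unfolding gderiv_def by blast
    then show ?thesis by (intro has_derivative_add has_derivative_const has_derivative_scaleR_left)
  qed
  have pd: "pd i (\<lambda>y. a + h (emb k y 0) *\<^sub>R c) = (\<lambda>y. 0 + pd (tng k i) h (emb k y 0) *\<^sub>R c)" for i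
  proof
    fix y
    have "emb k (axis i 1) 0 = axis (tng k i) 1"
      using exhaust_2[of i] by (auto simp: emb_def axis_def vec_eq_iff tng_def)
    then show "pd i (\<lambda>y. a + h (emb k y 0) *\<^sub>R c) y = 0 + pd (tng k i) h (emb k y 0) *\<^sub>R c"
      unfolding pd_def[of i] frechet_derivative_at[OF der, symmetric] by (simp add: inner_axis')
  qed
  have "Ck m UNIV (pd j h)" for m j using Suc.prems[of "Suc m"] by simp
  then have "Ck n V (pd i (\<lambda>y. a + h (emb k y 0) *\<^sub>R c))" for i
    unfolding pd by (rule Suc.IH)
  moreover have "(\<lambda>y. a + h (emb k y 0) *\<^sub>R c) differentiable at y" for y using der by (rule differentiableI)
  ultimately show ?case by (simp del: scaleR_zero_left)
qed

context epigraph
begin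

lemma lay0_eq: "lay y 0 = emb k y 0 + gam (emb k y 0) *\<^sub>R (eps *\<^sub>R axis k 1)"
  unfolding lay_def by (subst emb_shift) simp

lemma lay0_der: "((\<lambda>y. lay y 0) has_derivative (\<lambda>h. emb k h 0 + (emb k h 0 \<bullet> gam_grad (emb k y 0)) *\<^sub>R (eps *\<^sub>R axis k 1))) (at y)"
proof -
  have e0: "((\<lambda>y. emb k y 0) has_derivative (\<lambda>v. emb k v 0)) (at y)"
  proof -
    have "((\<lambda>y. y $ 1 *\<^sub>R axis (tng k 1) 1 + y $ 2 *\<^sub>R axis (tng k 2) 1 :: real^3) has_derivative (\<lambda>h. h $ 1 *\<^sub>R axis (tng k 1) 1 + h $ 2 *\<^sub>R axis (tng k 2) 1)) (at y)"
      by (intro has_derivative_add has_derivative_scaleR_left bounded_linear_imp_has_derivative bounded_linear_vec_nth)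
    then show ?thesis by (simp add: emb_def)
  qed
  have "((\<lambda>y. gam (emb k y 0)) has_derivative (\<lambda>h. emb k h 0 \<bullet> gam_grad (emb k y 0))) (at y)"
    using has_derivative_compose[OF e0] gam_gderiv[of "emb k y 0"] unfolding gderiv_def by blast
  then show ?thesis unfolding lay0_eq by (intro has_derivative_add e0 has_derivative_scaleR_left)
qed

lemma pd_lay0: "pd i (\<lambda>y. lay y 0) = (\<lambda>y. axis (tng k i) 1 + pd (tng k i) gam (emb k y 0) *\<^sub>R (eps *\<^sub>R axis k 1))"
proof
  fix y
  have "emb k (axis i 1) 0 = axis (tng k i) 1"
    using exhaust_2[of i] by (auto simp: emb_def axis_def vec_eq_iff tng_def)
  then show "pd i (\<lambda>y. lay y 0) y = axis (tng k i) 1 + pd (tng k i) gam (emb k y 0) *\<^sub>R (eps *\<^sub>R axis k 1)"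
    unfolding pd_def[of i] frechet_derivative_at[OF lay0_der, symmetric] by (simp add: inner_axis' gam_grad_def)
qed

lemma lay0_smooth: "smooth V (\<lambda>y. lay y 0)"
  unfolding smooth_def
proof
  fix n
  show "Ck n V (\<lambda>y. lay y 0)"
  proof (cases n)
    case 0
    then show ?thesis by (auto intro!: lay_cont continuous_intros)
  next
    case (Suc m)
    have "Ck l UNIV (pd j gam)" for l j using sm unfolding smooth_def by (metis Ck.simps(2))
    then have "Ck m V (pd i (\<lambda>y. lay y 0))" for i unfolding pd_lay0 by (rule Ck_emb)
    then show ?thesis using Suc lay0_der by (auto intro: differentiableI)
  qed
qed

lemma cross_lay0: "norm (cross3 (pd 1 (\<lambda>y. lay y 0) y) (pd 2 (\<lambda>y. lay y 0) y)) = norm (nv (lay y 0))"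
proof -
  have o: "nv (lay y 0) \<bullet> pd i (\<lambda>y. lay y 0) y = 0" for i
    unfolding pd_def frechet_derivative_at[OF lay0_der, symmetric]
  proof (rule nv_orth[OF lay0_der open_UNIV UNIV_I])
    show "eps * lay z 0 $ k = gam (lay z 0)" for z unfolding lay_def by (subst gam_emb) simp
  qed
  have t: "pd i (\<lambda>y. lay y 0) y $ tng k j = (if i = j then 1 else 0)" for i j
    using tng_ne[of k j] exhaust_2[of i] exhaust_2[of j] exhaust_3[of k] unfolding pd_lay0
    by (auto simp: axis_def tng_def)
  have "\<bar>cross3 (pd 1 (\<lambda>y. lay y 0) y) (pd 2 (\<lambda>y. lay y 0) y) $ k\<bar> = 1"
    unfolding cross_nth t by simp
  then show ?thesis using norm_cross_normal[OF o o, of k 1 2] by simp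
qed

context
  fixes S :: "(real^3) set" and p :: "real^3" and r :: real
  assumes graph: "S \<inter> ball p r = {x \<in> ball p r. eps * x $ k = gam x}"
begin

lemma lay0_image: "(\<lambda>y. lay y 0) ` {y. lay y 0 \<in> ball p r} = S \<inter> ball p r"
proof (intro set_eqI iffI)
  fix x assume "x \<in> S \<inter> ball p r"
  then have "x = lay (proj k x) 0" "x \<in> ball p r" using graph_lay[OF graph] by auto
  then show "x \<in> (\<lambda>y. lay y 0) ` {y. lay y 0 \<in> ball p r}" by (metis (mono_tags) imageI mem_Collect_eq)
qed (use lay_graph[OF graph] in blast)

text \<open>The graph itself is an admissible parametrisation, so a surface measure is determined on it.\<close>

lemma graph_param: "local_param S {y. lay y 0 \<in> ball p r} (\<lambda>y. lay y 0)"
  unfolding local_param_def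
proof (intro conjI)
  have pl: "proj k (lay y 0) = y" for y by (simp add: lay_def)
  show inj: "inj_on (\<lambda>y. lay y 0) {y. lay y 0 \<in> ball p r}" by (rule inj_onI) (metis pl)
  have "open ((\<lambda>y. lay y 0) -` ball p r)"
    by (intro open_vimage) (auto intro!: lay_cont continuous_intros)
  then show "open {y. lay y 0 \<in> ball p r}" by (simp add: vimage_def)
  show "smooth {y. lay y 0 \<in> ball p r} (\<lambda>y. lay y 0)" by (rule lay0_smooth)
  show "openin (top_of_set S) ((\<lambda>y. lay y 0) ` {y. lay y 0 \<in> ball p r})"
    unfolding lay0_image by (rule openin_open_Int) simp
  show "continuous_on ((\<lambda>y. lay y 0) ` {y. lay y 0 \<in> ball p r}) (inv_into {y. lay y 0 \<in> ball p r} (\<lambda>y. lay y 0))"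
  proof (rule continuous_on_cong[THEN iffD1, OF refl, rotated])
    show "continuous_on ((\<lambda>y. lay y 0) ` {y. lay y 0 \<in> ball p r}) (\<lambda>x. proj k x)" by (intro continuous_intros)
    fix x assume "x \<in> (\<lambda>y. lay y 0) ` {y. lay y 0 \<in> ball p r}"
    then obtain y where y: "x = lay y 0" "y \<in> {y. lay y 0 \<in> ball p r}" by blast
    then show "proj k x = inv_into {y. lay y 0 \<in> ball p r} (\<lambda>y. lay y 0) x"
      using inv_into_f_f[OF inj y(2)] pl by simp
  qed
  show "\<forall>y\<in>{y. lay y 0 \<in> ball p r}. cross3 (pd 1 (\<lambda>y. lay y 0) y) (pd 2 (\<lambda>y. lay y 0) y) \<noteq> 0"
  proof
    fix y
    have "norm (cross3 (pd 1 (\<lambda>y. lay y 0) y) (pd 2 (\<lambda>y. lay y 0) y)) \<ge> 1"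
      unfolding cross_lay0 by (rule norm_nv_ge1)
    then show "cross3 (pd 1 (\<lambda>y. lay y 0) y) (pd 2 (\<lambda>y. lay y 0) y) \<noteq> 0" by auto
  qed
qed

lemma surface_gmeas:
  assumes \<sigma>: "is_surface_measure S \<sigma>" and B: "B \<in> sets borel" "B \<subseteq> S \<inter> ball p r"
  shows "emeasure \<sigma> B = emeasure gmeas B"
proof -
  have B': "B \<subseteq> (\<lambda>y. lay y 0) ` {y. lay y 0 \<in> ball p r}" "B \<subseteq> ball p r" unfolding lay0_image using B(2) by auto
  show ?thesis
    unfolding gmeas_param[OF graph graph_param B(1) B']
    using \<sigma> graph_param B(1) B'(1) unfolding is_surface_measure_def by blast
qed

lemma surf_integral:
  fixes f :: "real^3 \<Rightarrow> real"
  assumes \<sigma>: "is_surface_measure S \<sigma>" and S: "S \<in> sets borel" and f [measurable]: "f \<in> borel_measurable borel"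
  shows "(LINT x|\<sigma>. indicator (S \<inter> ball p r) x * f x) = (LINT y|lborel. norm (nv (lay y 0)) * (indicator (S \<inter> ball p r) (lay y 0) * f (lay y 0)))"
proof -
  have [measurable]: "S \<inter> ball p r \<in> sets borel" using S by auto
  have s\<sigma>: "sets \<sigma> = sets borel" using \<sigma> by (simp add: is_surface_measure_def)
  then have m\<sigma>: "u \<in> borel_measurable \<sigma> \<longleftrightarrow> u \<in> borel_measurable borel" for u :: "real^3 \<Rightarrow> real"
    by (simp cong: measurable_cong_sets)
  have eq: "density \<sigma> (indicator (S \<inter> ball p r)) = density gmeas (indicator (S \<inter> ball p r))"
  proof (rule measure_eqI)
    fix B assume "B \<in> sets (density \<sigma> (indicator (S \<inter> ball p r)))"
    then have B: "B \<in> sets borel" using s\<sigma> by simp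
    have "emeasure \<sigma> (S \<inter> ball p r \<inter> B) = emeasure gmeas (S \<inter> ball p r \<inter> B)"
      by (rule surface_gmeas[OF \<sigma>]) (use B in auto)
    then show "emeasure (density \<sigma> (indicator (S \<inter> ball p r))) B = emeasure (density gmeas (indicator (S \<inter> ball p r))) B"
      using B s\<sigma> by (subst (1 2) emeasure_density) (auto simp: indicator_inter_arith[symmetric] cong: measurable_cong_sets)
  qed (simp add: s\<sigma>)
  have d: "integral\<^sup>L (density \<mu> (\<lambda>x. ennreal (indicator (S \<inter> ball p r) x))) f = (LINT x|\<mu>. indicator (S \<inter> ball p r) x * f x)"
    if "sets \<mu> = sets borel" for \<mu>
    using that by (subst integral_density) (auto cong: measurable_cong_sets)
  have "(LINT x|\<sigma>. indicator (S \<inter> ball p r) x * f x) = (LINT x|gmeas. indicator (S \<inter> ball p r) x * f x)"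
    using d[OF s\<sigma>] d[OF sets_gmeas(1)] eq by (simp add: ennreal_indicator)
  also have "\<dots> = (LINT y|density lborel (\<lambda>y. ennreal (norm (nv (lay y 0)))). indicator (S \<inter> ball p r) (lay y 0) * f (lay y 0))"
    unfolding gmeas_def by (subst integral_distr) auto
  also have "\<dots> = (LINT y|lborel. norm (nv (lay y 0)) * (indicator (S \<inter> ball p r) (lay y 0) * f (lay y 0)))"
    by (subst integral_density) auto
  finally show ?thesis .
qed

end

end

section \<open>Atlases of smooth domains\<close>

text \<open>For an interior point the ball is inside the domain and the graph is placed below it, so the closure is
  covered by charts of one kind.\<close>

definition chart :: "(real^3) set \<Rightarrow> real^3 \<Rightarrow> real \<Rightarrow> 3 \<Rightarrow> real \<Rightarrow> (real^3 \<Rightarrow> real) \<Rightarrow> bool" where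
  "chart U p r k eps gam \<longleftrightarrow> r > 0 \<and> epigraph k eps gam \<and> U \<inter> ball p r = {x \<in> ball p r. eps * x $ k > gam x}"

lemma chart_exists:
  assumes U: "smooth_bounded_domain U" and p: "p \<in> closure U"
  shows "\<exists>r k eps gam. chart U p r k eps gam"
proof (cases "p \<in> U")
  case True
  then obtain r where r: "r > 0" "ball p r \<subseteq> U"
    using U unfolding smooth_bounded_domain_def by (meson open_contains_ball)
  have "p $ 1 - r < x $ 1" if "x \<in> ball p r" for x
    using component_le_norm_cart[of "p - x" 1] that by (simp add: dist_norm)
  then have "U \<inter> ball p r = {x \<in> ball p r. 1 * x $ 1 > p $ 1 - r}" using r(2) by auto
  moreover have "epigraph 1 1 (\<lambda>x. p $ 1 - r)"
    by unfold_locales (auto intro: SC_smooth SC_const)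
  ultimately have "chart U p r 1 1 (\<lambda>x. p $ 1 - r)" using r(1) unfolding chart_def by blast
  then show ?thesis by blast
next
  case False
  then have "p \<in> frontier U" using p U by (simp add: frontier_def smooth_bounded_domain_def interior_open)
  then have "\<exists>r>0. \<exists>k. \<exists>\<epsilon>\<in>{-1, 1::real}. \<exists>\<gamma>::real^3 \<Rightarrow> real.
        smooth UNIV \<gamma> \<and> (\<forall>x t. \<gamma> (x + t *\<^sub>R axis k 1) = \<gamma> x) \<and>
        U \<inter> ball p r = {x \<in> ball p r. \<epsilon> * x $ k > \<gamma> x}"
    using U unfolding smooth_bounded_domain_def smooth_boundary_def by blast
  then obtain r k eps gam where c: "r > 0" "eps \<in> {-1, 1::real}" "smooth UNIV gam" "\<forall>x t. gam (x + t *\<^sub>R axis k 1) = gam x"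
    "U \<inter> ball p r = {x \<in> ball p r. eps * x $ k > gam x}"
    by blast
  have "epigraph k eps gam" by unfold_locales (use c in auto)
  then have "chart U p r k eps gam" using c unfolding chart_def by blast
  then show ?thesis by blast
qed

lemma chart_closure:
  assumes c: "chart U p r k eps gam" and U: "open U"
  shows "closure U \<inter> ball p r = {x \<in> ball p r. eps * x $ k \<ge> gam x}"
    "frontier U \<inter> ball p r = {x \<in> ball p r. eps * x $ k = gam x}"
proof -
  interpret epigraph k eps gam using c by (simp add: chart_def)
  have g: "U \<inter> ball p r = {x \<in> ball p r. eps * x $ k > gam x}" using c by (simp add: chart_def)
  show cl: "closure U \<inter> ball p r = {x \<in> ball p r. eps * x $ k \<ge> gam x}"
  proof (intro set_eqI iffI)
    fix x assume x: "x \<in> closure U \<inter> ball p r"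
    have "gam x \<le> eps * x $ k"
    proof (rule ccontr)
      assume n: "\<not> ?thesis"
      let ?T = "ball p r \<inter> {x. eps * x $ k < gam x}"
      have "open ?T" by (intro open_Int open_ball open_Collect_less continuous_intros gam_cont)
      moreover have "?T \<inter> U = {}"
      proof -
        have "z \<notin> U" if "z \<in> ?T" for z
        proof
          assume "z \<in> U"
          then have "z \<in> U \<inter> ball p r" using that by blast
          then show False unfolding g using that by auto
        qed
        then show ?thesis by blast
      qed
      ultimately have "?T \<inter> closure U = {}" by (simp add: open_Int_closure_eq_empty)
      then show False using x n by auto
    qed
    then show "x \<in> {x \<in> ball p r. eps * x $ k \<ge> gam x}" using x by blast
  next
    fix x assume "x \<in> {x \<in> ball p r. eps * x $ k \<ge> gam x}"
    then have x: "x \<in> ball p r" "eps * x $ k \<ge> gam x" by auto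
    have "x \<in> closure U"
      unfolding closure_approachable
    proof (intro allI impI)
      fix e :: real assume e: "e > 0"
      define t where "t = min e (r - dist p x) / 2"
      have t: "t > 0" "t < e" "t < r - dist p x" using e x(1) by (auto simp: t_def min_def field_simps)
      let ?z = "x + (t * eps) *\<^sub>R axis k 1"
      have n: "dist ?z x = t" using t by (simp add: dist_norm abs_mult)
      have "?z \<in> ball p r" using t n dist_triangle[of p ?z x] by (simp add: dist_commute)
      moreover have "eps * ?z $ k > gam ?z"
      proof -
        have "?z $ k = x $ k + t * eps" by (simp add: axis_def)
        moreover have "eps * (x $ k + t * eps) = eps * x $ k + (eps * eps) * t" by (simp add: algebra_simps del: eps2)
        ultimately show ?thesis unfolding inv using x(2) t(1) by simp
      qed
      ultimately have "?z \<in> U \<inter> ball p r" unfolding g by blast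
      then show "\<exists>y\<in>U. dist y x < e" using n t(2) by (metis IntD1)
    qed
    then show "x \<in> closure U \<inter> ball p r" using x by blast
  qed
  have "frontier U = closure U - U" using U by (simp add: frontier_def interior_open)
  then have e: "frontier U \<inter> ball p r = closure U \<inter> ball p r - U \<inter> ball p r" by blast
  have "x \<in> frontier U \<inter> ball p r \<longleftrightarrow> x \<in> ball p r \<and> eps * x $ k = gam x" for x
    unfolding e cl g Diff_iff mem_Collect_eq by (metis order_le_less order_less_irrefl)
  then show "frontier U \<inter> ball p r = {x \<in> ball p r. eps * x $ k = gam x}"
    by blast
qed

text \<open>A finite atlas of the closure. Half of each ball suffices to cover, which leaves room for functions
  supported in the smaller balls.\<close>

locale atlas =
  fixes U P :: "(real^3) set" and rad :: "real^3 \<Rightarrow> real" and ax :: "real^3 \<Rightarrow> 3" and sg :: "real^3 \<Rightarrow> real"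
    and gr :: "real^3 \<Rightarrow> real^3 \<Rightarrow> real"
  assumes dom: "smooth_bounded_domain U" and finP: "finite P"
    and ch: "\<And>p. p \<in> P \<Longrightarrow> chart U p (rad p) (ax p) (sg p) (gr p)"
    and cov: "closure U \<subseteq> (\<Union>p\<in>P. ball p (rad p / 2))"

lemma atlas_exists:
  assumes U: "smooth_bounded_domain U"
  shows "\<exists>P rad ax sg gr. atlas U P rad ax sg gr"
proof -
  have "\<forall>p\<in>closure U. \<exists>t. chart U p (fst t) (fst (snd t)) (fst (snd (snd t))) (snd (snd (snd t)))"
  proof
    fix p assume "p \<in> closure U"
    then obtain r k eps gam where "chart U p r k eps gam" using chart_exists[OF U] by blast
    then show "\<exists>t. chart U p (fst t) (fst (snd t)) (fst (snd (snd t))) (snd (snd (snd t)))"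
      by (intro exI[of _ "(r, k, eps, gam)"]) simp
  qed
  then have "\<exists>T. \<forall>p\<in>closure U. chart U p (fst (T p)) (fst (snd (T p))) (fst (snd (snd (T p)))) (snd (snd (snd (T p))))"
    by (rule bchoice)
  then obtain T where T: "\<forall>p\<in>closure U. chart U p (fst (T p)) (fst (snd (T p))) (fst (snd (snd (T p)))) (snd (snd (snd (T p))))"
    by (elim exE)
  define rad ax sg gr where "rad p = fst (T p)" and "ax p = fst (snd (T p))" and "sg p = fst (snd (snd (T p)))"
    and "gr p = snd (snd (snd (T p)))" for p
  have c: "chart U p (rad p) (ax p) (sg p) (gr p)" if "p \<in> closure U" for p
    using T that unfolding rad_def ax_def sg_def gr_def by blast
  have "compact (closure U)" using U by (simp add: smooth_bounded_domain_def compact_eq_bounded_closed bounded_closure)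
  then obtain P where P: "P \<subseteq> closure U" "finite P" "closure U \<subseteq> (\<Union>p\<in>P. ball p (rad p / 2))"
  proof (rule compactE_image[where C="closure U" and f="\<lambda>p. ball p (rad p / 2)"])
    show "closure U \<subseteq> (\<Union>p\<in>closure U. ball p (rad p / 2))"
    proof
      fix p assume p: "p \<in> closure U"
      then have "p \<in> ball p (rad p / 2)" using c[OF p] by (simp add: chart_def)
      then show "p \<in> (\<Union>p\<in>closure U. ball p (rad p / 2))" using p by blast
    qed
  qed auto
  have "atlas U P rad ax sg gr"
    by unfold_locales (use U P c in auto)
  then show ?thesis by blast
qed

context atlas
begin

lemma U_facts: "open U" "bounded U" "U \<noteq> {}" "compact (closure U)" "compact (frontier U)" "frontier U \<subseteq> closure U" "U \<inter> frontier U = {}"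
proof -
  show o: "open U" and b: "bounded U" and "U \<noteq> {}" using dom by (simp_all add: smooth_bounded_domain_def)
  have f: "frontier U = closure U - U" using o by (simp add: frontier_def interior_open)
  show "frontier U \<subseteq> closure U" "U \<inter> frontier U = {}" unfolding f by blast+
  show "compact (closure U)" using b by (simp add: compact_closure)
  show "compact (frontier U)" using b by (rule compact_frontier_bounded)
qed

lemma ep: "p \<in> P \<Longrightarrow> epigraph (ax p) (sg p) (gr p)"
  using ch by (simp add: chart_def)

lemma radp: "p \<in> P \<Longrightarrow> rad p > 0"
  using ch by (simp add: chart_def)

lemma grp: "p \<in> P \<Longrightarrow> frontier U \<inter> ball p (rad p) = {x \<in> ball p (rad p). sg p * x $ ax p = gr p x}"
  using chart_closure(2)[OF ch U_facts(1)] .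

abbreviation "S \<equiv> frontier U"

lemma S_borel [measurable]: "S \<in> sets borel"
  by (simp add: borel_closed)

text \<open>The boundary is cut into disjoint pieces, each inside one chart, and the graph measures are added on
  them. By \<open>gmeas_param\<close> the values on the pieces agree with any other parametrisation.\<close>

lemma surface_measure_exists: "\<exists>\<sigma>. is_surface_measure S \<sigma>"
proof -
  obtain f :: "real^3 \<Rightarrow> nat" where f: "inj_on f P" using finite_imp_inj_to_nat_seg[OF finP] by metis
  \<comment> \<open>points of the boundary are assigned to the first chart that contains them\<close>
  define E where "E p = S \<inter> ball p (rad p) - (\<Union>q\<in>{q\<in>P. f q < f p}. ball q (rad q))" for p
  have E: "E p \<in> sets borel" "E p \<subseteq> ball p (rad p)" "E p \<subseteq> S" for p
    unfolding E_def by (intro sets.Diff sets.Int S_borel borel_open open_UN ballI open_ball) auto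
  have disj: "E p \<inter> E q = {}" if "p \<in> P" "q \<in> P" "p \<noteq> q" for p q
  proof -
    have "f p < f q \<or> f q < f p" using f that by (metis inj_onD linorder_neqE_nat)
    then show ?thesis using that unfolding E_def by blast
  qed
  have un: "S \<subseteq> (\<Union>p\<in>P. E p)"
  proof
    fix x assume x: "x \<in> S"
    let ?Q = "{p\<in>P. x \<in> ball p (rad p)}"
    obtain p where p: "p \<in> P" "x \<in> ball p (rad p / 2)" using cov U_facts(6) x by blast
    have "x \<in> ball p (rad p)" using p(2) radp[OF p(1)] by simp
    then have "?Q \<noteq> {}" using p by blast
    then obtain q where q: "q \<in> ?Q" "\<And>q'. q' \<in> ?Q \<Longrightarrow> f q \<le> f q'" using ex_has_least_nat[of "\<lambda>q. q \<in> ?Q" _ f] by blast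
    then have "x \<in> E q" unfolding E_def using x by (auto simp: not_less[symmetric] simp del: mem_ball)
    then show "x \<in> (\<Union>p\<in>P. E p)" using q by blast
  qed
  let ?g = "\<lambda>p. epigraph.gmeas (ax p) (sg p) (gr p)"
  have sg: "sets (?g p) = sets borel" if "p \<in> P" for p using epigraph.sets_gmeas[OF ep[OF that]] by simp
  let ?\<mu> = "\<lambda>B. \<Sum>p\<in>P. emeasure (?g p) (B \<inter> E p)"
  define \<sigma> where "\<sigma> = measure_of UNIV (sets borel) ?\<mu>"
  have s\<sigma>: "sets \<sigma> = sets borel" unfolding \<sigma>_def using sets.sigma_sets_eq[of "borel :: (real^3) measure"] by simp
  have ca: "countably_additive (sets \<sigma>) ?\<mu>"
  proof (rule countably_additiveI)
    fix A :: "nat \<Rightarrow> (real^3) set" assume A: "range A \<subseteq> sets \<sigma>" "disjoint_family A"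
    have "(\<Sum>i. ?\<mu> (A i)) = (\<Sum>p\<in>P. \<Sum>i. emeasure (?g p) (A i \<inter> E p))"
      by (rule suminf_sum) simp
    also have "\<dots> = (\<Sum>p\<in>P. emeasure (?g p) (\<Union>i. A i \<inter> E p))"
    proof (rule sum.cong[OF refl])
      fix p assume p: "p \<in> P"
      have "range (\<lambda>i. A i \<inter> E p) \<subseteq> sets (?g p)" using A(1) E(1)[of p] s\<sigma> sg[OF p] by auto
      moreover have "disjoint_family (\<lambda>i. A i \<inter> E p)" using A(2) by (auto simp: disjoint_family_on_def)
      ultimately show "(\<Sum>i. emeasure (?g p) (A i \<inter> E p)) = emeasure (?g p) (\<Union>i. A i \<inter> E p)"
        by (rule suminf_emeasure)
    qed
    also have "\<dots> = ?\<mu> (\<Union>i. A i)" by simp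
    finally show "(\<Sum>i. ?\<mu> (A i)) = ?\<mu> (\<Union>i. A i)" .
  qed
  have em: "emeasure \<sigma> B = ?\<mu> B" if "B \<in> sets borel" for B
    by (rule emeasure_measure_of[OF \<sigma>_def _ _ ca]) (use that s\<sigma> in \<open>auto simp: positive_def\<close>)
  have "is_surface_measure S \<sigma>"
    unfolding is_surface_measure_def
  proof (intro conjI allI impI)
    show "sets \<sigma> = sets borel" by (rule s\<sigma>)
    have "- S \<inter> E p = {}" for p using E(3)[of p] by blast
    moreover have "- S \<in> sets borel" by measurable
    ultimately show "emeasure \<sigma> (- S) = 0" by (simp add: em)
    fix V \<psi> B assume lp: "local_param S V \<psi>" and B: "B \<in> sets borel" "B \<subseteq> \<psi> ` V"
    have V: "open V" "smooth V \<psi>" "openin (top_of_set S) (\<psi> ` V)" using lp by (auto simp: local_param_def)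
    have BS: "B \<subseteq> S" using B(2) openin_imp_subset[OF V(3)] by blast
    let ?J = "\<lambda>y. norm (cross3 (pd 1 \<psi> y) (pd 2 \<psi> y))"
    have "Ck 1 V \<psi>" using V(2) by (simp add: smooth_def del: Ck.simps)
    then have "continuous_on V (pd j \<psi>)" for j by simp
    then have Jc: "continuous_on V ?J" by (intro continuous_intros continuous_on_cross)
    have Jm: "(\<lambda>y. indicator V y *\<^sub>R ?J y) \<in> borel_measurable borel"
      by (rule borel_measurable_continuous_on_indicator[OF _ Jc]) (use V(1) in simp)
    have pre: "V \<inter> \<psi> -` C \<in> sets borel" if "C \<in> sets borel" for C
      by (rule continuous_preimage_borel[OF smooth_C1(2)[OF V(2)] V(1) that])
    have ind: "(\<Sum>p\<in>P. indicator (V \<inter> \<psi> -` (B \<inter> E p)) y :: ennreal) = indicator (V \<inter> \<psi> -` B) y" for y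
    proof (cases "y \<in> V \<inter> \<psi> -` B")
      case True
      then obtain q where q: "q \<in> P" "\<psi> y \<in> E q" using BS un by blast
      have "(\<Sum>p\<in>P. indicator (V \<inter> \<psi> -` (B \<inter> E p)) y :: ennreal) = (\<Sum>p\<in>P. if p = q then 1 else 0)"
        using disj[OF q(1)] q True by (intro sum.cong) (auto simp: indicator_def)
      then show ?thesis using True q finP by simp
    qed (auto simp: indicator_def)
    have "emeasure \<sigma> B = (\<Sum>p\<in>P. emeasure (?g p) (B \<inter> E p))" by (rule em[OF B(1)])
    also have "\<dots> = (\<Sum>p\<in>P. \<integral>\<^sup>+ y. ennreal (?J y) * indicator (V \<inter> \<psi> -` (B \<inter> E p)) y \<partial>lborel)"
      by (intro sum.cong epigraph.gmeas_param[OF ep grp lp]) (use B E in auto)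
    also have "\<dots> = (\<integral>\<^sup>+ y. (\<Sum>p\<in>P. ennreal (?J y) * indicator (V \<inter> \<psi> -` (B \<inter> E p)) y) \<partial>lborel)"
    proof (rule nn_integral_sum[symmetric])
      fix p
      have "(\<lambda>y. ennreal (indicator V y *\<^sub>R ?J y) * indicator (V \<inter> \<psi> -` (B \<inter> E p)) y) \<in> borel_measurable borel"
        using Jm pre[of "B \<inter> E p"] B(1) E(1) by measurable
      moreover have "(\<lambda>y. ennreal (indicator V y *\<^sub>R ?J y) * indicator (V \<inter> \<psi> -` (B \<inter> E p)) y) = (\<lambda>y. ennreal (?J y) * indicator (V \<inter> \<psi> -` (B \<inter> E p)) y)"
        by (auto simp: indicator_def fun_eq_iff)
      ultimately show "(\<lambda>y. ennreal (?J y) * indicator (V \<inter> \<psi> -` (B \<inter> E p)) y) \<in> borel_measurable lborel" by simp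
    qed
    also have "\<dots> = (\<integral>\<^sup>+ y. ennreal (?J y) * indicator (V \<inter> \<psi> -` B) y \<partial>lborel)"
      unfolding sum_distrib_left[symmetric] ind ..
    finally show "emeasure \<sigma> B = (\<integral>\<^sup>+ y. ennreal (?J y) * indicator (V \<inter> \<psi> -` B) y \<partial>lborel)" .
  qed
  then show ?thesis by blast
qed

abbreviation "\<sigma> \<equiv> surface_measure S"

lemma surface: "is_surface_measure S \<sigma>"
  unfolding surface_measure_def using surface_measure_exists by (rule someI_ex)

lemma sets_\<sigma> [simp, measurable_cong]: "sets \<sigma> = sets borel"
  using surface by (simp add: is_surface_measure_def)

lemma space_\<sigma> [simp]: "space \<sigma> = UNIV"
  using sets_eq_imp_space_eq[OF sets_\<sigma>] by simp

lemma \<sigma>_finite: "emeasure \<sigma> S < \<infinity>"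
proof -
  have "emeasure \<sigma> S \<le> emeasure \<sigma> (\<Union>p\<in>P. S \<inter> ball p (rad p / 2))"
  proof (rule emeasure_mono)
    show "(\<Union>p\<in>P. S \<inter> ball p (rad p / 2)) \<in> sets \<sigma>" using finP by (intro sets.finite_UN) auto
  qed (use cov U_facts(6) in blast)
  also have "\<dots> \<le> (\<Sum>p\<in>P. emeasure \<sigma> (S \<inter> ball p (rad p / 2)))"
    by (rule emeasure_subadditive_finite[OF finP]) auto
  also have "\<dots> < \<infinity>"
  proof -
    have "emeasure \<sigma> (S \<inter> ball p (rad p / 2)) < \<infinity>" if p: "p \<in> P" for p
    proof -
      have "emeasure \<sigma> (S \<inter> ball p (rad p / 2)) = emeasure (epigraph.gmeas (ax p) (sg p) (gr p)) (S \<inter> ball p (rad p / 2))"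
        by (rule epigraph.surface_gmeas[OF ep[OF p] grp[OF p] surface]) (use radp[OF p] in auto)
      also have "\<dots> < \<infinity>"
        by (rule epigraph.gmeas_finite[OF ep[OF p], of _ p "rad p / 2"]) auto
      finally show ?thesis .
    qed
    then show ?thesis by (simp add: less_top sum_Pinfty finP)
  qed
  finally show ?thesis .
qed

end

section \<open>Functions that are continuously differentiable up to the boundary\<close>

text \<open>The predicate carries the gradient \<open>G\<close> on the closure explicitly, which makes boundary values of
  derivatives available.\<close>

definition C1 :: "(real^'n::finite) set \<Rightarrow> (real^'n \<Rightarrow> real) \<Rightarrow> (real^'n \<Rightarrow> real^'n) \<Rightarrow> bool" where
  "C1 U u G \<longleftrightarrow> continuous_on (closure U) u \<and> continuous_on (closure U) G \<and> (\<forall>x\<in>U. GDERIV u x :> G x)"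

lemma C1_UNIV: "(\<And>x. GDERIV u x :> G x) \<Longrightarrow> continuous_on UNIV G \<Longrightarrow> C1 U u G"
  unfolding C1_def gderiv_def
  by (meson continuous_on_subset has_derivative_continuous continuous_at_imp_continuous_on subset_UNIV)

lemma C1_const: "C1 U (\<lambda>x. c) (\<lambda>x. 0)"
  by (simp add: C1_def GDERIV_const)

lemma C1_add: "C1 U u G \<Longrightarrow> C1 U v H \<Longrightarrow> C1 U (\<lambda>x. u x + v x) (\<lambda>x. G x + H x)"
  by (auto simp: C1_def intro!: continuous_intros GDERIV_add)

lemma C1_mult: "C1 U u G \<Longrightarrow> C1 U v H \<Longrightarrow> C1 U (\<lambda>x. u x * v x) (\<lambda>x. u x *\<^sub>R H x + v x *\<^sub>R G x)"
  by (auto simp: C1_def intro!: continuous_intros GDERIV_mult)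

lemma C1_compose:
  assumes "C1 U u G" "\<And>x. x \<in> U \<Longrightarrow> DERIV g (u x) :> g' (u x)" "continuous_on (u ` closure U) g" "continuous_on (u ` closure U) g'"
  shows "C1 U (\<lambda>x. g (u x)) (\<lambda>x. g' (u x) *\<^sub>R G x)"
proof -
  have u: "continuous_on (closure U) u" using assms(1) by (simp add: C1_def)
  have "GDERIV (\<lambda>x. g (u x)) x :> g' (u x) *\<^sub>R G x" if "x \<in> U" for x
    using assms(1,2) that by (intro GDERIV_DERIV_compose) (auto simp: C1_def)
  moreover have "continuous_on (closure U) (\<lambda>x. g (u x))" by (rule continuous_on_compose2[OF assms(3) u]) simp
  moreover have "continuous_on (closure U) (\<lambda>x. g' (u x))" by (rule continuous_on_compose2[OF assms(4) u]) simp
  ultimately show ?thesis using assms(1) by (simp add: C1_def continuous_on_scaleR)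
qed

lemma C1_sum: "finite I \<Longrightarrow> (\<And>i. i \<in> I \<Longrightarrow> C1 U (u i) (G i)) \<Longrightarrow> C1 U (\<lambda>x. \<Sum>i\<in>I. u i x) (\<lambda>x. \<Sum>i\<in>I. G i x)"
  by (induction I rule: finite_induct) (auto intro: C1_const C1_add)

lemma C1_pd: "C1 U u G \<Longrightarrow> x \<in> U \<Longrightarrow> pd j u x = G x $ j"
  by (auto simp: C1_def intro: pd_gderiv)

lemma Ck_closure_0: "Ck_closure k U u \<Longrightarrow> continuous_on (closure U) u"
  by (cases k) auto

lemma Ck_closure_C1:
  assumes "Ck_closure (Suc k) U u"
  shows "\<exists>G. C1 U u G \<and> (\<forall>j. Ck_closure k U (\<lambda>x. G x $ j))"
proof -
  have "\<forall>j. \<exists>v. Ck_closure k U v \<and> (\<forall>x\<in>U. v x = pd j u x)" using assms by simp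
  then obtain v where v: "\<And>j. Ck_closure k U (v j)" "\<And>j x. x \<in> U \<Longrightarrow> v j x = pd j u x" by metis
  let ?G = "\<lambda>x. \<chi> j. v j x"
  have "GDERIV u x :> ?G x" if "x \<in> U" for x
    using gderiv_pd[of u x] assms that v(2)[OF that] by simp
  moreover have "continuous_on (closure U) ?G" by (intro continuous_intros Ck_closure_0[OF v(1)])
  ultimately have "C1 U u ?G" using Ck_closure_0[OF assms] by (simp add: C1_def)
  then show ?thesis using v(1) by (intro exI[of _ ?G]) simp
qed

lemma C1_Ck_closure:
  assumes "C1 U u G"
  shows "Ck_closure 1 U u"
proof -
  have "u differentiable at x" if "x \<in> U" for x
    using assms that by (auto simp: C1_def gderiv_def differentiable_def)
  moreover have "continuous_on (closure U) (\<lambda>x. G x $ j)" for j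
    using assms by (auto simp: C1_def intro!: continuous_intros)
  moreover have "\<forall>x\<in>U. G x $ j = pd j u x" for j using C1_pd[OF assms] by simp
  moreover have "\<exists>v. continuous_on (closure U) v \<and> (\<forall>x\<in>U. v x = pd j u x)" for j
    by (intro exI[of _ "\<lambda>x. G x $ j"] conjI calculation)
  ultimately show ?thesis using assms by (simp add: C1_def)
qed

text \<open>Limits from inside the domain are unique at points of the closure, since every such point is a limit
  point of the open set.\<close>

lemma grad_closure_C1:
  assumes u: "C1 U u G" and U: "open U" and x: "x \<in> closure U"
  shows "grad_closure U u x = G x"
proof -
  have "x islimpt U"
    using x U by (metis closure_def UnE interior_limit_point interior_open mem_Collect_eq)
  then have nt: "at x within U \<noteq> bot" by (simp add: trivial_limit_within)
  have "((\<lambda>z. G z $ j) \<longlongrightarrow> G x $ j) (at x within closure U)" for j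
    using u x unfolding C1_def by (auto simp: continuous_on_def intro: tendsto_vec_nth)
  then have "((\<lambda>z. G z $ j) \<longlongrightarrow> G x $ j) (at x within U)" for j
    using tendsto_within_subset closure_subset by blast
  moreover have "\<forall>\<^sub>F z in at x within U. G z $ j = pd j u z" for j
    using C1_pd[OF u] by (auto simp: eventually_at_filter)
  ultimately have "(pd j u \<longlongrightarrow> G x $ j) (at x within U)" for j
    by (rule Lim_transform_eventually)
  then have "Lim (at x within U) (pd j u) = G x $ j" for j using tendsto_Lim[OF nt] by blast
  then show ?thesis by (simp add: grad_closure_def vec_eq_iff)
qed

lemma C1_bounded:
  assumes "C1 U u G" "compact (closure U)"
  shows "\<exists>B\<ge>0. \<forall>x\<in>closure U. \<bar>u x\<bar> \<le> B \<and> norm (G x) \<le> B"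
proof -
  have "bounded (u ` closure U)" "bounded (G ` closure U)"
    using assms by (auto simp: C1_def intro!: compact_imp_bounded compact_continuous_image)
  then obtain B1 B2 where B: "\<And>x. x \<in> closure U \<Longrightarrow> norm (u x) \<le> B1" "\<And>x. x \<in> closure U \<Longrightarrow> norm (G x) \<le> B2"
    unfolding bounded_iff by blast
  show ?thesis
  proof (intro exI conjI ballI)
    fix x assume "x \<in> closure U"
    from B[OF this] show "\<bar>u x\<bar> \<le> max 0 (max B1 B2)" "norm (G x) \<le> max 0 (max B1 B2)" by auto
  qed simp
qed

section \<open>The divergence theorem and the trace inequality\<close>

context atlas
begin

definition pbump :: "real^3 \<Rightarrow> real^3 \<Rightarrow> real" where "pbump p = bump p (rad p / 2)"
definition pbump_sum :: "real^3 \<Rightarrow> real" where "pbump_sum x = (\<Sum>p\<in>P. pbump p x)"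
text \<open>A partition of unity on the closure subordinate to the charts.\<close>

definition chi :: "real^3 \<Rightarrow> real^3 \<Rightarrow> real" where "chi p x = pbump p x * inverse (pbump_sum x)"
definition dchi :: "real^3 \<Rightarrow> real^3 \<Rightarrow> real^3" where
  "dchi p x = pbump p x *\<^sub>R (- (inverse (pbump_sum x))\<^sup>2 *\<^sub>R (\<Sum>q\<in>P. bump_grad q (rad q / 2) x)) + inverse (pbump_sum x) *\<^sub>R bump_grad p (rad p / 2) x"

lemma pbump_C1: "C1 Us (pbump p) (bump_grad p (rad p / 2))"
  unfolding pbump_def by (intro C1_UNIV bump_gderiv bump_cont)

lemma pbump_sum_pos: "x \<in> closure U \<Longrightarrow> pbump_sum x > 0"
proof -
  assume "x \<in> closure U"
  then obtain p where p: "p \<in> P" "x \<in> ball p (rad p / 2)" using cov by blast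
  have "pbump p x \<noteq> 0" using bump_pos_iff[of "rad p / 2" p x] p radp[OF p(1)] by (simp add: pbump_def)
  then have "pbump p x > 0" using bump_nonneg[of p "rad p / 2" x] by (simp add: pbump_def)
  moreover have "pbump p x \<le> pbump_sum x" unfolding pbump_sum_def
    by (rule member_le_sum[OF p(1)]) (auto simp: finP pbump_def bump_nonneg)
  ultimately show ?thesis by linarith
qed

lemma chi_C1: "C1 U (chi p) (dchi p)"
proof -
  have s: "C1 U pbump_sum (\<lambda>x. \<Sum>q\<in>P. bump_grad q (rad q / 2) x)"
    unfolding pbump_sum_def[abs_def] by (intro C1_sum finP pbump_C1)
  have nz: "x \<in> closure U \<Longrightarrow> pbump_sum x \<noteq> 0" for x using pbump_sum_pos[of x] by simp
  have "C1 U (\<lambda>x. inverse (pbump_sum x)) (\<lambda>x. - (inverse (pbump_sum x))\<^sup>2 *\<^sub>R (\<Sum>q\<in>P. bump_grad q (rad q / 2) x))"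
  proof -
    have "GDERIV (\<lambda>x. inverse (pbump_sum x)) x :> - (inverse (pbump_sum x))\<^sup>2 *\<^sub>R (\<Sum>q\<in>P. bump_grad q (rad q / 2) x)" if "x \<in> U" for x
      using s nz closure_subset[of U] that by (intro GDERIV_inverse) (auto simp: C1_def)
    then show ?thesis using s nz unfolding C1_def by (auto intro!: continuous_intros)
  qed
  from C1_mult[OF pbump_C1 this] show ?thesis unfolding chi_def[abs_def] dchi_def[abs_def] .
qed

lemma chi_0: "p \<in> P \<Longrightarrow> x \<notin> ball p (rad p / 2) \<Longrightarrow> chi p x = 0 \<and> dchi p x = 0"
  using bump_0[of "rad p / 2" x p] radp[of p] by (simp add: chi_def dchi_def pbump_def del: mem_ball)

lemma chi_sum: "x \<in> closure U \<Longrightarrow> (\<Sum>p\<in>P. chi p x) = 1"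
  using pbump_sum_pos[of x] by (simp add: chi_def sum_distrib_right[symmetric] pbump_sum_def[symmetric])

lemma dchi_sum: "x \<in> closure U \<Longrightarrow> (\<Sum>p\<in>P. dchi p x) = 0"
proof -
  assume x: "x \<in> closure U"
  let ?g = "\<Sum>q\<in>P. bump_grad q (rad q / 2) x"
  have "(\<Sum>p\<in>P. dchi p x) = (\<Sum>p\<in>P. pbump p x *\<^sub>R (- (inverse (pbump_sum x))\<^sup>2 *\<^sub>R ?g)) + (\<Sum>p\<in>P. inverse (pbump_sum x) *\<^sub>R bump_grad p (rad p / 2) x)"
    unfolding dchi_def by (rule sum.distrib)
  also have "\<dots> = pbump_sum x *\<^sub>R (- (inverse (pbump_sum x))\<^sup>2 *\<^sub>R ?g) + inverse (pbump_sum x) *\<^sub>R ?g"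
    by (simp only: scaleR_sum_left[symmetric] scaleR_sum_right[symmetric] pbump_sum_def[symmetric])
  also have "\<dots> = 0" using pbump_sum_pos[OF x] by (simp add: power2_eq_square)
  finally show ?thesis .
qed

lemma chi_nonneg: "x \<in> closure U \<Longrightarrow> chi p x \<ge> 0"
  using pbump_sum_pos[of x] bump_nonneg[of p "rad p / 2" x] by (simp add: chi_def pbump_def)

lemma chi_le1: "x \<in> closure U \<Longrightarrow> p \<in> P \<Longrightarrow> chi p x \<le> 1"
  using member_le_sum[of p P "\<lambda>p. chi p x"] chi_nonneg[of x] finP chi_sum[of x] by simp

text \<open>The inner unit normal of the graph in the chart at \<open>p\<close>.\<close>

definition un :: "real^3 \<Rightarrow> real^3 \<Rightarrow> real^3" where
  "un p x = (1 / norm (epigraph.nv (ax p) (sg p) (gr p) x)) *\<^sub>R epigraph.nv (ax p) (sg p) (gr p) x"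

text \<open>A function supported in one chart extends by zero to the epigraph, where \<open>epigraph_divergence\<close> applies.\<close>

lemma local_div:
  assumes p: "p \<in> P" and v: "C1 U v G"
    and z: "\<And>x. x \<notin> cball p (rad p / 2) \<Longrightarrow> v x = 0" "\<And>x. x \<notin> cball p (rad p / 2) \<Longrightarrow> G x = 0"
  shows "(LINT x:U|lebesgue. G x $ j) = - (LINT x:S|\<sigma>. v x * un p x $ j)"
proof -
  interpret E: epigraph "ax p" "sg p" "gr p" by (rule ep[OF p])
  let ?r = "rad p"
  have r: "?r > 0" by (rule radp[OF p])
  note c = ch[OF p] and cc = chart_closure[OF ch[OF p] U_facts(1)]
  have g: "U \<inter> ball p ?r = {x \<in> ball p ?r. sg p * x $ ax p > gr p x}" using c by (simp add: chart_def)
  have cont: "continuous_on E.cl f"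
    if f: "continuous_on (closure U) f" "\<And>x. x \<notin> cball p (?r / 2) \<Longrightarrow> f x = 0" for f :: "real^3 \<Rightarrow> 'b::real_normed_vector"
  proof -
    let ?A = "E.cl \<inter> cball p (3 / 4 * ?r)" and ?B = "E.cl \<inter> {x. dist p x \<ge> 3 / 4 * ?r}"
    have "continuous_on (?A \<union> ?B) (\<lambda>x. if dist p x \<le> 3 / 4 * ?r then f x else 0)"
    proof (rule continuous_on_cases)
      show "closed ?A" by (intro closed_Int E.cl_closed closed_cball)
      show "closed ?B" by (intro closed_Int E.cl_closed closed_Collect_le continuous_intros)
      have "?A \<subseteq> closure U \<inter> ball p ?r" unfolding cc(1) using r by auto
      then show "continuous_on ?A f" by (intro continuous_on_subset[OF f(1)]) blast
      show "\<forall>x. x \<in> ?A \<and> \<not> dist p x \<le> 3 / 4 * ?r \<or> x \<in> ?B \<and> dist p x \<le> 3 / 4 * ?r \<longrightarrow> f x = 0"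
        using r by (auto intro!: f(2))
    qed simp
    moreover have "?A \<union> ?B = E.cl" by auto
    moreover have "(if dist p x \<le> 3 / 4 * ?r then f x else 0) = f x" for x
      using f(2)[of x] r by auto
    ultimately show ?thesis by simp
  qed
  have vc: "continuous_on E.cl v" and Gc: "continuous_on E.cl G"
    using v z by (auto simp: C1_def intro!: cont)
  have der: "GDERIV v x :> G x" if x: "x \<in> E.W" for x
  proof (cases "x \<in> ball p ?r")
    case True
    then have "x \<in> U \<inter> ball p ?r" unfolding g using x by (simp add: E.W_def)
    then show ?thesis using v by (auto simp: C1_def)
  next
    case False
    have xn: "x \<notin> cball p (?r / 2)" using False r by auto
    have "GDERIV (\<lambda>x. 0) x :> G x" unfolding z(2)[OF xn] by (rule GDERIV_const)
    then show ?thesis unfolding gderiv_def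
      by (rule has_derivative_transform_within_open[where s="- cball p (?r / 2)"]) (use xn z(1) in auto)
  qed
  have "(LINT x:U|lebesgue. G x $ j) = (LINT x|lborel. indicator E.W x * G x $ j)"
  proof -
    have e: "indicator U x *\<^sub>R G x $ j = indicator E.W x * G x $ j" for x
    proof (cases "x \<in> ball p ?r")
      case True
      then have "x \<in> U \<longleftrightarrow> x \<in> E.W" using g unfolding E.W_def by blast
      then show ?thesis by (simp add: indicator_def)
    next
      case False
      have "x \<notin> cball p (?r / 2)" using False r by auto
      then show ?thesis using z(2) by simp
    qed
    have "integrable lborel (\<lambda>x. indicator E.W x * G x $ j)"
      by (rule E.indW_integrable[where p=p and R="?r / 2"]) (use Gc z(2) in \<open>auto intro!: continuous_intros\<close>)
    then show ?thesis unfolding set_lebesgue_integral_def e by (intro integral_completion) auto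
  qed
  also have "\<dots> = - (LINT y|lborel. v (E.lay y 0) * E.nv (E.lay y 0) $ j)"
    by (rule E.epigraph_divergence[OF vc Gc der z])
  also have "(LINT y|lborel. v (E.lay y 0) * E.nv (E.lay y 0) $ j) = (LINT x:S|\<sigma>. v x * un p x $ j)"
  proof -
    let ?f = "\<lambda>x. (indicator S x *\<^sub>R v x) * un p x $ j"
    have vS: "(\<lambda>x. indicator S x *\<^sub>R v x) \<in> borel_measurable borel"
      using v U_facts(6) by (intro borel_measurable_continuous_on_indicator S_borel) (auto simp: C1_def intro: continuous_on_subset)
    have "continuous_on UNIV (un p)" unfolding un_def[abs_def]
      using E.norm_nv_ge1 by (intro continuous_intros E.nv_cont) (metis norm_zero not_one_le_zero)
    then have "(\<lambda>x. un p x $ j) \<in> borel_measurable borel"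
      by (intro borel_measurable_continuous_onI continuous_intros)
    then have fm: "?f \<in> borel_measurable borel" using vS by simp
    have "(LINT x:S|\<sigma>. v x * un p x $ j) = (LINT x|\<sigma>. indicator (S \<inter> ball p ?r) x * ?f x)"
      unfolding set_lebesgue_integral_def
    proof (rule bint_cong[OF refl])
      fix x
      have "x \<notin> ball p ?r \<Longrightarrow> v x = 0" using r by (intro z(1)) auto
      then show "indicator S x *\<^sub>R (v x * un p x $ j) = indicator (S \<inter> ball p ?r) x * ?f x"
        by (auto simp: indicator_def simp del: mem_ball)
    qed
    also have "\<dots> = (LINT y|lborel. norm (E.nv (E.lay y 0)) * (indicator (S \<inter> ball p ?r) (E.lay y 0) * ?f (E.lay y 0)))"
      by (rule E.surf_integral[OF grp[OF p] surface S_borel fm])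
    also have "\<dots> = (LINT y|lborel. v (E.lay y 0) * E.nv (E.lay y 0) $ j)"
    proof (rule bint_cong[OF refl])
      fix y
      show "norm (E.nv (E.lay y 0)) * (indicator (S \<inter> ball p ?r) (E.lay y 0) * ?f (E.lay y 0)) = v (E.lay y 0) * E.nv (E.lay y 0) $ j"
      proof (cases "E.lay y 0 \<in> ball p ?r")
        case True
        then have "E.lay y 0 \<in> S" using E.lay_graph[OF grp[OF p]] by blast
        moreover have "norm (E.nv (E.lay y 0)) \<noteq> 0" using E.norm_nv_ge1[of "E.lay y 0"] by linarith
        ultimately show ?thesis using True by (simp add: un_def)
      next
        case False
        have "v (E.lay y 0) = 0" by (rule z(1)) (use False r in auto)
        then show ?thesis by simp
      qed
    qed
    finally show ?thesis by simp
  qed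
  finally show ?thesis .
qed

abbreviation contc :: "(real^3 \<Rightarrow> _::topological_space) \<Rightarrow> bool" where "contc \<equiv> continuous_on (closure U)"

lemma set_integrable_U:
  assumes "contc f"
  shows "set_integrable lebesgue U (f :: real^3 \<Rightarrow> real)"
proof -
  have "bounded (f ` closure U)" by (intro compact_imp_bounded compact_continuous_image assms U_facts)
  then obtain B where B: "\<And>x. x \<in> closure U \<Longrightarrow> norm (f x) \<le> B" unfolding bounded_iff by blast
  obtain p R where R: "U \<subseteq> cball p R" using U_facts(2) bounded_subset_cball by blast
  have m: "(\<lambda>x. indicator U x *\<^sub>R f x) \<in> borel_measurable borel"
    by (rule borel_measurable_continuous_on_indicator) (use U_facts(1) continuous_on_subset[OF assms closure_subset] in auto)
  have "integrable lborel (\<lambda>x. indicator U x *\<^sub>R f x)"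
  proof (rule integrable_supp[OF m, where B="max B 0"])
    show "norm (indicator U x *\<^sub>R f x) \<le> max B 0" for x
      using B[of x] closure_subset[of U] by (cases "x \<in> U") auto
    show "x \<notin> cball p R \<Longrightarrow> indicator U x *\<^sub>R f x = 0" for x using R by (auto simp: indicator_def)
  qed
  then show ?thesis unfolding set_integrable_def using m by (subst integrable_completion) auto
qed

lemma set_integrable_S:
  assumes "(\<lambda>x. indicator S x *\<^sub>R f x) \<in> borel_measurable borel" "\<And>x. x \<in> S \<Longrightarrow> \<bar>f x\<bar> \<le> B"
  shows "set_integrable \<sigma> S (f :: real^3 \<Rightarrow> real)"
  unfolding set_integrable_def
proof (rule bintegrable_bound[where f="\<lambda>x. indicator S x *\<^sub>R B"])
  show "integrable \<sigma> (\<lambda>x. indicator S x *\<^sub>R B)"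
    using \<sigma>_finite by (intro integrable_scaleR_left) (simp add: integrable_indicator_iff)
  show "(\<lambda>x. indicator S x *\<^sub>R f x) \<in> borel_measurable \<sigma>" using assms(1) by (simp cong: measurable_cong_sets)
  show "AE x in \<sigma>. norm (indicator S x *\<^sub>R f x) \<le> norm (indicator S x *\<^sub>R B)"
  proof (rule AE_I2)
    fix x
    show "norm (indicator S x *\<^sub>R f x) \<le> norm (indicator S x *\<^sub>R B)"
    proof (cases "x \<in> S")
      case True
      show ?thesis using assms(2)[OF True] abs_ge_self[of B] True by simp
    qed simp
  qed
qed

lemma cont_meas_S: "contc f \<Longrightarrow> (\<lambda>x. indicator S x *\<^sub>R f x) \<in> borel_measurable borel"
  for f :: "real^3 \<Rightarrow> real"
  by (intro borel_measurable_continuous_on_indicator S_borel) (use U_facts(6) continuous_on_subset in auto)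

lemma cont_bounded: "contc f \<Longrightarrow> \<exists>B\<ge>0. \<forall>x\<in>closure U. \<bar>f x\<bar> \<le> B"
  for f :: "real^3 \<Rightarrow> real"
proof -
  assume "contc f"
  then have "bounded (f ` closure U)" by (intro compact_imp_bounded compact_continuous_image U_facts)
  then obtain B where B: "\<And>x. x \<in> closure U \<Longrightarrow> norm (f x) \<le> B" unfolding bounded_iff by blast
  show ?thesis
  proof (intro exI conjI ballI)
    fix x assume "x \<in> closure U"
    from B[OF this] show "\<bar>f x\<bar> \<le> max B 0" by simp
  qed simp
qed

lemma un_cont: "p \<in> P \<Longrightarrow> continuous_on UNIV (un p)"
proof -
  assume p: "p \<in> P"
  interpret E: epigraph "ax p" "sg p" "gr p" by (rule ep[OF p])
  have "norm (E.nv x) \<noteq> 0" for x using E.norm_nv_ge1[of x] by linarith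
  then show ?thesis unfolding un_def[abs_def] by (intro continuous_intros E.nv_cont) auto
qed

lemma un_norm: "p \<in> P \<Longrightarrow> norm (un p x) = 1"
proof -
  assume p: "p \<in> P"
  interpret E: epigraph "ax p" "sg p" "gr p" by (rule ep[OF p])
  have "norm (E.nv x) \<noteq> 0" using E.norm_nv_ge1[of x] by linarith
  then show ?thesis by (simp add: un_def)
qed

text \<open>The inner unit normal, glued together by the partition of unity: on the boundary the local normals
  coincide, and this expression extends them continuously to the closure.\<close>

definition nu :: "real^3 \<Rightarrow> real^3" where "nu x = (\<Sum>p\<in>P. chi p x *\<^sub>R un p x)"

lemma nu_cont: "contc nu"
  unfolding nu_def[abs_def]
  by (intro continuous_intros continuous_on_subset[OF un_cont]) (use chi_C1 in \<open>auto simp: C1_def\<close>)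

lemma nu_norm: "x \<in> closure U \<Longrightarrow> norm (nu x) \<le> 1"
proof -
  assume x: "x \<in> closure U"
  have "norm (nu x) \<le> (\<Sum>p\<in>P. norm (chi p x *\<^sub>R un p x))" unfolding nu_def by (rule norm_sum)
  also have "\<dots> = (\<Sum>p\<in>P. chi p x)" using chi_nonneg[OF x] un_norm by (intro sum.cong) auto
  finally show ?thesis using chi_sum[OF x] by simp
qed

lemma chi_local_div:
  assumes p: "p \<in> P" and v: "C1 U v G"
  shows "(LINT x:U|lebesgue. chi p x * G x $ j + v x * dchi p x $ j) = - (LINT x:S|\<sigma>. v x * (chi p x * un p x $ j))"
proof -
  have z: "chi p x = 0" "dchi p x = 0" if "x \<notin> cball p (rad p / 2)" for x
    using chi_0[OF p, of x] that ball_subset_cball by blast+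
  have "(LINT x:U|lebesgue. (chi p x *\<^sub>R G x + v x *\<^sub>R dchi p x) $ j) = - (LINT x:S|\<sigma>. (chi p x * v x) * un p x $ j)"
    by (rule local_div[OF p C1_mult[OF chi_C1 v]]) (use z in auto)
  then show ?thesis by (simp add: mult_ac)
qed

text \<open>Summation of the local identities: the gradients of the partition of unity add up to zero.\<close>

lemma divergence_theorem:
  assumes v: "C1 U v G"
  shows "(LINT x:U|lebesgue. G x $ j) = - (LINT x:S|\<sigma>. v x * nu x $ j)"
proof -
  have vc: "contc v" "contc G" using v by (auto simp: C1_def)
  have cc: "contc (chi p)" "contc (dchi p)" for p using chi_C1 by (auto simp: C1_def)
  have i1: "set_integrable lebesgue U (\<lambda>x. chi p x * G x $ j + v x * dchi p x $ j)" for p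
    by (intro set_integrable_U continuous_intros vc cc)
  have c2: "contc (\<lambda>x. v x * (chi p x * un p x $ j))" if "p \<in> P" for p
    by (intro continuous_intros vc cc continuous_on_subset[OF un_cont[OF that]]) auto
  have i2: "set_integrable \<sigma> S (\<lambda>x. v x * (chi p x * un p x $ j))" if p: "p \<in> P" for p
  proof -
    obtain B where "\<And>x. x \<in> closure U \<Longrightarrow> \<bar>v x * (chi p x * un p x $ j)\<bar> \<le> B" using cont_bounded[OF c2[OF p]] by blast
    then show ?thesis using U_facts(6) by (intro set_integrable_S cont_meas_S c2 p) blast
  qed
  have "(LINT x:U|lebesgue. G x $ j) = (LINT x:U|lebesgue. (\<Sum>p\<in>P. chi p x * G x $ j + v x * dchi p x $ j))"
  proof (rule set_lebesgue_integral_cong)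
    show "U \<in> sets lebesgue" using U_facts(1) by simp
    show "\<forall>x. x \<in> U \<longrightarrow> G x $ j = (\<Sum>p\<in>P. chi p x * G x $ j + v x * dchi p x $ j)"
    proof (intro allI impI)
      fix x assume "x \<in> U"
      then have x: "x \<in> closure U" using closure_subset by blast
      have "(\<Sum>p\<in>P. chi p x * G x $ j + v x * dchi p x $ j) = (\<Sum>p\<in>P. chi p x) * G x $ j + v x * (\<Sum>p\<in>P. dchi p x) $ j"
        by (simp add: sum.distrib sum_distrib_left sum_distrib_right)
      then show "G x $ j = (\<Sum>p\<in>P. chi p x * G x $ j + v x * dchi p x $ j)"
        using chi_sum[OF x] dchi_sum[OF x] by simp
    qed
  qed
  also have "\<dots> = (\<Sum>p\<in>P. LINT x:U|lebesgue. chi p x * G x $ j + v x * dchi p x $ j)"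
    using i1 unfolding set_lebesgue_integral_def set_integrable_def scaleR_sum_right by (intro bint_sum) auto
  also have "\<dots> = - (\<Sum>p\<in>P. LINT x:S|\<sigma>. v x * (chi p x * un p x $ j))"
    by (simp add: chi_local_div[OF _ v] sum_negf)
  also have "(\<Sum>p\<in>P. LINT x:S|\<sigma>. v x * (chi p x * un p x $ j)) = (LINT x:S|\<sigma>. (\<Sum>p\<in>P. v x * (chi p x * un p x $ j)))"
    using i2 unfolding set_lebesgue_integral_def set_integrable_def scaleR_sum_right by (intro bint_sum[symmetric]) auto
  also have "\<dots> = (LINT x:S|\<sigma>. v x * nu x $ j)"
    by (simp add: nu_def sum_distrib_left)
  finally show ?thesis .
qed

text \<open>If \<open>D x\<close> had a negative component along the inner normal, \<open>d\<close> would decrease, hence become negative,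
  along a short segment that starts at \<open>x\<close> and runs inside the domain.\<close>

lemma inward_gradient:
  assumes d: "C1 U d D" "\<And>x. x \<in> U \<Longrightarrow> d x > 0" and x: "x \<in> S" "d x = 0"
  shows "D x \<bullet> nu x \<ge> 0"
proof -
  have xc: "x \<in> closure U" using x U_facts(6) by blast
  have loc: "D x \<bullet> un p x \<ge> 0" if p: "p \<in> P" "x \<in> ball p (rad p)" for p
  proof (rule ccontr)
    interpret E: epigraph "ax p" "sg p" "gr p" by (rule ep[OF p(1)])
    let ?N = "E.nv x"
    assume "\<not> ?thesis"
    then have "D x \<bullet> ?N < 0" unfolding un_def using E.norm_nv_ge1[of x] by (simp add: zero_le_divide_iff not_le divide_less_0_iff)
    then have "\<forall>\<^sub>F z in at x within closure U. D z \<bullet> ?N < 0"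
      using d(1) xc by (intro order_tendstoD(2)[of _ "D x \<bullet> ?N"] tendsto_intros) (auto simp: C1_def continuous_on_def)
    then obtain \<delta> where \<delta>: "\<delta> > 0" "\<And>z. z \<in> closure U \<Longrightarrow> z \<noteq> x \<Longrightarrow> dist z x < \<delta> \<Longrightarrow> D z \<bullet> ?N < 0"
      unfolding eventually_at by auto
    have gx: "sg p * x $ ax p = gr p x" using grp[OF p(1)] x p(2) by blast
    let ?h = "\<lambda>t. sg p * (x + t *\<^sub>R ?N) $ ax p - gr p (x + t *\<^sub>R ?N)"
    have "((\<lambda>t. gr p (x + t *\<^sub>R ?N)) has_derivative (\<lambda>t. (t *\<^sub>R ?N) \<bullet> E.gam_grad x)) (at 0)"
      using E.gam_gderiv[of x] unfolding gderiv_def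
      by (intro has_derivative_compose[of "\<lambda>t. x + t *\<^sub>R ?N" _ 0 UNIV "gr p", simplified]) (auto intro!: derivative_eq_intros)
    then have "((\<lambda>t. gr p (x + t *\<^sub>R ?N)) has_real_derivative (?N \<bullet> E.gam_grad x)) (at 0)"
      unfolding has_field_derivative_def by (rule has_derivative_eq_rhs) auto
    moreover have "((\<lambda>t. sg p * (x + t *\<^sub>R ?N) $ ax p) has_real_derivative sg p * ?N $ ax p) (at 0)"
      unfolding vector_add_component vector_scaleR_component by (auto intro!: derivative_eq_intros)
    ultimately have h': "(?h has_real_derivative (sg p * ?N $ ax p - ?N \<bullet> E.gam_grad x)) (at 0)"
      by (rule DERIV_diff[rotated])
    have "sg p * ?N $ ax p - ?N \<bullet> E.gam_grad x = ?N \<bullet> ?N"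
    proof -
      have "?N \<bullet> ?N = ?N \<bullet> (sg p *\<^sub>R axis (ax p) 1) - ?N \<bullet> E.gam_grad x"
        unfolding E.nv_def[of x] by (simp add: inner_diff_right)
      then show ?thesis by (simp add: inner_axis)
    qed
    also have "?N \<bullet> ?N > 0" using E.norm_nv_ge1[of x] by (metis inner_gt_zero_iff norm_zero not_one_le_zero)
    finally have "sg p * ?N $ ax p - ?N \<bullet> E.gam_grad x > 0" .
    from DERIV_pos_inc_right[OF h' this]
    obtain e where e: "e > 0" "\<And>t. 0 < t \<Longrightarrow> t < e \<Longrightarrow> ?h 0 < ?h t" by auto
    have N1: "norm ?N > 0" using E.norm_nv_ge1[of x] by linarith
    \<comment> \<open>small enough to stay in the chart, in the region of negative slope, and above the graph\<close>
    define m where "m = min e (min (\<delta> / norm ?N) ((rad p - dist p x) / norm ?N))"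
    have m: "m > 0" using e \<delta> N1 p(2) by (simp add: m_def)
    define b where "b = m / 2"
    have bm: "b > 0" "b < m" using m by (simp_all add: b_def)
    have "m \<le> e" "m \<le> \<delta> / norm ?N" "m \<le> (rad p - dist p x) / norm ?N" unfolding m_def by auto
    then have b': "b < e" "b < \<delta> / norm ?N" "b < (rad p - dist p x) / norm ?N" using bm(2) by linarith+
    have b: "b > 0" "b < e" "b * norm ?N < \<delta>" "b * norm ?N < rad p - dist p x"
      using bm(1) b' N1 by (simp_all add: pos_less_divide_eq)
    have inside: "x + t *\<^sub>R ?N \<in> U" if t: "0 < t" "t \<le> b" for t
    proof -
      have "t * norm ?N \<le> b * norm ?N" using t by (intro mult_right_mono) auto
      moreover have "dist p (x + t *\<^sub>R ?N) \<le> dist p x + norm (t *\<^sub>R ?N)"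
        by (metis add_diff_cancel_left' dist_commute dist_norm dist_triangle)
      ultimately have "x + t *\<^sub>R ?N \<in> ball p (rad p)" using b(4) t by simp
      moreover have "sg p * (x + t *\<^sub>R ?N) $ ax p > gr p (x + t *\<^sub>R ?N)" using e(2)[of t] t b(2) gx by simp
      ultimately have "x + t *\<^sub>R ?N \<in> U \<inter> ball p (rad p)" using ch[OF p(1)] unfolding chart_def by blast
      then show ?thesis by blast
    qed
    have "\<exists>\<xi>>0. \<xi> < b \<and> d (x + b *\<^sub>R ?N) - d (x + 0 *\<^sub>R ?N) = (\<lambda>h. (h *\<^sub>R ?N) \<bullet> D (x + \<xi> *\<^sub>R ?N)) (b - 0)"
      proof (rule mvt[OF b(1)])
        have "(\<lambda>t. x + t *\<^sub>R ?N) ` {0..b} \<subseteq> closure U"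
        proof
          fix z assume "z \<in> (\<lambda>t. x + t *\<^sub>R ?N) ` {0..b}"
          then obtain t where t: "0 \<le> t" "t \<le> b" "z = x + t *\<^sub>R ?N" by auto
          show "z \<in> closure U"
          proof (cases "t = 0")
            case False
            then have "z \<in> U" using inside[of t] t by simp
            then show ?thesis using closure_subset by blast
          qed (use t xc in simp)
        qed
        then show "continuous_on {0..b} (\<lambda>t. d (x + t *\<^sub>R ?N))"
          using d(1) unfolding C1_def
          by (elim conjE) (rule continuous_on_compose2[of "closure U" d], assumption, intro continuous_intros)
        show "((\<lambda>t. d (x + t *\<^sub>R ?N)) has_derivative (\<lambda>h. (h *\<^sub>R ?N) \<bullet> D (x + \<xi> *\<^sub>R ?N))) (at \<xi>)" if "0 < \<xi>" "\<xi> < b" for \<xi>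
        proof -
          have "(d has_derivative (\<lambda>h. h \<bullet> D (x + \<xi> *\<^sub>R ?N))) (at (x + \<xi> *\<^sub>R ?N))"
            using d(1) inside[of \<xi>] that by (auto simp: C1_def gderiv_def)
          then show ?thesis
            by (intro has_derivative_compose[of "\<lambda>t. x + t *\<^sub>R ?N" _ \<xi> UNIV d, simplified]) (auto intro!: derivative_eq_intros)
        qed
      qed blast
    then obtain \<xi> where \<xi>: "0 < \<xi>" "\<xi> < b" "d (x + b *\<^sub>R ?N) = b * (?N \<bullet> D (x + \<xi> *\<^sub>R ?N))"
      using x(2) by auto
    have "d (x + b *\<^sub>R ?N) > 0" using d(2) inside[of b] b(1) by simp
    then have pos: "D (x + \<xi> *\<^sub>R ?N) \<bullet> ?N > 0" using \<xi>(3) b(1) by (simp add: zero_less_mult_iff inner_commute)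
    have "\<xi> * norm ?N \<le> b * norm ?N" using \<xi> by (intro mult_right_mono) auto
    then have "dist (x + \<xi> *\<^sub>R ?N) x < \<delta>" using b(3) \<xi>(1) by (simp add: dist_norm)
    moreover have "x + \<xi> *\<^sub>R ?N \<noteq> x" using \<xi>(1) N1 by auto
    moreover have "x + \<xi> *\<^sub>R ?N \<in> closure U" using inside[of \<xi>] \<xi> closure_subset by auto
    ultimately show False using \<delta>(2)[of "x + \<xi> *\<^sub>R ?N"] pos by linarith
  qed
  have "D x \<bullet> nu x = (\<Sum>p\<in>P. chi p x * (D x \<bullet> un p x))" by (simp add: nu_def inner_sum_right)
  also have "\<dots> \<ge> 0"
  proof (rule sum_nonneg)
    fix p assume p: "p \<in> P"
    show "chi p x * (D x \<bullet> un p x) \<ge> 0"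
    proof (cases "x \<in> ball p (rad p)")
      case True
      then show ?thesis using loc[OF p] chi_nonneg[OF xc] by simp
    next
      case False
      then have "x \<notin> ball p (rad p / 2)" using radp[OF p] by auto
      then show ?thesis using chi_0[OF p] by simp
    qed
  qed
  finally show ?thesis .
qed

text \<open>In a chart the component of the inner unit normal along the axis is bounded below, so the boundary
  integral is dominated by the divergence theorem applied to \<open>\<chi> u^2\<close> along that axis.\<close>

lemma trace_inequality: "\<exists>C\<ge>0. \<forall>u G. C1 U u G \<longrightarrow>
   (LINT x:S|\<sigma>. (u x)^2) \<le> C * (LINT x:U|lebesgue. (u x)^2 + (norm (G x))^2)"
proof -
  have "\<exists>C\<ge>0. \<forall>u G. C1 U u G \<longrightarrow> (LINT x:S|\<sigma>. chi p x * (u x)^2) \<le> C * (LINT x:U|lebesgue. (u x)^2 + (norm (G x))^2)"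
    if p: "p \<in> P" for p
  proof -
    interpret E: epigraph "ax p" "sg p" "gr p" by (rule ep[OF p])
    obtain K where K: "K \<ge> 0" "\<And>x. x \<in> closure U \<Longrightarrow> norm (dchi p x) \<le> K"
      using C1_bounded[OF chi_C1[of p] U_facts(4)] by blast
    have "bounded (E.nv ` closure U)" by (intro compact_imp_bounded compact_continuous_image E.nv_cont U_facts)
    then obtain M where M: "\<And>x. x \<in> closure U \<Longrightarrow> norm (E.nv x) \<le> M" unfolding bounded_iff by blast
    have M0: "M \<ge> 0" using M U_facts(3) norm_ge_zero order_trans closure_subset by blast
    have "(LINT x:S|\<sigma>. chi p x * (u x)^2) \<le> M * (K + 1) * (LINT x:U|lebesgue. (u x)^2 + (norm (G x))^2)" if u: "C1 U u G" for u G
    proof -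
      have uc: "contc u" "contc G" using u by (auto simp: C1_def)
      have cc: "contc (chi p)" "contc (dchi p)" using chi_C1 by (auto simp: C1_def)
      have uu: "C1 U (\<lambda>x. (u x)^2) (\<lambda>x. (2 * u x) *\<^sub>R G x)"
        using C1_mult[OF u u] by (simp add: power2_eq_square scaleR_left.add[symmetric] del: scaleR_left.add)
      let ?k = "ax p"
      let ?F = "\<lambda>x. chi p x * ((2 * u x) *\<^sub>R G x) $ ?k + (u x)^2 * dchi p x $ ?k"
      have int: "set_integrable \<sigma> S f" if c: "contc f" for f :: "real^3 \<Rightarrow> real"
      proof -
        obtain B where "\<And>x. x \<in> closure U \<Longrightarrow> \<bar>f x\<bar> \<le> B" using cont_bounded[OF c] by blast
        then show ?thesis using U_facts(6) by (intro set_integrable_S cont_meas_S c) blast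
      qed
      have "(LINT x:S|\<sigma>. chi p x * (u x)^2) \<le> (LINT x:S|\<sigma>. (M * sg p) * ((u x)^2 * (chi p x * un p x $ ?k)))"
      proof (rule set_integral_mono)
        show "set_integrable \<sigma> S (\<lambda>x. chi p x * (u x)^2)" by (intro int continuous_intros uc cc)
        show "set_integrable \<sigma> S (\<lambda>x. (M * sg p) * ((u x)^2 * (chi p x * un p x $ ?k)))"
          by (intro int continuous_intros uc cc continuous_on_subset[OF un_cont[OF p]]) auto
        fix x assume "x \<in> S"
        then have x: "x \<in> closure U" using U_facts(6) by blast
        have n: "norm (E.nv x) > 0" using E.norm_nv_ge1[of x] by linarith
        have "sg p * un p x $ ?k = 1 / norm (E.nv x)" by (simp add: un_def)
        then have "1 \<le> M * (sg p * un p x $ ?k)" using M[OF x] n by (simp add: pos_le_divide_eq)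
        then have "chi p x * (u x)^2 * 1 \<le> chi p x * (u x)^2 * (M * (sg p * un p x $ ?k))"
          using chi_nonneg[OF x, of p] by (intro mult_left_mono) auto
        then show "chi p x * (u x)^2 \<le> (M * sg p) * ((u x)^2 * (chi p x * un p x $ ?k))" by (simp add: mult_ac)
      qed
      also have "\<dots> = (M * sg p) * (LINT x:S|\<sigma>. (u x)^2 * (chi p x * un p x $ ?k))" by simp
      also have "\<dots> = (M * sg p) * - (LINT x:U|lebesgue. ?F x)"
        using chi_local_div[OF p uu, of ?k] by simp
      also have "\<dots> = M * (LINT x:U|lebesgue. - sg p * ?F x)"
        by (simp only: set_integral_mult_right)
      also have "\<dots> \<le> M * (LINT x:U|lebesgue. (K + 1) * ((u x)^2 + (norm (G x))^2))"
      proof (intro mult_left_mono M0 set_integral_mono)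
        show "set_integrable lebesgue U (\<lambda>x. - sg p * ?F x)"
          by (intro set_integrable_U continuous_intros uc cc)
        show "set_integrable lebesgue U (\<lambda>x. (K + 1) * ((u x)^2 + (norm (G x))^2))"
          by (intro set_integrable_U continuous_intros uc)
        fix x assume "x \<in> U"
        then have x: "x \<in> closure U" using closure_subset by blast
        have "- sg p * ?F x \<le> \<bar>?F x\<bar>" using abs_ge_self[of "- sg p * ?F x"] by (simp add: abs_mult)
        also have "\<dots> \<le> chi p x * (2 * \<bar>u x\<bar> * norm (G x)) + (u x)^2 * K"
        proof -
          have "\<bar>chi p x * ((2 * u x) *\<^sub>R G x) $ ?k\<bar> \<le> chi p x * (2 * \<bar>u x\<bar> * norm (G x))"
            using chi_nonneg[OF x, of p] component_le_norm_cart[of "G x" ?k] by (simp add: abs_mult mult_left_mono)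
          moreover have "\<bar>(u x)^2 * dchi p x $ ?k\<bar> \<le> (u x)^2 * K"
            unfolding abs_mult using component_le_norm_cart[of "dchi p x" ?k] K(2)[OF x] by (simp add: mult_left_mono)
          ultimately show ?thesis using abs_triangle_ineq[of "chi p x * ((2 * u x) *\<^sub>R G x) $ ?k" "(u x)^2 * dchi p x $ ?k"] by linarith
        qed
        also have "\<dots> \<le> 1 * ((u x)^2 + (norm (G x))^2) + (u x)^2 * K"
          using chi_nonneg[OF x, of p] chi_le1[OF x p] sum_squares_bound[of "\<bar>u x\<bar>" "norm (G x)"]
          by (intro add_right_mono mult_mono) auto
        also have "\<dots> \<le> (K + 1) * ((u x)^2 + (norm (G x))^2)"
          using K(1) by (simp add: algebra_simps)
        finally show "- sg p * ?F x \<le> (K + 1) * ((u x)^2 + (norm (G x))^2)" .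
      qed
      also have "\<dots> = M * (K + 1) * (LINT x:U|lebesgue. (u x)^2 + (norm (G x))^2)" by simp
      finally show ?thesis .
    qed
    then show ?thesis using M0 K(1) by (intro exI[of _ "M * (K + 1)"]) auto
  qed
  then obtain C where C: "\<And>p. p \<in> P \<Longrightarrow> C p \<ge> 0"
    "\<And>p u G. p \<in> P \<Longrightarrow> C1 U u G \<Longrightarrow> (LINT x:S|\<sigma>. chi p x * (u x)^2) \<le> C p * (LINT x:U|lebesgue. (u x)^2 + (norm (G x))^2)"
    using bchoice[of P "\<lambda>p C. C \<ge> 0 \<and> (\<forall>u G. C1 U u G \<longrightarrow> (LINT x:S|\<sigma>. chi p x * (u x)^2) \<le> C * (LINT x:U|lebesgue. (u x)^2 + (norm (G x))^2))"] by blast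
  show ?thesis
  proof (intro exI conjI allI impI)
    show "(\<Sum>p\<in>P. C p) \<ge> 0" using C(1) by (rule sum_nonneg)
    fix u G assume u: "C1 U u G"
    have int: "set_integrable \<sigma> S (\<lambda>x. chi p x * (u x)^2)" for p
    proof -
      have c: "contc (\<lambda>x. chi p x * (u x)^2)"
        using u chi_C1[of p] unfolding C1_def by (intro continuous_intros) auto
      obtain B where "\<And>x. x \<in> closure U \<Longrightarrow> \<bar>chi p x * (u x)^2\<bar> \<le> B" using cont_bounded[OF c] by blast
      then show ?thesis using U_facts(6) by (intro set_integrable_S cont_meas_S c) blast
    qed
    have "(LINT x:S|\<sigma>. (u x)^2) = (LINT x:S|\<sigma>. (\<Sum>p\<in>P. chi p x * (u x)^2))"
      by (rule set_lebesgue_integral_cong) (use chi_sum U_facts(6) in \<open>auto simp: sum_distrib_right[symmetric]\<close>)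
    also have "\<dots> = (\<Sum>p\<in>P. LINT x:S|\<sigma>. chi p x * (u x)^2)"
      using int unfolding set_lebesgue_integral_def set_integrable_def scaleR_sum_right by (intro bint_sum) auto
    also have "\<dots> \<le> (\<Sum>p\<in>P. C p * (LINT x:U|lebesgue. (u x)^2 + (norm (G x))^2))"
      by (intro sum_mono C(2) u)
    finally show "(LINT x:S|\<sigma>. (u x)^2) \<le> (\<Sum>p\<in>P. C p) * (LINT x:U|lebesgue. (u x)^2 + (norm (G x))^2)"
      by (simp add: sum_distrib_right)
  qed
qed

end

section \<open>Density of smooth functions\<close>

lemma L2_on_restrict: "S \<in> sets M \<Longrightarrow> L2_on M S u \<longleftrightarrow> L2 (restrict_space M S) u"
  unfolding L2_on_def L2_def set_borel_measurable_def set_integrable_def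
  by (subst borel_measurable_restrict_space_iff, simp add: sets.Int_space_eq2)
     (subst integrable_restrict_space, auto simp: sets.Int_space_eq2)

lemma set_integrable_restrict: "S \<in> sets M \<Longrightarrow> set_integrable M S u \<longleftrightarrow> integrable (restrict_space M S) (u :: _ \<Rightarrow> real)"
  unfolding set_integrable_def by (subst integrable_restrict_space) (auto simp: sets.Int_space_eq2)

lemma set_lint_restrict: "S \<in> sets M \<Longrightarrow> (LINT x:S|M. u x) = integral\<^sup>L (restrict_space M S) (u :: _ \<Rightarrow> real)"
  unfolding set_lebesgue_integral_def by (subst integral_restrict_space) (auto simp: sets.Int_space_eq2)

lemma AE_restrict: "S \<in> sets M \<Longrightarrow> (AE x in restrict_space M S. Q x) \<longleftrightarrow> (AE x in M. x \<in> S \<longrightarrow> Q x)"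
  by (subst AE_restrict_space_iff) (auto simp: sets.Int_space_eq2)

lemma L2lim_cong:
  fixes M :: "'a measure"
  assumes "L2lim M Us u" "\<And>n x. x \<in> space M \<Longrightarrow> Us n x = V n x" "\<And>x. x \<in> space M \<Longrightarrow> u x = v x"
  shows "L2lim M V v"
proof -
  have c: "L2 M a \<longleftrightarrow> L2 M b" if e: "\<And>x. x \<in> space M \<Longrightarrow> a x = b x" for a b :: "'a \<Rightarrow> real"
  proof -
    have "a \<in> borel_measurable M \<longleftrightarrow> b \<in> borel_measurable M" by (rule measurable_cong) (rule e)
    moreover have "integrable M (\<lambda>x. (a x)^2) \<longleftrightarrow> integrable M (\<lambda>x. (b x)^2)"
      by (rule Bochner_Integration.integrable_cong) (simp_all add: e)
    ultimately show ?thesis by (simp add: L2_def)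
  qed
  have 1: "L2 M (Us n) \<longleftrightarrow> L2 M (V n)" "L2 M u \<longleftrightarrow> L2 M v" for n
    by (rule c, simp add: assms)+
  have 2: "(LINT x|M. (Us n x - u x)^2) = (LINT x|M. (V n x - v x)^2)" for n
    by (rule bint_cong) (simp_all add: assms)
  show ?thesis using assms(1) unfolding L2lim_def 1 2 .
qed

lemma L2lim_cong_AE:
  assumes "L2lim M Us u" "AE x in M. u x = v x" "v \<in> borel_measurable M"
  shows "L2lim M Us v"
proof -
  have s: "L2 M v" using assms by (auto simp: L2lim_def intro: L2_cong_AE)
  have "(LINT x|M. (Us n x - u x)^2) = (LINT x|M. (Us n x - v x)^2)" for n
  proof (rule integral_cong_AE)
    have "L2 M (\<lambda>x. Us n x - u x)" "L2 M (\<lambda>x. Us n x - v x)" using assms(1) s by (auto simp: L2lim_def intro: L2_diff)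
    then show "(\<lambda>x. (Us n x - u x)^2) \<in> borel_measurable M" "(\<lambda>x. (Us n x - v x)^2) \<in> borel_measurable M"
      by (auto simp: L2_def)
    show "AE x in M. (Us n x - u x)^2 = (Us n x - v x)^2" using assms(2) by eventually_elim simp
  qed
  then show ?thesis using assms(1) s by (simp add: L2lim_def)
qed

context atlas
begin

abbreviation "MU \<equiv> lebesgue_on U"

lemma U_leb [simp]: "U \<in> sets lebesgue" using U_facts(1) by simp
lemma U_bor [simp, measurable]: "U \<in> sets borel" using U_facts(1) by simp

lemma MU_finite: "finite_measure MU"
  using U_facts(1,2) by (intro finite_measure_lebesgue_on lmeasurable_open)

lemma L2_closure: "contc f \<Longrightarrow> L2 MU f"
proof -
  assume c: "contc f"
  have "set_integrable lebesgue U f" "set_integrable lebesgue U (\<lambda>x. (f x)^2)"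
    using c by (auto intro!: set_integrable_U continuous_intros)
  then show ?thesis by (simp add: L2_def set_integrable_restrict)
qed

lemma meas_closure: "contc f \<Longrightarrow> f \<in> borel_measurable MU" for f :: "real^3 \<Rightarrow> real"
  using L2_closure by (simp add: L2_def)

lemma Hk_facts:
  assumes "f \<in> Hk (Suc k) U"
  shows "L2 MU f" "is_wpd U j f (wpd U j f)" "L2 MU (wpd U j f)"
    "\<exists>v. is_wpd U j f v \<and> v \<in> Hk k U \<and> (AE x in MU. wpd U j f x = v x)"
proof -
  show "L2 MU f" using assms by (simp add: Hk_def L2_on_restrict)
  obtain v where v: "is_wpd U j f v" "v \<in> Hk k U" using assms by (auto simp: Hk_def)
  have ae: "AE x in MU. wpd U j f x = v x"
    using wpd_AE[OF U_facts(1) v(1)] by (simp add: AE_restrict)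
  show "\<exists>v. is_wpd U j f v \<and> v \<in> Hk k U \<and> (AE x in MU. wpd U j f x = v x)" using v ae by blast
  show w: "is_wpd U j f (wpd U j f)" using wpd_is_wpd[OF v(1)] .
  have vs: "L2 MU v" using v(2) by (cases k) (simp_all add: Hk_def L2_on_restrict)
  have "wpd U j f \<in> borel_measurable MU"
  proof -
    have "(\<lambda>x. indicator U x *\<^sub>R v x) \<in> borel_measurable lebesgue"
      using vs by (simp add: L2_def borel_measurable_restrict_space_iff)
    moreover have "AE x in lebesgue. indicator U x *\<^sub>R v x = indicator U x *\<^sub>R wpd U j f x"
      using ae by (simp add: AE_restrict) (auto elim: eventually_mono simp: indicator_def)
    ultimately have "(\<lambda>x. indicator U x *\<^sub>R wpd U j f x) \<in> borel_measurable lebesgue" by (rule borel_measurable_AE)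
    then show ?thesis by (simp add: borel_measurable_restrict_space_iff)
  qed
  moreover have "AE x in MU. v x = wpd U j f x" using ae by eventually_elim simp
  ultimately show "L2 MU (wpd U j f)" by (intro L2_cong_AE[OF vs])
qed

lemma L2_rep:
  assumes f: "L2 MU f"
  shows "\<exists>F. borel_rep U f F \<and> integrable lborel F \<and> integrable lborel (\<lambda>x. (F x)^2) \<and> (AE x in MU. F x = f x)"
proof -
  have "set_borel_measurable lebesgue U f"
    using f by (simp add: L2_def set_borel_measurable_def borel_measurable_restrict_space_iff)
  then obtain F where F: "borel_rep U f F" using borel_rep_exists[of U f] by auto
  have [measurable]: "F \<in> borel_measurable borel" using F by (simp add: borel_rep_def)
  interpret finite_measure MU by (rule MU_finite)
  have "integrable MU f" using L2_prod[OF f, of "\<lambda>x. 1"] by (simp add: L2_def)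
  then have "set_integrable lebesgue U f" by (simp add: set_integrable_restrict)
  then have i1: "integrable lborel F" using borel_rep_integral(1)[OF F, of "\<lambda>x. 1"] by simp
  have ae: "AE x in lebesgue. F x = indicator U x * f x" using F by (simp add: borel_rep_def)
  have "integrable lebesgue (\<lambda>x. indicator U x *\<^sub>R (f x)^2)"
    using f by (simp add: L2_def flip: set_integrable_restrict) (simp add: set_integrable_def)
  then have "integrable lebesgue (\<lambda>x. (F x)^2)"
  proof (rule integrable_cong_AE_imp)
    show "(\<lambda>x. (F x)^2) \<in> borel_measurable lebesgue" by (rule measurable_completion) simp
    show "AE x in lebesgue. indicator U x *\<^sub>R (f x)^2 = (F x)^2"
      using ae by eventually_elim (auto simp: indicator_def)
  qed
  then have "integrable lborel (\<lambda>x. (F x)^2)" by (subst (asm) integrable_completion) auto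
  moreover have "AE x in MU. F x = f x"
    using ae by (simp add: AE_restrict) (auto elim: eventually_mono simp: indicator_def)
  ultimately show ?thesis using F i1 by blast
qed

text \<open>By \<open>bker_L2_small\<close>, it is enough that supports shrink to the origin; the kernels may be off centre.\<close>

lemma moll_L2lim:
  assumes F: "integrable lborel F" "integrable lborel (\<lambda>x. (F x)^2)"
    and r: "\<And>n. r n > 0" and lim: "(\<lambda>n. norm (q n) + r n) \<longlonglongrightarrow> (0::real)"
  shows "L2lim MU (\<lambda>n. moll (bker (q n) (r n)) F) F"
proof -
  let ?u = "\<lambda>n. moll (bker (q n) (r n)) F"
  have c: "contc (?u n)" for n
    using bker_moll_gderiv(1)[OF F(1) r[of n], of "q n"] unfolding gderiv_def
    by (meson has_derivative_continuous continuous_at_imp_continuous_on)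
  have [measurable]: "F \<in> borel_measurable borel" using F by auto
  have Fs: "L2 MU F"
  proof -
    have Fl: "F \<in> borel_measurable lebesgue" by (rule measurable_completion) simp
    have "integrable lebesgue (\<lambda>x. (F x)^2)" using F(2) by (subst integrable_completion) auto
    then have "integrable lebesgue (\<lambda>x. indicator U x *\<^sub>R (F x)^2)" by (intro integrable_mult_indicator) auto
    then have "integrable MU (\<lambda>x. (F x)^2)" by (simp add: set_integrable_def flip: set_integrable_restrict)
    then show ?thesis using Fl by (simp add: L2_def measurable_restrict_space1)
  qed
  have s: "L2 MU (\<lambda>x. ?u n x - F x)" for n by (rule L2_diff[OF L2_closure[OF c] Fs])
  have le: "(LINT x|MU. (?u n x - F x)^2) \<le> e"
    if e: "e > 0" and b: "(\<integral>\<^sup>+x. ennreal ((?u n x - F x)^2) \<partial>lborel) \<le> ennreal e" for n e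
  proof -
    have "ennreal (LINT x|MU. (?u n x - F x)^2) = (\<integral>\<^sup>+x. ennreal ((?u n x - F x)^2) \<partial>MU)"
      using s[of n] by (intro nn_integral_eq_integral[symmetric]) (auto simp: L2_def)
    also have "\<dots> = (\<integral>\<^sup>+x. ennreal ((?u n x - F x)^2) * indicator U x \<partial>lborel)"
      by (subst nn_integral_restrict_space) (auto simp: nn_integral_completion)
    also have "\<dots> \<le> (\<integral>\<^sup>+x. ennreal ((?u n x - F x)^2) \<partial>lborel)"
      by (intro nn_integral_mono) (auto simp: indicator_def)
    also note b
    finally show ?thesis using e by (simp add: ennreal_le_iff)
  qed
  have "(\<lambda>n. LINT x|MU. (?u n x - F x)^2) \<longlonglongrightarrow> 0"
  proof (rule tendstoI)
    fix e :: real assume e: "e > 0"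
    have "\<exists>\<delta>>0. \<forall>q r. r > 0 \<longrightarrow> norm q + r < \<delta> \<longrightarrow> (\<integral>\<^sup>+x. ennreal ((moll (bker q r) F x - F x)^2) \<partial>lborel) \<le> ennreal (e / 2)"
      by (rule bker_L2_small[OF F]) (use e in simp)
    then obtain \<delta> where \<delta>: "\<delta> > 0" "\<forall>q r. r > 0 \<longrightarrow> norm q + r < \<delta> \<longrightarrow> (\<integral>\<^sup>+x. ennreal ((moll (bker q r) F x - F x)^2) \<partial>lborel) \<le> ennreal (e / 2)"
      by (elim exE conjE)
    have "\<forall>\<^sub>F n in sequentially. norm (q n) + r n < \<delta>" using lim \<delta>(1) by (rule order_tendstoD(2))
    then show "\<forall>\<^sub>F n in sequentially. dist (LINT x|MU. (?u n x - F x)^2) 0 < e"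
    proof eventually_elim
      case (elim n)
      have "(LINT x|MU. (?u n x - F x)^2) \<le> e / 2"
        by (rule le) (use e \<delta>(2) elim r[of n] in auto)
      moreover have "(LINT x|MU. (?u n x - F x)^2) \<ge> 0" by (intro integral_nonneg_AE) auto
      ultimately show ?case using e by (simp add: dist_real_def)
    qed
  qed
  then show ?thesis using Fs L2_closure[OF c] by (simp add: L2lim_def)
qed

definition inward_dir :: "real^3 \<Rightarrow> real^3" where "inward_dir p = sg p *\<^sub>R axis (ax p) 1"

lemma inward_dir_norm: "p \<in> P \<Longrightarrow> norm (inward_dir p) = 1"
  using epigraph.eps2(2)[OF ep] by (simp add: inward_dir_def)

text \<open>The graph is Lipschitz on the ball, so moving a point of the closure by \<open>\<delta>\<close> along the axis leaves room
  for a ball of radius \<open>\<kappa> \<delta>\<close> inside the domain.\<close>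

lemma inner_cone:
  assumes p: "p \<in> P"
  shows "\<exists>\<kappa>>0. \<exists>\<delta>0>0. \<forall>\<delta>. 0 < \<delta> \<longrightarrow> \<delta> < \<delta>0 \<longrightarrow> (\<forall>x\<in>closure U \<inter> cball p (rad p / 2). cball (x - (- \<delta> *\<^sub>R inward_dir p)) (\<kappa> * \<delta>) \<subseteq> U)"
proof -
  interpret E: epigraph "ax p" "sg p" "gr p" by (rule ep[OF p])
  let ?r = "rad p"
  have r: "?r > 0" by (rule radp[OF p])
  have "bounded (E.gam_grad ` cball p ?r)" by (intro compact_imp_bounded compact_continuous_image E.gam_grad_cont) auto
  then obtain L0 where L0: "\<And>x. x \<in> cball p ?r \<Longrightarrow> norm (E.gam_grad x) \<le> L0" unfolding bounded_iff by blast
  define L where "L = max L0 0"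
  have L: "L \<ge> 0" by (simp add: L_def)
  have L2: "norm (E.gam_grad x) \<le> L" if "x \<in> ball p ?r" for x
    using L0[of x] that ball_subset_cball[of p ?r] unfolding L_def by (intro max.coboundedI1) blast
  have lip: "\<bar>gr p x - gr p y\<bar> \<le> L * norm (x - y)" if "x \<in> ball p ?r" "y \<in> ball p ?r" for x y
  proof -
    have "norm (gr p x - gr p y) \<le> L * norm (x - y)"
    proof (rule differentiable_bound[where S="ball p ?r" and f'="\<lambda>x h. h \<bullet> E.gam_grad x"])
      show "(gr p has_derivative (\<lambda>h. h \<bullet> E.gam_grad x)) (at x within ball p ?r)" for x
        using E.gam_gderiv[of x] by (auto simp: gderiv_def intro: has_derivative_at_withinI)
      show "onorm (\<lambda>h. h \<bullet> E.gam_grad x) \<le> L" if "x \<in> ball p ?r" for x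
      proof (rule onorm_bound[OF L])
        show "norm (h \<bullet> E.gam_grad x) \<le> L * norm h" for h
          using Cauchy_Schwarz_ineq2[of h "E.gam_grad x"] mult_left_mono[OF L2[OF that] norm_ge_zero[of h]] by (simp add: mult.commute)
      qed
    qed (use that in auto)
    then show ?thesis by simp
  qed
  \<comment> \<open>chosen so that a ball of radius \<open>\<kappa> \<delta>\<close> changes the height above the graph by at most \<open>\<delta> / 2\<close>\<close>
  define \<kappa> where "\<kappa> = 1 / (2 * (L + 1))"
  have \<kappa>: "\<kappa> > 0" "\<kappa> \<le> 1 / 2" "\<kappa> * (1 + L) = 1 / 2" using L by (auto simp: \<kappa>_def field_simps)
  have main: "y \<in> U" if \<delta>: "0 < \<delta>" "\<delta> < ?r / 4" and x: "x \<in> closure U" "x \<in> cball p (?r / 2)" and y: "y \<in> cball (x - (- \<delta> *\<^sub>R inward_dir p)) (\<kappa> * \<delta>)" for \<delta> x y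
  proof -
    define z where "z = y - x - \<delta> *\<^sub>R inward_dir p"
    have yz: "y = (x + z) + (\<delta> * sg p) *\<^sub>R axis (ax p) 1" by (simp add: z_def inward_dir_def)
    have nz: "norm z \<le> \<kappa> * \<delta>"
      using y by (simp add: z_def dist_norm norm_minus_commute algebra_simps)
    have nz2: "norm z \<le> \<delta> / 2" using nz \<delta>(1) mult_right_mono[OF \<kappa>(2), of \<delta>] by linarith
    have xb: "x \<in> ball p ?r" using x(2) r by auto
    have d1: "dist p (x + z) \<le> dist p x + norm z"
      by (metis add_diff_cancel_left' dist_commute dist_norm dist_triangle)
    have xzb: "x + z \<in> ball p ?r" using d1 nz2 \<delta> x(2) by simp
    have "dist p y \<le> dist p (x + z) + dist (x + z) y" by (rule dist_triangle)
    moreover have "dist (x + z) y = \<delta>" unfolding yz using \<delta>(1) by (simp add: dist_norm abs_mult)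
    ultimately have yb: "y \<in> ball p ?r" using d1 nz2 \<delta> x(2) by simp
    have "x \<in> closure U \<inter> ball p ?r" using x xb by blast
    then have gx: "sg p * x $ ax p \<ge> gr p x" unfolding chart_closure(1)[OF ch[OF p] U_facts(1)] by blast
    have gy: "gr p y = gr p (x + z)" unfolding yz by (rule E.inv)
    have "gr p (x + z) \<le> gr p x + L * norm z" using lip[OF xzb xb] by simp
    moreover have "L * norm z \<le> L * (\<kappa> * \<delta>)" using nz L by (rule mult_left_mono)
    moreover have "sg p * y $ ax p \<ge> sg p * x $ ax p + \<delta> - \<kappa> * \<delta>"
    proof -
      have "y $ ax p = x $ ax p + z $ ax p + \<delta> * sg p" unfolding yz by (simp add: axis_def)
      then have "sg p * y $ ax p = sg p * x $ ax p + sg p * z $ ax p + \<delta> * (sg p * sg p)" by (simp add: algebra_simps del: E.eps2)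
      moreover have "\<bar>sg p * z $ ax p\<bar> \<le> \<kappa> * \<delta>"
        using component_le_norm_cart[of z "ax p"] nz by (simp add: abs_mult)
      ultimately show ?thesis by simp
    qed
    moreover have "\<kappa> * \<delta> + L * (\<kappa> * \<delta>) < \<delta>"
    proof -
      have "\<kappa> * \<delta> + L * (\<kappa> * \<delta>) = (\<kappa> * (1 + L)) * \<delta>" by (simp add: algebra_simps)
      then show ?thesis using \<delta>(1) unfolding \<kappa>(3) by simp
    qed
    ultimately have "sg p * y $ ax p > gr p y" using gx gy by linarith
    then have "y \<in> U \<inter> ball p ?r" using yb ch[OF p] unfolding chart_def by blast
    then show ?thesis by blast
  qed
  show ?thesis
  proof (rule exI[of _ \<kappa>], rule conjI[OF \<kappa>(1)], rule exI[of _ "?r / 4"], intro conjI allI impI ballI subsetI)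
    show "?r / 4 > 0" using r by simp
    fix \<delta> x y assume "0 < \<delta>" "\<delta> < ?r / 4" "x \<in> closure U \<inter> cball p (?r / 2)" "y \<in> cball (x - (- \<delta> *\<^sub>R inward_dir p)) (\<kappa> * \<delta>)"
    then show "y \<in> U" using main by (elim IntE)
  qed
qed

text \<open>In each chart the function is mollified with a kernel shifted along the axis, so that only values inside
  the domain are used by \<open>inner_cone\<close>; the pieces are joined by the partition of unity. An average does not
  exceed an essential bound, which yields the last clause.\<close>

lemma density:
  assumes f: "f \<in> Hk (Suc m) U"
  shows "\<exists>u G. (\<forall>n. C1 U (u n) (G n)) \<and> L2lim MU u f \<and> (\<forall>j. L2lim MU (\<lambda>n x. G n x $ j) (wpd U j f)) \<and>
    (\<forall>B\<ge>0. (AE x in MU. \<bar>f x\<bar> \<le> B) \<longrightarrow> (\<forall>n. \<forall>x\<in>closure U. \<bar>u n x\<bar> \<le> B))"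
proof -
  note h = Hk_facts[OF f]
  obtain F where F: "borel_rep U f F" "integrable lborel F" "integrable lborel (\<lambda>x. (F x)^2)" "AE x in MU. F x = f x"
    using L2_rep[OF h(1)] by blast
  have "\<forall>j. \<exists>V. borel_rep U (wpd U j f) V \<and> integrable lborel V \<and> integrable lborel (\<lambda>x. (V x)^2) \<and> (AE x in MU. V x = wpd U j f x)"
    using L2_rep[OF h(3)] by blast
  then have "\<exists>V. \<forall>j. borel_rep U (wpd U j f) (V j) \<and> integrable lborel (V j) \<and> integrable lborel (\<lambda>x. (V j x)^2) \<and> (AE x in MU. V j x = wpd U j f x)"
    by (rule choice)
  then obtain V where V0: "\<forall>j. borel_rep U (wpd U j f) (V j) \<and> integrable lborel (V j) \<and> integrable lborel (\<lambda>x. (V j x)^2) \<and> (AE x in MU. V j x = wpd U j f x)"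
    by (elim exE)
  note V = V0[rule_format, THEN conjunct1] V0[rule_format, THEN conjunct2, THEN conjunct1]
    V0[rule_format, THEN conjunct2, THEN conjunct2, THEN conjunct1] V0[rule_format, THEN conjunct2, THEN conjunct2, THEN conjunct2]
  obtain \<kappa> \<delta>0 where k: "\<And>p. p \<in> P \<Longrightarrow> \<kappa> p > 0" "\<And>p. p \<in> P \<Longrightarrow> \<delta>0 p > 0"
    "\<And>p \<delta> x. p \<in> P \<Longrightarrow> 0 < \<delta> \<Longrightarrow> \<delta> < \<delta>0 p \<Longrightarrow> x \<in> closure U \<inter> cball p (rad p / 2) \<Longrightarrow> cball (x - (- \<delta> *\<^sub>R inward_dir p)) (\<kappa> p * \<delta>) \<subseteq> U"
  proof -
    define Q where "Q p t \<longleftrightarrow> fst t > 0 \<and> snd t > 0 \<and> (\<forall>\<delta>. 0 < \<delta> \<longrightarrow> \<delta> < snd t \<longrightarrow> (\<forall>x\<in>closure U \<inter> cball p (rad p / 2). cball (x - (- \<delta> *\<^sub>R inward_dir p)) (fst t * \<delta>) \<subseteq> U))"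
      for p and t :: "real \<times> real"
    have "\<forall>p\<in>P. \<exists>t. Q p t"
    proof
      fix p assume "p \<in> P"
      from inner_cone[OF this] obtain \<kappa> \<delta>0 where "\<kappa> > 0" "\<delta>0 > 0" "\<forall>\<delta>. 0 < \<delta> \<longrightarrow> \<delta> < \<delta>0 \<longrightarrow> (\<forall>x\<in>closure U \<inter> cball p (rad p / 2). cball (x - (- \<delta> *\<^sub>R inward_dir p)) (\<kappa> * \<delta>) \<subseteq> U)"
        by (elim exE conjE)
      then have "Q p (\<kappa>, \<delta>0)" unfolding Q_def fst_conv snd_conv by (intro conjI) assumption+
      then show "\<exists>t. Q p t" by (rule exI)
    qed
    then have "\<exists>T. \<forall>p\<in>P. Q p (T p)" by (rule bchoice)
    then obtain T where T: "\<forall>p\<in>P. Q p (T p)" by (elim exE)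
    show ?thesis
    proof (rule that[of "\<lambda>p. fst (T p)" "\<lambda>p. snd (T p)"])
      fix p assume "p \<in> P"
      then have Q: "Q p (T p)" using T by blast
      then show "fst (T p) > 0" "snd (T p) > 0" unfolding Q_def by blast+
      fix \<delta> x assume "0 < \<delta>" "\<delta> < snd (T p)" "x \<in> closure U \<inter> cball p (rad p / 2)"
      then show "cball (x - (- \<delta> *\<^sub>R inward_dir p)) (fst (T p) * \<delta>) \<subseteq> U" using Q unfolding Q_def by blast
    qed
  qed
  define dm where "dm = Min (insert 1 (\<delta>0 ` P))"
  have dm: "dm > 0" "\<And>p. p \<in> P \<Longrightarrow> dm \<le> \<delta>0 p" unfolding dm_def using finP k(2) by auto
  \<comment> \<open>the offset \<open>n + 2\<close> keeps every shift strictly below all the thresholds\<close>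
  define \<delta> where "\<delta> n = dm / real (n + 2)" for n
  have \<delta>: "\<delta> n > 0" "p \<in> P \<Longrightarrow> \<delta> n < \<delta>0 p" for n p
  proof -
    show "\<delta> n > 0" using dm(1) by (simp add: \<delta>_def)
    have "\<delta> n < dm" using dm(1) by (simp add: \<delta>_def divide_less_eq)
    then show "p \<in> P \<Longrightarrow> \<delta> n < \<delta>0 p" using dm(2)[of p] by simp
  qed
  have \<delta>l: "\<delta> \<longlonglongrightarrow> 0"
    unfolding \<delta>_def[abs_def]
    by (rule tendsto_divide_0[OF tendsto_const filterlim_at_top_imp_at_infinity])
      (rule filterlim_compose[OF filterlim_real_sequentially filterlim_add_const_nat_at_top])
  define q r where "q p n = - \<delta> n *\<^sub>R inward_dir p" and "r p n = \<kappa> p * \<delta> n" for p n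
  have r: "r p n > 0" if "p \<in> P" for p n using k(1)[OF that] \<delta>(1) by (simp add: r_def)
  have ql: "(\<lambda>n. norm (q p n) + r p n) \<longlonglongrightarrow> 0" if p: "p \<in> P" for p
  proof -
    have "(\<lambda>n. \<delta> n + \<kappa> p * \<delta> n) \<longlonglongrightarrow> 0 + \<kappa> p * 0" by (intro tendsto_intros \<delta>l)
    moreover have "norm (q p n) = \<delta> n" for n using \<delta>(1)[of n] inward_dir_norm[OF p] by (simp add: q_def)
    ultimately show ?thesis by (simp add: r_def)
  qed
  have sub: "cball (x - q p n) (r p n) \<subseteq> U" if "p \<in> P" "x \<in> closure U" "x \<in> cball p (rad p / 2)" for p n x
    unfolding q_def r_def using k(3)[OF that(1) \<delta>(1) \<delta>(2)[OF that(1)]] that by blast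
  \<comment> \<open>clamping the representative keeps the bound\<close>
  obtain F' where F': "borel_rep U f F'" "integrable lborel F'" "integrable lborel (\<lambda>x. (F' x)^2)" "AE x in MU. F' x = f x"
    "\<And>B x. B \<ge> 0 \<Longrightarrow> (AE x in MU. \<bar>f x\<bar> \<le> B) \<Longrightarrow> \<bar>F' x\<bar> \<le> B"
  proof (cases "\<exists>B\<ge>0. AE x in MU. \<bar>f x\<bar> \<le> B")
    case False
    then show ?thesis using that[OF F] by blast
  next
    case True
    define B0 where "B0 = Inf {B. B \<ge> 0 \<and> (AE x in MU. \<bar>f x\<bar> \<le> B)}"
    have B0: "B0 \<ge> 0" unfolding B0_def using True by (intro cInf_greatest) auto
    have B0le: "B0 \<le> B" if "B \<ge> 0" "AE x in MU. \<bar>f x\<bar> \<le> B" for B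
      unfolding B0_def using that by (intro cInf_lower) (auto intro: bdd_belowI[of _ 0])
    have aeB: "AE x in MU. \<bar>f x\<bar> \<le> B0"
    proof -
      have "AE x in MU. \<bar>f x\<bar> \<le> B0 + 1 / real (Suc n)" for n
      proof -
        have "\<exists>B\<in>{B. B \<ge> 0 \<and> (AE x in MU. \<bar>f x\<bar> \<le> B)}. B < B0 + 1 / real (Suc n)"
          unfolding B0_def by (rule cInf_lessD) (use True in auto)
        then obtain B where "B < B0 + 1 / real (Suc n)" "AE x in MU. \<bar>f x\<bar> \<le> B" by blast
        then show ?thesis by (auto elim: eventually_mono)
      qed
      then have "AE x in MU. \<forall>n. \<bar>f x\<bar> \<le> B0 + 1 / real (Suc n)" by (simp add: AE_all_countable)
      then show ?thesis
      proof eventually_elim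
        case (elim x)
        have "(\<lambda>n. B0 + 1 / real (Suc n)) \<longlonglongrightarrow> B0 + 0"
          by (intro tendsto_intros LIMSEQ_Suc lim_1_over_n)
        then show ?case using elim by (intro LIMSEQ_le_const[of _ "B0"]) auto
      qed
    qed
    let ?F = "\<lambda>x. max (- B0) (min B0 (F x))"
    have [measurable]: "F \<in> borel_measurable borel" using F by auto
    have le: "\<bar>?F x\<bar> \<le> \<bar>F x\<bar>" for x using B0 by auto
    have "AE x in lebesgue. x \<in> U \<longrightarrow> \<bar>f x\<bar> \<le> B0" using aeB by (simp add: AE_restrict)
    then have "AE x in lebesgue. ?F x = indicator U x * f x"
      using F(1)[unfolded borel_rep_def, THEN conjunct2, THEN conjunct2]
      by eventually_elim (use B0 in \<open>auto simp: indicator_def split: if_splits\<close>)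
    then have rep: "borel_rep U f ?F" using F(1) B0 by (auto simp: borel_rep_def)
    have i1: "integrable lborel ?F"
      by (rule bintegrable_bound[OF F(2)]) (use le in auto)
    have i2: "integrable lborel (\<lambda>x. (?F x)^2)"
      by (rule bintegrable_bound[OF F(3)]) (use le in \<open>auto simp: abs_le_square_iff intro!: AE_I2\<close>)
    have "AE x in MU. ?F x = f x" using F(4) aeB by eventually_elim auto
    then show ?thesis
    proof (rule that[OF rep i1 i2])
      fix B x assume B: "B \<ge> 0" "AE x in MU. \<bar>f x\<bar> \<le> B"
      have "\<bar>?F x\<bar> \<le> B0" using B0 by auto
      also have "B0 \<le> B" by (rule B0le[OF B])
      finally show "\<bar>?F x\<bar> \<le> B" .
    qed
  qed
  let ?w = "\<lambda>p n. moll (bker (q p n) (r p n)) F'" and ?wg = "\<lambda>p n. mollg (bker_grad (q p n) (r p n)) F'"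
  define u where "u n x = (\<Sum>p\<in>P. chi p x * ?w p n x)" for n x
  define G where "G n x = (\<Sum>p\<in>P. chi p x *\<^sub>R ?wg p n x + ?w p n x *\<^sub>R dchi p x)" for n x
  have C: "C1 U (u n) (G n)" for n
    unfolding u_def[abs_def] G_def[abs_def]
    by (intro C1_sum finP C1_mult chi_C1 C1_UNIV bker_moll_gderiv[OF F'(2) r])
  have cc: "contc (chi p)" "contc (\<lambda>x. dchi p x $ j)" for p j
    using chi_C1[of p] by (auto simp: C1_def intro!: continuous_intros)
  have bd: "L2lim MU (\<lambda>n x. g x * Us n x) (\<lambda>x. g x * v x)" if Us: "L2lim MU Us v" and g: "contc g" for Us v g
  proof -
    obtain B where "\<And>x. x \<in> closure U \<Longrightarrow> \<bar>g x\<bar> \<le> B" using cont_bounded[OF g] by blast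
    then show ?thesis using closure_subset[of U]
      by (intro L2lim_bdd[OF Us meas_closure[OF g], of B] AE_I2) auto
  qed
  have Uc: "x \<in> U \<Longrightarrow> x \<in> closure U" for x using closure_subset by blast
  have Lw: "L2lim MU (?w p) F'" if "p \<in> P" for p by (rule moll_L2lim[OF F'(2,3) r[OF that] ql[OF that]])
  have 1: "L2lim MU u f"
  proof (rule L2lim_cong_AE)
    have "L2lim MU (\<lambda>n x. \<Sum>p\<in>P. chi p x * ?w p n x) (\<lambda>x. \<Sum>p\<in>P. chi p x * F' x)"
      by (intro L2lim_sum finP bd Lw cc)
    then show "L2lim MU u F'"
      by (rule L2lim_cong) (auto simp: u_def sum_distrib_right[symmetric] chi_sum Uc)
  qed (use F'(4) h(1) in \<open>auto simp: L2_def\<close>)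
  have 2: "L2lim MU (\<lambda>n x. G n x $ j) (wpd U j f)" for j
  proof (rule L2lim_cong_AE)
    have "L2lim MU (\<lambda>n x. \<Sum>p\<in>P. chi p x * moll (bker (q p n) (r p n)) (V j) x + dchi p x $ j * ?w p n x) (\<lambda>x. \<Sum>p\<in>P. chi p x * V j x + dchi p x $ j * F' x)"
      by (intro L2lim_sum finP L2lim_add bd Lw cc moll_L2lim[OF V(2,3)] r ql)
    then show "L2lim MU (\<lambda>n x. G n x $ j) (V j)"
    proof (rule L2lim_cong)
      fix n x assume "x \<in> space MU"
      then have x: "x \<in> closure U" using Uc by simp
      have "chi p x * moll (bker (q p n) (r p n)) (V j) x = chi p x * ?wg p n x $ j" if p: "p \<in> P" for p
      proof (cases "x \<in> cball p (rad p / 2)")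
        case True
        show ?thesis
          using wpd_moll[OF h(2) F'(1) V(1) F'(2) r[OF p] sub[OF p x True]] by simp
      next
        case False
        then have "chi p x = 0" using chi_0[OF p, of x] ball_subset_cball by blast
        then show ?thesis by simp
      qed
      then show "(\<Sum>p\<in>P. chi p x * moll (bker (q p n) (r p n)) (V j) x + dchi p x $ j * ?w p n x) = G n x $ j"
        unfolding G_def sum_component by (intro sum.cong refl) (simp add: mult.commute)
    next
      fix x assume "x \<in> space MU"
      then have x: "x \<in> closure U" using Uc by simp
      have "(\<Sum>p\<in>P. chi p x * V j x + dchi p x $ j * F' x) = (\<Sum>p\<in>P. chi p x) * V j x + (\<Sum>p\<in>P. dchi p x) $ j * F' x"
        by (simp add: sum.distrib sum_distrib_right)
      then show "(\<Sum>p\<in>P. chi p x * V j x + dchi p x $ j * F' x) = V j x" using chi_sum[OF x] dchi_sum[OF x] by simp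
    qed
  qed (use V(4) h(3) in \<open>auto simp: L2_def\<close>)
  have 3: "\<bar>u n x\<bar> \<le> B" if B: "B \<ge> 0" "AE x in MU. \<bar>f x\<bar> \<le> B" and x: "x \<in> closure U" for B n x
  proof -
    have w: "\<bar>?w p n x\<bar> \<le> B" if p: "p \<in> P" for p
      using moll_near[OF F'(2) bker_kernel[OF r[OF p], of "q p n" n], of x 0 B] F'(5)[OF B] by simp
    have "\<bar>u n x\<bar> \<le> (\<Sum>p\<in>P. \<bar>chi p x * ?w p n x\<bar>)" unfolding u_def by (rule sum_abs)
    also have "\<dots> \<le> (\<Sum>p\<in>P. chi p x * B)"
      using chi_nonneg[OF x] w by (intro sum_mono) (auto simp: abs_mult intro: mult_left_mono)
    also have "\<dots> = B" using chi_sum[OF x] by (simp add: sum_distrib_right[symmetric])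
    finally show ?thesis .
  qed
  show ?thesis using C 1 2 3 by (intro exI[of _ u] exI[of _ G]) blast
qed

end

section \<open>Weak derivatives of products\<close>

context atlas
begin

lemma integrable_imp_locally_integrable:
  assumes "integrable MU u"
  shows "locally_integrable U u"
  unfolding locally_integrable_def
proof (intro allI impI)
  fix K assume K: "compact K" "K \<subseteq> U"
  have "set_integrable lebesgue U u" using assms by (simp add: set_integrable_restrict)
  then show "set_integrable lebesgue K u"
    by (rule set_integrable_subset) (use K in \<open>auto simp: borel_compact\<close>)
qed

text \<open>A test function vanishes on the boundary, so the divergence theorem has no boundary term.\<close>

lemma by_parts_test:
  assumes v: "C1 U v G" and t: "test_fun U \<phi>"
  shows "(LINT x|MU. v x * pd j \<phi> x) = - (LINT x|MU. G x $ j * \<phi> x)"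
proof -
  have c: "closure {x. \<phi> x \<noteq> 0} \<subseteq> U" using t by (simp add: test_fun_def)
  have p: "C1 U \<phi> (\<lambda>x. \<chi> j. pd j \<phi> x)"
    by (rule C1_UNIV) (auto intro!: gderiv_pd test_fun_bdd[OF t] continuous_intros)
  have z: "\<phi> x = 0" if "x \<in> S" for x
    using test_fun_bdd(4)[OF t, of x] c that U_facts(7) by blast
  have vc: "contc v" "contc (\<lambda>x. G x $ j)" using v by (auto simp: C1_def intro!: continuous_intros)
  have "(LINT x:U|lebesgue. (v x *\<^sub>R (\<chi> j. pd j \<phi> x) + \<phi> x *\<^sub>R G x) $ j) = - (LINT x:S|\<sigma>. v x * \<phi> x * nu x $ j)"
    by (rule divergence_theorem[OF C1_mult[OF v p]])
  also have "(LINT x:S|\<sigma>. v x * \<phi> x * nu x $ j) = 0"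
    using z unfolding set_lebesgue_integral_def by (intro integral_eq_zero_AE AE_I2) (auto simp: indicator_def)
  finally have "(LINT x|MU. v x * pd j \<phi> x + G x $ j * \<phi> x) = 0"
    by (simp add: set_lint_restrict mult.commute)
  moreover have "integrable MU (\<lambda>x. v x * pd j \<phi> x)" "integrable MU (\<lambda>x. G x $ j * \<phi> x)"
    by (intro L2_prod L2_closure vc continuous_on_subset[OF test_fun_bdd(1)[OF t]] continuous_on_subset[OF test_fun_bdd(2)[OF t]]; simp)+
  ultimately show ?thesis by simp
qed

text \<open>Approximation of both factors by smooth functions, with \<open>by_parts_test\<close> for the products; only products
  of \<open>L^2\<close> limits occur.\<close>

lemma product_rule:
  assumes f: "f \<in> Hk (Suc m) U" and g: "g \<in> Hk (Suc l) U"
  shows "is_wpd U j (\<lambda>x. f x * g x) (\<lambda>x. f x * wpd U j g x + wpd U j f x * g x)"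
proof -
  note hf = Hk_facts[OF f] and hg = Hk_facts[OF g]
  obtain u G where u: "\<And>n. C1 U (u n) (G n)" "L2lim MU u f" "\<And>j. L2lim MU (\<lambda>n x. G n x $ j) (wpd U j f)"
    using density[OF f] by blast
  obtain v H where v: "\<And>n. C1 U (v n) (H n)" "L2lim MU v g" "\<And>j. L2lim MU (\<lambda>n x. H n x $ j) (wpd U j g)"
    using density[OF g] by blast
  have i: "integrable MU (\<lambda>x. f x * g x)" "integrable MU (\<lambda>x. f x * wpd U j g x + wpd U j f x * g x)"
    by (intro bintegrable_add L2_prod hf hg)+
  show ?thesis
    unfolding is_wpd_def
  proof (intro conjI allI impI integrable_imp_locally_integrable i)
    fix \<phi> assume t: "test_fun U \<phi>"
    have bd: "L2lim MU (\<lambda>n x. h x * Us n x) (\<lambda>x. h x * w x)" if Us: "L2lim MU Us w" and h: "continuous_on UNIV h" for Us w and h :: "real^3 \<Rightarrow> real"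
    proof -
      have hc: "contc h" using h by (rule continuous_on_subset) simp
      obtain B where "\<And>x. x \<in> closure U \<Longrightarrow> \<bar>h x\<bar> \<le> B" using cont_bounded[OF hc] by blast
      then show ?thesis using closure_subset[of U] by (intro L2lim_bdd[OF Us meas_closure[OF hc], of B] AE_I2) auto
    qed
    note pc = test_fun_bdd(1)[OF t] and dc = test_fun_bdd(2)[OF t, of j]
    have "(\<lambda>n. LINT x|MU. (pd j \<phi> x * u n x) * v n x) \<longlonglongrightarrow> (LINT x|MU. (pd j \<phi> x * f x) * g x)"
      by (intro L2lim_prod bd u v dc)
    moreover have "(LINT x|MU. (pd j \<phi> x * u n x) * v n x) = - ((LINT x|MU. (\<phi> x * u n x) * H n x $ j) + (LINT x|MU. (\<phi> x * G n x $ j) * v n x))" for n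
    proof -
      have "(LINT x|MU. (u n x * v n x) * pd j \<phi> x) = - (LINT x|MU. (u n x *\<^sub>R H n x + v n x *\<^sub>R G n x) $ j * \<phi> x)"
        by (rule by_parts_test[OF C1_mult[OF u(1) v(1)] t])
      also have "(LINT x|MU. (u n x *\<^sub>R H n x + v n x *\<^sub>R G n x) $ j * \<phi> x) = (LINT x|MU. (\<phi> x * u n x) * H n x $ j + (\<phi> x * G n x $ j) * v n x)"
        by (simp add: algebra_simps)
      also have "\<dots> = (LINT x|MU. (\<phi> x * u n x) * H n x $ j) + (LINT x|MU. (\<phi> x * G n x $ j) * v n x)"
        using bd[OF u(2) pc] bd[OF u(3) pc] v(2) v(3)
        by (intro bint_add L2_prod) (auto simp: L2lim_def)
      finally show ?thesis by (simp add: mult_ac)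
    qed
    moreover have "(\<lambda>n. - ((LINT x|MU. (\<phi> x * u n x) * H n x $ j) + (LINT x|MU. (\<phi> x * G n x $ j) * v n x)))
        \<longlonglongrightarrow> - ((LINT x|MU. (\<phi> x * f x) * wpd U j g x) + (LINT x|MU. (\<phi> x * wpd U j f x) * g x))"
      by (intro tendsto_intros L2lim_prod bd u v pc)
    ultimately have "(LINT x|MU. (pd j \<phi> x * f x) * g x) = - ((LINT x|MU. (\<phi> x * f x) * wpd U j g x) + (LINT x|MU. (\<phi> x * wpd U j f x) * g x))"
      by (metis (no_types, lifting) LIMSEQ_unique tendsto_cong_limit ext)
    also have "(LINT x|MU. (\<phi> x * f x) * wpd U j g x) + (LINT x|MU. (\<phi> x * wpd U j f x) * g x) = (LINT x|MU. (\<phi> x * f x) * wpd U j g x + (\<phi> x * wpd U j f x) * g x)"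
      using bd[OF u(2) pc] bd[OF u(3) pc] hg
      by (intro bint_add[symmetric] L2_prod) (auto simp: L2lim_def)
    finally show "(LINT x:U|lebesgue. f x * g x * pd j \<phi> x) = - (LINT x:U|lebesgue. (f x * wpd U j g x + wpd U j f x * g x) * \<phi> x)"
      by (simp add: set_lint_restrict algebra_simps)
  qed
qed

lemma wpd_AE_MU: "is_wpd U j f v \<Longrightarrow> AE x in MU. wpd U j f x = v x"
  using wpd_AE[OF U_facts(1)] by (simp add: AE_restrict)

lemma is_wpd_add:
  assumes u: "is_wpd U j f u" and v: "is_wpd U j g v"
  shows "is_wpd U j (\<lambda>x. f x + c * g x) (\<lambda>x. u x + c * v x)"
proof -
  have l: "locally_integrable U f" "locally_integrable U u" "locally_integrable U g" "locally_integrable U v"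
    using u v by (auto simp: is_wpd_def)
  show ?thesis
    unfolding is_wpd_def
  proof (intro conjI allI impI)
    show "locally_integrable U (\<lambda>x. f x + c * g x)" "locally_integrable U (\<lambda>x. u x + c * v x)"
      using l unfolding locally_integrable_def by auto
    fix \<phi> assume t: "test_fun U \<phi>"
    have c: "compact (closure {x. \<phi> x \<noteq> 0})" "closure {x. \<phi> x \<noteq> 0} \<subseteq> U" using t by (auto simp: test_fun_def)
    have i: "set_integrable lebesgue U (\<lambda>x. w x * \<phi> x)" "set_integrable lebesgue U (\<lambda>x. w x * pd j \<phi> x)" if "locally_integrable U w" for w
    proof -
      have s: "\<phi> x \<noteq> 0 \<Longrightarrow> x \<in> closure {x. \<phi> x \<noteq> 0}" "pd j \<phi> x \<noteq> 0 \<Longrightarrow> x \<in> closure {x. \<phi> x \<noteq> 0}" for x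
        using test_fun_bdd(4)[OF t, of x j] by blast+
      show "set_integrable lebesgue U (\<lambda>x. w x * \<phi> x)" by (rule locally_integrable_test[OF that test_fun_bdd(1)[OF t] c s(1)])
      show "set_integrable lebesgue U (\<lambda>x. w x * pd j \<phi> x)" by (rule locally_integrable_test[OF that test_fun_bdd(2)[OF t] c s(2)])
    qed
    have "(LINT x:U|lebesgue. (f x + c * g x) * pd j \<phi> x) = (LINT x:U|lebesgue. f x * pd j \<phi> x) + c * (LINT x:U|lebesgue. g x * pd j \<phi> x)"
      using i[OF l(1)] i[OF l(3)] by (simp add: distrib_right mult.assoc)
    also have "\<dots> = - (LINT x:U|lebesgue. u x * \<phi> x) + c * - (LINT x:U|lebesgue. v x * \<phi> x)"
      using u v t unfolding is_wpd_def by simp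
    also have "\<dots> = - (LINT x:U|lebesgue. (u x + c * v x) * \<phi> x)"
      using i[OF l(2)] i[OF l(4)] by (simp add: distrib_right mult.assoc)
    finally show "(LINT x:U|lebesgue. (f x + c * g x) * pd j \<phi> x) = - (LINT x:U|lebesgue. (u x + c * v x) * \<phi> x)" .
  qed
qed

lemma is_wpd_cong_AE:
  assumes u: "is_wpd U j f u" and fg: "AE x in MU. f x = g x" and g: "integrable MU g"
  shows "is_wpd U j g u"
proof -
  have ae: "AE x in lebesgue. x \<in> U \<longrightarrow> f x = g x" using fg by (simp add: AE_restrict)
  have "(LINT x:U|lebesgue. g x * pd j \<phi> x) = (LINT x:U|lebesgue. f x * pd j \<phi> x)" if t: "test_fun U \<phi>" for \<phi>
  proof -
    have c: "compact (closure {x. \<phi> x \<noteq> 0})" "closure {x. \<phi> x \<noteq> 0} \<subseteq> U" using t by (auto simp: test_fun_def)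
    have l: "locally_integrable U f" "locally_integrable U g" using u integrable_imp_locally_integrable[OF g] by (auto simp: is_wpd_def)
    have i: "set_integrable lebesgue U (\<lambda>x. w x * pd j \<phi> x)" if "locally_integrable U w" for w
    proof (rule locally_integrable_test[OF that test_fun_bdd(2)[OF t] c])
      show "pd j \<phi> x \<noteq> 0 \<Longrightarrow> x \<in> closure {x. \<phi> x \<noteq> 0}" for x using test_fun_bdd(4)[OF t, of x j] by blast
    qed
    show ?thesis
      using i[OF l(1)] i[OF l(2)] ae unfolding set_lebesgue_integral_def set_integrable_def
      by (intro integral_cong_AE) (auto simp: indicator_def elim: eventually_mono)
  qed
  then show ?thesis using u integrable_imp_locally_integrable[OF g] unfolding is_wpd_def by simp
qed

abbreviation "MSg \<equiv> restrict_space \<sigma> S"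

section \<open>Boundary traces\<close>

lemma MSg_finite: "finite_measure MSg"
proof (rule finite_measureI)
  have "emeasure MSg (space MSg) = emeasure \<sigma> S"
    by (subst emeasure_restrict_space) (auto simp: space_restrict_space)
  then show "emeasure MSg (space MSg) \<noteq> \<infinity>" using \<sigma>_finite by simp
qed

lemma S_sets\<sigma> [simp]: "S \<in> sets \<sigma>" by simp

lemma L2_S: "contc f \<Longrightarrow> L2 MSg f"
proof -
  assume c: "contc f"
  obtain B where "\<And>x. x \<in> closure U \<Longrightarrow> \<bar>f x\<bar> \<le> B" using cont_bounded[OF c] by blast
  then have B: "\<And>x. x \<in> S \<Longrightarrow> \<bar>f x\<bar> \<le> B" using U_facts(6) by blast
  have "f \<in> borel_measurable MSg"
    using cont_meas_S[OF c] by (simp add: borel_measurable_restrict_space_iff cong: measurable_cong_sets)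
  moreover have "AE x in MSg. \<bar>f x\<bar> \<le> B" using B by (intro AE_I2) (auto simp: space_restrict_space)
  ultimately show ?thesis by (rule L2_bounded_finite[OF MSg_finite])
qed

text \<open>Completeness of \<open>L^2\<close> for rapidly converging sequences: the differences are summable almost everywhere,
  and Fatou's lemma identifies the pointwise limit as the \<open>L^2\<close> limit.\<close>

lemma cauchy_L2_limit:
  fixes v :: "nat \<Rightarrow> 'a \<Rightarrow> real"
  assumes M: "finite_measure M" and s: "\<And>n. L2 M (v n)"
    and c: "\<And>n. (LINT x|M. (v (Suc n) x - v n x)^2) \<le> (1 / 4) ^ n"
  shows "\<exists>h. L2lim M v h"
proof -
  interpret finite_measure M by fact
  have [measurable]: "v n \<in> borel_measurable M" for n using s by (simp add: L2_def)
  let ?d = "\<lambda>n x. \<bar>v (Suc n) x - v n x\<bar>"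
  have sd: "L2 M (\<lambda>x. v (Suc n) x - v n x)" for n by (intro L2_diff s)
  have q4: "(1 / 4 :: real) ^ n = ((1 / 2) ^ n)^2" for n by (simp add: power2_eq_square flip: power_mult_distrib)
  define A where "A = measure M (space M)"
  have A: "A \<ge> 0" by (simp add: A_def)
  have s1: "L2 M (\<lambda>x. 1)" by (simp add: L2_def)
  have sd': "L2 M (?d n)" for n using sd[of n] by (simp add: L2_def)
  have i1: "integrable M (?d n)" for n using L2_prod[OF sd'[of n] s1] by simp
  have n1: "(LINT x|M. ?d n x) \<le> sqrt A * (1 / 2) ^ n" for n
  proof -
    have "(LINT x|M. ?d n x * 1)^2 \<le> (LINT x|M. (?d n x)^2) * (LINT x|M. 1^2)" by (rule L2_CS[OF sd' s1])
    also have "\<dots> \<le> (1 / 4) ^ n * A" using c[of n] A by (simp add: A_def mult_right_mono)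
    also have "\<dots> = (sqrt A * (1 / 2) ^ n)^2"
      unfolding q4 power_mult_distrib using A by (simp only: real_sqrt_pow2 mult.commute)
    finally show ?thesis using A by (auto intro: power2_le_imp_le)
  qed
  have "AE x in M. summable (\<lambda>n. ?d n x)"
  proof -
    have "(\<integral>\<^sup>+x. (\<Sum>n. ennreal (?d n x)) \<partial>M) = (\<Sum>n. \<integral>\<^sup>+x. ennreal (?d n x) \<partial>M)"
      by (rule nn_integral_suminf) measurable
    also have "\<dots> = (\<Sum>n. ennreal (LINT x|M. ?d n x))"
      using i1 by (intro suminf_cong nn_integral_eq_integral) auto
    also have "\<dots> \<le> (\<Sum>n. ennreal (sqrt A * (1 / 2) ^ n))"
      using n1 by (intro suminf_le ennreal_leI) auto
    also have "\<dots> < \<infinity>"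
      using A by (subst suminf_ennreal2) (auto intro!: summable_mult complete_algebra_summable_geometric)
    finally have "(\<integral>\<^sup>+x. (\<Sum>n. ennreal (?d n x)) \<partial>M) \<noteq> \<infinity>" by simp
    then have "AE x in M. (\<Sum>n. ennreal (?d n x)) \<noteq> \<infinity>" by (intro nn_integral_PInf_AE) auto
    then show ?thesis
    proof eventually_elim
      case (elim x)
      then show ?case by (intro summable_suminf_not_top) auto
    qed
  qed
  then have conv: "AE x in M. convergent (\<lambda>n. v n x)"
  proof eventually_elim
    case (elim x)
    then have "summable (\<lambda>n. v (Suc n) x - v n x)" by (rule summable_rabs_cancel)
    then have "convergent (\<lambda>n. \<Sum>i<n. v (Suc i) x - v i x)" by (simp add: summable_iff_convergent)
    moreover have "(\<lambda>n. \<Sum>i<n. v (Suc i) x - v i x) = (\<lambda>n. v n x - v 0 x)"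
      by (rule ext) (rule sum_lessThan_telescope)
    ultimately have "convergent (\<lambda>n. v n x - v 0 x)" by (simp only:)
    then show ?case using convergent_add[of "\<lambda>n. v n x - v 0 x" "\<lambda>n. v 0 x"] by (simp add: convergent_const)
  qed
  define h where "h x = lim (\<lambda>n. v n x)" for x
  have hm [measurable]: "h \<in> borel_measurable M" unfolding h_def[abs_def] by measurable
  have lim: "AE x in M. (\<lambda>n. v n x) \<longlonglongrightarrow> h x"
    using conv by eventually_elim (simp add: h_def convergent_LIMSEQ_iff)
  have step: "(\<integral>\<^sup>+x. ennreal ((v (n + m) x - v n x)^2) \<partial>M) \<le> ennreal (4 * (1 / 4) ^ n)" for n m
  proof -
    have sq: "sqrt (LINT x|M. (f x + g x)^2) \<le> sqrt (LINT x|M. (f x)^2) + sqrt (LINT x|M. (g x)^2)" if "L2 M f" "L2 M g" for f g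
    proof (rule real_le_lsqrt)
      let ?a = "LINT x|M. (f x)^2" and ?b = "LINT x|M. (g x)^2" and ?c = "LINT x|M. f x * g x"
      have ab: "?a \<ge> 0" "?b \<ge> 0" by (intro integral_nonneg_AE; simp)+
      have "?c^2 \<le> ?a * ?b" by (rule L2_CS[OF that])
      then have "\<bar>?c\<bar> \<le> sqrt (?a * ?b)" by (rule real_le_rsqrt[of "\<bar>?c\<bar>", simplified])
      then have "?c \<le> sqrt ?a * sqrt ?b" by (simp add: real_sqrt_mult)
      moreover have "(LINT x|M. (f x + g x)^2) = ?a + 2 * ?c + ?b"
      proof -
        have "(LINT x|M. (f x + g x)^2) = (LINT x|M. (f x)^2 + 2 * (f x * g x) + (g x)^2)"
          by (simp add: power2_sum mult.assoc add_ac)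
        then show ?thesis using that L2_prod[OF that] by (simp add: L2_def)
      qed
      ultimately show "(LINT x|M. (f x + g x)^2) \<le> (sqrt ?a + sqrt ?b)^2" using ab by (simp add: power2_sum)
      show "0 \<le> sqrt ?a + sqrt ?b" using ab by simp
    qed
    have r: "sqrt (LINT x|M. (v (n + m) x - v n x)^2) \<le> 2 * (1 / 2) ^ n * (1 - (1 / 2) ^ m)"
    proof (induction m)
      case 0
      then show ?case by simp
    next
      case (Suc m)
      have "sqrt (LINT x|M. (v (n + Suc m) x - v n x)^2) \<le> sqrt (LINT x|M. (v (Suc (n + m)) x - v (n + m) x)^2) + sqrt (LINT x|M. (v (n + m) x - v n x)^2)"
        using sq[of "\<lambda>x. v (Suc (n + m)) x - v (n + m) x" "\<lambda>x. v (n + m) x - v n x"] s by (simp add: L2_diff)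
      also have "sqrt (LINT x|M. (v (Suc (n + m)) x - v (n + m) x)^2) \<le> sqrt ((1 / 4) ^ (n + m))"
        using c[of "n + m"] by simp
      also have "sqrt ((1 / 4) ^ (n + m)) = (1 / 2 :: real) ^ (n + m)"
        by (simp add: real_sqrt_power real_sqrt_divide)
      also note Suc
      finally have "sqrt (LINT x|M. (v (n + Suc m) x - v n x)^2) \<le> (1 / 2) ^ (n + m) + 2 * (1 / 2) ^ n * (1 - (1 / 2) ^ m)" by simp
      also have "\<dots> = 2 * (1 / 2) ^ n * (1 - (1 / 2) ^ Suc m)" by (simp add: power_add algebra_simps)
      finally show ?case .
    qed
    have "2 * (1 / 2 :: real) ^ n * (1 - (1 / 2) ^ m) \<le> 2 * (1 / 2) ^ n * 1" by (intro mult_left_mono) auto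
    then have "sqrt (LINT x|M. (v (n + m) x - v n x)^2) \<le> 2 * (1 / 2) ^ n" using r by linarith
    then have "(LINT x|M. (v (n + m) x - v n x)^2) \<le> (2 * (1 / 2) ^ n)^2" by (rule sqrt_le_D)
    also have "(2 * (1 / 2 :: real) ^ n)^2 = 4 * (1 / 4) ^ n" unfolding q4 power_mult_distrib by simp
    finally have "(LINT x|M. (v (n + m) x - v n x)^2) \<le> 4 * (1 / 4) ^ n" .
    moreover have "(\<integral>\<^sup>+x. ennreal ((v (n + m) x - v n x)^2) \<partial>M) = ennreal (LINT x|M. (v (n + m) x - v n x)^2)"
      using L2_diff[OF s s] by (intro nn_integral_eq_integral) (auto simp: L2_def)
    ultimately show ?thesis by (simp add: ennreal_leI)
  qed
  have fat: "(\<integral>\<^sup>+x. ennreal ((h x - v n x)^2) \<partial>M) \<le> ennreal (4 * (1 / 4) ^ n)" for n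
  proof -
    have "(\<integral>\<^sup>+x. ennreal ((h x - v n x)^2) \<partial>M) = (\<integral>\<^sup>+x. liminf (\<lambda>m. ennreal ((v (n + m) x - v n x)^2)) \<partial>M)"
    proof (rule nn_integral_cong_AE)
      show "AE x in M. ennreal ((h x - v n x)^2) = liminf (\<lambda>m. ennreal ((v (n + m) x - v n x)^2))"
        using lim
      proof eventually_elim
        case (elim x)
        have "(\<lambda>m. v (n + m) x) \<longlonglongrightarrow> h x" using LIMSEQ_ignore_initial_segment[OF elim, of n] by (simp add: add.commute)
        then have "(\<lambda>m. ennreal ((v (n + m) x - v n x)^2)) \<longlonglongrightarrow> ennreal ((h x - v n x)^2)"
          by (intro tendsto_intros) auto
        from lim_imp_Liminf[OF trivial_limit_sequentially this] show ?case by (rule sym)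
      qed
    qed
    also have "\<dots> \<le> liminf (\<lambda>m. \<integral>\<^sup>+x. ennreal ((v (n + m) x - v n x)^2) \<partial>M)"
      by (rule nn_integral_liminf) measurable
    also have "\<dots> \<le> ennreal (4 * (1 / 4) ^ n)"
      by (rule Liminf_le) (use step in \<open>auto intro: always_eventually\<close>)
    finally show ?thesis .
  qed
  have ih: "integrable M (\<lambda>x. (h x - v n x)^2)" for n
    by (rule integrableI_nonneg) (use fat[of n] in \<open>auto intro: le_less_trans\<close>)
  have sh: "L2 M (\<lambda>x. h x - v n x)" for n using ih by (simp add: L2_def)
  have "L2 M h" using L2_add[OF sh s, of 0 0] by simp
  moreover have "(\<lambda>n. LINT x|M. (v n x - h x)^2) \<longlonglongrightarrow> 0"
  proof (rule tendsto_sandwich[OF always_eventually always_eventually tendsto_const])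
    show "\<forall>n. 0 \<le> (LINT x|M. (v n x - h x)^2)" by (auto intro: integral_nonneg_AE)
    show "\<forall>n. (LINT x|M. (v n x - h x)^2) \<le> 4 * (1 / 4) ^ n"
    proof
      fix n
      have "ennreal (LINT x|M. (h x - v n x)^2) \<le> ennreal (4 * (1 / 4) ^ n)"
        using fat[of n] ih[of n] by (subst nn_integral_eq_integral[symmetric]) auto
      then show "(LINT x|M. (v n x - h x)^2) \<le> 4 * (1 / 4) ^ n" by (simp add: power2_commute ennreal_le_iff)
    qed
    show "(\<lambda>n. 4 * (1 / 4 :: real) ^ n) \<longlonglongrightarrow> 0" by (intro tendsto_mult_right_zero LIMSEQ_realpow_zero) auto
  qed
  ultimately show ?thesis using s by (auto simp: L2lim_def)
qed

lemma Hk_Suc: "f \<in> Hk (Suc k) U \<longleftrightarrow> L2_on lebesgue U f \<and> (\<forall>j. \<exists>v. is_wpd U j f v \<and> v \<in> Hk k U)"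
  by (simp add: Hk_def)

lemma Hk_mono: "f \<in> Hk (Suc k) U \<Longrightarrow> f \<in> Hk k U"
proof (induction k arbitrary: f)
  case 0
  then show ?case by (simp add: Hk_def)
next
  case (Suc k)
  have "\<exists>v. is_wpd U j f v \<and> v \<in> Hk k U" for j
  proof -
    obtain v where "is_wpd U j f v" "v \<in> Hk (Suc k) U" using Suc.prems unfolding Hk_Suc[of f "Suc k"] by blast
    then show ?thesis using Suc.IH by blast
  qed
  then show ?case using Suc.prems unfolding Hk_Suc[of f "Suc k"] Hk_Suc[of f k] by blast
qed

lemma Hk_1: "f \<in> Hk (Suc k) U \<Longrightarrow> f \<in> Hk 1 U"
  by (induction k) (auto dest: Hk_mono simp del: One_nat_def simp flip: One_nat_def)

text \<open>By the trace inequality, the boundary values of smooth approximations form a Cauchy sequence in \<open>L^2\<close> of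
  the boundary; a subsequence converges fast enough for \<open>cauchy_L2_limit\<close>.\<close>

lemma trace_exists:
  assumes f: "f \<in> Hk (Suc m) U"
  shows "\<exists>h. is_bdry_trace U f h"
proof -
  note hf = Hk_facts[OF f]
  obtain u G where u: "\<And>n. C1 U (u n) (G n)" "L2lim MU u f" "\<And>j. L2lim MU (\<lambda>n x. G n x $ j) (wpd U j f)"
    using density[OF f] by blast
  obtain C where C: "C \<ge> 0" "\<And>u G. C1 U u G \<Longrightarrow> (LINT x:S|\<sigma>. (u x)^2) \<le> C * (LINT x:U|lebesgue. (u x)^2 + (norm (G x))^2)"
    using trace_inequality by blast
  define E where "E n = (LINT x|MU. (u n x - f x)^2) + (\<Sum>j\<in>UNIV. LINT x|MU. (G n x $ j - wpd U j f x)^2)" for n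
  have El: "E \<longlonglongrightarrow> 0"
  proof -
    have "(\<lambda>n. (LINT x|MU. (u n x - f x)^2) + (\<Sum>j\<in>UNIV. LINT x|MU. (G n x $ j - wpd U j f x)^2)) \<longlonglongrightarrow> 0 + (\<Sum>j\<in>(UNIV::3 set). 0)"
      using u by (intro tendsto_intros) (auto simp: L2lim_def)
    then show ?thesis unfolding E_def[abs_def] by simp
  qed
  have nn: "(LINT x|MU. (g x)^2) \<ge> 0" for g :: "real^3 \<Rightarrow> real" by (intro integral_nonneg_AE) auto
  have Ele: "(LINT x|MU. (u n x - f x)^2) \<le> E n" "(LINT x|MU. (G n x $ j - wpd U j f x)^2) \<le> E n" for n j
    unfolding E_def using nn member_le_sum[of j UNIV "\<lambda>j. LINT x|MU. (G n x $ j - wpd U j f x)^2"]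
    by (auto intro!: sum_nonneg add_increasing)
  have "\<exists>n. E n \<le> (1 / 4) ^ k / (4 * (C + 1))" for k
  proof -
    have "(1 / 4) ^ k / (4 * (C + 1)) > 0" using C(1) by simp
    then have "\<forall>\<^sub>F n in sequentially. E n < (1 / 4) ^ k / (4 * (C + 1))" by (rule order_tendstoD(2)[OF El])
    then have "\<exists>n. E n < (1 / 4) ^ k / (4 * (C + 1))" by (rule eventually_happens'[rotated]) simp
    then show ?thesis using less_imp_le by blast
  qed
  then have "\<exists>r. \<forall>k. E (r k) \<le> (1 / 4) ^ k / (4 * (C + 1))" by (intro choice allI)
  then obtain r where r0: "\<forall>k. E (r k) \<le> (1 / 4) ^ k / (4 * (C + 1))" by (elim exE)
  note r = r0[rule_format]
  have E0: "E n \<ge> 0" for n by (rule order_trans[OF nn Ele(1)])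
  have Erl: "(\<lambda>k. E (r k)) \<longlonglongrightarrow> 0"
  proof (rule tendsto_sandwich[OF always_eventually always_eventually tendsto_const])
    show "\<forall>k. 0 \<le> E (r k)" using E0 by blast
    show "\<forall>k. E (r k) \<le> (1 / 4) ^ k / (4 * (C + 1))" using r by blast
    show "(\<lambda>k. (1 / 4) ^ k / (4 * (C + 1))) \<longlonglongrightarrow> 0" by (intro tendsto_divide_zero LIMSEQ_realpow_zero) auto
  qed
  have cu: "contc (u n)" "contc (G n)" for n using u(1) by (auto simp: C1_def)
  have diff: "(LINT x:S|\<sigma>. (u (r (Suc k)) x - u (r k) x)^2) \<le> (1 / 4) ^ k" for k
  proof -
    let ?a = "r (Suc k)" and ?b = "r k"
    have "C1 U (\<lambda>x. u ?a x + (- 1) * u ?b x) (\<lambda>x. G ?a x + ((- 1) *\<^sub>R G ?b x + u ?b x *\<^sub>R 0))"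
      by (intro C1_add C1_mult C1_const u)
    then have c1: "C1 U (\<lambda>x. u ?a x - u ?b x) (\<lambda>x. G ?a x - G ?b x)" by simp
    have sq: "(a - b)^2 \<le> 2 * (a - c)^2 + 2 * (b - c)^2" for a b c :: real
      using zero_le_power2[of "a + b - 2 * c"] by (simp add: power2_eq_square algebra_simps)
    have s1: "L2 MU (\<lambda>x. u n x - f x)" "L2 MU (\<lambda>x. G n x $ j - wpd U j f x)" for n j
      using u(2,3) by (auto simp: L2lim_def intro: L2_diff)
    have nG: "(norm v)^2 = (\<Sum>j\<in>UNIV. (v $ j)^2)" for v :: "real^3"
      unfolding power2_norm_eq_inner inner_vec_def by (simp add: power2_eq_square)
    have "(LINT x|MU. (u ?a x - u ?b x)^2 + (norm (G ?a x - G ?b x))^2)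
      \<le> (LINT x|MU. 2 * ((u ?a x - f x)^2 + (\<Sum>j\<in>UNIV. (G ?a x $ j - wpd U j f x)^2)) + 2 * ((u ?b x - f x)^2 + (\<Sum>j\<in>UNIV. (G ?b x $ j - wpd U j f x)^2)))"
    proof (rule integral_mono)
      show "integrable MU (\<lambda>x. (u ?a x - u ?b x)^2 + (norm (G ?a x - G ?b x))^2)"
        by (simp only: set_integrable_restrict[symmetric] U_leb) (intro set_integrable_U continuous_intros cu)
      show "integrable MU (\<lambda>x. 2 * ((u ?a x - f x)^2 + (\<Sum>j\<in>UNIV. (G ?a x $ j - wpd U j f x)^2)) + 2 * ((u ?b x - f x)^2 + (\<Sum>j\<in>UNIV. (G ?b x $ j - wpd U j f x)^2)))"
        using s1 by (intro bintegrable_add bintegrable_mult bintegrable_sum) (auto simp: L2_def)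
      fix x
      have "(norm (G ?a x - G ?b x))^2 \<le> (\<Sum>j\<in>UNIV. 2 * (G ?a x $ j - wpd U j f x)^2 + 2 * (G ?b x $ j - wpd U j f x)^2)"
        unfolding nG vector_minus_component by (intro sum_mono sq)
      then show "(u ?a x - u ?b x)^2 + (norm (G ?a x - G ?b x))^2 \<le> 2 * ((u ?a x - f x)^2 + (\<Sum>j\<in>UNIV. (G ?a x $ j - wpd U j f x)^2)) + 2 * ((u ?b x - f x)^2 + (\<Sum>j\<in>UNIV. (G ?b x $ j - wpd U j f x)^2))"
        using sq[of "u ?a x" "u ?b x" "f x"] by (simp add: sum.distrib sum_distrib_left[symmetric])
    qed
    also have "\<dots> = 2 * E ?a + 2 * E ?b"
    proof -
      have i: "integrable MU (\<lambda>x. (u n x - f x)^2)" "integrable MU (\<lambda>x. (G n x $ j - wpd U j f x)^2)" for n j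
        using s1 by (simp_all add: L2_def)
      have e: "(LINT x|MU. (u n x - f x)^2 + (\<Sum>j\<in>UNIV. (G n x $ j - wpd U j f x)^2)) = E n" for n
        unfolding E_def using i by (subst bint_add) (auto simp: bint_sum)
      have i2: "integrable MU (\<lambda>x. (u n x - f x)^2 + (\<Sum>j\<in>UNIV. (G n x $ j - wpd U j f x)^2))" for n
        using i by (intro bintegrable_add bintegrable_sum)
      show ?thesis unfolding e[symmetric] integral_mult_right_zero[symmetric]
        by (rule bint_add; intro bintegrable_mult i2)
    qed
    finally have le: "(LINT x|MU. (u ?a x - u ?b x)^2 + (norm (G ?a x - G ?b x))^2) \<le> 2 * E ?a + 2 * E ?b" .
    have "(LINT x:S|\<sigma>. (u ?a x - u ?b x)^2) \<le> C * (LINT x|MU. (u ?a x - u ?b x)^2 + (norm (G ?a x - G ?b x))^2)"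
      using C(2)[OF c1] by (simp add: set_lint_restrict)
    also have "\<dots> \<le> (C + 1) * (2 * E ?a + 2 * E ?b)"
    proof (rule mult_mono[OF _ le])
      show "0 \<le> (LINT x|MU. (u ?a x - u ?b x)^2 + (norm (G ?a x - G ?b x))^2)" by (intro integral_nonneg_AE) auto
    qed (use C(1) in auto)
    also have "\<dots> \<le> (C + 1) * (2 * ((1 / 4) ^ k / (4 * (C + 1))) + 2 * ((1 / 4) ^ k / (4 * (C + 1))))"
    proof (intro mult_left_mono add_mono)
      have "(1 / 4 :: real) ^ Suc k / (4 * (C + 1)) \<le> (1 / 4) ^ k / (4 * (C + 1))" using C(1) by (intro divide_right_mono) auto
      then show "E ?a \<le> (1 / 4) ^ k / (4 * (C + 1))" using r[of "Suc k"] by linarith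
    qed (use r C(1) in auto)
    also have "\<dots> = (1 / 4) ^ k"
    proof -
      have "c * (2 * (q / (4 * c)) + 2 * (q / (4 * c))) = q" if "c \<noteq> 0" for c q :: real
        using that by (simp add: field_simps)
      moreover have "C + 1 \<noteq> 0" using C(1) by simp
      ultimately show ?thesis by blast
    qed
    finally show ?thesis .
  qed
  have "\<exists>h. L2lim MSg (\<lambda>k. u (r k)) h"
    by (rule cauchy_L2_limit[OF MSg_finite L2_S[OF cu(1)]]) (use diff in \<open>simp add: set_lint_restrict\<close>)
  then obtain h where h: "L2lim MSg (\<lambda>k. u (r k)) h" by blast
  have le0: "(\<lambda>k. LINT x|MU. (g (r k) x)^2) \<longlonglongrightarrow> 0" if "\<And>n. (LINT x|MU. (g n x)^2) \<le> E n" for g :: "nat \<Rightarrow> real^3 \<Rightarrow> real"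
    by (rule tendsto_sandwich[OF always_eventually always_eventually tendsto_const Erl]) (use that nn in auto)
  have "is_bdry_trace U f h"
    unfolding is_bdry_trace_def
  proof (intro conjI exI[of _ "\<lambda>k. u (r k)"] allI)
    show "f \<in> Hk 1 U" by (rule Hk_1[OF f])
    show "L2_on \<sigma> S h" using h by (simp add: L2_on_restrict L2lim_def)
    show "Ck_closure 1 U (u (r n))" for n by (rule C1_Ck_closure[OF u(1)])
    show "(\<lambda>n. LINT x:U|lebesgue. (u (r n) x - f x)^2) \<longlonglongrightarrow> 0"
      unfolding set_lint_restrict[OF U_leb] by (rule le0) (rule Ele)
    show "(\<lambda>n. LINT x:S|\<sigma>. (u (r n) x - h x)^2) \<longlonglongrightarrow> 0"
      using h unfolding set_lint_restrict[OF S_sets\<sigma>] by (simp add: L2lim_def)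
    fix j
    have "(LINT x:U|lebesgue. (pd j (u n) x - wpd U j f x)^2) = (LINT x:U|lebesgue. (G n x $ j - wpd U j f x)^2)" for n
      by (rule set_lebesgue_integral_cong) (auto simp: C1_pd[OF u(1)])
    then show "(\<lambda>n. LINT x:U|lebesgue. (pd j (u (r n)) x - wpd U j f x)^2) \<longlonglongrightarrow> 0"
      using le0[OF Ele(2)[of _ j]] by (simp add: set_lint_restrict)
  qed
  then show ?thesis by blast
qed

lemma bdry_trace: "f \<in> Hk (Suc m) U \<Longrightarrow> is_bdry_trace U f (bdry_trace U f)"
  unfolding bdry_trace_def by (rule someI_ex[OF trace_exists])

lemma trace_approximation:
  assumes f: "f \<in> Hk (Suc m) U" and h: "is_bdry_trace U f h"
  shows "\<exists>u G. (\<forall>n. C1 U (u n) (G n)) \<and> L2lim MU u f \<and> (\<forall>j. L2lim MU (\<lambda>n x. G n x $ j) (wpd U j f)) \<and> L2lim MSg u h"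
proof -
  note hf = Hk_facts[OF f]
  obtain u where u: "\<forall>n. Ck_closure 1 U (u n)" "(\<lambda>n. LINT x:U|lebesgue. (u n x - f x)^2) \<longlonglongrightarrow> 0"
    "\<forall>j. (\<lambda>n. LINT x:U|lebesgue. (pd j (u n) x - wpd U j f x)^2) \<longlonglongrightarrow> 0"
    "(\<lambda>n. LINT x:S|\<sigma>. (u n x - h x)^2) \<longlonglongrightarrow> 0" "L2_on \<sigma> S h"
    using h unfolding is_bdry_trace_def by blast
  have "\<forall>n. \<exists>G. C1 U (u n) G"
  proof
    fix n
    have "Ck_closure (Suc 0) U (u n)" using u(1) by simp
    from Ck_closure_C1[OF this] show "\<exists>G. C1 U (u n) G" by blast
  qed
  then have "\<exists>G. \<forall>n. C1 U (u n) (G n)" by (rule choice)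
  then obtain G where G: "\<And>n. C1 U (u n) (G n)" by blast
  have c: "contc (u n)" "contc (\<lambda>x. G n x $ j)" for n j
    using G[of n] by (auto simp: C1_def intro!: continuous_intros)
  have 1: "L2lim MU u f" using u(2) hf(1) L2_closure[OF c(1)] by (simp add: L2lim_def set_lint_restrict)
  have 2: "L2lim MU (\<lambda>n x. G n x $ j) (wpd U j f)" for j
  proof -
    have e: "(LINT x:U|lebesgue. (pd j (u n) x - wpd U j f x)^2) = (LINT x:U|lebesgue. (G n x $ j - wpd U j f x)^2)" for n
      by (rule set_lebesgue_integral_cong) (auto simp: C1_pd[OF G])
    have "(\<lambda>n. LINT x:U|lebesgue. (G n x $ j - wpd U j f x)^2) \<longlonglongrightarrow> 0" using u(3)[rule_format, of j] by (simp only: e)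
    then show ?thesis using hf(3) L2_closure[OF c(2)] by (simp add: L2lim_def set_lint_restrict)
  qed
  have 3: "L2lim MSg u h" using u(4,5) L2_S[OF c(1)] by (simp add: L2lim_def set_lint_restrict L2_on_restrict)
  show ?thesis using G 1 2 3 by blast
qed

section \<open>The weighted energy inequality\<close>

text \<open>The divergence theorem for the components of \<open>\<psi> u^2 a\<close>.\<close>

lemma energy_identity:
  assumes \<psi>: "C1 U \<psi> d\<psi>" and u: "C1 U u G" and a: "\<And>j. C1 U (\<lambda>x. a x $ j) (A j)"
  shows "(LINT x|MU. 2 * \<psi> x * u x * (G x \<bullet> a x) + (u x)^2 * (\<psi> x * (\<Sum>j\<in>UNIV. A j x $ j) + d\<psi> x \<bullet> a x))
    = - (LINT x|MSg. \<psi> x * (u x)^2 * (a x \<bullet> nu x))"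
proof -
  have c: "contc \<psi>" "contc d\<psi>" "contc u" "contc G"
    "contc (\<lambda>x. a x $ j)" "contc (A j)" for j
    using assms by (auto simp: C1_def)
  let ?v = "\<lambda>j x. \<psi> x * (u x * u x) * a x $ j"
  let ?g = "\<lambda>j x. (\<psi> x * (u x * u x)) *\<^sub>R A j x + a x $ j *\<^sub>R (\<psi> x *\<^sub>R (u x *\<^sub>R G x + u x *\<^sub>R G x) + (u x * u x) *\<^sub>R d\<psi> x)"
  have C: "C1 U (?v j) (?g j)" for j by (intro C1_mult \<psi> u a)
  have i1: "integrable MU (\<lambda>x. ?g j x $ j)" for j
    by (simp only: set_integrable_restrict[symmetric] U_leb) (intro set_integrable_U continuous_intros c)
  have cv: "contc (\<lambda>x. ?v j x * nu x $ j)" for j by (intro continuous_intros c nu_cont)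
  have i2: "integrable MSg (\<lambda>x. ?v j x * nu x $ j)" for j
  proof -
    interpret finite_measure MSg by (rule MSg_finite)
    have "L2 MSg (\<lambda>x. 1)" by (simp add: L2_def)
    from L2_prod[OF L2_S[OF cv[of j]] this] show ?thesis by simp
  qed
  have "(LINT x|MU. 2 * \<psi> x * u x * (G x \<bullet> a x) + (u x)^2 * (\<psi> x * (\<Sum>j\<in>UNIV. A j x $ j) + d\<psi> x \<bullet> a x)) = (LINT x|MU. (\<Sum>j\<in>UNIV. ?g j x $ j))"
    by (rule bint_cong)
      (auto simp: inner_vec_def sum_3 power2_eq_square algebra_simps)
  also have "\<dots> = (\<Sum>j\<in>UNIV. LINT x|MU. ?g j x $ j)" by (rule bint_sum) (rule i1)
  also have "\<dots> = (\<Sum>j\<in>UNIV. - (LINT x|MSg. ?v j x * nu x $ j))"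
    using divergence_theorem[OF C] by (simp only: set_lint_restrict[OF U_leb] set_lint_restrict[OF S_sets\<sigma>])
  also have "\<dots> = - (LINT x|MSg. (\<Sum>j\<in>UNIV. ?v j x * nu x $ j))"
    by (subst bint_sum) (auto simp: sum_negf i2)
  also have "(LINT x|MSg. (\<Sum>j\<in>UNIV. ?v j x * nu x $ j)) = (LINT x|MSg. \<psi> x * (u x)^2 * (a x \<bullet> nu x))"
    by (rule bint_cong) (auto simp: inner_vec_def sum_3 power2_eq_square algebra_simps)
  finally show ?thesis .
qed

text \<open>The energy inequality, with \<open>D\<close> in the role of \<open>div a\<close>, is taken as a property of the field. It makes
  sense for fields that are only weakly differentiable and is stable under approximation of \<open>a\<close>.\<close>

definition admissible :: "(real^3 \<Rightarrow> real^3) \<Rightarrow> (real^3 \<Rightarrow> real) \<Rightarrow> (real^3) set \<Rightarrow> real \<Rightarrow> bool" where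
  "admissible a D \<Gamma> K \<longleftrightarrow> (\<forall>\<psi> d\<psi> u G. C1 U \<psi> d\<psi> \<longrightarrow> (\<forall>x\<in>closure U. \<psi> x \<ge> 0) \<longrightarrow> C1 U u G \<longrightarrow>
    (LINT x|MU. 2 * \<psi> x * u x * (G x \<bullet> a x) + (u x)^2 * (\<psi> x * D x + d\<psi> x \<bullet> a x)) \<le> K * (LINT x|MSg. indicator \<Gamma> x * (\<psi> x * (u x)^2)))"

lemma admissible_C1:
  assumes a: "\<And>j. C1 U (\<lambda>x. a x $ j) (A j)" and \<Gamma>: "\<Gamma> \<in> sets borel" and K: "K \<ge> 0" "\<And>x. x \<in> \<Gamma> \<Longrightarrow> x \<in> S \<Longrightarrow> norm (a x) \<le> K"
    and out: "\<And>x. x \<in> S - \<Gamma> \<Longrightarrow> a x \<bullet> nu x \<ge> 0"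
  shows "admissible a (\<lambda>x. \<Sum>j\<in>UNIV. A j x $ j) \<Gamma> K"
  unfolding admissible_def
proof (intro allI impI)
  fix \<psi> d\<psi> u G assume \<psi>: "C1 U \<psi> d\<psi>" "\<forall>x\<in>closure U. \<psi> x \<ge> 0" and u: "C1 U u G"
  have c: "contc \<psi>" "contc u" "contc (\<lambda>x. a x $ j)" for j
    using \<psi>(1) u a[of j] by (auto simp: C1_def)
  have ca: "contc a" using continuous_on_vec_lambda[of "closure U" "\<lambda>j x. a x $ j", OF c(3)] by (simp add: vec_lambda_eta)
  have int: "integrable MSg f" if f: "contc f" for f :: "real^3 \<Rightarrow> real"
  proof -
    interpret finite_measure MSg by (rule MSg_finite)
    have "L2 MSg (\<lambda>x. 1)" by (simp add: L2_def)
    from L2_prod[OF L2_S[OF f] this] show ?thesis by simp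
  qed
  have i1: "integrable MSg (\<lambda>x. \<psi> x * (u x)^2 * (a x \<bullet> nu x))" by (intro int continuous_intros c ca nu_cont)
  have i0: "integrable MSg (\<lambda>x. \<psi> x * (u x)^2)" by (intro int continuous_intros c)
  have \<Gamma>m: "S \<inter> \<Gamma> \<in> sets MSg" using \<Gamma> by (simp add: sets_restrict_space_iff)
  have i2: "integrable MSg (\<lambda>x. indicator \<Gamma> x * (\<psi> x * (u x)^2))"
  proof -
    have "integrable MSg (\<lambda>x. indicator (S \<inter> \<Gamma>) x *\<^sub>R (\<psi> x * (u x)^2))" by (rule integrable_mult_indicator[OF \<Gamma>m i0])
    then show ?thesis by (rule Bochner_Integration.integrable_cong[OF refl, THEN iffD1, rotated]) (auto simp: space_restrict_space indicator_def)
  qed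
  have "- (LINT x|MSg. \<psi> x * (u x)^2 * (a x \<bullet> nu x)) = (LINT x|MSg. - (\<psi> x * (u x)^2 * (a x \<bullet> nu x)))" by simp
  also have "\<dots> \<le> (LINT x|MSg. K * (indicator \<Gamma> x * (\<psi> x * (u x)^2)))"
  proof (rule integral_mono)
    fix x assume "x \<in> space MSg"
    then have x: "x \<in> S" "x \<in> closure U" using U_facts(6) by (auto simp: space_restrict_space)
    have p: "\<psi> x * (u x)^2 \<ge> 0" using \<psi>(2) x by simp
    show "- (\<psi> x * (u x)^2 * (a x \<bullet> nu x)) \<le> K * (indicator \<Gamma> x * (\<psi> x * (u x)^2))"
    proof (cases "x \<in> \<Gamma>")
      case True
      have "\<bar>a x \<bullet> nu x\<bar> \<le> norm (a x) * norm (nu x)" by (rule Cauchy_Schwarz_ineq2)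
      also have "\<dots> \<le> K * 1" using K(1) K(2)[OF True x(1)] nu_norm[OF x(2)] by (intro mult_mono) auto
      finally have "- (a x \<bullet> nu x) \<le> K" by simp
      from mult_left_mono[OF this p] show ?thesis using True by (simp add: mult_ac)
    next
      case False
      then have "a x \<bullet> nu x \<ge> 0" using out x(1) by blast
      then show ?thesis using p False by simp
    qed
  qed (use i1 i2 in auto)
  also have "\<dots> = K * (LINT x|MSg. indicator \<Gamma> x * (\<psi> x * (u x)^2))" by simp
  finally show "(LINT x|MU. 2 * \<psi> x * u x * (G x \<bullet> a x) + (u x)^2 * (\<psi> x * (\<Sum>j\<in>UNIV. A j x $ j) + d\<psi> x \<bullet> a x)) \<le> K * (LINT x|MSg. indicator \<Gamma> x * (\<psi> x * (u x)^2))"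
    unfolding energy_identity[OF \<psi>(1) u a] .
qed

text \<open>Weak convergence tested against continuous functions. Products of two \<open>L^2\<close> convergent sequences, such
  as the quadratic expressions in \<open>b\<close> and its derivatives below, converge in this sense.\<close>

definition weak_lim :: "(nat \<Rightarrow> real^3 \<Rightarrow> real) \<Rightarrow> (real^3 \<Rightarrow> real) \<Rightarrow> bool" where
  "weak_lim Us u \<longleftrightarrow> (\<forall>c. contc c \<longrightarrow> (\<forall>n. integrable MU (\<lambda>x. c x * Us n x)) \<and> integrable MU (\<lambda>x. c x * u x)
    \<and> (\<lambda>n. LINT x|MU. c x * Us n x) \<longlonglongrightarrow> (LINT x|MU. c x * u x))"

lemma weak_lim_add: "weak_lim Us u \<Longrightarrow> weak_lim V v \<Longrightarrow> weak_lim (\<lambda>n x. Us n x + V n x) (\<lambda>x. u x + v x)"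
  unfolding weak_lim_def by (auto simp: distrib_left intro!: tendsto_add)

lemma weak_lim_diff: "weak_lim Us u \<Longrightarrow> weak_lim V v \<Longrightarrow> weak_lim (\<lambda>n x. Us n x - V n x) (\<lambda>x. u x - v x)"
  unfolding weak_lim_def by (auto simp: right_diff_distrib intro!: tendsto_diff)

lemma weak_lim_mult:
  assumes "contc g" "weak_lim Us u"
  shows "weak_lim (\<lambda>n x. g x * Us n x) (\<lambda>x. g x * u x)"
  unfolding weak_lim_def
proof (intro allI impI)
  fix c :: "real^3 \<Rightarrow> real" assume "contc c"
  then have "contc (\<lambda>x. c x * g x)" using assms(1) by (intro continuous_intros)
  then show "(\<forall>n. integrable MU (\<lambda>x. c x * (g x * Us n x))) \<and> integrable MU (\<lambda>x. c x * (g x * u x))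
    \<and> (\<lambda>n. LINT x|MU. c x * (g x * Us n x)) \<longlonglongrightarrow> (LINT x|MU. c x * (g x * u x))"
    using assms(2) unfolding weak_lim_def mult.assoc[symmetric] by blast
qed

lemma weak_lim_sum: "finite I \<Longrightarrow> (\<And>i. i \<in> I \<Longrightarrow> weak_lim (Us i) (u i)) \<Longrightarrow> weak_lim (\<lambda>n x. \<Sum>i\<in>I. Us i n x) (\<lambda>x. \<Sum>i\<in>I. u i x)"
proof (induction I rule: finite_induct)
  case empty
  then show ?case by (simp add: weak_lim_def)
qed (auto intro: weak_lim_add)

lemma weak_lim_prod:
  assumes Us: "L2lim MU Us u" and V: "L2lim MU V v"
  shows "weak_lim (\<lambda>n x. Us n x * V n x) (\<lambda>x. u x * v x)"
  unfolding weak_lim_def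
proof (intro allI impI)
  fix c :: "real^3 \<Rightarrow> real" assume c: "contc c"
  obtain B where "\<And>x. x \<in> closure U \<Longrightarrow> \<bar>c x\<bar> \<le> B" using cont_bounded[OF c] by blast
  then have cU: "L2lim MU (\<lambda>n x. c x * Us n x) (\<lambda>x. c x * u x)" using closure_subset[of U]
    by (intro L2lim_bdd[OF Us meas_closure[OF c], of B] AE_I2) auto
  show "(\<forall>n. integrable MU (\<lambda>x. c x * (Us n x * V n x))) \<and> integrable MU (\<lambda>x. c x * (u x * v x))
    \<and> (\<lambda>n. LINT x|MU. c x * (Us n x * V n x)) \<longlonglongrightarrow> (LINT x|MU. c x * (u x * v x))"
    unfolding mult.assoc[symmetric]
    using cU V by (intro conjI allI L2lim_prod L2_prod) (auto simp: L2lim_def)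
qed

text \<open>The field \<open>b \<times> (\<delta> \<times> b)\<close>; it is orthogonal to \<open>b\<close>.\<close>

definition perp :: "(real^3 \<Rightarrow> real^3) \<Rightarrow> (real^3 \<Rightarrow> real^3) \<Rightarrow> real^3 \<Rightarrow> real^3" where
  "perp \<delta> b x = (b x \<bullet> b x) *\<^sub>R \<delta> x - (b x \<bullet> \<delta> x) *\<^sub>R b x"

text \<open>The divergence of \<open>perp\<close> by the product rule, where \<open>H i\<close> and \<open>B i\<close> are the gradients of the \<open>i\<close>-th
  components of \<open>\<delta>\<close> and \<open>b\<close>.\<close>

definition perp_div :: "(real^3 \<Rightarrow> real^3) \<Rightarrow> (3 \<Rightarrow> real^3 \<Rightarrow> real^3) \<Rightarrow> (real^3 \<Rightarrow> real^3) \<Rightarrow> (3 \<Rightarrow> real^3 \<Rightarrow> real^3) \<Rightarrow> real^3 \<Rightarrow> real" where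
  "perp_div \<delta> H b B x = (\<Sum>j\<in>UNIV. \<Sum>i\<in>UNIV. (2 * \<delta> x $ j) * (b x $ i * B i x $ j) + H j x $ j * (b x $ i * b x $ i)
      - (\<delta> x $ i * (b x $ j * B i x $ j) + H i x $ j * (b x $ i * b x $ j) + \<delta> x $ i * (b x $ i * B j x $ j)))"

lemma perp_nth: "perp \<delta> b x $ j = (\<Sum>i\<in>UNIV. \<delta> x $ j * (b x $ i * b x $ i) - \<delta> x $ i * (b x $ i * b x $ j))"
  by (simp add: perp_def inner_vec_def sum_3 algebra_simps)

text \<open>For smooth approximations \<open>b_n\<close> with the same bound as \<open>b\<close> the fields are \<open>C^1\<close> and uniformly bounded,
  so \<open>admissible_C1\<close> gives the inequality with one constant; field and divergence are quadratic in \<open>b_n\<close> and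
  its gradient and converge weakly.\<close>

lemma admissible_perp:
  assumes \<delta>: "\<And>i. C1 U (\<lambda>x. \<delta> x $ i) (H i)" and b: "\<And>i. (\<lambda>x. b x $ i) \<in> Hk (Suc m) U"
    and K0: "K0 \<ge> 0" "\<And>i. AE x in MU. \<bar>b x $ i\<bar> \<le> K0"
  shows "\<exists>K\<ge>0. admissible (perp \<delta> b) (perp_div \<delta> H b (\<lambda>i x. wgrad U (\<lambda>x. b x $ i) x)) S K"
proof -
  have "\<forall>i. \<exists>uG. (\<forall>n. C1 U (fst uG n) (snd uG n)) \<and> L2lim MU (fst uG) (\<lambda>x. b x $ i) \<and> (\<forall>j. L2lim MU (\<lambda>n x. snd uG n x $ j) (wpd U j (\<lambda>x. b x $ i))) \<and>
    (\<forall>n. \<forall>x\<in>closure U. \<bar>fst uG n x\<bar> \<le> K0)"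
  proof
    fix i
    obtain u G where "\<forall>n. C1 U (u n) (G n)" "L2lim MU u (\<lambda>x. b x $ i)" "\<forall>j. L2lim MU (\<lambda>n x. G n x $ j) (wpd U j (\<lambda>x. b x $ i))"
      "\<forall>B\<ge>0. (AE x in MU. \<bar>b x $ i\<bar> \<le> B) \<longrightarrow> (\<forall>n. \<forall>x\<in>closure U. \<bar>u n x\<bar> \<le> B)"
      using density[OF b[of i]] by blast
    then show "\<exists>uG. (\<forall>n. C1 U (fst uG n) (snd uG n)) \<and> L2lim MU (fst uG) (\<lambda>x. b x $ i) \<and> (\<forall>j. L2lim MU (\<lambda>n x. snd uG n x $ j) (wpd U j (\<lambda>x. b x $ i))) \<and>
      (\<forall>n. \<forall>x\<in>closure U. \<bar>fst uG n x\<bar> \<le> K0)"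
      using K0 by (intro exI[of _ "(u, G)"]) simp
  qed
  then have "\<exists>T. \<forall>i. (\<forall>n. C1 U (fst (T i) n) (snd (T i) n)) \<and> L2lim MU (fst (T i)) (\<lambda>x. b x $ i) \<and> (\<forall>j. L2lim MU (\<lambda>n x. snd (T i) n x $ j) (wpd U j (\<lambda>x. b x $ i))) \<and>
      (\<forall>n. \<forall>x\<in>closure U. \<bar>fst (T i) n x\<bar> \<le> K0)" by (rule choice)
  then obtain T where T: "\<And>i n. C1 U (fst (T i) n) (snd (T i) n)" "\<And>i. L2lim MU (fst (T i)) (\<lambda>x. b x $ i)"
    "\<And>i j. L2lim MU (\<lambda>n x. snd (T i) n x $ j) (wpd U j (\<lambda>x. b x $ i))" "\<And>i n x. x \<in> closure U \<Longrightarrow> \<bar>fst (T i) n x\<bar> \<le> K0"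
    by blast
  define bn where "bn n x = (\<chi> i. fst (T i) n x)" for n x
  define Bn where "Bn n i = snd (T i) n" for n i
  have bn: "C1 U (\<lambda>x. bn n x $ i) (Bn n i)" "L2lim MU (\<lambda>n x. bn n x $ i) (\<lambda>x. b x $ i)" "L2lim MU (\<lambda>n x. Bn n i x $ j) (\<lambda>x. wgrad U (\<lambda>x. b x $ i) x $ j)" for n i j
    using T by (simp_all add: bn_def Bn_def wgrad_def)
  have dc: "contc (\<lambda>x. \<delta> x $ i)" "contc (H i)" for i using \<delta> by (auto simp: C1_def)
  have Hc: "contc (\<lambda>x. H i x $ j)" for i j by (intro continuous_intros dc)
  let ?B = "\<lambda>i x. wgrad U (\<lambda>x. b x $ i) x"
  have wa: "weak_lim (\<lambda>n x. perp \<delta> (bn n) x $ j) (\<lambda>x. perp \<delta> b x $ j)" for j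
    unfolding perp_nth by (intro weak_lim_sum weak_lim_diff weak_lim_mult weak_lim_prod bn dc) simp
  have wd: "weak_lim (\<lambda>n. perp_div \<delta> H (bn n) (Bn n)) (perp_div \<delta> H b ?B)"
    unfolding perp_div_def[abs_def] by (intro weak_lim_sum weak_lim_diff weak_lim_add weak_lim_mult weak_lim_prod bn dc Hc continuous_intros) simp_all
  have "bounded (\<delta> ` closure U)"
  proof -
    have "contc \<delta>" using continuous_on_vec_lambda[of "closure U" "\<lambda>j x. \<delta> x $ j", OF dc(1)] by (simp add: vec_lambda_eta)
    then show ?thesis by (intro compact_imp_bounded compact_continuous_image U_facts)
  qed
  then obtain Kd where Kd: "\<And>x. x \<in> closure U \<Longrightarrow> norm (\<delta> x) \<le> Kd" unfolding bounded_iff by blast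
  have Kd0: "Kd \<ge> 0"
  proof -
    obtain x where "x \<in> closure U" using U_facts(3) closure_subset by blast
    from Kd[OF this] show ?thesis using norm_ge_zero order_trans by blast
  qed
  define K where "K = 2 * (3 * K0)^2 * Kd"
  have K: "K \<ge> 0" using Kd0 by (simp add: K_def)
  have an: "norm (perp \<delta> (bn n) x) \<le> K" if x: "x \<in> closure U" for n x
  proof -
    have "norm (bn n x) \<le> (\<Sum>i\<in>UNIV. \<bar>bn n x $ i\<bar>)" by (rule norm_le_l1_cart)
    also have "\<dots> \<le> 3 * K0" using T(4)[OF x, of 1 n] T(4)[OF x, of 2 n] T(4)[OF x, of 3 n] by (simp add: sum_3 bn_def)
    finally have n: "norm (bn n x) \<le> 3 * K0" .
    have "norm (perp \<delta> (bn n) x) \<le> norm ((bn n x \<bullet> bn n x) *\<^sub>R \<delta> x) + norm ((bn n x \<bullet> \<delta> x) *\<^sub>R bn n x)"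
      unfolding perp_def by (rule norm_triangle_ineq4)
    also have "\<dots> \<le> (norm (bn n x) * norm (bn n x)) * norm (\<delta> x) + (norm (bn n x) * norm (\<delta> x)) * norm (bn n x)"
      unfolding norm_scaleR by (intro add_mono mult_right_mono Cauchy_Schwarz_ineq2) auto
    also have "\<dots> = 2 * (norm (bn n x))^2 * norm (\<delta> x)" by (simp add: power2_eq_square)
    also have "\<dots> \<le> 2 * (3 * K0)^2 * Kd" using n Kd[OF x] Kd0 K0 by (intro mult_mono power_mono) auto
    finally show ?thesis by (simp add: K_def)
  qed
  have aC: "\<exists>A. (\<forall>j. C1 U (\<lambda>x. perp \<delta> (bn n) x $ j) (A j)) \<and> (\<forall>x. (\<Sum>j\<in>UNIV. A j x $ j) = perp_div \<delta> H (bn n) (Bn n) x)" for n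
  proof (intro exI conjI allI)
    let ?b = "\<lambda>i x. bn n x $ i"
    let ?A = "\<lambda>j x. \<Sum>i\<in>UNIV. (\<delta> x $ j *\<^sub>R (?b i x *\<^sub>R Bn n i x + ?b i x *\<^sub>R Bn n i x) + (?b i x * ?b i x) *\<^sub>R H j x)
      + ((- 1) *\<^sub>R (\<delta> x $ i *\<^sub>R (?b i x *\<^sub>R Bn n j x + ?b j x *\<^sub>R Bn n i x) + (?b i x * ?b j x) *\<^sub>R H i x) + (\<delta> x $ i * (?b i x * ?b j x)) *\<^sub>R 0)"
    show "C1 U (\<lambda>x. perp \<delta> (bn n) x $ j) (?A j)" for j
    proof -
      have "C1 U (\<lambda>x. \<Sum>i\<in>UNIV. \<delta> x $ j * (?b i x * ?b i x) + (- 1) * (\<delta> x $ i * (?b i x * ?b j x))) (?A j)"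
        by (intro C1_sum C1_add C1_mult C1_const \<delta> bn) simp
      then show ?thesis by (simp add: perp_nth)
    qed
    show "(\<Sum>j\<in>UNIV. ?A j x $ j) = perp_div \<delta> H (bn n) (Bn n) x" for x
      unfolding perp_div_def sum_component by (intro sum.cong refl) (simp add: algebra_simps)
  qed
  show ?thesis
  proof (intro exI conjI)
    show "K \<ge> 0" by (rule K)
    show "admissible (perp \<delta> b) (perp_div \<delta> H b ?B) S K"
      unfolding admissible_def
    proof (intro allI impI)
      fix \<psi> d\<psi> u G assume \<psi>: "C1 U \<psi> d\<psi>" "\<forall>x\<in>closure U. \<psi> x \<ge> 0" and u: "C1 U u G"
      have c: "contc \<psi>" "contc d\<psi>" "contc u" "contc G"
        using \<psi>(1) u by (auto simp: C1_def)
      let ?I = "\<lambda>a D x. 2 * \<psi> x * u x * (G x \<bullet> a x) + (u x)^2 * (\<psi> x * D x + d\<psi> x \<bullet> a x)"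
      let ?J = "\<lambda>a D x. (\<Sum>j\<in>UNIV. (2 * \<psi> x * u x * G x $ j + (u x)^2 * d\<psi> x $ j) * a x $ j) + ((u x)^2 * \<psi> x) * D x"
      have IJ: "?I a D x = 1 * ?J a D x" for a :: "real^3 \<Rightarrow> real^3" and D x
        by (simp add: inner_vec_def sum_3 algebra_simps)
      have "weak_lim (\<lambda>n x. ?J (perp \<delta> (bn n)) (perp_div \<delta> H (bn n) (Bn n)) x) (\<lambda>x. ?J (perp \<delta> b) (perp_div \<delta> H b ?B) x)"
        by (intro weak_lim_add weak_lim_sum weak_lim_mult wa wd continuous_intros c) simp
      from this[unfolded weak_lim_def, rule_format, OF continuous_on_const[of _ 1]]
      have lim: "(\<lambda>n. LINT x|MU. ?I (perp \<delta> (bn n)) (perp_div \<delta> H (bn n) (Bn n)) x) \<longlonglongrightarrow> (LINT x|MU. ?I (perp \<delta> b) (perp_div \<delta> H b ?B) x)"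
        unfolding IJ by (elim conjE)
      have le: "(LINT x|MU. ?I (perp \<delta> (bn n)) (perp_div \<delta> H (bn n) (Bn n)) x) \<le> K * (LINT x|MSg. indicator S x * (\<psi> x * (u x)^2))" for n
      proof -
        obtain A where A: "\<forall>j. C1 U (\<lambda>x. perp \<delta> (bn n) x $ j) (A j)" "\<forall>x. (\<Sum>j\<in>UNIV. A j x $ j) = perp_div \<delta> H (bn n) (Bn n) x"
          using aC[of n] by (elim exE conjE)
        have "admissible (perp \<delta> (bn n)) (\<lambda>x. \<Sum>j\<in>UNIV. A j x $ j) S K"
          by (rule admissible_C1[OF A(1)[rule_format] S_borel K]) (use an U_facts(6) in auto)
        then show ?thesis using \<psi> u unfolding admissible_def A(2)[rule_format] by blast
      qed
      show "(LINT x|MU. ?I (perp \<delta> b) (perp_div \<delta> H b ?B) x) \<le> K * (LINT x|MSg. indicator S x * (\<psi> x * (u x)^2))"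
        by (rule LIMSEQ_le_const2[OF lim]) (use le in blast)
    qed
  qed
qed

text \<open>All terms are quadratic in \<open>f\<close> and its gradient with bounded coefficients, so the inequality passes to
  the limit along smooth functions that converge in \<open>H^1\<close> together with their boundary values.\<close>

lemma admissible_H1:
  assumes adm: "admissible a D \<Gamma> K" and \<Gamma>: "\<Gamma> \<in> sets borel"
    and a: "\<And>j. (\<lambda>x. a x $ j) \<in> borel_measurable MU" "\<And>j. AE x in MU. \<bar>a x $ j\<bar> \<le> Ka"
    and D: "D \<in> borel_measurable MU" "AE x in MU. \<bar>D x\<bar> \<le> KD"
    and \<psi>: "C1 U \<psi> d\<psi>" "\<And>x. x \<in> closure U \<Longrightarrow> \<psi> x \<ge> 0"
    and f: "f \<in> Hk (Suc m) U"
  shows "(LINT x|MU. 2 * \<psi> x * f x * (wgrad U f x \<bullet> a x) + (f x)^2 * (\<psi> x * D x + d\<psi> x \<bullet> a x))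
    \<le> K * (LINT x|MSg. indicator \<Gamma> x * (\<psi> x * (bdry_trace U f x)^2))"
    "integrable MU (\<lambda>x. 2 * \<psi> x * f x * (wgrad U f x \<bullet> a x) + (f x)^2 * (\<psi> x * D x + d\<psi> x \<bullet> a x))"
proof -
  let ?h = "bdry_trace U f"
  obtain u G where u: "\<And>n. C1 U (u n) (G n)" "L2lim MU u f" "\<And>j. L2lim MU (\<lambda>n x. G n x $ j) (wpd U j f)" "L2lim MSg u ?h"
    using trace_approximation[OF f bdry_trace[OF f]] by blast
  have c: "contc \<psi>" "contc (\<lambda>x. d\<psi> x $ j)" for j
    using \<psi>(1) by (auto simp: C1_def intro!: continuous_intros)
  have cl: "x \<in> U \<Longrightarrow> x \<in> closure U" for x using closure_subset by blast
  have bc: "\<exists>B. AE x in MU. \<bar>g x\<bar> \<le> B" if g: "contc g" for g :: "real^3 \<Rightarrow> real"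
  proof -
    obtain B where "\<And>x. x \<in> closure U \<Longrightarrow> \<bar>g x\<bar> \<le> B" using cont_bounded[OF g] by blast
    then have "AE x in MU. \<bar>g x\<bar> \<le> B" using cl by (intro AE_I2) simp
    then show ?thesis by blast
  qed
  have bm: "\<exists>B. AE x in MU. \<bar>g x * h x\<bar> \<le> B" if gh: "\<exists>B. AE x in MU. \<bar>g x\<bar> \<le> B" "\<exists>B. AE x in MU. \<bar>h x\<bar> \<le> B" for g h :: "real^3 \<Rightarrow> real"
  proof -
    obtain B1 B2 where "AE x in MU. \<bar>g x\<bar> \<le> B1" "AE x in MU. \<bar>h x\<bar> \<le> B2" using gh by blast
    then have "AE x in MU. \<bar>g x * h x\<bar> \<le> B1 * B2"
      by eventually_elim (auto simp: abs_mult intro: mult_mono)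
    then show ?thesis by blast
  qed
  have mc: "\<psi> \<in> borel_measurable MU" "(\<lambda>x. d\<psi> x $ j) \<in> borel_measurable MU" for j by (intro meas_closure c)+
  have Lb: "L2lim MU (\<lambda>n x. g x * Us n x) (\<lambda>x. g x * v x)" if "L2lim MU Us v" "g \<in> borel_measurable MU" "\<exists>B. AE x in MU. \<bar>g x\<bar> \<le> B" for g Us v
    using that L2lim_bdd by blast
  have b1: "\<exists>B. AE x in MU. \<bar>a x $ j\<bar> \<le> B" "\<exists>B. AE x in MU. \<bar>D x\<bar> \<le> B" for j using a D by blast+
  let ?I = "\<lambda>u G x. 2 * \<psi> x * u x * (G x \<bullet> a x) + (u x)^2 * (\<psi> x * D x + d\<psi> x \<bullet> a x)"
  let ?J = "\<lambda>u G x. (\<Sum>j\<in>UNIV. (2 * (u x * ((\<psi> x * a x $ j) * G x $ j))) + u x * ((d\<psi> x $ j * a x $ j) * u x)) + u x * ((\<psi> x * D x) * u x)"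
  have IJ: "?I u G = ?J u G" for u :: "real^3 \<Rightarrow> real" and G :: "real^3 \<Rightarrow> real^3"
    by (rule ext) (simp add: inner_vec_def sum_3 power2_eq_square algebra_simps)
  have t1: "L2lim MU (\<lambda>n x. (\<psi> x * a x $ j) * G n x $ j) (\<lambda>x. (\<psi> x * a x $ j) * wgrad U f x $ j)" for j
    using u(3) by (intro Lb bm bc b1 c borel_measurable_times mc a) (simp add: wgrad_def)
  have t2: "L2lim MU (\<lambda>n x. (d\<psi> x $ j * a x $ j) * u n x) (\<lambda>x. (d\<psi> x $ j * a x $ j) * f x)" for j
    by (intro Lb bm bc b1 c borel_measurable_times mc a u)
  have t3: "L2lim MU (\<lambda>n x. (\<psi> x * D x) * u n x) (\<lambda>x. (\<psi> x * D x) * f x)"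
    by (intro Lb bm bc b1 c borel_measurable_times mc D u)
  have sU: "L2 MU (u n)" "L2 MU f" for n using u(2) by (simp_all add: L2lim_def)
  have sl: "L2 MU (V n)" "L2 MU v" if "L2lim MU V v" for V v n using that by (simp_all add: L2lim_def)
  have iJ: "integrable MU (?J (u n) (G n))" "integrable MU (?J f (wgrad U f))" for n
    by (intro bintegrable_add bintegrable_sum bintegrable_mult L2_prod sU sl[OF t1] sl[OF t2] sl[OF t3])+
  have split: "(LINT x|MU. ?J w V x) = (\<Sum>j\<in>UNIV. 2 * (LINT x|MU. w x * ((\<psi> x * a x $ j) * V x $ j)) + (LINT x|MU. w x * ((d\<psi> x $ j * a x $ j) * w x))) + (LINT x|MU. w x * ((\<psi> x * D x) * w x))"
    if "L2 MU w" "\<And>j. L2 MU (\<lambda>x. (\<psi> x * a x $ j) * V x $ j)" "\<And>j. L2 MU (\<lambda>x. (d\<psi> x $ j * a x $ j) * w x)" "L2 MU (\<lambda>x. (\<psi> x * D x) * w x)" for w V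
  proof -
    have i: "integrable MU (\<lambda>x. w x * ((\<psi> x * a x $ j) * V x $ j))" "integrable MU (\<lambda>x. w x * ((d\<psi> x $ j * a x $ j) * w x))" "integrable MU (\<lambda>x. w x * ((\<psi> x * D x) * w x))" for j
      by (intro L2_prod that)+
    have i2: "integrable MU (\<lambda>x. 2 * (w x * ((\<psi> x * a x $ j) * V x $ j)))" for j by (intro bintegrable_mult i)
    have "(LINT x|MU. ?J w V x) = (LINT x|MU. (\<Sum>j\<in>UNIV. (2 * (w x * ((\<psi> x * a x $ j) * V x $ j))) + w x * ((d\<psi> x $ j * a x $ j) * w x))) + (LINT x|MU. w x * ((\<psi> x * D x) * w x))"
      by (intro bint_add bintegrable_sum bintegrable_add i i2)
    also have "(LINT x|MU. (\<Sum>j\<in>UNIV. (2 * (w x * ((\<psi> x * a x $ j) * V x $ j))) + w x * ((d\<psi> x $ j * a x $ j) * w x)))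
       = (\<Sum>j\<in>UNIV. LINT x|MU. (2 * (w x * ((\<psi> x * a x $ j) * V x $ j))) + w x * ((d\<psi> x $ j * a x $ j) * w x))"
      by (intro bint_sum bintegrable_add i i2)
    also have "\<dots> = (\<Sum>j\<in>UNIV. 2 * (LINT x|MU. w x * ((\<psi> x * a x $ j) * V x $ j)) + (LINT x|MU. w x * ((d\<psi> x $ j * a x $ j) * w x)))"
      by (intro sum.cong refl) (simp only: bint_add[OF i2 i(2)] integral_mult_right_zero)
    finally show ?thesis .
  qed
  have lim: "(\<lambda>n. LINT x|MU. ?J (u n) (G n) x) \<longlonglongrightarrow> (LINT x|MU. ?J f (wgrad U f) x)"
    unfolding split[OF sU(1) sl(1)[OF t1] sl(1)[OF t2] sl(1)[OF t3]] split[OF sU(2) sl(2)[OF t1] sl(2)[OF t2] sl(2)[OF t3]]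
    by (intro tendsto_intros L2lim_prod u t1 t2 t3)
  have limS: "(\<lambda>n. K * (LINT x|MSg. indicator \<Gamma> x * (\<psi> x * (u n x)^2))) \<longlonglongrightarrow> K * (LINT x|MSg. indicator \<Gamma> x * (\<psi> x * (?h x)^2))"
  proof -
    obtain B where B: "\<And>x. x \<in> closure U \<Longrightarrow> \<bar>\<psi> x\<bar> \<le> B" using cont_bounded[OF c(1)] by blast
    have "(\<lambda>x. indicator \<Gamma> x :: real) \<in> borel_measurable MSg"
      using \<Gamma> by (intro measurable_restrict_space1) (simp cong: measurable_cong_sets)
    moreover have "\<psi> \<in> borel_measurable MSg" using L2_S[OF c(1)] by (simp add: L2_def)
    ultimately have m: "(\<lambda>x. indicator \<Gamma> x * \<psi> x) \<in> borel_measurable MSg" by (rule borel_measurable_times)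
    have "AE x in MSg. \<bar>indicator \<Gamma> x * \<psi> x\<bar> \<le> B"
    proof (rule AE_I2)
      fix x assume "x \<in> space MSg"
      then have "x \<in> closure U" using U_facts(6) by (auto simp: space_restrict_space)
      then show "\<bar>indicator \<Gamma> x * \<psi> x\<bar> \<le> B" using B[of x] by (auto simp: indicator_def)
    qed
    from L2lim_prod[OF u(4) L2lim_bdd[OF u(4) m this]]
    show ?thesis by (intro tendsto_mult_left) (simp add: power2_eq_square mult_ac)
  qed
  have le: "(LINT x|MU. ?J (u n) (G n) x) \<le> K * (LINT x|MSg. indicator \<Gamma> x * (\<psi> x * (u n x)^2))" for n
  proof -
    have "(LINT x|MU. ?I (u n) (G n) x) \<le> K * (LINT x|MSg. indicator \<Gamma> x * (\<psi> x * (u n x)^2))"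
      by (rule adm[unfolded admissible_def, rule_format, OF \<psi> u(1)])
    then show ?thesis unfolding IJ .
  qed
  show "(LINT x|MU. ?I f (wgrad U f) x) \<le> K * (LINT x|MSg. indicator \<Gamma> x * (\<psi> x * (?h x)^2))"
    unfolding IJ by (rule LIMSEQ_le[OF lim limS]) (use le in blast)
  show "integrable MU (?I f (wgrad U f))" unfolding IJ by (rule iJ(2))
qed

end

section \<open>Second weak derivatives and bounded coefficients\<close>

text \<open>The second difference of \<open>\<phi>\<close> over a small square equals the mixed derivative at an intermediate point,
  by the mean value theorem in either order.\<close>

lemma pd_symmetric:
  fixes \<phi> :: "real^'n::finite \<Rightarrow> real"
  assumes s: "smooth UNIV \<phi>"
  shows "pd i (pd j \<phi>) x = pd j (pd i \<phi>) x"
proof -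
  have C2: "Ck 2 UNIV \<phi>" using s by (simp add: smooth_def)
  have d0: "\<phi> differentiable at y" for y using C2 by (simp add: numeral_2_eq_2)
  have d1: "pd a \<phi> differentiable at y" for a y using C2 by (simp add: numeral_2_eq_2)
  have c2: "continuous_on UNIV (pd a (pd b \<phi>))" for a b using C2 by (simp add: numeral_2_eq_2)
  have line: "((\<lambda>s. u (z + s *\<^sub>R axis a 1)) has_real_derivative pd a u (z + s *\<^sub>R axis a 1)) (at s)"
    if "\<And>y. u differentiable at y" for u :: "real^'n \<Rightarrow> real" and z a s
  proof -
    have "(u has_derivative (\<lambda>h. h \<bullet> (\<chi> j. pd j u (z + s *\<^sub>R axis a 1)))) (at (z + s *\<^sub>R axis a 1))"
      using gderiv_pd[OF that] by (simp add: gderiv_def)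
    then have "((\<lambda>s. u (z + s *\<^sub>R axis a 1)) has_derivative (\<lambda>t. (t *\<^sub>R axis a 1) \<bullet> (\<chi> j. pd j u (z + s *\<^sub>R axis a 1)))) (at s)"
      by (intro has_derivative_compose[of "\<lambda>s. z + s *\<^sub>R axis a 1" _ s UNIV u, simplified]) (auto intro!: derivative_eq_intros)
    then show ?thesis unfolding has_field_derivative_def
      by (rule has_derivative_eq_rhs) (auto simp: inner_axis' mult.commute)
  qed
  define \<Delta> where "\<Delta> a b t = \<phi> (x + t *\<^sub>R axis a 1 + t *\<^sub>R axis b 1) - \<phi> (x + t *\<^sub>R axis a 1) - \<phi> (x + t *\<^sub>R axis b 1) + \<phi> x" for a b t
  have key: "\<exists>\<xi> \<eta>. 0 < \<xi> \<and> \<xi> < t \<and> 0 < \<eta> \<and> \<eta> < t \<and> \<Delta> a b t = t * t * pd b (pd a \<phi>) (x + \<xi> *\<^sub>R axis a 1 + \<eta> *\<^sub>R axis b 1)"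
    if t: "t > 0" for t a b
  proof -
    let ?f = "\<lambda>s. \<phi> (x + t *\<^sub>R axis b 1 + s *\<^sub>R axis a 1) - \<phi> (x + s *\<^sub>R axis a 1)"
    have "\<exists>\<xi>>0. \<xi> < t \<and> ?f t - ?f 0 = (t - 0) * (pd a \<phi> (x + t *\<^sub>R axis b 1 + \<xi> *\<^sub>R axis a 1) - pd a \<phi> (x + \<xi> *\<^sub>R axis a 1))"
      by (rule MVT2[OF t]) (intro DERIV_diff line d0)
    then obtain \<xi> where \<xi>: "0 < \<xi>" "\<xi> < t" "?f t - ?f 0 = t * (pd a \<phi> (x + t *\<^sub>R axis b 1 + \<xi> *\<^sub>R axis a 1) - pd a \<phi> (x + \<xi> *\<^sub>R axis a 1))"
      by auto
    let ?g = "\<lambda>s. pd a \<phi> (x + \<xi> *\<^sub>R axis a 1 + s *\<^sub>R axis b 1)"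
    have "\<exists>\<eta>>0. \<eta> < t \<and> ?g t - ?g 0 = (t - 0) * pd b (pd a \<phi>) (x + \<xi> *\<^sub>R axis a 1 + \<eta> *\<^sub>R axis b 1)"
      by (rule MVT2[OF t]) (intro line d1)
    then obtain \<eta> where \<eta>: "0 < \<eta>" "\<eta> < t" "?g t - ?g 0 = t * pd b (pd a \<phi>) (x + \<xi> *\<^sub>R axis a 1 + \<eta> *\<^sub>R axis b 1)"
      by auto
    have "x + t *\<^sub>R axis b 1 + \<xi> *\<^sub>R axis a 1 = x + \<xi> *\<^sub>R axis a 1 + t *\<^sub>R axis b 1"
      "x + t *\<^sub>R axis b 1 + t *\<^sub>R axis a 1 = x + t *\<^sub>R axis a 1 + t *\<^sub>R axis b 1" by (simp_all add: add_ac)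
    note c = this
    have "\<Delta> a b t = ?f t - ?f 0" by (simp add: \<Delta>_def c(2))
    also have "\<dots> = t * (?g t - ?g 0)" unfolding \<xi>(3) c(1) by simp
    also have "\<dots> = t * t * pd b (pd a \<phi>) (x + \<xi> *\<^sub>R axis a 1 + \<eta> *\<^sub>R axis b 1)" unfolding \<eta>(3) by simp
    finally show ?thesis using \<xi>(1,2) \<eta>(1,2) by blast
  qed
  define t where "t n = 1 / real (Suc n)" for n
  have t: "t n > 0" for n by (simp add: t_def)
  have tl: "t \<longlonglongrightarrow> 0" unfolding t_def[abs_def] using LIMSEQ_inverse_real_of_nat by (simp add: inverse_eq_divide)
  have lim: "(\<lambda>n. \<Delta> a b (t n) / (t n * t n)) \<longlonglongrightarrow> pd b (pd a \<phi>) x" for a b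
  proof -
    let ?p = "\<lambda>z. x + fst z *\<^sub>R axis a 1 + snd z *\<^sub>R axis b 1"
    let ?R = "\<lambda>n z. 0 < fst z \<and> fst z < t n \<and> 0 < snd z \<and> snd z < t n \<and> \<Delta> a b (t n) = t n * t n * pd b (pd a \<phi>) (?p z)"
    have "\<forall>n. \<exists>z. ?R n z"
    proof
      fix n
      obtain \<xi> \<eta> where "0 < \<xi> \<and> \<xi> < t n \<and> 0 < \<eta> \<and> \<eta> < t n \<and> \<Delta> a b (t n) = t n * t n * pd b (pd a \<phi>) (x + \<xi> *\<^sub>R axis a 1 + \<eta> *\<^sub>R axis b 1)"
        using key[OF t[of n], of a b] by blast
      then show "\<exists>z. ?R n z" by (intro exI[of _ "(\<xi>, \<eta>)"]) simp
    qed
    from choice[OF this] obtain z where z: "\<And>n. ?R n (z n)" by blast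
    have l1: "(\<lambda>n. fst (z n)) \<longlonglongrightarrow> 0" "(\<lambda>n. snd (z n)) \<longlonglongrightarrow> 0"
      by (rule tendsto_sandwich[OF always_eventually always_eventually tendsto_const tl]; use z less_imp_le in blast)+
    have "(\<lambda>n. ?p (z n)) \<longlonglongrightarrow> x + 0 *\<^sub>R axis a 1 + 0 *\<^sub>R axis b 1" by (intro tendsto_intros l1)
    then have "(\<lambda>n. ?p (z n)) \<longlonglongrightarrow> x" by simp
    from continuous_on_tendsto_compose[OF c2[of b a] this]
    have "(\<lambda>n. pd b (pd a \<phi>) (?p (z n))) \<longlonglongrightarrow> pd b (pd a \<phi>) x" by simp
    moreover have "\<Delta> a b (t n) / (t n * t n) = pd b (pd a \<phi>) (?p (z n))" for n
      using z[of n] t[of n] by simp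
    ultimately show ?thesis by simp
  qed
  have "\<Delta> i j = \<Delta> j i" by (simp add: fun_eq_iff \<Delta>_def add_ac)
  then show ?thesis using LIMSEQ_unique[OF lim[of j i]] lim[of i j] by simp
qed

lemma test_fun_pd: assumes t: "test_fun Us \<phi>" shows "test_fun Us (pd j \<phi>)"
proof -
  have "{x. pd j \<phi> x \<noteq> 0} \<subseteq> closure {x. \<phi> x \<noteq> 0}" using test_fun_bdd(4)[OF t] by blast
  then have s: "closure {x. pd j \<phi> x \<noteq> 0} \<subseteq> closure {x. \<phi> x \<noteq> 0}" by (rule closure_minimal) simp
  have sm: "Ck (Suc k) UNIV \<phi>" for k using t unfolding test_fun_def smooth_def by blast
  have "smooth UNIV (pd j \<phi>)"
    unfolding smooth_def
  proof
    show "Ck k UNIV (pd j \<phi>)" for k using sm[of k] by simp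
  qed
  moreover have "compact (closure {x. pd j \<phi> x \<noteq> 0})"
    using t s unfolding test_fun_def compact_eq_bounded_closed by (blast intro: bounded_subset closed_closure)
  ultimately show ?thesis using t s unfolding test_fun_def by blast
qed

context atlas
begin

lemma L2_integrable: "L2 MU u \<Longrightarrow> integrable MU u"
proof -
  interpret finite_measure MU by (rule MU_finite)
  show "L2 MU u \<Longrightarrow> integrable MU u" using L2_prod[of MU u "\<lambda>x. 1"] by (simp add: L2_def)
qed

lemma Hk_cong_AE:
  assumes f: "f \<in> Hk k U" and fg: "AE x in MU. f x = g x" and g: "L2 MU g"
  shows "g \<in> Hk k U"
proof (cases k)
  case 0
  then show ?thesis using g by (simp add: Hk_def L2_on_restrict)
next
  case (Suc m)
  have "integrable MU g" by (rule L2_integrable[OF g])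
  then have "\<exists>v. is_wpd U j g v \<and> v \<in> Hk m U" for j
    using f is_wpd_cong_AE[OF _ fg] unfolding Suc Hk_Suc by blast
  then show ?thesis using g unfolding Suc Hk_Suc by (simp add: L2_on_restrict)
qed

lemma wpd_Hk: assumes f: "f \<in> Hk (Suc k) U" shows "wpd U j f \<in> Hk k U"
proof -
  obtain v where v: "is_wpd U j f v" "v \<in> Hk k U" "AE x in MU. wpd U j f x = v x"
    using Hk_facts(4)[OF f] by blast
  have "AE x in MU. v x = wpd U j f x" using v(3) by eventually_elim simp
  then show ?thesis by (rule Hk_cong_AE[OF v(2) _ Hk_facts(3)[OF f]])
qed

text \<open>Both orders of differentiation are moved onto the test function, where they commute.\<close>

lemma wpd_symmetric:
  assumes g: "g \<in> Hk (Suc (Suc k)) U"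
  shows "AE x in MU. wpd U i (wpd U j g) x = wpd U j (wpd U i g) x"
proof (rule wpd_AE_MU)
  have h: "is_wpd U a (wpd U b g) (wpd U a (wpd U b g))" for a b by (rule Hk_facts(2)[OF wpd_Hk[OF g]])
  have e: "(LINT x:U|lebesgue. wpd U a (wpd U b g) x * \<phi> x) = (LINT x:U|lebesgue. g x * pd b (pd a \<phi>) x)" if t: "test_fun U \<phi>" for a b \<phi>
  proof -
    have "(LINT x:U|lebesgue. wpd U b g x * pd a \<phi> x) = - (LINT x:U|lebesgue. wpd U a (wpd U b g) x * \<phi> x)"
      using h t unfolding is_wpd_def by blast
    moreover have "(LINT x:U|lebesgue. g x * pd b (pd a \<phi>) x) = - (LINT x:U|lebesgue. wpd U b g x * pd a \<phi> x)"
      using Hk_facts(2)[OF g, of b] test_fun_pd[OF t] unfolding is_wpd_def by blast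
    ultimately show ?thesis by linarith
  qed
  show "is_wpd U i (wpd U j g) (wpd U j (wpd U i g))"
    unfolding is_wpd_def
  proof (intro conjI allI impI)
    show "locally_integrable U (wpd U j g)" "locally_integrable U (wpd U j (wpd U i g))"
      using h unfolding is_wpd_def by blast+
    fix \<phi> assume t: "test_fun U \<phi>"
    have sm: "smooth UNIV \<phi>" using t by (simp add: test_fun_def)
    have "(LINT x:U|lebesgue. wpd U j g x * pd i \<phi> x) = - (LINT x:U|lebesgue. wpd U i (wpd U j g) x * \<phi> x)"
      using h t unfolding is_wpd_def by blast
    also have "\<dots> = - (LINT x:U|lebesgue. wpd U j (wpd U i g) x * \<phi> x)"
      unfolding e[OF t] pd_symmetric[OF sm, of j i] ..
    finally show "(LINT x:U|lebesgue. wpd U j g x * pd i \<phi> x) = - (LINT x:U|lebesgue. wpd U j (wpd U i g) x * \<phi> x)" .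
  qed
qed

lemma Linf_bound: "Linf_on lebesgue U u \<Longrightarrow> u \<in> borel_measurable MU \<and> (\<exists>B\<ge>0. AE x in MU. \<bar>u x\<bar> \<le> B)"
proof -
  assume u: "Linf_on lebesgue U u"
  then obtain B where "AE x in lebesgue. x \<in> U \<longrightarrow> \<bar>u x\<bar> \<le> B" by (auto simp: Linf_on_def)
  then have "AE x in MU. \<bar>u x\<bar> \<le> B" by (simp add: AE_restrict)
  then have "AE x in MU. \<bar>u x\<bar> \<le> max B 0" by eventually_elim simp
  moreover have "u \<in> borel_measurable MU"
    using u by (simp add: Linf_on_def set_borel_measurable_def borel_measurable_restrict_space_iff)
  ultimately show ?thesis by (intro conjI exI[of _ "max B 0"]) auto
qed

lemma Winf_Suc: "u \<in> Wk_inf (Suc k) U \<longleftrightarrow> Linf_on lebesgue U u \<and> (\<forall>j. \<exists>v. is_wpd U j u v \<and> v \<in> Wk_inf k U)"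
  by (simp add: Wk_inf_def)

lemma Winf_bound: "u \<in> Wk_inf k U \<Longrightarrow> u \<in> borel_measurable MU \<and> (\<exists>B\<ge>0. AE x in MU. \<bar>u x\<bar> \<le> B)"
  by (rule Linf_bound) (cases k; simp add: Wk_inf_def)

lemma Winf_Hk: "u \<in> Wk_inf k U \<Longrightarrow> u \<in> Hk k U"
proof (induction k arbitrary: u)
  case 0
  obtain B where "AE x in MU. \<bar>u x\<bar> \<le> B" "u \<in> borel_measurable MU" using Winf_bound[OF 0] by blast
  then show ?case using L2_bounded_finite[OF MU_finite] by (auto simp: Hk_def L2_on_restrict)
next
  case (Suc k)
  obtain B where "AE x in MU. \<bar>u x\<bar> \<le> B" "u \<in> borel_measurable MU" using Winf_bound[OF Suc.prems] by blast
  then have "L2_on lebesgue U u" using L2_bounded_finite[OF MU_finite] by (auto simp: L2_on_restrict)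
  then show ?case using Suc.prems Suc.IH unfolding Hk_Suc Winf_Suc by blast
qed

lemma Winf_wpd:
  assumes u: "u \<in> Wk_inf (Suc k) U"
  shows "\<exists>B\<ge>0. AE x in MU. \<bar>wpd U j u x\<bar> \<le> B"
proof -
  obtain v where v: "is_wpd U j u v" "v \<in> Wk_inf k U" using u unfolding Winf_Suc by blast
  obtain B where B: "B \<ge> 0" "AE x in MU. \<bar>v x\<bar> \<le> B" using Winf_bound[OF v(2)] by blast
  have "AE x in MU. \<bar>wpd U j u x\<bar> \<le> B" using B(2) wpd_AE_MU[OF v(1)] by eventually_elim simp
  then show ?thesis using B(1) by blast
qed

lemma Winf_wpd2:
  assumes u: "u \<in> Wk_inf (Suc (Suc k)) U"
  shows "\<exists>B\<ge>0. AE x in MU. \<bar>wpd U i (wpd U j u) x\<bar> \<le> B"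
proof -
  obtain v where v: "is_wpd U j u v" "v \<in> Wk_inf (Suc k) U" using u unfolding Winf_Suc by blast
  obtain z where z: "is_wpd U i v z" "z \<in> Wk_inf k U" using v(2) unfolding Winf_Suc[of v] by blast
  have ae: "AE x in MU. v x = wpd U j u x" using wpd_AE_MU[OF v(1)] by eventually_elim simp
  have s: "L2 MU (wpd U j u)" by (rule Hk_facts(3)[OF Winf_Hk[OF u]])
  have "integrable MU (wpd U j u)" by (rule L2_integrable[OF s])
  from is_wpd_cong_AE[OF z(1) ae this] have "is_wpd U i (wpd U j u) z" .
  from wpd_AE_MU[OF this] have e: "AE x in MU. wpd U i (wpd U j u) x = z x" .
  obtain B where B: "B \<ge> 0" "AE x in MU. \<bar>z x\<bar> \<le> B" using Winf_bound[OF z(2)] by blast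
  have "AE x in MU. \<bar>wpd U i (wpd U j u) x\<bar> \<le> B" using B(2) e by eventually_elim simp
  then show ?thesis using B(1) by blast
qed

section \<open>The Carleman estimate for a transport operator\<close>

text \<open>The weight \<open>\<psi>\<close> has the logarithmic gradient \<open>\<kappa> \<delta>\<close>. From \<open>\<kappa> (a \<bullet> \<delta>) \<ge> c0 \<theta>\<close> one quarter of \<open>c0 \<theta>\<close> pays
  for the divergence \<open>D\<close> and another quarter for the mixed term by Young's inequality; one half remains.\<close>

lemma transport_general:
  assumes adm: "admissible a D \<Gamma> K" and \<Gamma>: "\<Gamma> \<in> sets borel"
    and a: "\<And>j. (\<lambda>x. a x $ j) \<in> borel_measurable MU" "\<And>j. AE x in MU. \<bar>a x $ j\<bar> \<le> Ka"
    and D: "D \<in> borel_measurable MU" "AE x in MU. \<bar>D x\<bar> \<le> KD"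
    and c0: "c0 > 0" "AE x in MU. a x \<bullet> \<delta> x \<ge> c0"
    and \<psi>: "C1 U \<psi> (\<lambda>x. (\<psi> x * \<kappa> x) *\<^sub>R \<delta> x)" "\<And>x. x \<in> closure U \<Longrightarrow> \<psi> x \<ge> 0"
    and \<theta>: "contc \<theta>" "\<And>x. x \<in> closure U \<Longrightarrow> \<theta> x > 0" "\<And>x. x \<in> closure U \<Longrightarrow> \<theta> x \<ge> 4 * KD / c0" "\<And>x. x \<in> closure U \<Longrightarrow> \<kappa> x \<ge> \<theta> x"
    and f: "f \<in> Hk (Suc m) U"
  shows "c0 / 2 * (LINT x|MU. \<psi> x * \<theta> x * (f x)^2) \<le> 4 / c0 * (LINT x|MU. \<psi> x / \<theta> x * (wgrad U f x \<bullet> a x)^2)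
    + K * (LINT x|MSg. indicator \<Gamma> x * (\<psi> x * (bdry_trace U f x)^2))"
proof -
  note hf = Hk_facts[OF f]
  note H = admissible_H1[OF adm \<Gamma> a D \<psi> f]
  have \<psi>c: "contc \<psi>" using \<psi>(1) by (simp add: C1_def)
  have wt: "integrable MU (\<lambda>x. w x * (v x)^2)" if w: "contc w" and v: "L2 MU v" for w v
  proof -
    obtain B where "\<And>x. x \<in> closure U \<Longrightarrow> \<bar>w x\<bar> \<le> B" using cont_bounded[OF w] by blast
    then have "L2 MU (\<lambda>x. w x * v x)" using closure_subset[of U]
      by (intro L2_bdd[OF v meas_closure[OF w], of B] AE_I2) auto
    from L2_prod[OF this v] show ?thesis by (simp add: power2_eq_square mult.assoc)
  qed
  have ga: "L2 MU (\<lambda>x. wgrad U f x \<bullet> a x)"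
  proof -
    have "L2 MU (\<lambda>x. \<Sum>j\<in>UNIV. a x $ j * wpd U j f x)"
      by (intro L2_sum L2_bdd[OF hf(3) a]) simp
    then show ?thesis by (simp add: wgrad_def inner_vec_def mult.commute)
  qed
  have nz: "x \<in> closure U \<Longrightarrow> \<theta> x \<noteq> 0" for x using \<theta>(2)[of x] by simp
  have i1: "integrable MU (\<lambda>x. \<psi> x * \<theta> x * (f x)^2)" by (intro wt continuous_intros \<psi>c \<theta> hf)
  have i2: "integrable MU (\<lambda>x. \<psi> x / \<theta> x * (wgrad U f x \<bullet> a x)^2)" by (intro wt continuous_intros \<psi>c \<theta> ga) (use nz in blast)
  have i1': "integrable MU (\<lambda>x. c0 / 2 * (\<psi> x * \<theta> x * (f x)^2))" "integrable MU (\<lambda>x. 4 / c0 * (\<psi> x / \<theta> x * (wgrad U f x \<bullet> a x)^2))"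
    by (intro bintegrable_mult i1 i2)+
  let ?I = "\<lambda>x. 2 * \<psi> x * f x * (wgrad U f x \<bullet> a x) + (f x)^2 * (\<psi> x * D x + (\<psi> x * \<kappa> x) *\<^sub>R \<delta> x \<bullet> a x)"
  have "c0 / 2 * (LINT x|MU. \<psi> x * \<theta> x * (f x)^2) - 4 / c0 * (LINT x|MU. \<psi> x / \<theta> x * (wgrad U f x \<bullet> a x)^2)
     = (LINT x|MU. c0 / 2 * (\<psi> x * \<theta> x * (f x)^2) - 4 / c0 * (\<psi> x / \<theta> x * (wgrad U f x \<bullet> a x)^2))"
    unfolding integral_mult_right_zero[symmetric] by (rule Bochner_Integration.integral_diff[symmetric]) (rule i1')+
  also have "\<dots> \<le> (LINT x|MU. ?I x)"
  proof (rule integral_mono_AE)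
    have "AE x in MU. x \<in> closure U" using closure_subset[of U] by (intro AE_I2) auto
    then show "AE x in MU. c0 / 2 * (\<psi> x * \<theta> x * (f x)^2) - 4 / c0 * (\<psi> x / \<theta> x * (wgrad U f x \<bullet> a x)^2) \<le> ?I x"
      using D(2) c0(2)
    proof eventually_elim
      case (elim x)
      let ?X = "wgrad U f x \<bullet> a x"
      have t: "\<theta> x > 0" and p: "\<psi> x \<ge> 0" using \<theta>(2) \<psi>(2) elim(1) by auto
      have "0 \<le> (c0 / 4 * \<theta> x) * (f x + 4 / (c0 * \<theta> x) * ?X)^2" using c0(1) t by simp
      also have "\<dots> = c0 / 4 * \<theta> x * (f x)^2 + 2 * f x * ?X + 4 / c0 * (?X^2 / \<theta> x)"
        using c0(1) t by (simp add: power2_eq_square field_simps)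
      finally have y: "2 * f x * ?X \<ge> - (c0 / 4 * \<theta> x * (f x)^2) - 4 / c0 * (?X^2 / \<theta> x)" by linarith
      have "- D x \<le> KD" using elim(2) by simp
      also have "KD \<le> c0 / 4 * \<theta> x" using \<theta>(3)[OF elim(1)] c0(1) by (simp add: field_simps)
      finally have "(f x)^2 * (- D x) \<le> (f x)^2 * (c0 / 4 * \<theta> x)" by (rule mult_left_mono) simp
      then have d: "(f x)^2 * D x \<ge> - (c0 / 4 * \<theta> x * (f x)^2)" by (simp add: mult_ac)
      have "\<theta> x * c0 \<le> \<kappa> x * (a x \<bullet> \<delta> x)" using \<theta>(4)[OF elim(1)] t elim(3) c0(1) by (intro mult_mono) auto
      then have k: "(f x)^2 * (\<theta> x * c0) \<le> (f x)^2 * (\<kappa> x * (a x \<bullet> \<delta> x))" by (rule mult_left_mono) simp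
      have "c0 / 2 * \<theta> x * (f x)^2 - 4 / c0 * (?X^2 / \<theta> x) \<le> 2 * f x * ?X + (f x)^2 * D x + (f x)^2 * (\<kappa> x * (a x \<bullet> \<delta> x))"
        using y d k by (simp add: mult_ac)
      from mult_left_mono[OF this p]
      show ?case by (simp add: algebra_simps inner_commute)
    qed
  qed (use i1' H(2) in auto)
  also have "\<dots> \<le> K * (LINT x|MSg. indicator \<Gamma> x * (\<psi> x * (bdry_trace U f x)^2))" by (rule H(1))
  finally show ?thesis by linarith
qed

end

text \<open>The large parameter \<open>\<theta> = s \<lambda> \<phi>_0\<close> of the estimates.\<close>

definition lpar :: "real \<Rightarrow> real \<Rightarrow> (real^3 \<Rightarrow> real) \<Rightarrow> real^3 \<Rightarrow> real" where "lpar s l d x = s * l * phi0 l d x"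
definition wgt :: "real \<Rightarrow> real \<Rightarrow> (real^3 \<Rightarrow> real) \<Rightarrow> real^3 \<Rightarrow> real" where "wgt s l d x = exp (2 * s * phi0 l d x)"

lemma wgt_pos: "wgt s l d x > 0" by (simp add: wgt_def)

lemma lpar_ge:
  assumes "s \<ge> 1" "l \<ge> 1" "d x \<ge> 0"
  shows "lpar s l d x \<ge> l" "lpar s l d x \<ge> 1"
proof -
  have "phi0 l d x \<ge> 1" using assms by (simp add: phi0_def)
  then have "l * phi0 l d x \<ge> l * 1" using assms by (intro mult_left_mono) auto
  then have "1 * l \<le> s * (l * phi0 l d x)" using assms by (intro mult_mono) auto
  then show "lpar s l d x \<ge> l" by (simp add: lpar_def mult.assoc)
  then show "lpar s l d x \<ge> 1" using assms by linarith
qed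

context atlas
begin

lemma weighted_integrable_U:
  assumes w: "contc w" and v: "L2 MU v"
  shows "integrable MU (\<lambda>x. w x * (v x)^2)"
proof -
  obtain B where "\<And>x. x \<in> closure U \<Longrightarrow> \<bar>w x\<bar> \<le> B" using cont_bounded[OF w] by blast
  then have "L2 MU (\<lambda>x. w x * v x)" using closure_subset[of U]
    by (intro L2_bdd[OF v meas_closure[OF w], of B] AE_I2) auto
  from L2_prod[OF this v] show ?thesis by (simp add: power2_eq_square mult.assoc)
qed

lemma weighted_integrable_S:
  assumes w: "contc w" and v: "L2 MSg v"
  shows "integrable MSg (\<lambda>x. w x * (v x)^2)"
proof -
  obtain B where B: "\<And>x. x \<in> closure U \<Longrightarrow> \<bar>w x\<bar> \<le> B" using cont_bounded[OF w] by blast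
  have "AE x in MSg. x \<in> S" by (rule AE_I2) simp
  then have "AE x in MSg. \<bar>w x\<bar> \<le> B" by eventually_elim (use B in \<open>simp add: frontier_def\<close>)
  moreover have "w \<in> borel_measurable MSg" using L2_S[OF w] by (simp add: L2_def)
  ultimately have "L2 MSg (\<lambda>x. w x * v x)" by (intro L2_bdd[OF v, of _ B])
  from L2_prod[OF this v] show ?thesis by (simp add: power2_eq_square mult.assoc)
qed

text \<open>\<open>transport_general\<close> with the weights \<open>\<psi> = \<theta> e\<close>, where \<open>\<kappa> = 2 \<theta> + \<lambda>\<close>, and \<open>\<psi> = e / \<theta>\<close>, where \<open>\<kappa> = 2 \<theta> -
  \<lambda>\<close>; here \<open>e\<close> is the exponential weight.\<close>

lemma transport_estimate:
  assumes adm: "admissible a D \<Gamma> K" and \<Gamma>: "\<Gamma> \<in> sets borel" and K: "K \<ge> 0"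
    and a: "\<And>j. (\<lambda>x. a x $ j) \<in> borel_measurable MU" "\<And>j. AE x in MU. \<bar>a x $ j\<bar> \<le> Ka"
    and D: "D \<in> borel_measurable MU" "AE x in MU. \<bar>D x\<bar> \<le> KD"
    and c0: "c0 > 0" "AE x in MU. a x \<bullet> \<delta> x \<ge> c0"
    and d: "C1 U d \<delta>" "\<forall>x\<in>closure U. d x \<ge> 0"
  shows "\<exists>l0\<ge>1. \<exists>C>0. (\<forall>l\<ge>l0. \<forall>s\<ge>1. \<forall>m. \<forall>f\<in>Hk (Suc m) U.
    (LINT x|MU. (lpar s l d x)^2 * wgt s l d x * (f x)^2) \<le> C * (LINT x|MU. wgt s l d x * (wgrad U f x \<bullet> a x)^2)
       + C * (LINT x|MSg. indicator \<Gamma> x * (lpar s l d x * wgt s l d x * (bdry_trace U f x)^2))) \<and>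
    (\<forall>l\<ge>l0. \<forall>s\<ge>1. \<forall>m. \<forall>f\<in>Hk (Suc m) U.
    (LINT x|MU. wgt s l d x * (f x)^2) \<le> C * (LINT x|MU. wgt s l d x / (lpar s l d x)^2 * (wgrad U f x \<bullet> a x)^2)
       + C * (LINT x|MSg. indicator \<Gamma> x * (wgt s l d x / lpar s l d x * (bdry_trace U f x)^2)))"
    (is "\<exists>l0\<ge>1. \<exists>C>0. (\<forall>l\<ge>l0. \<forall>s\<ge>1. \<forall>m. \<forall>f\<in>_ m. ?L1 s l f \<le> C * ?R1 s l f + C * ?B1 s l f) \<and> (\<forall>l\<ge>l0. \<forall>s\<ge>1. \<forall>m. \<forall>f\<in>_ m. ?L2 s l f \<le> C * ?R2 s l f + C * ?B2 s l f)")
proof -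
  \<comment> \<open>both terms of \<open>transport_general\<close>, divided by \<open>c0 / 2\<close>\<close>
  define C where "C = 8 / c0^2 + 2 * K / c0"
  have C: "C > 0" "8 / c0^2 \<le> C" "2 * K / c0 \<le> C" using c0(1) K by (auto simp: C_def intro!: add_pos_nonneg)
  have scale: "X \<le> C * Y + C * Z" if h: "c0 / 2 * X \<le> 4 / c0 * Y + K * Z" and "Y \<ge> 0" "Z \<ge> 0" for X Y Z
  proof -
    have "2 / c0 * (c0 / 2 * X) \<le> 2 / c0 * (4 / c0 * Y + K * Z)" using h c0(1) by (intro mult_left_mono) auto
    then have "X \<le> 8 / c0^2 * Y + 2 * K / c0 * Z" using c0(1) by (simp add: power2_eq_square distrib_left)
    also have "\<dots> \<le> C * Y + C * Z" using C that by (intro add_mono mult_right_mono) auto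
    finally show ?thesis .
  qed
  have dc: "contc d" using d(1) by (simp add: C1_def)
  have main: "?L1 s l f \<le> C * ?R1 s l f + C * ?B1 s l f \<and> ?L2 s l f \<le> C * ?R2 s l f + C * ?B2 s l f"
    if l: "l \<ge> max 1 (4 * KD / c0)" and s: "s \<ge> 1" and f: "f \<in> Hk (Suc m) U" for l s m f
  proof -
    let ?\<theta> = "lpar s l d" let ?e = "wgt s l d"
    have l1: "l \<ge> 1" "l \<ge> 4 * KD / c0" using l by auto
    have \<theta>: "?\<theta> x \<ge> l" "?\<theta> x > 0" "?\<theta> x \<ge> 4 * KD / c0" if "x \<in> closure U" for x
      using lpar_ge[of s l d x, OF s l1(1) d(2)[rule_format, OF that]] l1 by linarith+
    have \<theta>c: "contc ?\<theta>" unfolding lpar_def[abs_def] phi0_def by (intro continuous_intros dc)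
    have pos: "lpar s l d x > 0" for x using s l1 by (simp add: lpar_def phi0_def)
    let ?g1 = "\<lambda>t. s * l * exp (l * t) * exp (2 * s * exp (l * t))"
    let ?g2 = "\<lambda>t. exp (2 * s * exp (l * t)) / (s * l * exp (l * t))"
    have "C1 U (\<lambda>x. ?g1 (d x)) (\<lambda>x. (\<lambda>t. ?g1 t * (l + 2 * (s * l * exp (l * t)))) (d x) *\<^sub>R \<delta> x)"
      by (intro C1_compose[OF d(1)] continuous_intros) (auto intro!: derivative_eq_intros simp: algebra_simps)
    then have p1: "C1 U (\<lambda>x. ?\<theta> x * ?e x) (\<lambda>x. ((?\<theta> x * ?e x) * (l + 2 * ?\<theta> x)) *\<^sub>R \<delta> x)"
      by (simp add: lpar_def wgt_def phi0_def)
    have "C1 U (\<lambda>x. ?g2 (d x)) (\<lambda>x. (\<lambda>t. ?g2 t * (- l + 2 * (s * l * exp (l * t)))) (d x) *\<^sub>R \<delta> x)"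
      using s l1 by (intro C1_compose[OF d(1)] continuous_intros) (auto intro!: derivative_eq_intros simp: field_simps power2_eq_square)
    then have p2: "C1 U (\<lambda>x. ?e x / ?\<theta> x) (\<lambda>x. ((?e x / ?\<theta> x) * (- l + 2 * ?\<theta> x)) *\<^sub>R \<delta> x)"
      by (simp add: lpar_def wgt_def phi0_def)
    have I1: "c0 / 2 * (LINT x|MU. ?\<theta> x * ?e x * ?\<theta> x * (f x)^2) \<le> 4 / c0 * (LINT x|MU. ?\<theta> x * ?e x / ?\<theta> x * (wgrad U f x \<bullet> a x)^2)
      + K * (LINT x|MSg. indicator \<Gamma> x * (?\<theta> x * ?e x * (bdry_trace U f x)^2))"
    proof (rule transport_general[OF adm \<Gamma> a D c0 p1 _ \<theta>c \<theta>(2,3) _ f])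
      fix x assume x: "x \<in> closure U"
      show "0 \<le> ?\<theta> x * ?e x" using wgt_pos[of s l d x] \<theta>(2)[OF x] by simp
      show "?\<theta> x \<le> l + 2 * ?\<theta> x" using \<theta>(2)[OF x] l1 by linarith
    qed
    have I2: "c0 / 2 * (LINT x|MU. ?e x / ?\<theta> x * ?\<theta> x * (f x)^2) \<le> 4 / c0 * (LINT x|MU. ?e x / ?\<theta> x / ?\<theta> x * (wgrad U f x \<bullet> a x)^2)
      + K * (LINT x|MSg. indicator \<Gamma> x * (?e x / ?\<theta> x * (bdry_trace U f x)^2))"
    proof (rule transport_general[OF adm \<Gamma> a D c0 p2 _ \<theta>c \<theta>(2,3) _ f])
      fix x assume x: "x \<in> closure U"
      show "0 \<le> ?e x / ?\<theta> x" using wgt_pos[of s l d x] \<theta>(2)[OF x] by simp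
      show "?\<theta> x \<le> - l + 2 * ?\<theta> x" using \<theta>(1)[OF x] by linarith
    qed
    have nz: "lpar s l d x \<noteq> 0" for x using pos[of x] by simp
    have e: "?\<theta> x * ?e x * ?\<theta> x = (?\<theta> x)^2 * ?e x" "?\<theta> x * ?e x / ?\<theta> x = ?e x" "?e x / ?\<theta> x * ?\<theta> x = ?e x" "?e x / ?\<theta> x / ?\<theta> x = ?e x / (?\<theta> x)^2" for x
      using nz[of x] by (simp_all add: power2_eq_square mult_ac)
    have en: "?e x \<ge> 0" "?\<theta> x \<ge> 0" for x using wgt_pos[of s l d x] pos[of x] by auto
    show ?thesis
      using I1 I2 unfolding e
      by (intro conjI scale) (auto intro!: bint_nonneg mult_nonneg_nonneg divide_nonneg_nonneg en)
  qed
  show ?thesis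
    by (rule exI[of _ "max 1 (4 * KD / c0)"], rule conjI, simp, rule exI[of _ C], rule conjI, rule C(1),
        rule conjI, intro allI impI ballI, rule main[THEN conjunct1], assumption+,
        intro allI impI ballI, rule main[THEN conjunct2])
qed

end

lemma norm_vec_sq: "(norm (x :: 'a::real_normed_vector^'n::finite))^2 = (\<Sum>i\<in>UNIV. (norm (x $ i))^2)"
  by (simp add: norm_vec_def L2_set_def sum_nonneg)

lemma weighted_mono:
  assumes "integrable M (\<lambda>x. w x * p x)" "integrable M (\<lambda>x. w x * q x)" "integrable M (\<lambda>x. w x * r x)"
    and w: "AE x in M. w x \<ge> (0::real)" and le: "AE x in M. p x \<le> c * (q x + r x)"
  shows "(LINT x|M. w x * p x) \<le> c * ((LINT x|M. w x * q x) + (LINT x|M. w x * r x))"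
proof -
  have "(LINT x|M. w x * p x) \<le> (LINT x|M. c * (w x * q x + w x * r x))"
  proof (rule integral_mono_AE)
    show "AE x in M. w x * p x \<le> c * (w x * q x + w x * r x)"
      using w le
    proof eventually_elim
      case (elim x)
      have "w x * p x \<le> w x * (c * (q x + r x))" by (rule mult_left_mono[OF elim(2,1)])
      then show ?case by (simp add: algebra_simps)
    qed
  qed (intro assms bintegrable_mult bintegrable_add)+
  also have "\<dots> = c * ((LINT x|M. w x * q x) + (LINT x|M. w x * r x))"
    using assms(2,3) by simp
  finally show ?thesis .
qed

lemma AE_bound_finite:
  fixes u :: "'i::finite \<Rightarrow> 'a \<Rightarrow> real"
  assumes "\<And>i. \<exists>B\<ge>0. AE x in M. \<bar>u i x\<bar> \<le> B"
  shows "\<exists>B\<ge>0. AE x in M. \<forall>i. \<bar>u i x\<bar> \<le> B"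
proof -
  have "\<forall>i. \<exists>B. B \<ge> 0 \<and> (AE x in M. \<bar>u i x\<bar> \<le> B)" using assms by blast
  from choice[OF this] obtain B where B: "\<And>i. B i \<ge> 0" "\<And>i. AE x in M. \<bar>u i x\<bar> \<le> B i" by blast
  have le: "B i \<le> sum B UNIV" for i by (rule member_le_sum) (auto simp: B)
  have "AE x in M. \<forall>i\<in>UNIV. \<bar>u i x\<bar> \<le> sum B UNIV"
  proof (rule AE_finite_allI)
    show "AE x in M. \<bar>u i x\<bar> \<le> sum B UNIV" for i using B(2)[of i] by eventually_elim (use le[of i] in linarith)
  qed simp
  then show ?thesis by (intro exI[of _ "sum B UNIV"] conjI sum_nonneg) (auto simp: B)
qed

lemma compact_pos_bound:
  fixes u :: "'a::topological_space \<Rightarrow> real"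
  assumes "compact S" "S \<noteq> {}" "continuous_on S u" "\<And>x. x \<in> S \<Longrightarrow> u x > 0"
  shows "\<exists>c>0. \<forall>x\<in>S. u x \<ge> c"
  using continuous_attains_inf[OF assms(1-3)] assms(4) by blast

text \<open>Compactness of the product of \<open>S\<close> with the unit sphere.\<close>

lemma matrix_lower_bound:
  fixes A :: "'a::topological_space \<Rightarrow> real^'n::finite^'n"
  assumes S: "compact S" "S \<noteq> {}" and A: "continuous_on S A" "\<And>x. x \<in> S \<Longrightarrow> det (A x) \<noteq> 0"
  shows "\<exists>c>0. \<forall>x\<in>S. \<forall>v. c * norm v \<le> norm (A x *v v)"
proof -
  have "continuous_on (S \<times> sphere 0 1) (\<lambda>z. A (fst z) *v snd z)"
    unfolding matrix_vector_mult_def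
    by (intro continuous_intros continuous_on_compose2[OF A(1)]) auto
  then have c: "continuous_on (S \<times> sphere 0 1) (\<lambda>z. norm (A (fst z) *v snd z))" by (rule continuous_on_norm)
  have ne: "S \<times> sphere (0::real^'n) 1 \<noteq> {}" using S(2) by simp
  have pos: "norm (A (fst z) *v snd z) > 0" if z: "z \<in> S \<times> sphere 0 1" for z
  proof -
    have "invertible (A (fst z))" using A(2)[of "fst z"] z unfolding invertible_det_nz by auto
    then have "inj ((*v) (A (fst z)))" by (simp add: inj_matrix_vector_mult)
    moreover have "snd z \<noteq> 0" using z by auto
    ultimately have "A (fst z) *v snd z \<noteq> 0" using injD[of "(*v) (A (fst z))" "snd z" 0] by auto
    then show ?thesis by simp
  qed
  obtain k where k: "k > 0" "\<forall>z\<in>S \<times> sphere 0 1. norm (A (fst z) *v snd z) \<ge> k"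
    using compact_pos_bound[OF compact_Times[OF S(1) compact_sphere] ne c pos] by blast
  have "k * norm v \<le> norm (A x *v v)" if x: "x \<in> S" for x v
  proof (cases "v = 0")
    case False
    have "k \<le> norm (A x *v ((1 / norm v) *\<^sub>R v))" using k(2)[rule_format, of "(x, (1 / norm v) *\<^sub>R v)"] x False by simp
    also have "\<dots> = norm (A x *v v) / norm v" by (simp add: matrix_vector_mult_scaleR)
    finally show ?thesis using False by (simp add: field_simps)
  qed simp
  then show ?thesis using k(1) by blast
qed

section \<open>The two differential operators\<close>

context atlas
begin

lemma Hk_mult_Winf:
  assumes f: "f \<in> Hk (Suc m) U" and w: "w \<in> Wk_inf (Suc l) U"
  shows "(\<lambda>x. f x * w x) \<in> Hk (Suc 0) U"
    "is_wpd U j (\<lambda>x. f x * w x) (\<lambda>x. f x * wpd U j w x + wpd U j f x * w x)"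
proof -
  note hf = Hk_facts[OF f] and hw = Hk_facts[OF Winf_Hk[OF w]]
  obtain B where B: "AE x in MU. \<bar>w x\<bar> \<le> B" "w \<in> borel_measurable MU" using Winf_bound[OF w] by blast
  have s: "L2 MU (\<lambda>x. u x * w x)" if "L2 MU u" for u using L2_bdd[OF that B(2,1)] by (simp add: mult.commute)
  have s': "L2 MU (\<lambda>x. f x * wpd U j w x)" for j
  proof -
    obtain B' where B': "AE x in MU. \<bar>wpd U j w x\<bar> \<le> B'" using Winf_wpd[OF w] by blast
    show ?thesis using L2_bdd[OF hf(1) _ B'] hw(3)[of j] by (simp add: mult.commute L2_def)
  qed
  show p: "is_wpd U j (\<lambda>x. f x * w x) (\<lambda>x. f x * wpd U j w x + wpd U j f x * w x)" for j
    by (rule product_rule[OF f Winf_Hk[OF w]])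
  have "L2 MU (\<lambda>x. f x * wpd U j w x + wpd U j f x * w x)" for j
    by (intro L2_add s s' hf)
  then have "\<exists>v. is_wpd U j (\<lambda>x. f x * w x) v \<and> v \<in> Hk 0 U" for j
    using p[of j] by (intro exI conjI) (auto simp: Hk_def L2_on_restrict)
  then show "(\<lambda>x. f x * w x) \<in> Hk (Suc 0) U" unfolding Hk_Suc using s[OF hf(1)] by (simp add: L2_on_restrict)
qed

lemma weighted_integrable_norm:
  assumes w: "contc w" and V: "\<And>i. L2 MU (\<lambda>x. V x $ i)"
  shows "integrable MU (\<lambda>x. w x * (norm (V x :: real^'n::finite))^2)"
  unfolding norm_vec_sq sum_distrib_left real_norm_def power2_abs
  by (intro bintegrable_sum weighted_integrable_U[OF w] V)

lemma weight_setup: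
  assumes d: "Ck_closure 2 U d" "\<forall>x\<in>U. d x > 0"
  shows "\<exists>\<delta> H. C1 U d \<delta> \<and> (\<forall>i. C1 U (\<lambda>x. \<delta> x $ i) (H i)) \<and> (\<forall>x\<in>closure U. d x \<ge> 0 \<and> grad_closure U d x = \<delta> x)"
proof -
  have "Ck_closure (Suc 1) U d" using d(1) by (simp add: numeral_2_eq_2)
  from Ck_closure_C1[OF this] obtain \<delta> where \<delta>: "C1 U d \<delta>" "\<And>j. Ck_closure 1 U (\<lambda>x. \<delta> x $ j)" by blast
  have "\<forall>i. \<exists>G. C1 U (\<lambda>x. \<delta> x $ i) G"
  proof
    fix i have "Ck_closure (Suc 0) U (\<lambda>x. \<delta> x $ i)" using \<delta>(2) by simp
    from Ck_closure_C1[OF this] show "\<exists>G. C1 U (\<lambda>x. \<delta> x $ i) G" by blast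
  qed
  from choice[OF this] obtain H where H: "\<forall>i. C1 U (\<lambda>x. \<delta> x $ i) (H i)" by blast
  have "d x \<ge> 0" if "x \<in> closure U" for x
  proof (rule continuous_ge_on_closure[OF _ that])
    show "contc d" using \<delta>(1) by (simp add: C1_def)
  qed (use d(2) in \<open>auto intro: less_imp_le\<close>)
  then show ?thesis using \<delta>(1) H grad_closure_C1[OF \<delta>(1) U_facts(1)] by (intro exI conjI) auto
qed

lemma weights_cont:
  assumes d: "contc d"
  shows "contc (wgt s l d)" "contc (lpar s l d)"
  unfolding lpar_def[abs_def] wgt_def[abs_def] phi0_def by (intro continuous_intros d)+

text \<open>Since \<open>\<theta> \<ge> \<lambda>\<close>, lower-order terms carry a factor \<open>\<lambda>^{-2}\<close> and can be absorbed.\<close>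

lemma weights_compare:
  assumes d: "contc d" "\<And>x. x \<in> closure U \<Longrightarrow> d x \<ge> 0" and sl: "s \<ge> 1" "l \<ge> 1"
    and v: "\<And>w. contc w \<Longrightarrow> integrable MU (\<lambda>x. w x * v x)" "\<And>x. v x \<ge> 0"
  shows "l^2 * (LINT x|MU. wgt s l d x * v x) \<le> (LINT x|MU. (lpar s l d x)^2 * wgt s l d x * v x)"
    "l^2 * (LINT x|MU. wgt s l d x / (lpar s l d x)^2 * v x) \<le> (LINT x|MU. wgt s l d x * v x)"
proof -
  have ae: "AE x in MU. x \<in> closure U" using closure_subset[of U] by (intro AE_I2) auto
  have nz: "lpar s l d x \<noteq> 0" for x using sl by (simp add: lpar_def phi0_def)
  have le: "l^2 \<le> (lpar s l d x)^2" if "x \<in> closure U" for x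
    using lpar_ge[of s l d x, OF sl d(2)[OF that]] sl by (intro power_mono) auto
  have i: "integrable MU (\<lambda>x. wgt s l d x * v x)" "integrable MU (\<lambda>x. (lpar s l d x)^2 * wgt s l d x * v x)"
    "integrable MU (\<lambda>x. wgt s l d x / (lpar s l d x)^2 * v x)"
    using nz by (intro v(1) continuous_intros weights_cont d; simp)+
  show "l^2 * (LINT x|MU. wgt s l d x * v x) \<le> (LINT x|MU. (lpar s l d x)^2 * wgt s l d x * v x)"
    unfolding integral_mult_right_zero[symmetric]
  proof (rule integral_mono_AE)
    show "AE x in MU. l^2 * (wgt s l d x * v x) \<le> (lpar s l d x)^2 * wgt s l d x * v x"
      using ae
    proof eventually_elim
      case (elim x)
      have "l^2 * (wgt s l d x * v x) \<le> (lpar s l d x)^2 * (wgt s l d x * v x)"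
        using le[OF elim] wgt_pos[of s l d x] v(2)[of x] by (intro mult_right_mono) auto
      then show ?case by (simp add: mult.assoc)
    qed
  qed (intro bintegrable_mult i)+
  show "l^2 * (LINT x|MU. wgt s l d x / (lpar s l d x)^2 * v x) \<le> (LINT x|MU. wgt s l d x * v x)"
    unfolding integral_mult_right_zero[symmetric]
  proof (rule integral_mono_AE)
    show "AE x in MU. l^2 * (wgt s l d x / (lpar s l d x)^2 * v x) \<le> wgt s l d x * v x"
      using ae
    proof eventually_elim
      case (elim x)
      have "l^2 * (wgt s l d x / (lpar s l d x)^2 * v x) \<le> (lpar s l d x)^2 * (wgt s l d x / (lpar s l d x)^2 * v x)"
        using le[OF elim] wgt_pos[of s l d x] v(2)[of x] by (intro mult_right_mono) auto
      then show ?case using nz[of x] by simp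
    qed
  qed (intro bintegrable_mult i)+
qed

text \<open>The product rule for \<open>div (f A)\<close>, solved for \<open>A \<nabla>f\<close>.\<close>

lemma P_op_pointwise:
  assumes A: "\<forall>i j. (\<lambda>x. A x $ i $ j) \<in> Wk_inf (Suc k) U" and f: "f \<in> Hk (Suc m) U"
  shows "AE x in MU. A x *v wgrad U f x = P_op U A f x - f x *\<^sub>R (\<chi> i. \<Sum>j\<in>UNIV. wpd U j (\<lambda>x. A x $ i $ j) x)"
    "L2 MU (\<lambda>x. P_op U A f x $ i)"
proof -
  have P: "P_op U A f x $ i = (\<Sum>j\<in>UNIV. wpd U j (\<lambda>x. f x * A x $ i $ j) x)" for x i
    by (simp add: P_op_def wdiv_def)
  note h = Hk_mult_Winf[OF f A[rule_format]]
  show "L2 MU (\<lambda>x. P_op U A f x $ i)" unfolding P by (intro L2_sum Hk_facts(3)[OF h(1)]) simp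
  have "AE x in MU. \<forall>z\<in>UNIV. wpd U (snd z) (\<lambda>x. f x * A x $ fst z $ snd z) x
     = f x * wpd U (snd z) (\<lambda>x. A x $ fst z $ snd z) x + wpd U (snd z) f x * A x $ fst z $ snd z"
    by (rule AE_finite_allI) (simp_all add: wpd_AE_MU[OF h(2)])
  then show "AE x in MU. A x *v wgrad U f x = P_op U A f x - f x *\<^sub>R (\<chi> i. \<Sum>j\<in>UNIV. wpd U j (\<lambda>x. A x $ i $ j) x)"
  proof eventually_elim
    case (elim x)
    have e: "wpd U j (\<lambda>x. f x * A x $ i $ j) x = f x * wpd U j (\<lambda>x. A x $ i $ j) x + wpd U j f x * A x $ i $ j" for i j
      using elim[rule_format, of "(i, j)"] by simp
    show ?case
      by (simp add: vec_eq_iff P e matrix_vector_mult_def wgrad_def sum.distrib sum_distrib_left mult.commute)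
  qed
qed

lemma C1_vec_meas:
  assumes "\<And>i. C1 U (\<lambda>x. \<delta> x $ i) (H i)"
  shows "contc \<delta>" "\<exists>B\<ge>0. \<forall>x\<in>closure U. norm (\<delta> x :: real^3) \<le> B"
proof -
  show c: "contc \<delta>"
    using continuous_on_vec_lambda[of "closure U" "\<lambda>i x. \<delta> x $ i"] assms by (simp add: C1_def)
  have "bounded (\<delta> ` closure U)" by (intro compact_imp_bounded compact_continuous_image c U_facts)
  then obtain B where B: "\<And>x. x \<in> closure U \<Longrightarrow> norm (\<delta> x) \<le> B" unfolding bounded_iff by blast
  then show "\<exists>B\<ge>0. \<forall>x\<in>closure U. norm (\<delta> x) \<le> B"
    by (intro exI[of _ "max B 0"]) (auto simp: max.coboundedI1)
qed

lemma ae_closure: "(\<And>x. x \<in> closure U \<Longrightarrow> Q x) \<Longrightarrow> AE x in MU. Q x"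
  using closure_subset[of U] by (intro AE_I2) auto

section \<open>The two Carleman estimates\<close>

text \<open>The transport estimate for \<open>\<nabla>d\<close>, whose right-hand side is bounded through \<open>P_op_pointwise\<close>. The term
  with \<open>f\<close> is absorbed as soon as \<open>\<lambda>^2\<close> exceeds the constants involved.\<close>

lemma carleman_div:
  assumes \<Gamma>: "openin (top_of_set S) \<Gamma>" and d: "Ck_closure 2 U d" "\<forall>x\<in>U. d x > 0"
    and grad: "\<forall>x\<in>closure U. norm (grad_closure U d x) > 0" and zero: "\<forall>x\<in>S - \<Gamma>. d x = 0"
    and A: "\<forall>i j. (\<lambda>x. A x $ i $ j) \<in> Wk_inf 1 U" "contc A" "\<forall>x\<in>closure U. det (A x) \<noteq> 0"
  shows "\<exists>l0\<ge>1. \<exists>C>0. \<forall>l\<ge>l0. \<forall>s\<ge>1. \<forall>f\<in>Hk 1 U.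
    (LINT x|MU. wgt s l d x * (norm (wgrad U f x))^2) + (LINT x|MU. (lpar s l d x)^2 * wgt s l d x * (f x)^2)
    \<le> C * (LINT x|MU. wgt s l d x * (norm (P_op U A f x))^2)
      + C * (LINT x|MSg. indicator \<Gamma> x * (lpar s l d x * wgt s l d x * (bdry_trace U f x)^2))"
    (is "\<exists>l0\<ge>1. \<exists>C>0. \<forall>l\<ge>l0. \<forall>s\<ge>1. \<forall>f\<in>_. ?L s l f \<le> C * ?R s l f + C * ?S s l f")
proof -
  from weight_setup[OF d] obtain \<delta> H where \<delta>: "C1 U d \<delta>" "\<And>i. C1 U (\<lambda>x. \<delta> x $ i) (H i)"
    and d0: "\<And>x. x \<in> closure U \<Longrightarrow> d x \<ge> 0" and gc: "\<And>x. x \<in> closure U \<Longrightarrow> grad_closure U d x = \<delta> x" by blast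
  have dc: "contc d" using \<delta>(1) by (simp add: C1_def)
  note \<delta>c = C1_vec_meas(1)[OF \<delta>(2)]
  obtain K where K: "K \<ge> 0" "\<And>x. x \<in> closure U \<Longrightarrow> norm (\<delta> x) \<le> K" using C1_vec_meas(2)[OF \<delta>(2)] by blast
  have ne: "closure U \<noteq> {}" using U_facts(3) closure_subset by blast
  have \<Gamma>b: "\<Gamma> \<in> sets borel"
  proof -
    obtain T where "open T" "\<Gamma> = S \<inter> T" using \<Gamma> openin_open by blast
    then show ?thesis by simp
  qed
  have Sc: "x \<in> S \<Longrightarrow> x \<in> closure U" for x using U_facts(6) by blast
  have adm: "admissible \<delta> (\<lambda>x. \<Sum>j\<in>UNIV. H j x $ j) \<Gamma> K"
    using inward_gradient[OF \<delta>(1)] d(2) zero by (intro admissible_C1[OF \<delta>(2) \<Gamma>b K(1)] K(2) Sc) auto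
  let ?D = "\<lambda>x. \<Sum>j\<in>UNIV. H j x $ j"
  have Dc: "contc ?D"
    using \<delta>(2) by (intro continuous_intros) (auto simp: C1_def)
  obtain KD where KD: "\<forall>x\<in>closure U. \<bar>?D x\<bar> \<le> KD" using cont_bounded[OF Dc] by blast
  have "\<exists>c>0. \<forall>x\<in>closure U. \<delta> x \<bullet> \<delta> x \<ge> c"
  proof (rule compact_pos_bound[OF U_facts(4) ne])
    show "contc (\<lambda>x. \<delta> x \<bullet> \<delta> x)" by (intro continuous_intros \<delta>c)
    show "x \<in> closure U \<Longrightarrow> 0 < \<delta> x \<bullet> \<delta> x" for x using grad gc[of x] by auto
  qed
  then obtain c0 where c0: "c0 > 0" "\<forall>x\<in>closure U. \<delta> x \<bullet> \<delta> x \<ge> c0" by blast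
  have am: "(\<lambda>x. \<delta> x $ j) \<in> borel_measurable MU" for j by (intro meas_closure continuous_intros \<delta>c)
  have ab: "AE x in MU. \<bar>\<delta> x $ j\<bar> \<le> K" for j
    by (rule ae_closure) (use K(2) component_le_norm_cart order_trans in blast)
  have d0': "\<forall>x\<in>closure U. d x \<ge> 0" using d0 by blast
  have D_ae: "AE x in MU. \<bar>?D x\<bar> \<le> KD" by (rule ae_closure) (rule KD[rule_format])
  have c0_ae: "AE x in MU. \<delta> x \<bullet> \<delta> x \<ge> c0" by (rule ae_closure) (rule c0(2)[rule_format])
  from transport_estimate[OF adm \<Gamma>b K(1) am ab meas_closure[OF Dc] D_ae c0(1) c0_ae \<delta>(1) d0']
  obtain l1 C where l1: "l1 \<ge> 1" "C > 0" and T: "\<forall>l\<ge>l1. \<forall>s\<ge>1. \<forall>m. \<forall>f\<in>Hk (Suc m) U.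
    (LINT x|MU. (lpar s l d x)^2 * wgt s l d x * (f x)^2) \<le> C * (LINT x|MU. wgt s l d x * (wgrad U f x \<bullet> \<delta> x)^2)
       + C * (LINT x|MSg. indicator \<Gamma> x * (lpar s l d x * wgt s l d x * (bdry_trace U f x)^2))"
    by blast
  obtain cA where cA: "cA > 0" "\<forall>x\<in>closure U. \<forall>v. cA * norm v \<le> norm (A x *v v)"
    using matrix_lower_bound[OF U_facts(4) ne A(2)] A(3) by blast
  have A1: "\<forall>i j. (\<lambda>x. A x $ i $ j) \<in> Wk_inf (Suc 0) U" using A(1) by simp
  let ?E = "\<lambda>x. \<chi> i. \<Sum>j\<in>UNIV. wpd U j (\<lambda>x. A x $ i $ j) x"
  have "\<exists>B\<ge>0. AE x in MU. norm (?E x) \<le> B"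
  proof -
    obtain B where B: "B \<ge> 0" "AE x in MU. \<forall>z. \<bar>wpd U (snd z) (\<lambda>x. A x $ fst z $ snd z) x\<bar> \<le> B"
      using AE_bound_finite[where M = MU and u = "\<lambda>z. wpd U (snd z) (\<lambda>x. A x $ fst z $ snd z)"] Winf_wpd[OF A1[rule_format]] by blast
    have "AE x in MU. norm (?E x) \<le> (\<Sum>i\<in>(UNIV::3 set). \<Sum>j\<in>(UNIV::3 set). B)"
      using B(2)
    proof eventually_elim
      case (elim x)
      have e: "\<bar>wpd U j (\<lambda>x. A x $ i $ j) x\<bar> \<le> B" for i j using elim[rule_format, of "(i, j)"] by simp
      have "norm (?E x) \<le> (\<Sum>i\<in>UNIV. \<bar>?E x $ i\<bar>)" by (rule norm_le_l1_cart)
      also have "\<dots> \<le> (\<Sum>i\<in>UNIV. \<Sum>j\<in>UNIV. \<bar>wpd U j (\<lambda>x. A x $ i $ j) x\<bar>)" by (simp add: sum_mono sum_abs)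
      also have "\<dots> \<le> (\<Sum>i\<in>(UNIV::3 set). \<Sum>j\<in>(UNIV::3 set). B)" by (intro sum_mono e)
      finally show ?case .
    qed
    then show ?thesis using B(1) by (intro exI conjI) (auto intro!: sum_nonneg)
  qed
  then obtain B where B: "B \<ge> 0" "AE x in MU. norm (?E x) \<le> B" by blast
  \<comment> \<open>from \<open>cA |\<nabla>f| \<le> |P f| + B |f|\<close> and \<open>(p + q)^2 \<le> 2 p^2 + 2 q^2\<close>\<close>
  define c where "c = 2 * (1 + B^2) / cA^2"
  have c: "c > 0" using cA(1) by (auto simp: c_def intro!: divide_pos_pos add_pos_nonneg)
  define M where "M = C * (K^2 * c)"
  have M: "M \<ge> 0" using l1(2) c by (simp add: M_def)
  have main: "?L s l f \<le> (c + 4 * M + 4 * C) * ?R s l f + (c + 4 * M + 4 * C) * ?S s l f"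
    (is "?G + ?X \<le> _ * ?P + _ * ?B")
    if l: "l \<ge> l1 + 2 * M + c" and s: "s \<ge> 1" and f: "f \<in> Hk 1 U" for l s f
  proof -
    have l': "l \<ge> l1" "l \<ge> 1" using l l1(1) M c by auto
    have f1: "f \<in> Hk (Suc 0) U" using f by simp
    note hf = Hk_facts[OF f1] and wc = weights_cont[OF dc, of s l]
    let ?F = "LINT x|MU. wgt s l d x * (f x)^2" and ?T = "LINT x|MU. wgt s l d x * (wgrad U f x \<bullet> \<delta> x)^2"
    have ga: "L2 MU (\<lambda>x. wgrad U f x \<bullet> \<delta> x)"
    proof -
      have "L2 MU (\<lambda>x. \<Sum>j\<in>UNIV. \<delta> x $ j * wpd U j f x)" by (intro L2_sum L2_bdd[OF hf(3) am ab]) simp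
      then show ?thesis by (simp add: wgrad_def inner_vec_def mult.commute)
    qed
    have iG: "integrable MU (\<lambda>x. wgt s l d x * (norm (wgrad U f x))^2)"
      by (intro weighted_integrable_norm wc) (simp add: wgrad_def hf)
    have iF: "integrable MU (\<lambda>x. wgt s l d x * (f x)^2)" by (intro weighted_integrable_U wc hf)
    have iP: "integrable MU (\<lambda>x. wgt s l d x * (norm (P_op U A f x))^2)"
      by (intro weighted_integrable_norm wc P_op_pointwise(2)[OF A1 f1])
    have iT: "integrable MU (\<lambda>x. wgt s l d x * (wgrad U f x \<bullet> \<delta> x)^2)" by (intro weighted_integrable_U wc ga)
    have ep: "AE x in MU. wgt s l d x \<ge> 0" using wgt_pos[of s l d] by (intro AE_I2) (simp add: less_imp_le)
    have GP: "?G \<le> c * (?P + ?F)"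
    proof (rule weighted_mono[OF iG iP iF ep])
      have "AE x in MU. x \<in> closure U" by (rule ae_closure)
      then show "AE x in MU. (norm (wgrad U f x))^2 \<le> c * ((norm (P_op U A f x))^2 + (f x)^2)"
        using P_op_pointwise(1)[OF A1 f1] B(2)
      proof eventually_elim
        case (elim x)
        let ?p = "norm (P_op U A f x)" and ?q = "\<bar>f x\<bar> * B"
        have "cA * norm (wgrad U f x) \<le> norm (A x *v wgrad U f x)" using cA(2) elim(1) by blast
        also have "\<dots> \<le> ?p + norm (f x *\<^sub>R ?E x)" unfolding elim(2) by (rule norm_triangle_ineq4)
        also have "\<dots> = ?p + \<bar>f x\<bar> * norm (?E x)" by simp
        also have "\<dots> \<le> ?p + ?q" using elim(3) by (intro add_left_mono mult_left_mono) auto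
        finally have "(cA * norm (wgrad U f x))^2 \<le> (?p + ?q)^2" using cA(1) by (intro power_mono) auto
        also have "\<dots> \<le> 2 * ?p^2 + 2 * ?q^2" using sum_squares_bound[of ?p ?q] by (simp add: power2_sum)
        also have "\<dots> = 2 * ?p^2 + 2 * (B^2 * (f x)^2)" by (simp add: power_mult_distrib mult.commute)
        also have "\<dots> \<le> 2 * (1 + B^2) * (?p^2 + (f x)^2)" by (simp add: distrib_left distrib_right)
        finally show ?case using cA(1) by (simp add: c_def power_mult_distrib field_simps)
      qed
    qed
    have TG: "?T \<le> K^2 * ?G"
    proof -
      have "?T \<le> K^2 * (?G + (LINT x|MU. wgt s l d x * 0))"
      proof (rule weighted_mono[OF iT iG _ ep])
        have "AE x in MU. x \<in> closure U" by (rule ae_closure)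
        then show "AE x in MU. (wgrad U f x \<bullet> \<delta> x)^2 \<le> K^2 * ((norm (wgrad U f x))^2 + 0)"
        proof eventually_elim
          case (elim x)
          have "\<bar>wgrad U f x \<bullet> \<delta> x\<bar> \<le> norm (wgrad U f x) * norm (\<delta> x)" by (rule Cauchy_Schwarz_ineq2)
          also have "\<dots> \<le> norm (wgrad U f x) * K" using K(2)[OF elim] by (intro mult_left_mono) auto
          finally have "\<bar>wgrad U f x \<bullet> \<delta> x\<bar>^2 \<le> (norm (wgrad U f x) * K)^2" by (rule power_mono) simp
          then show ?case by (simp add: power_mult_distrib mult.commute)
        qed
      qed simp
      then show ?thesis by simp
    qed
    have X: "?X \<le> C * ?T + C * ?B" using T l'(1) s f1 by blast
    have F: "l^2 * ?F \<le> ?X"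
      by (rule weights_compare(1)[OF dc d0 s l'(2)]) (auto intro: weighted_integrable_U hf)
    have "wgt s l d x \<ge> 0" "lpar s l d x \<ge> 0" for x using s l' by (simp_all add: wgt_def lpar_def phi0_def)
    then have nn: "?F \<ge> 0" "?P \<ge> 0" "?B \<ge> 0"
      by (auto intro!: bint_nonneg mult_nonneg_nonneg)
    have l2: "l^2 \<ge> l" using l'(2) by (simp add: power2_eq_square)
    have "C * ?T \<le> C * (K^2 * (c * (?P + ?F)))"
      using order_trans[OF TG mult_left_mono[OF GP]] l1(2) by (intro mult_left_mono) auto
    also have "\<dots> = M * ?P + M * ?F" by (simp add: M_def algebra_simps)
    finally have 1: "?X \<le> M * ?P + M * ?F + C * ?B" using X by linarith
    have "(2 * M) * ?F \<le> l^2 * ?F" "c * ?F \<le> l^2 * ?F" using l2 l l1(1) M c by (intro mult_right_mono nn; linarith)+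
    then have 2: "2 * (M * ?F) \<le> ?X" "c * ?F \<le> ?X" using F by auto
    have "c * ?B \<ge> 0" "M * ?B \<ge> 0" "C * ?P \<ge> 0" using nn M c l1(2) by auto
    then show ?thesis using 1 2 GP by (simp add: algebra_simps)
  qed
  show ?thesis
    by (rule exI[of _ "l1 + 2 * M + c"], rule conjI, use l1(1) M c in linarith, rule exI[of _ "c + 4 * M + 4 * C"],
        rule conjI, use l1(2) M c in linarith, intro allI impI ballI, rule main)
qed

text \<open>The Lagrange identity \<open>v \<bullet> (b \<times> (\<delta> \<times> b)) = (v \<times> b) \<bullet> (\<delta> \<times> b)\<close>.\<close>

lemma perp_cross_bound:
  fixes v :: "real^3"
  shows "(v \<bullet> perp \<delta> b x)^2 \<le> (norm (cross3 v (b x)))^2 * (norm (cross3 (\<delta> x) (b x)))^2"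
proof -
  have e: "v \<bullet> perp \<delta> b x = cross3 v (b x) \<bullet> cross3 (\<delta> x) (b x)"
    by (simp add: perp_def dot_cross inner_diff_right inner_commute mult.commute)
  have "\<bar>v \<bullet> perp \<delta> b x\<bar> \<le> norm (cross3 v (b x)) * norm (cross3 (\<delta> x) (b x))"
    unfolding e by (rule Cauchy_Schwarz_ineq2)
  then have "\<bar>v \<bullet> perp \<delta> b x\<bar>^2 \<le> (norm (cross3 v (b x)) * norm (cross3 (\<delta> x) (b x)))^2" by (rule power_mono) simp
  then show ?thesis by (simp add: power_mult_distrib)
qed

lemma perp_inner: "perp \<delta> b x \<bullet> \<delta> x = (norm (cross3 (\<delta> x) (b x)))^2"
  unfolding power2_norm_eq_inner dot_cross by (simp add: perp_def inner_diff_left inner_diff_right inner_commute)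

text \<open>The entries of the curl of \<open>g b\<close>, indexed by a pair of directions in order to treat the three components
  at once.\<close>

definition rot_entry :: "(real^3 \<Rightarrow> real^3) \<Rightarrow> (real^3 \<Rightarrow> real) \<Rightarrow> 3 \<Rightarrow> 3 \<Rightarrow> real^3 \<Rightarrow> real" where
  "rot_entry b g p q x = wpd U p (\<lambda>x. g x * b x $ q) x - wpd U q (\<lambda>x. g x * b x $ p) x"

lemma Q_op_nth:
  "Q_op U b g x $ 1 = rot_entry b g 2 3 x" "Q_op U b g x $ 2 = rot_entry b g 3 1 x" "Q_op U b g x $ 3 = rot_entry b g 1 2 x"
  by (simp_all add: Q_op_def wrot_def rot_entry_def vector_3)

lemma rot_entry_AE:
  assumes g: "g \<in> Hk (Suc m) U" and b: "\<And>i. (\<lambda>x. b x $ i) \<in> Wk_inf (Suc l) U"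
  shows "AE x in MU. rot_entry b g p q x = wpd U p g x * b x $ q - wpd U q g x * b x $ p
    + g x * (wpd U p (\<lambda>x. b x $ q) x - wpd U q (\<lambda>x. b x $ p) x)"
    "L2 MU (rot_entry b g p q)"
proof -
  note h = Hk_mult_Winf[OF g b]
  show "AE x in MU. rot_entry b g p q x = wpd U p g x * b x $ q - wpd U q g x * b x $ p
    + g x * (wpd U p (\<lambda>x. b x $ q) x - wpd U q (\<lambda>x. b x $ p) x)"
    using wpd_AE_MU[OF h(2)[of p q]] wpd_AE_MU[OF h(2)[of q p]]
    by eventually_elim (simp add: rot_entry_def algebra_simps)
  show "L2 MU (rot_entry b g p q)" unfolding rot_entry_def[abs_def] by (intro L2_diff Hk_facts(3)[OF h(1)])
qed

text \<open>The derivative in direction \<open>k\<close> of the entry for \<open>p\<close> and \<open>q\<close>. Its first two terms form a component of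
  \<open>\<nabla>(\<partial>_k g) \<times> b\<close>; the others contain at most first derivatives of \<open>g\<close>.\<close>

definition drot_entry :: "(real^3 \<Rightarrow> real^3) \<Rightarrow> (real^3 \<Rightarrow> real) \<Rightarrow> 3 \<Rightarrow> 3 \<Rightarrow> 3 \<Rightarrow> real^3 \<Rightarrow> real" where
  "drot_entry b g k p q x = wpd U p (wpd U k g) x * b x $ q - wpd U q (wpd U k g) x * b x $ p
    + wpd U p g x * wpd U k (\<lambda>x. b x $ q) x - wpd U q g x * wpd U k (\<lambda>x. b x $ p) x
    + wpd U k g x * (wpd U p (\<lambda>x. b x $ q) x - wpd U q (\<lambda>x. b x $ p) x)
    + g x * (wpd U k (wpd U p (\<lambda>x. b x $ q)) x - wpd U k (wpd U q (\<lambda>x. b x $ p)) x)"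

text \<open>The product rule applied to each term, with the second derivatives of \<open>g\<close> interchanged by
  \<open>wpd_symmetric\<close>.\<close>

lemma rot_entry_wpd:
  assumes g: "g \<in> Hk (Suc (Suc m)) U" and b: "\<And>i. (\<lambda>x. b x $ i) \<in> Wk_inf (Suc (Suc l)) U"
  shows "\<exists>W. is_wpd U k (rot_entry b g p q) W \<and> L2 MU W \<and> (AE x in MU. W x = drot_entry b g k p q x)"
proof -
  let ?b = "\<lambda>i x. b x $ i"
  have hb: "?b i \<in> Hk (Suc (Suc l)) U" for i by (rule Winf_Hk[OF b])
  note T1 = product_rule[OF wpd_Hk[OF g] hb, of k]
  note T3 = product_rule[OF g wpd_Hk[OF hb], of k]
  from is_wpd_add[OF is_wpd_add[OF is_wpd_add[OF T1[of p q] T1[of q p], of "-1"] T3[of p q], of 1] T3[of q p], of "-1"]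
  have W: "is_wpd U k (\<lambda>x. wpd U p g x * ?b q x + -1 * (wpd U q g x * ?b p x) + 1 * (g x * wpd U p (?b q) x) + -1 * (g x * wpd U q (?b p) x))
    (\<lambda>x. (wpd U p g x * wpd U k (?b q) x + wpd U k (wpd U p g) x * ?b q x)
      + -1 * (wpd U q g x * wpd U k (?b p) x + wpd U k (wpd U q g) x * ?b p x)
      + 1 * (g x * wpd U k (wpd U p (?b q)) x + wpd U k g x * wpd U p (?b q) x)
      + -1 * (g x * wpd U k (wpd U q (?b p)) x + wpd U k g x * wpd U q (?b p) x))" (is "is_wpd _ _ ?Us ?W") .
  have s: "L2 MU (rot_entry b g p q)" by (rule rot_entry_AE(2)[OF g b])
  have "integrable MU (rot_entry b g p q)" by (rule L2_integrable[OF s])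
  moreover have "AE x in MU. ?Us x = rot_entry b g p q x" using rot_entry_AE(1)[OF g b, of p q] by eventually_elim (simp add: algebra_simps)
  ultimately have rW: "is_wpd U k (rot_entry b g p q) ?W" by (intro is_wpd_cong_AE[OF W])
  have ae: "AE x in MU. ?W x = drot_entry b g k p q x"
    using wpd_symmetric[OF g, of k p] wpd_symmetric[OF g, of k q]
  proof eventually_elim
    case (elim x)
    show ?case unfolding drot_entry_def elim by (simp add: algebra_simps)
  qed
  have bd: "L2 MU (\<lambda>x. u x * w x)" if "L2 MU u" "w \<in> borel_measurable MU" "\<exists>B\<ge>0. AE x in MU. \<bar>w x\<bar> \<le> B" for u w
    using L2_bdd[OF that(1,2)] that(3) by (auto simp: mult.commute)
  have m: "?b i \<in> borel_measurable MU" "wpd U j (?b i) \<in> borel_measurable MU" "wpd U a (wpd U j (?b i)) \<in> borel_measurable MU" for i j a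
    using Hk_facts(1,3)[OF hb] Hk_facts(3)[OF wpd_Hk[OF hb]] by (auto simp: L2_def)
  have bb: "\<exists>B\<ge>0. AE x in MU. \<bar>?b i x\<bar> \<le> B" for i using Winf_bound[OF b] by blast
  have sW: "L2 MU ?W"
    by (intro L2_add L2_cmult bd m bb Winf_wpd[OF b] Winf_wpd2[OF b] Hk_facts(1)[OF g] Hk_facts(3)[OF g] Hk_facts(3)[OF wpd_Hk[OF g]])
  from rW sW ae show ?thesis by (intro exI[of _ ?W] conjI)
qed

lemma drot_entry_AE:
  assumes g: "g \<in> Hk (Suc (Suc m)) U" and b: "\<And>i. (\<lambda>x. b x $ i) \<in> Wk_inf (Suc (Suc l)) U"
  shows "AE x in MU. wpd U k (rot_entry b g p q) x = drot_entry b g k p q x"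
    "L2 MU (wpd U k (rot_entry b g p q))"
proof -
  obtain W where W: "is_wpd U k (rot_entry b g p q) W" and ae: "AE x in MU. W x = drot_entry b g k p q x"
    using rot_entry_wpd[OF g b, of k p q] by blast
  show "AE x in MU. wpd U k (rot_entry b g p q) x = drot_entry b g k p q x"
    using wpd_AE_MU[OF W] ae by eventually_elim (rule trans)
  have "\<exists>v. is_wpd U j (rot_entry b g p q) v \<and> v \<in> Hk 0 U" for j
  proof -
    obtain V where "is_wpd U j (rot_entry b g p q) V" "L2 MU V" using rot_entry_wpd[OF g b, of j p q] by blast
    then show ?thesis by (intro exI[of _ V]) (simp add: Hk_def L2_on_restrict)
  qed
  then have "rot_entry b g p q \<in> Hk (Suc 0) U" unfolding Hk_Suc using rot_entry_AE(2)[OF g b] by (simp add: L2_on_restrict)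
  from Hk_facts(3)[OF this] show "L2 MU (wpd U k (rot_entry b g p q))" .
qed

text \<open>Solving the two product rules for \<open>\<nabla>g \<times> b\<close> and \<open>\<nabla>(\<partial>_k g) \<times> b\<close>. The numerical constant is generous: it
  covers the three components and the squares of up to six products bounded by \<open>B\<close>.\<close>

lemma Q_op_pointwise:
  assumes g: "g \<in> Hk (Suc (Suc m)) U" and b: "\<And>i. (\<lambda>x. b x $ i) \<in> Wk_inf (Suc (Suc l)) U"
    and B: "B \<ge> 0" "AE x in MU. \<forall>i. \<bar>b x $ i\<bar> \<le> B" "AE x in MU. \<forall>z. \<bar>wpd U (fst z) (\<lambda>x. b x $ snd z) x\<bar> \<le> B"
      "AE x in MU. \<forall>z. \<bar>wpd U (fst z) (wpd U (fst (snd z)) (\<lambda>x. b x $ snd (snd z))) x\<bar> \<le> B"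
  shows "AE x in MU. (norm (cross3 (wgrad U g x) (b x)))^2 \<le> (2 + 192 * B^2) * ((norm (Q_op U b g x))^2 + (g x)^2)"
    "AE x in MU. (norm (cross3 (wgrad U (wpd U k g) x) (b x)))^2 \<le> (2 + 192 * B^2) * ((norm (wjac U (Q_op U b g) x))^2 + ((norm (wgrad U g x))^2 + (g x)^2))"
proof -
  have b1: "(\<lambda>x. b x $ i) \<in> Wk_inf (Suc (Suc l)) U" for i by (rule b)
  have sq3: "(norm (v::real^3))^2 = (v $ 1)^2 + (v $ 2)^2 + (v $ 3)^2" for v by (simp add: norm_vec_sq sum_3)
  have cr: "cross3 v w $ 1 = v $ 2 * w $ 3 - v $ 3 * w $ 2" "cross3 v w $ 2 = v $ 3 * w $ 1 - v $ 1 * w $ 3"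
    "cross3 v w $ 3 = v $ 1 * w $ 2 - v $ 2 * w $ 1" for v w by (simp_all add: cross3_def vector_3)
  have split: "u^2 \<le> 2 * q^2 + 2 * r^2" if "q = u + t" "\<bar>t\<bar> \<le> r" for u q r t :: real
  proof -
    have "u^2 = (q - t)^2" using that by simp
    also have "\<dots> \<le> 2 * q^2 + 2 * t^2" using zero_le_power2[of "q + t"] by (simp add: power2_sum power2_diff)
    also have "t^2 \<le> r^2" using that(2) abs_ge_zero[of t] by (metis abs_le_square_iff abs_of_nonneg order_trans)
    finally show ?thesis by simp
  qed
  note r1 = rot_entry_AE(1)[OF g b1] and r2 = drot_entry_AE(1)[OF g b1, of k, unfolded drot_entry_def]
  show "AE x in MU. (norm (cross3 (wgrad U g x) (b x)))^2 \<le> (2 + 192 * B^2) * ((norm (Q_op U b g x))^2 + (g x)^2)"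
    using r1[of 2 3] r1[of 3 1] r1[of 1 2] B(3)
  proof eventually_elim
    case (elim x)
    have t: "\<bar>g x * (wpd U p (\<lambda>x. b x $ q) x - wpd U q (\<lambda>x. b x $ p) x)\<bar> \<le> 2 * B * \<bar>g x\<bar>" for p q
    proof -
      have "\<bar>wpd U p (\<lambda>x. b x $ q) x - wpd U q (\<lambda>x. b x $ p) x\<bar> \<le> 2 * B"
        using elim(4)[rule_format, of "(p, q)"] elim(4)[rule_format, of "(q, p)"] by simp
      from mult_left_mono[OF this, of "\<bar>g x\<bar>"] show ?thesis by (simp add: abs_mult mult_ac)
    qed
    note e = split[OF elim(1) t[of 2 3]] split[OF elim(2) t[of 3 1]] split[OF elim(3) t[of 1 2]]
    have "(norm (cross3 (wgrad U g x) (b x)))^2 \<le> 2 * (norm (Q_op U b g x))^2 + 6 * (2 * B * \<bar>g x\<bar>)^2"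
      unfolding sq3 cr Q_op_nth using e by (simp add: wgrad_def)
    also have "(2 * B * \<bar>g x\<bar>)^2 = 4 * (B^2 * (g x)^2)" by (simp add: power_mult_distrib)
    also have "2 * (norm (Q_op U b g x))^2 + 6 * (4 * (B^2 * (g x)^2)) \<le> (2 + 192 * B^2) * ((norm (Q_op U b g x))^2 + (g x)^2)"
      using mult_nonneg_nonneg[of "B^2" "(g x)^2"] mult_nonneg_nonneg[of "B^2" "(norm (Q_op U b g x))^2"] zero_le_power2[of "g x"]
      by (simp add: distrib_left distrib_right del: zero_le_mult_iff zero_le_power2)
    finally show ?case .
  qed
  show "AE x in MU. (norm (cross3 (wgrad U (wpd U k g) x) (b x)))^2 \<le> (2 + 192 * B^2) * ((norm (wjac U (Q_op U b g) x))^2 + ((norm (wgrad U g x))^2 + (g x)^2))"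
    using r2[of 2 3] r2[of 3 1] r2[of 1 2] B(3,4)
  proof eventually_elim
    case (elim x)
    let ?n = "norm (wgrad U g x)" and ?J = "(norm (wjac U (Q_op U b g) x))^2"
    let ?r = "4 * (B * ?n) + 2 * (B * \<bar>g x\<bar>)"
    have n: "\<bar>wpd U j g x\<bar> \<le> ?n" for j using component_le_norm_cart[of "wgrad U g x" j] by (simp add: wgrad_def)
    have d1: "\<bar>wpd U p (\<lambda>x. b x $ q) x\<bar> \<le> B" for p q using elim(4)[rule_format, of "(p, q)"] by simp
    have d2: "\<bar>wpd U a (wpd U p (\<lambda>x. b x $ q)) x\<bar> \<le> B" for a p q using elim(5)[rule_format, of "(a, p, q)"] by simp
    have m: "\<bar>u * w\<bar> \<le> B * n" if "\<bar>u\<bar> \<le> n" "\<bar>w\<bar> \<le> B" for u w n :: real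
      using mult_mono[OF that] by (simp add: abs_mult mult.commute that order_trans[OF abs_ge_zero that(1)])
    have t: "\<bar>wpd U p g x * wpd U k (\<lambda>x. b x $ q) x - wpd U q g x * wpd U k (\<lambda>x. b x $ p) x
      + wpd U k g x * (wpd U p (\<lambda>x. b x $ q) x - wpd U q (\<lambda>x. b x $ p) x)
      + g x * (wpd U k (wpd U p (\<lambda>x. b x $ q)) x - wpd U k (wpd U q (\<lambda>x. b x $ p)) x)\<bar> \<le> ?r" for p q
      using m[OF n[of p] d1[of k q]] m[OF n[of q] d1[of k p]] m[OF n[of k] d1[of p q]] m[OF n[of k] d1[of q p]]
        m[OF order_refl[of "\<bar>g x\<bar>"] d2[of k p q]] m[OF order_refl[of "\<bar>g x\<bar>"] d2[of k q p]]
      unfolding right_diff_distrib abs_le_iff by (intro conjI; linarith)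
    have "?r^2 \<le> 2 * (4 * (B * ?n))^2 + 2 * (2 * (B * \<bar>g x\<bar>))^2"
      using zero_le_power2[of "4 * (B * ?n) - 2 * (B * \<bar>g x\<bar>)"] by (simp add: power2_sum power2_diff)
    also have "\<dots> = 32 * (B^2 * ?n^2) + 8 * (B^2 * (g x)^2)" by (simp add: power_mult_distrib)
    finally have r: "?r^2 \<le> 32 * (B^2 * ?n^2) + 8 * (B^2 * (g x)^2)" .
    let ?R = "\<lambda>p q. (wpd U k (rot_entry b g p q) x)^2"
    have fs: "u^2 \<le> 2 * w^2 + 2 * ?r^2" if "w = u + t1 - t2 + t3 + t4" "\<bar>t1 - t2 + t3 + t4\<bar> \<le> ?r" for u w t1 t2 t3 t4
      by (rule split[OF _ that(2)]) (simp add: that(1))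
    have c1: "(norm (cross3 (wgrad U (wpd U k g) x) (b x)))^2 \<le> 2 * (?R 2 3 + ?R 3 1 + ?R 1 2) + 6 * ?r^2"
      using fs[OF elim(1) t[of 2 3]] fs[OF elim(2) t[of 3 1]] fs[OF elim(3) t[of 1 2]]
      unfolding sq3 cr by (simp add: wgrad_def)
    have "(wpd U k (\<lambda>y. Q_op U b g y $ i) x)^2 \<le> (norm (wjac U (Q_op U b g) x $ i))^2" for i
      using power_mono[OF component_le_norm_cart[of "wjac U (Q_op U b g) x $ i" k] abs_ge_zero, of 2] by (simp add: wjac_def wgrad_def)
    from this[of 1] this[of 2] this[of 3] have "?R 2 3 + ?R 3 1 + ?R 1 2 \<le> ?J"
      unfolding norm_vec_sq[of "wjac U (Q_op U b g) x"] sum_3 Q_op_nth by (simp add: eta_contract_eq)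
    then have "2 * (?R 2 3 + ?R 3 1 + ?R 1 2) + 6 * ?r^2 \<le> 2 * ?J + 6 * (32 * (B^2 * ?n^2) + 8 * (B^2 * (g x)^2))"
      by (intro add_mono mult_left_mono r) auto
    also have "\<dots> = 2 * ?J + 192 * (B^2 * ?n^2) + 48 * (B^2 * (g x)^2)" by simp
    finally have "2 * (?R 2 3 + ?R 3 1 + ?R 1 2) + 6 * ?r^2 \<le> 2 * ?J + 192 * (B^2 * ?n^2) + 48 * (B^2 * (g x)^2)" .
    note order_trans[OF c1 this]
    also have "\<dots> \<le> (2 + 192 * B^2) * (?J + (?n^2 + (g x)^2))"
      using mult_nonneg_nonneg[of "B^2" "(g x)^2"] mult_nonneg_nonneg[of "B^2" "?J"] zero_le_power2[of "g x"] zero_le_power2[of ?n]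
      by (simp add: distrib_left distrib_right del: zero_le_mult_iff zero_le_power2)
    finally show ?case .
  qed
qed

lemma Q_op_L2:
  assumes g: "g \<in> Hk (Suc (Suc m)) U" and b: "\<And>i. (\<lambda>x. b x $ i) \<in> Wk_inf (Suc (Suc l)) U"
  shows "L2 MU (\<lambda>x. Q_op U b g x $ i)" "L2 MU (\<lambda>x. wjac U (Q_op U b g) x $ i $ k)"
proof -
  note r = rot_entry_AE(2)[OF g b] drot_entry_AE(2)[OF g b]
  have e: "(\<lambda>x. Q_op U b g x $ 1) = rot_entry b g 2 3" "(\<lambda>x. Q_op U b g x $ 2) = rot_entry b g 3 1" "(\<lambda>x. Q_op U b g x $ 3) = rot_entry b g 1 2"
    by (simp_all add: fun_eq_iff Q_op_nth)
  show "L2 MU (\<lambda>x. Q_op U b g x $ i)" using exhaust_3[of i] r by (auto simp: e)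
  show "L2 MU (\<lambda>x. wjac U (Q_op U b g) x $ i $ k)"
    using exhaust_3[of i] r by (auto simp: wjac_def wgrad_def e)
qed

end

text \<open>The final absorption for the second estimate: \<open>G\<close> and \<open>X\<close> are the two integrals on the left, \<open>J\<close> and \<open>Q\<close>
  those of the right-hand side, \<open>B1\<close> and \<open>B2\<close> the boundary terms, and \<open>F\<close> and \<open>R\<close> the lower-order terms, which
  are small for large \<open>\<lambda>\<close>.\<close>

lemma absorb_rot:
  fixes G X F J Q R B1 B2 M C :: real
  assumes "G \<le> 3 * (M * J + M * R) + C * B2" "X \<le> M * Q + M * F + C * B1"
    "6 * (M * F) \<le> X" "F \<le> X" "6 * (M * R) \<le> G + F"
    and "M \<ge> 0" "C \<ge> 0" "Q \<ge> 0" "J \<ge> 0" "B1 \<ge> 0" "B2 \<ge> 0"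
  shows "G + X \<le> (6 * M + 4 * C) * (J + Q) + (6 * M + 4 * C) * (B2 + B1)"
proof -
  have "M * Q \<ge> 0" "M * J \<ge> 0" "C * Q \<ge> 0" "C * J \<ge> 0" "M * B1 \<ge> 0" "C * B1 \<ge> 0" "M * B2 \<ge> 0" "C * B2 \<ge> 0"
    using assms(6-) by simp_all
  then show ?thesis using assms(1-5) by (simp add: distrib_left distrib_right)
qed

context atlas
begin

text \<open>The transport estimate for \<open>perp\<close> is applied to \<open>g\<close> and to its three derivatives; \<open>absorb_rot\<close> collects
  the results.\<close>

lemma carleman_rot:
  assumes d: "Ck_closure 2 U d" "\<forall>x\<in>U. d x > 0"
    and b: "\<forall>i. (\<lambda>x. b x $ i) \<in> Wk_inf 2 U" "contc b"
    and nz: "\<forall>x\<in>closure U. norm (cross3 (grad_closure U d x) (b x)) \<noteq> 0"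
  shows "\<exists>l0\<ge>1. \<exists>C>0. \<forall>l\<ge>l0. \<forall>s\<ge>1. \<forall>g\<in>Hk 2 U.
    (LINT x|MU. wgt s l d x * (norm (wgrad U g x))^2) + (LINT x|MU. (lpar s l d x)^2 * wgt s l d x * (g x)^2)
    \<le> C * ((LINT x|MU. wgt s l d x / (lpar s l d x)^2 * (norm (wjac U (Q_op U b g) x))^2)
         + (LINT x|MU. wgt s l d x * (norm (Q_op U b g x))^2))
      + C * ((\<Sum>k\<in>UNIV. LINT x|MSg. indicator S x * (wgt s l d x / lpar s l d x * (bdry_trace U (wpd U k g) x)^2))
         + (LINT x|MSg. indicator S x * (lpar s l d x * wgt s l d x * (bdry_trace U g x)^2)))"
    (is "\<exists>l0\<ge>1. \<exists>C>0. \<forall>l\<ge>l0. \<forall>s\<ge>1. \<forall>g\<in>_. ?L s l g \<le> C * ?R s l g + C * ?S s l g")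
proof -
  from weight_setup[OF d] obtain \<delta> H where \<delta>: "C1 U d \<delta>" "\<And>i. C1 U (\<lambda>x. \<delta> x $ i) (H i)"
    and d0: "\<forall>x\<in>closure U. d x \<ge> 0" and gc: "\<And>x. x \<in> closure U \<Longrightarrow> grad_closure U d x = \<delta> x" by blast
  have dc: "contc d" using \<delta>(1) by (simp add: C1_def)
  note \<delta>c = C1_vec_meas(1)[OF \<delta>(2)]
  have ne: "closure U \<noteq> {}" using U_facts(3) closure_subset by blast
  have b2: "(\<lambda>x. b x $ i) \<in> Wk_inf (Suc (Suc 0)) U" for i using b(1) by (simp add: numeral_2_eq_2)
  have hb: "(\<lambda>x. b x $ i) \<in> Hk (Suc (Suc 0)) U" for i by (rule Winf_Hk[OF b2])
  obtain B0 where B0: "B0 \<ge> 0" "AE x in MU. \<forall>i. \<bar>b x $ i\<bar> \<le> B0"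
    using AE_bound_finite[where M = MU and u = "\<lambda>i x. b x $ i"] Winf_bound[OF b2] by blast
  obtain B1 where B1: "B1 \<ge> 0" "AE x in MU. \<forall>z. \<bar>wpd U (fst z) (\<lambda>x. b x $ snd z) x\<bar> \<le> B1"
    using AE_bound_finite[where M = MU and u = "\<lambda>z. wpd U (fst z) (\<lambda>x. b x $ snd z)"] Winf_wpd[OF b2] by blast
  obtain B2 where B2: "B2 \<ge> 0" "AE x in MU. \<forall>z. \<bar>wpd U (fst z) (wpd U (fst (snd z)) (\<lambda>x. b x $ snd (snd z))) x\<bar> \<le> B2"
    using AE_bound_finite[where M = MU and u = "\<lambda>z. wpd U (fst z) (wpd U (fst (snd z)) (\<lambda>x. b x $ snd (snd z)))"] Winf_wpd2[OF b2] by blast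
  define B where "B = B0 + B1 + B2"
  have Bp: "B \<ge> 0" and le: "B0 \<le> B" "B1 \<le> B" "B2 \<le> B" using B0 B1 B2 by (auto simp: B_def)
  have bb: "AE x in MU. \<forall>i. \<bar>b x $ i\<bar> \<le> B" using B0(2) by eventually_elim (use le order_trans in blast)
  have db: "AE x in MU. \<forall>z. \<bar>wpd U (fst z) (\<lambda>x. b x $ snd z) x\<bar> \<le> B" using B1(2) by eventually_elim (use le order_trans in blast)
  have ddb: "AE x in MU. \<forall>z. \<bar>wpd U (fst z) (wpd U (fst (snd z)) (\<lambda>x. b x $ snd (snd z))) x\<bar> \<le> B" using B2(2) by eventually_elim (use le order_trans in blast)
  have bbi: "AE x in MU. \<bar>b x $ i\<bar> \<le> B" for i using bb by eventually_elim blast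
  let ?a = "perp \<delta> b" and ?D = "perp_div \<delta> H b (\<lambda>i x. wgrad U (\<lambda>x. b x $ i) x)"
  obtain K where K: "K \<ge> 0" and adm: "admissible ?a ?D S K"
    using admissible_perp[OF \<delta>(2) hb Bp bbi] by blast
  have ac: "contc ?a" unfolding perp_def[abs_def] by (intro continuous_intros \<delta>c b(2))
  have am: "(\<lambda>x. ?a x $ j) \<in> borel_measurable MU" for j by (intro meas_closure continuous_intros ac)
  have bdd: "\<exists>k. \<forall>x\<in>closure U. norm (f x) \<le> k" if "contc f" for f :: "real^3 \<Rightarrow> real^3"
  proof -
    have "bounded (f ` closure U)" by (intro compact_imp_bounded compact_continuous_image that U_facts)
    then show ?thesis unfolding bounded_iff by blast
  qed
  obtain Ka where Ka: "\<And>x. x \<in> closure U \<Longrightarrow> norm (?a x) \<le> Ka" using bdd[OF ac] by blast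
  obtain Kd where Kd: "\<And>x. x \<in> closure U \<Longrightarrow> norm (\<delta> x) \<le> Kd" using bdd[OF \<delta>c] by blast
  obtain Kx where Kx: "\<And>x. x \<in> closure U \<Longrightarrow> norm (cross3 (\<delta> x) (b x)) \<le> Kx"
    using bdd[OF continuous_on_cross[OF \<delta>c b(2)]] by blast
  have ab: "AE x in MU. \<bar>?a x $ j\<bar> \<le> Ka" for j
    by (rule ae_closure) (use Ka component_le_norm_cart order_trans in blast)
  have HC: "contc (H i)" for i using \<delta>(2) by (simp add: C1_def)
  have "\<exists>KH. \<forall>x\<in>closure U. \<forall>i j. \<bar>H i x $ j\<bar> \<le> KH"
  proof -
    have "\<forall>i. \<exists>k. \<forall>x\<in>closure U. norm (H i x) \<le> k" using bdd[OF HC] by blast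
    from choice[OF this] obtain k where k: "\<And>i x. x \<in> closure U \<Longrightarrow> norm (H i x) \<le> k i" by blast
    have "\<bar>H i x $ j\<bar> \<le> (\<Sum>i\<in>UNIV. \<bar>k i\<bar>)" if "x \<in> closure U" for i j x
    proof -
      have "\<bar>H i x $ j\<bar> \<le> \<bar>k i\<bar>" using component_le_norm_cart[of "H i x" j] k[OF that, of i] by linarith
      also have "\<dots> \<le> (\<Sum>i\<in>UNIV. \<bar>k i\<bar>)" by (rule member_le_sum) auto
      finally show ?thesis .
    qed
    then show ?thesis by blast
  qed
  then obtain KH where KH: "\<And>x i j. x \<in> closure U \<Longrightarrow> \<bar>H i x $ j\<bar> \<le> KH" by blast
  have Dm: "?D \<in> borel_measurable MU"
  proof -
    have m: "(\<lambda>x. \<delta> x $ i) \<in> borel_measurable MU" "(\<lambda>x. b x $ i) \<in> borel_measurable MU" "(\<lambda>x. H i x $ j) \<in> borel_measurable MU" for i j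
      by (intro meas_closure continuous_intros \<delta>c b(2) HC)+
    have w: "(\<lambda>x. wgrad U (\<lambda>x. b x $ i) x $ j) \<in> borel_measurable MU" for i j
      using Hk_facts(3)[OF hb] by (simp add: wgrad_def L2_def)
    show ?thesis unfolding perp_div_def[abs_def] by (intro borel_measurable_sum borel_measurable_diff borel_measurable_add borel_measurable_times borel_measurable_const m w)
  qed
  let ?t = "(2 * Kd) * (B * B) + KH * (B * B) + (Kd * (B * B) + KH * (B * B) + Kd * (B * B))"
  let ?KD = "\<Sum>j\<in>(UNIV::3 set). \<Sum>i\<in>(UNIV::3 set). ?t"
  have Db: "AE x in MU. \<bar>?D x\<bar> \<le> ?KD"
  proof -
    have "AE x in MU. x \<in> closure U" by (rule ae_closure)
    then show ?thesis using bb db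
    proof eventually_elim
      case (elim x)
      have bi: "\<bar>b x $ i\<bar> \<le> B" and di: "\<bar>\<delta> x $ i\<bar> \<le> Kd" and Hi: "\<bar>H i x $ j\<bar> \<le> KH" for i j
        using elim(2) component_le_norm_cart[of "\<delta> x" i] Kd[OF elim(1)] KH[OF elim(1)] by (auto intro: order_trans)
      have wi: "\<bar>wgrad U (\<lambda>x. b x $ i) x $ j\<bar> \<le> B" for i j using elim(3)[rule_format, of "(j, i)"] by (simp add: wgrad_def)
      have m: "\<bar>u * v\<bar> \<le> p * q" if "\<bar>u\<bar> \<le> p" "\<bar>v\<bar> \<le> q" for u v p q :: real
        using mult_mono[OF that] order_trans[OF abs_ge_zero that(1)] by (simp add: abs_mult)
      have tri: "\<bar>t1 + t2 - (t3 + t4 + t5)\<bar> \<le> p1 + p2 + (p3 + p4 + p5)"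
        if "\<bar>t1\<bar> \<le> p1" "\<bar>t2\<bar> \<le> p2" "\<bar>t3\<bar> \<le> p3" "\<bar>t4\<bar> \<le> p4" "\<bar>t5\<bar> \<le> p5" for t1 t2 t3 t4 t5 p1 p2 p3 p4 p5 :: real
        using that by linarith
      have d2: "\<bar>2 * \<delta> x $ j\<bar> \<le> 2 * Kd" for j using di[of j] by simp
      show ?case unfolding perp_div_def
        by (rule order_trans[OF sum_abs], rule sum_mono, rule order_trans[OF sum_abs], rule sum_mono)
          (intro tri m d2 bi di Hi wi)
    qed
  qed
  have "\<exists>c>0. \<forall>x\<in>closure U. ?a x \<bullet> \<delta> x \<ge> c"
  proof (rule compact_pos_bound[OF U_facts(4) ne])
    show "contc (\<lambda>x. ?a x \<bullet> \<delta> x)" by (intro continuous_intros \<delta>c ac)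
    show "x \<in> closure U \<Longrightarrow> 0 < ?a x \<bullet> \<delta> x" for x using nz gc[of x] by (auto simp: perp_inner)
  qed
  then obtain c0 where c0: "c0 > 0" "\<forall>x\<in>closure U. ?a x \<bullet> \<delta> x \<ge> c0" by blast
  have c0_ae: "AE x in MU. ?a x \<bullet> \<delta> x \<ge> c0" by (rule ae_closure) (rule c0(2)[rule_format])
  from transport_estimate[OF adm S_borel K am ab Dm Db c0(1) c0_ae \<delta>(1) d0]
  obtain l1 C where l1: "l1 \<ge> 1" "C > 0" and T1: "\<forall>l\<ge>l1. \<forall>s\<ge>1. \<forall>m. \<forall>f\<in>Hk (Suc m) U.
    (LINT x|MU. (lpar s l d x)^2 * wgt s l d x * (f x)^2) \<le> C * (LINT x|MU. wgt s l d x * (wgrad U f x \<bullet> ?a x)^2)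
       + C * (LINT x|MSg. indicator S x * (lpar s l d x * wgt s l d x * (bdry_trace U f x)^2))"
    and T2: "\<forall>l\<ge>l1. \<forall>s\<ge>1. \<forall>m. \<forall>f\<in>Hk (Suc m) U.
    (LINT x|MU. wgt s l d x * (f x)^2) \<le> C * (LINT x|MU. wgt s l d x / (lpar s l d x)^2 * (wgrad U f x \<bullet> ?a x)^2)
       + C * (LINT x|MSg. indicator S x * (wgt s l d x / lpar s l d x * (bdry_trace U f x)^2))"
    by blast
  \<comment> \<open>the bound on \<open>|\<delta> \<times> b|^2\<close> times the constant of \<open>Q_op_pointwise\<close>\<close>
  define c where "c = Kx^2 * (2 + 192 * B^2)"
  have c: "c \<ge> 0" by (simp add: c_def)
  have cmp: "(v \<bullet> ?a x)^2 \<le> c * r" if x: "x \<in> closure U" and r: "(norm (cross3 v (b x)))^2 \<le> (2 + 192 * B^2) * r" for x v r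
  proof -
    have "(v \<bullet> ?a x)^2 \<le> (norm (cross3 v (b x)))^2 * (norm (cross3 (\<delta> x) (b x)))^2" by (rule perp_cross_bound)
    also have "\<dots> \<le> ((2 + 192 * B^2) * r) * Kx^2"
      by (rule mult_mono[OF r power_mono[OF Kx[OF x] norm_ge_zero] order_trans[OF zero_le_power2 r] zero_le_power2])
    finally show ?thesis by (simp add: c_def mult_ac)
  qed
  define M where "M = C * c"
  have M: "M \<ge> 0" using l1(2) c by (simp add: M_def)
  let ?C = "6 * M + 4 * C"
  have main: "?L s l g \<le> ?C * ?R s l g + ?C * ?S s l g"
    (is "?G + ?X \<le> _ * (?J + ?Q) + _ * ((\<Sum>k\<in>UNIV. ?B2 k) + ?B1)")
    if l: "l \<ge> l1 + 6 * M" and s: "s \<ge> 1" and g2: "g \<in> Hk 2 U" for l s g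
  proof -
    have l': "l \<ge> l1" "l \<ge> 1" using l l1(1) M by auto
    have g: "g \<in> Hk (Suc (Suc 0)) U" using g2 by (simp add: numeral_2_eq_2)
    note hg = Hk_facts[OF g] and hk = wpd_Hk[OF g]
    note wc = weights_cont[OF dc, of s l]
    have tp: "lpar s l d x > 0" for x using s l' by (simp add: lpar_def phi0_def)
    have en: "wgt s l d x \<ge> 0" "lpar s l d x \<ge> 0" for x using s l' by (simp_all add: wgt_def lpar_def phi0_def)
    have wc2: "contc (\<lambda>x. wgt s l d x / (lpar s l d x)^2)"
      by (intro continuous_intros wc) (use tp in \<open>simp add: less_imp_neq[symmetric]\<close>)
    have ae: "AE x in MU. x \<in> closure U" by (rule ae_closure)
    let ?F = "LINT x|MU. wgt s l d x * (g x)^2" and ?T = "LINT x|MU. wgt s l d x * (wgrad U g x \<bullet> ?a x)^2"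
    let ?Gk = "\<lambda>k. LINT x|MU. wgt s l d x * (wpd U k g x)^2"
    let ?v = "\<lambda>x. (norm (wgrad U g x))^2 + (g x)^2"
    let ?R = "LINT x|MU. wgt s l d x / (lpar s l d x)^2 * ?v x"
    let ?Tk = "\<lambda>k. LINT x|MU. wgt s l d x / (lpar s l d x)^2 * (wgrad U (wpd U k g) x \<bullet> ?a x)^2"
    have ga: "L2 MU (\<lambda>x. wgrad U f x \<bullet> ?a x)" if "f \<in> Hk (Suc m) U" for f m
    proof -
      have "L2 MU (\<lambda>x. \<Sum>j\<in>UNIV. ?a x $ j * wpd U j f x)" by (intro L2_sum L2_bdd[OF Hk_facts(3)[OF that] am ab]) simp
      then show ?thesis by (simp add: wgrad_def inner_vec_def mult.commute)
    qed
    have iG: "integrable MU (\<lambda>x. w x * (norm (wgrad U g x))^2)" if "contc w" for w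
      by (intro weighted_integrable_norm that) (simp add: wgrad_def hg)
    have iv: "integrable MU (\<lambda>x. w x * ?v x)" if "contc w" for w
      unfolding distrib_left by (intro bintegrable_add iG weighted_integrable_U that hg)
    have iQ: "integrable MU (\<lambda>x. wgt s l d x * (norm (Q_op U b g x))^2)"
      by (intro weighted_integrable_norm wc Q_op_L2(1)[OF g b2])
    have iJ: "integrable MU (\<lambda>x. wgt s l d x / (lpar s l d x)^2 * (norm (wjac U (Q_op U b g) x))^2)"
      unfolding norm_vec_sq[of "wjac _ _ _"] sum_distrib_left
      by (intro bintegrable_sum weighted_integrable_norm wc2 Q_op_L2(2)[OF g b2])
    have ep: "AE x in MU. wgt s l d x \<ge> 0" "AE x in MU. wgt s l d x / (lpar s l d x)^2 \<ge> 0" using en by (auto intro!: AE_I2)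
    have T: "?T \<le> c * (?Q + ?F)"
    proof (rule weighted_mono[OF weighted_integrable_U[OF wc(1) ga[OF g]] iQ weighted_integrable_U[OF wc(1) hg(1)] ep(1)])
      show "AE x in MU. (wgrad U g x \<bullet> ?a x)^2 \<le> c * ((norm (Q_op U b g x))^2 + (g x)^2)"
        using ae Q_op_pointwise(1)[OF g b2 Bp bb db ddb] by eventually_elim (rule cmp)
    qed
    have Tk: "?Tk k \<le> c * (?J + ?R)" for k
    proof (rule weighted_mono[OF weighted_integrable_U[OF wc2 ga[OF hk]] iJ iv[OF wc2] ep(2)])
      show "AE x in MU. (wgrad U (wpd U k g) x \<bullet> ?a x)^2 \<le> c * ((norm (wjac U (Q_op U b g) x))^2 + ?v x)"
        using ae Q_op_pointwise(2)[OF g b2 Bp bb db ddb, of k] by eventually_elim (rule cmp)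
    qed
    have X: "?X \<le> C * ?T + C * ?B1" using T1 l'(1) s g by blast
    have Gk: "?Gk k \<le> C * ?Tk k + C * ?B2 k" for k using T2 l'(1) s hk by blast
    have "?G = (\<Sum>k\<in>UNIV. ?Gk k)"
    proof -
      have "?G = (LINT x|MU. (\<Sum>k\<in>UNIV. wgt s l d x * (wpd U k g x)^2))"
        by (simp add: norm_vec_sq sum_distrib_left wgrad_def)
      also have "\<dots> = (\<Sum>k\<in>UNIV. ?Gk k)"
        by (rule bint_sum) (intro weighted_integrable_U wc hg)
      finally show ?thesis .
    qed
    also have "\<dots> \<le> (\<Sum>k\<in>UNIV. C * (c * (?J + ?R)) + C * ?B2 k)"
      using Gk Tk l1(2) by (intro sum_mono order_trans[OF Gk] add_right_mono mult_left_mono) auto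
    also have "\<dots> = 3 * (M * ?J + M * ?R) + C * (\<Sum>k\<in>UNIV. ?B2 k)"
      by (simp add: sum.distrib sum_distrib_left M_def algebra_simps)
    finally have G: "?G \<le> 3 * (M * ?J + M * ?R) + C * (\<Sum>k\<in>UNIV. ?B2 k)" .
    have F: "l^2 * ?F \<le> ?X"
      by (rule weights_compare(1)[OF dc d0[rule_format] s l'(2)]) (auto intro: weighted_integrable_U hg)
    have "l^2 * ?R \<le> (LINT x|MU. wgt s l d x * ?v x)"
      by (rule weights_compare(2)[OF dc d0[rule_format] s l'(2)]) (auto intro: iv)
    also have "\<dots> = ?G + ?F" unfolding distrib_left by (intro bint_add iG weighted_integrable_U wc hg)
    finally have R: "l^2 * ?R \<le> ?G + ?F" .
    have nn: "?F \<ge> 0" "?Q \<ge> 0" "?J \<ge> 0" "?R \<ge> 0" "?B1 \<ge> 0" "?B2 k \<ge> 0" for k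
      using en by (auto intro!: bint_nonneg mult_nonneg_nonneg divide_nonneg_nonneg add_nonneg_nonneg)
    have nB: "(\<Sum>k\<in>UNIV. ?B2 k) \<ge> 0" by (intro sum_nonneg nn)
    have l2: "l^2 \<ge> l" using l'(2) by (simp add: power2_eq_square)
    have "C * ?T \<le> C * (c * (?Q + ?F))" using T l1(2) by (intro mult_left_mono) auto
    also have "\<dots> = M * ?Q + M * ?F" by (simp add: M_def algebra_simps)
    finally have X': "?X \<le> M * ?Q + M * ?F + C * ?B1" using X by linarith
    have "(6 * M) * ?F \<le> l^2 * ?F" "1 * ?F \<le> l^2 * ?F" "(6 * M) * ?R \<le> l^2 * ?R"
      using l2 l l1(1) M by (intro mult_right_mono nn; linarith)+
    then have ab: "6 * (M * ?F) \<le> ?X" "?F \<le> ?X" "6 * (M * ?R) \<le> ?G + ?F" using F R by (simp_all add: mult.assoc)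
    show ?thesis by (rule absorb_rot[OF G X' ab M less_imp_le[OF l1(2)] nn(2,3,5) nB])
  qed
  show ?thesis
    by (rule exI[of _ "l1 + 6 * M"], rule conjI, use l1(1) M in linarith, rule exI[of _ "?C"],
        rule conjI, use l1(2) M in linarith, intro allI impI ballI, rule main)
qed

end

lemma (in atlas) LINT_surface:
  assumes "\<Gamma> \<in> sets borel" "\<Gamma> \<subseteq> S"
  shows "(LINT x:\<Gamma>|\<sigma>. F x) = (LINT x|MSg. indicator \<Gamma> x * (F x :: real))"
proof -
  have "(LINT x|MSg. indicator \<Gamma> x * F x) = (LINT x:S|\<sigma>. indicator \<Gamma> x * F x)" by (simp add: set_lint_restrict)
  also have "\<dots> = (LINT x:\<Gamma>|\<sigma>. F x)" unfolding set_lebesgue_integral_def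
    using assms(2) by (intro bint_cong refl) (auto simp: indicator_def)
  finally show ?thesis by simp
qed

theorem theorem3p4:
  fixes \<Omega> \<Gamma> :: "(real^3) set"
    and d :: "real^3 \<Rightarrow> real"
    and A :: "real^3 \<Rightarrow> real^3^3"
    and b :: "real^3 \<Rightarrow> real^3"
  assumes "smooth_bounded_domain \<Omega>"
    and "openin (top_of_set (frontier \<Omega>)) \<Gamma>" and "\<Gamma> \<noteq> {}"
    and "Ck_closure 2 \<Omega> d"
    and "\<forall>x\<in>\<Omega>. d x > 0"
    and "\<forall>x\<in>closure \<Omega>. norm (grad_closure \<Omega> d x) > 0"
    and "\<forall>x\<in>frontier \<Omega> - \<Gamma>. d x = 0"
    and "\<forall>i j. (\<lambda>x. A x $ i $ j) \<in> Wk_inf 1 \<Omega>" and "continuous_on (closure \<Omega>) A"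
    and "\<forall>i. (\<lambda>x. b x $ i) \<in> Wk_inf 2 \<Omega>" and "continuous_on (closure \<Omega>) b"
    and "\<forall>x\<in>closure \<Omega>. det (A x) \<noteq> 0"
    and "\<forall>x\<in>closure \<Omega>. norm (cross3 (grad_closure \<Omega> d x) (b x)) \<noteq> 0"
  shows "\<exists>l\<^sub>0\<ge>1. \<exists>s\<^sub>0\<ge>1. \<exists>C>0. \<forall>l\<ge>l\<^sub>0. \<forall>s\<ge>s\<^sub>0.
    (\<forall>f\<in>Hk 1 \<Omega>.
      (LINT x:\<Omega>|lebesgue.
         ((norm (wgrad \<Omega> f x))\<^sup>2 + s\<^sup>2 * l\<^sup>2 * (phi0 l d x)\<^sup>2 * \<bar>f x\<bar>\<^sup>2) * exp (2 * s * phi0 l d x))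
      \<le> C * (LINT x:\<Omega>|lebesgue. (norm (P_op \<Omega> A f x))\<^sup>2 * exp (2 * s * phi0 l d x))
        + C * (LINT x:\<Gamma>|surface_measure (frontier \<Omega>).
            s * l * phi0 l d x * \<bar>bdry_trace \<Omega> f x\<bar>\<^sup>2 * exp (2 * s * phi0 l d x))) \<and>
    (\<forall>g\<in>Hk 2 \<Omega>.
      (LINT x:\<Omega>|lebesgue.
         ((norm (wgrad \<Omega> g x))\<^sup>2 + s\<^sup>2 * l\<^sup>2 * (phi0 l d x)\<^sup>2 * \<bar>g x\<bar>\<^sup>2) * exp (2 * s * phi0 l d x))
      \<le> C * (LINT x:\<Omega>|lebesgue.
            (1 / (s\<^sup>2 * l\<^sup>2 * (phi0 l d x)\<^sup>2) * (norm (wjac \<Omega> (Q_op \<Omega> b g) x))\<^sup>2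
              + (norm (Q_op \<Omega> b g x))\<^sup>2) * exp (2 * s * phi0 l d x))
        + C * (LINT x:frontier \<Omega>|surface_measure (frontier \<Omega>).
            (1 / (s * l * phi0 l d x) * (norm (bdry_grad \<Omega> g x))\<^sup>2
              + s * l * phi0 l d x * \<bar>bdry_trace \<Omega> g x\<bar>\<^sup>2) * exp (2 * s * phi0 l d x)))"
proof -
  obtain P rad ax sg gr where "atlas \<Omega> P rad ax sg gr" using atlas_exists[OF assms(1)] by blast
  then interpret atlas \<Omega> P rad ax sg gr .
  let ?L = "\<lambda>f s l. LINT x:\<Omega>|lebesgue. ((norm (wgrad \<Omega> f x))\<^sup>2 + s\<^sup>2 * l\<^sup>2 * (phi0 l d x)\<^sup>2 * \<bar>f x\<bar>\<^sup>2) * exp (2 * s * phi0 l d x)"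
  let ?P = "\<lambda>f s l. LINT x:\<Omega>|lebesgue. (norm (P_op \<Omega> A f x))\<^sup>2 * exp (2 * s * phi0 l d x)" and ?B = "\<lambda>f s l. LINT x:\<Gamma>|\<sigma>. s * l * phi0 l d x * \<bar>bdry_trace \<Omega> f x\<bar>\<^sup>2 * exp (2 * s * phi0 l d x)"
  let ?JQ = "\<lambda>g s l. LINT x:\<Omega>|lebesgue. (1 / (s\<^sup>2 * l\<^sup>2 * (phi0 l d x)\<^sup>2) * (norm (wjac \<Omega> (Q_op \<Omega> b g) x))\<^sup>2
              + (norm (Q_op \<Omega> b g x))\<^sup>2) * exp (2 * s * phi0 l d x)"
  let ?BB = "\<lambda>g s l. LINT x:S|\<sigma>. (1 / (s * l * phi0 l d x) * (norm (bdry_grad \<Omega> g x))\<^sup>2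
              + s * l * phi0 l d x * \<bar>bdry_trace \<Omega> g x\<bar>\<^sup>2) * exp (2 * s * phi0 l d x)"
  obtain l1 C1 where l1: "l1 \<ge> 1" "C1 > 0" and E1: "\<forall>l\<ge>l1. \<forall>s\<ge>1. \<forall>f\<in>Hk 1 \<Omega>.
    (LINT x|MU. wgt s l d x * (norm (wgrad \<Omega> f x))\<^sup>2) + (LINT x|MU. (lpar s l d x)\<^sup>2 * wgt s l d x * (f x)\<^sup>2)
    \<le> C1 * (LINT x|MU. wgt s l d x * (norm (P_op \<Omega> A f x))\<^sup>2)
      + C1 * (LINT x|MSg. indicator \<Gamma> x * (lpar s l d x * wgt s l d x * (bdry_trace \<Omega> f x)\<^sup>2))"
    using carleman_div[OF assms(2,4,5,6,7,8,9,12)] by blast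
  obtain l2 C2 where l2: "l2 \<ge> 1" "C2 > 0" and E2: "\<forall>l\<ge>l2. \<forall>s\<ge>1. \<forall>g\<in>Hk 2 \<Omega>.
    (LINT x|MU. wgt s l d x * (norm (wgrad \<Omega> g x))\<^sup>2) + (LINT x|MU. (lpar s l d x)\<^sup>2 * wgt s l d x * (g x)\<^sup>2)
    \<le> C2 * ((LINT x|MU. wgt s l d x / (lpar s l d x)\<^sup>2 * (norm (wjac \<Omega> (Q_op \<Omega> b g) x))\<^sup>2)
         + (LINT x|MU. wgt s l d x * (norm (Q_op \<Omega> b g x))\<^sup>2))
      + C2 * ((\<Sum>k\<in>UNIV. LINT x|MSg. indicator S x * (wgt s l d x / lpar s l d x * (bdry_trace \<Omega> (wpd \<Omega> k g) x)\<^sup>2))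
         + (LINT x|MSg. indicator S x * (lpar s l d x * wgt s l d x * (bdry_trace \<Omega> g x)\<^sup>2)))"
    using carleman_rot[OF assms(4,5,10,11,13)] by blast
  define C where "C = C1 + C2"
  have \<Gamma>: "\<Gamma> \<in> sets borel" "\<Gamma> \<subseteq> S"
  proof -
    obtain T where "open T" "\<Gamma> = S \<inter> T" using assms(2) openin_open by blast
    then show "\<Gamma> \<in> sets borel" "\<Gamma> \<subseteq> S" by auto
  qed
  have dc: "continuous_on (closure \<Omega>) d" by (rule Ck_closure_0[OF assms(4)])
  have b2: "(\<lambda>x. b x $ i) \<in> Wk_inf (Suc (Suc 0)) \<Omega>" for i using assms(10) by (simp add: numeral_2_eq_2)
  have lhs: "(?L f s l)
    = (LINT x|MU. wgt s l d x * (norm (wgrad \<Omega> f x))\<^sup>2) + (LINT x|MU. (lpar s l d x)\<^sup>2 * wgt s l d x * (f x)\<^sup>2)"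
    if f: "f \<in> Hk (Suc m) \<Omega>" for f m s l
  proof -
    note hf = Hk_facts[OF f] and wc = weights_cont[OF dc, of s l]
    have "(?L f s l)
      = (LINT x|MU. wgt s l d x * (norm (wgrad \<Omega> f x))\<^sup>2 + (lpar s l d x)\<^sup>2 * wgt s l d x * (f x)\<^sup>2)"
      by (simp add: set_lint_restrict wgt_def lpar_def power_mult_distrib algebra_simps)
    also have "\<dots> = (LINT x|MU. wgt s l d x * (norm (wgrad \<Omega> f x))\<^sup>2) + (LINT x|MU. (lpar s l d x)\<^sup>2 * wgt s l d x * (f x)\<^sup>2)"
      by (intro bint_add weighted_integrable_norm weighted_integrable_U continuous_intros wc hf)
        (simp add: wgrad_def hf)
    finally show ?thesis .
  qed
  have part1: "(?L f s l)
      \<le> C * (?P f s l)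
        + C * (?B f s l)"
    if l: "l \<ge> max l1 l2" and s: "s \<ge> 1" and f: "f \<in> Hk 1 \<Omega>" for l s f
  proof -
    have f1: "f \<in> Hk (Suc 0) \<Omega>" using f by simp
    have en: "wgt s l d x \<ge> 0" "lpar s l d x \<ge> 0" for x using s l l1 by (simp_all add: wgt_def lpar_def phi0_def)
    let ?Pw = "LINT x|MU. wgt s l d x * (norm (P_op \<Omega> A f x))\<^sup>2"
    let ?Bw = "LINT x|MSg. indicator \<Gamma> x * (lpar s l d x * wgt s l d x * (bdry_trace \<Omega> f x)\<^sup>2)"
    have nn: "?Pw \<ge> 0" "?Bw \<ge> 0" using en by (auto intro!: bint_nonneg mult_nonneg_nonneg)
    have P: "(?P f s l) = ?Pw"
      by (simp add: set_lint_restrict wgt_def mult.commute)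
    have B: "(?B f s l) = ?Bw"
      unfolding LINT_surface[OF \<Gamma>] by (simp add: wgt_def lpar_def mult_ac)
    have "C1 * ?Pw + C1 * ?Bw \<le> C * ?Pw + C * ?Bw"
      using l2(2) nn by (intro add_mono mult_right_mono) (auto simp: C_def)
    then show ?thesis unfolding lhs[OF f1] P B using E1 l s f by (meson max.boundedE order_trans)
  qed
  have part2: "(?L g s l)
      \<le> C * (?JQ g s l)
        + C * (?BB g s l)"
    if l: "l \<ge> max l1 l2" and s: "s \<ge> 1" and g: "g \<in> Hk 2 \<Omega>" for l s g
  proof -
    have g1: "g \<in> Hk (Suc (Suc 0)) \<Omega>" using g by (simp add: numeral_2_eq_2)
    have tp: "lpar s l d x > 0" and en: "wgt s l d x \<ge> 0" "lpar s l d x \<ge> 0" for x using s l l1 by (simp_all add: wgt_def lpar_def phi0_def)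
    note wc = weights_cont[OF dc, of s l]
    have nz: "lpar s l d x \<noteq> 0" for x using tp[of x] by simp
    let ?J = "LINT x|MU. wgt s l d x / (lpar s l d x)\<^sup>2 * (norm (wjac \<Omega> (Q_op \<Omega> b g) x))\<^sup>2"
    let ?Q = "LINT x|MU. wgt s l d x * (norm (Q_op \<Omega> b g x))\<^sup>2"
    let ?b = "\<lambda>k x. indicator S x * (wgt s l d x / lpar s l d x * (bdry_trace \<Omega> (wpd \<Omega> k g) x)\<^sup>2)"
    let ?c = "\<lambda>x. indicator S x * (lpar s l d x * wgt s l d x * (bdry_trace \<Omega> g x)\<^sup>2)"
    have tr: "L2 MSg (bdry_trace \<Omega> f)" if "f \<in> Hk (Suc m) \<Omega>" for f m
      using bdry_trace[OF that] by (simp add: is_bdry_trace_def L2_on_restrict)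
    have iS: "integrable MSg (\<lambda>x. indicator S x * u x)" if "integrable MSg u" for u :: "real^3 \<Rightarrow> real"
      by (rule Bochner_Integration.integrable_cong[THEN iffD1, OF refl _ that]) simp
    have ib: "integrable MSg (?b k)" for k
      by (intro iS weighted_integrable_S continuous_intros wc tr[OF wpd_Hk[OF g1]]) (use nz in simp)
    have ic: "integrable MSg ?c" by (intro iS weighted_integrable_S continuous_intros wc tr[OF g1])
    have iQ: "integrable MU (\<lambda>x. wgt s l d x * (norm (Q_op \<Omega> b g x))\<^sup>2)"
      by (intro weighted_integrable_norm wc Q_op_L2(1)[OF g1 b2])
    have iJ: "integrable MU (\<lambda>x. wgt s l d x / (lpar s l d x)\<^sup>2 * (norm (wjac \<Omega> (Q_op \<Omega> b g) x))\<^sup>2)"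
      unfolding norm_vec_sq[of "wjac _ _ _"] sum_distrib_left
      by (intro bintegrable_sum weighted_integrable_norm continuous_intros wc Q_op_L2(2)[OF g1 b2]) (use nz in simp)
    have JQ: "(?JQ g s l) = ?J + ?Q"
    proof -
      have "(?JQ g s l)
        = (LINT x|MU. wgt s l d x / (lpar s l d x)\<^sup>2 * (norm (wjac \<Omega> (Q_op \<Omega> b g) x))\<^sup>2 + wgt s l d x * (norm (Q_op \<Omega> b g x))\<^sup>2)"
        by (simp add: set_lint_restrict wgt_def lpar_def power_mult_distrib algebra_simps)
      also have "\<dots> = ?J + ?Q" by (intro bint_add iJ iQ)
      finally show ?thesis .
    qed
    have BB: "(?BB g s l) = (\<Sum>k\<in>UNIV. LINT x|MSg. ?b k x) + (LINT x|MSg. ?c x)"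
    proof -
      have "(?BB g s l)
        = (LINT x|MSg. (\<Sum>k\<in>UNIV. ?b k x) + ?c x)"
        unfolding LINT_surface[OF S_borel order_refl]
        by (intro bint_cong refl)
          (simp add: wgt_def lpar_def norm_vec_sq bdry_grad_def sum_distrib_left sum_divide_distrib algebra_simps)
      also have "\<dots> = (LINT x|MSg. (\<Sum>k\<in>UNIV. ?b k x)) + (LINT x|MSg. ?c x)"
        by (intro bint_add bintegrable_sum ib ic)
      also have "(LINT x|MSg. (\<Sum>k\<in>UNIV. ?b k x)) = (\<Sum>k\<in>UNIV. LINT x|MSg. ?b k x)"
        by (rule bint_sum) (rule ib)
      finally show ?thesis .
    qed
    have nn: "?J + ?Q \<ge> 0" "(\<Sum>k\<in>UNIV. LINT x|MSg. ?b k x) + (LINT x|MSg. ?c x) \<ge> 0"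
      using en by (auto intro!: add_nonneg_nonneg sum_nonneg bint_nonneg mult_nonneg_nonneg divide_nonneg_nonneg)
    have le: "C2 * (?J + ?Q) + C2 * ((\<Sum>k\<in>UNIV. LINT x|MSg. ?b k x) + (LINT x|MSg. ?c x))
      \<le> C * (?J + ?Q) + C * ((\<Sum>k\<in>UNIV. LINT x|MSg. ?b k x) + (LINT x|MSg. ?c x))"
      using l1(2) by (intro add_mono mult_right_mono nn) (auto simp: C_def)
    show ?thesis unfolding lhs[OF g1] JQ BB using E2 l s g by (intro order_trans[OF _ le]) simp
  qed
  show ?thesis
    by (rule exI[of _ "max l1 l2"], rule conjI, use l1 in simp, rule exI[of _ 1], rule conjI, simp,
        rule exI[of _ C], rule conjI, use l1 l2 in \<open>simp add: C_def\<close>, intro allI impI conjI ballI,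
        rule part1, assumption+, rule part2)
qed

end
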